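(* Let $m\in\mathbb Z$, let $y=\sum_{r=0}^{\infty}y_{m+r+1,m-r}E_{m+r+1,m-r}\in\mathfrak b_2^*(a)$ with $y_{m+r+1,m-r}\neq 0$ for all $r\ge 0$, and let $T^{m,y}$ be the induced unitary representation of the group $B_0^{\mathbb Z}$ in $\mathcal H^m=L^2(X_m,\mu_b)$, $X_m= B_m\times B^{(m)}$, $\mu_b=\mu_{b,m}\otimes\mu_b^{(m)}$, corresponding to the generic orbit generated by $y$; that is, $$(T^{m,y}_tf)(x)=S(h(x,t))\left(\frac{d\mu_b(xt)}{d\mu_b(x)}\right)^{1/2}f(xt),\qquad f\in\mathcal H^m,\ x\in X_m,\ t\in B_0^{\mathbb Z}$$ (all objects and standing assumptions are given in the context). If the measure $\mu_{b,m}\otimes\mu_b^{(m)}$ on $B_m\times B^{(m)}$ is right $B_{m,0}\times B_0^{(m)}$-ergodic, then $T^{m,y}$ is irreducible. Moreover, the generators $A_{kr}=\frac{d}{dt}T^{m,y}_{I+tE_{kr}}\big|_{t=0}$ of the one-parameter groups $t\mapsto T^{m,y}_{I+tE_{kr}}$ are $$A_{kr}=\sum_{s=-\infty}^{k-1}x_{sk}D_{sr}+D_{kr},\ (k,r)\in\Delta^{(m)},\qquad A_{kr}=\sum_{s=m+1}^{k-1}x_{sk}D_{sr}+D_{kr},\ (k,r)\in\Delta_m,$$ and for $(k,r)\in\Delta(m)$ the operator $A_{kr}$ is multiplication by the function $2\pi i\,S_{kr}(x)$, where $$(2\pi i)^{-1}\big(A_{kr}\big)_{(k,r)\in\Delta(m)}=\big(S_{kr}\big)_{(k,r)\in\Delta(m)}=\big(x_m^{-1}\,y\,x^{(m)}\big)^T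 .$$
   Context: **Groups.** $E_{kn}$ ($k,n\in\mathbb Z$) are the matrix units of real matrices indexed by $\mathbb Z\times\mathbb Z$. $B^{\mathbb Z}=\{I+\sum_{k<n}x_{kn}E_{kn}\}$ is the group of all real upper unitriangular $\mathbb Z\times\mathbb Z$ matrices (entries of products and inverses are finite sums). $B_0^{\mathbb Z}\subset B^{\mathbb Z}$ is the subgroup of those with only finitely many nonzero off-diagonal entries. For fixed $m\in\mathbb Z$ put $\Delta_m=\{(k,r): m+1\le k<r\}$, $\Delta(m)=\{(k,r):k\le m<r\}$, $\Delta^{(m)}=\{(k,r):k<r\le m\}$, and let $B_m$, $B(m)$, $B^{(m)}$ be the subgroups of $B^{\mathbb Z}$ of matrices $I+\sum x_{kr}E_{kr}$ with sum over $(k,r)$ in $\Delta_m,\Delta(m),\Delta^{(m)}$ respectively. Put $B_{m,0}=B_m\cap B_0^{\mathbb Z}$, $B_0^{(m)}=B^{(m)}\cap B_0^{\mathbb Z}$. Elements of $B_m$ and $B^{(m)}$ commute with each other, $B(m)$ is commutative, and every element of $B^{\mathbb Z}$ is uniquely $h\,x_m\,x^{(m)}$ with $h\in B(m)$, $x_m\in B_m$, $x^{(m)}\in B^{(m)}$; so $X_m:=B(m)\backslash B^{\mathbb Z}\cong B_m\times B^{(m)}$. The group $B_0^{\mathbb Z}$ acts on $X_m$ from the right; for $x=(x_m,x^{(m)})$ let $s(x)=x_mx^{(m)}\in B^{\mathbb Z}$, and define $h(x,t)\in B(m)$ and $xt\in X_m$ by $s(x)t=h(x,t)s(xt)$. **Hilbert–Lie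 completion.** $a=(a_{kn})_{k<n}$ is a fixed family of positive numbers with $a_{kn}\le C\,a_{kl}a_{ln}$ for all integers $k<l<n$ and some constant $C>0$. $\mathfrak b_2(a)=\{x=\sum_{k<n}x_{kn}E_{kn}:\sum_{k<n}|x_{kn}|^2a_{kn}<\infty\}$ and $B_2(a)=\{I+x: x\in\mathfrak b_2(a)\}$ (a group). The dual is $\mathfrak b_2^*(a)=\{y=\sum_{k>n}y_{kn}E_{kn}:\sum_{k>n}|y_{kn}|^2a_{nk}^{-1}<\infty\}$, with the pairing $\langle y,x\rangle=\mathrm{tr}(xy)=\sum_{k<n}x_{kn}y_{nk}$ (absolutely convergent). **Character.** For $h\in B(m)\cap B_2(a)$, $S(h)=\exp(2\pi i\langle y,h-I\rangle)$; this is a unitary character of $B(m)\cap B_2(a)$. **Measure.** $b_{kn}>0$ are fixed for $(k,n)\in\Delta_m\cup\Delta^{(m)}$, and $\mu_b=\mu_{b,m}\otimes\mu_b^{(m)}$ is the product measure on $X_m=B_m\times B^{(m)}$ of the one-dimensional Gaussian measures $\sqrt{b_{kn}/\pi}\,\exp(-b_{kn}x_{kn}^2)\,dx_{kn}$, over $(k,n)\in\Delta_m$ (giving $\mu_{b,m}$) and $(k,n)\in\Delta^{(m)}$ (giving $\mu_b^{(m)}$). Standing assumptions: (i) $\sum_{(k,n)\in\Delta_m\cup\Delta^{(m)}}a_{kn}/b_{kn}<\infty$, so $\mu_b$ is concentrated on $(B_m\cap B_2(a))\times(B^{(m)}\cap B_2(a))$, and $h(x,t)\in B(m)\cap B_2(a)$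 for $\mu_b$-a.e. $x$ and all $t\in B_0^{\mathbb Z}$; (ii) $\sum_{s=-\infty}^{k-1}b_{sn}/b_{sk}<\infty$ for all $k<n\le m$, which is equivalent to $\mu_b$ being quasi-invariant under the right action of $B_{m,0}\times B_0^{(m)}$ on $B_m\times B^{(m)}$. Right $B_{m,0}\times B_0^{(m)}$-ergodic means: every measurable function $f$ with, for each $t\in B_{m,0}\times B_0^{(m)}$, $f(xt)=f(x)$ for $\mu_b$-a.e. $x$, is $\mu_b$-a.e. constant. **Derivatives and the functions $S_{kr}$.** $D_{kn}=\frac{\partial}{\partial x_{kn}}-b_{kn}x_{kn}$, i.e. $(D_{kn}f)(x)=\frac{d}{dt}\left(\frac{d\mu_b(x+tE_{kn})}{d\mu_b(x)}\right)^{1/2}f(x+tE_{kn})\big|_{t=0}$. For $(k,r)\in\Delta(m)$, $S_{kr}(x)=\langle y,h(x,I+E_{kr})-I\rangle$; the identity $(S_{kr})=(x_m^{-1}yx^{(m)})^T$ means $S_{kr}(x)=(x_m^{-1}yx^{(m)})_{rk}=\sum_{p\ge0}(x_m^{-1})_{r,m+p+1}\,y_{m+p+1,m-p}\,(x^{(m)})_{m-p,k}$, for $\mu_b$-a.e. $x=(x_m,x^{(m)})$. The formulas for $A_{kr}$ with $(k,r)\in\Delta_m\cup\Delta^{(m)}$ are understood on smooth compactly supported cylinder functions (functions of finitely many coordinates), with series converging in $L^2$. *)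

theory Defs
  imports "HOL-Probability.Probability" "HOL-Algebra.Group"
begin

type_synonym zmat = "int \<Rightarrow> int \<Rightarrow> real"

definition mat_id :: zmat where
  "mat_id i j = (if i = j then 1 else 0)"

text \<open>One product for all matrices. For two upper triangular matrices only
  \<open>k \<le> l \<le> n\<close> contributes, so that the sum is finite; for
  products with lower triangular matrices the sum may be infinite.\<close>

definition mat_mult :: "zmat \<Rightarrow> zmat \<Rightarrow> zmat" (infixl "\<odot>" 70) where
  "(A \<odot> B) k n = (\<Sum>\<^sub>\<infinity>l. A k l * B l n)"

text \<open>\<open>I + t E\<^sub>k\<^sub>r\<close>\<close>

definition mat_elem :: "int \<Rightarrow> int \<Rightarrow> real \<Rightarrow> zmat" where
  "mat_elem k r t i j = mat_id i j + (if i = k \<and> j = r then t else 0)"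

definition BZ :: "zmat set" where
  "BZ = {x. (\<forall>k. x k k = 1) \<and> (\<forall>k n. n < k \<longrightarrow> x k n = 0)}"

definition mat_inv :: "zmat \<Rightarrow> zmat" where
  "mat_inv x = (THE z. z \<in> BZ \<and> x \<odot> z = mat_id \<and> z \<odot> x = mat_id)"

definition B0Z :: "zmat set" where
  "B0Z = {x \<in> BZ. finite {(k, n). k \<noteq> n \<and> x k n \<noteq> 0}}"

definition B0Z_group :: "zmat monoid" where
  "B0Z_group = \<lparr>carrier = B0Z, mult = (\<odot>), one = mat_id\<rparr>"

text \<open>The index sets \<open>\<Delta>\<^sub>m\<close>, \<open>\<Delta>(m)\<close> and
  \<open>\<Delta>\<close> with upper index \<open>(m)\<close>, respectively. The subgroups
  \<open>B\<^sub>m\<close>, \<open>B(m)\<close> and \<open>B\<close> with upper index \<open>(m)\<close>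
  are \<open>unitri (Delta_sub m)\<close>, \<open>unitri (Delta_mid m)\<close> and
  \<open>unitri (Delta_sup m)\<close>.\<close>

definition Delta_sub :: "int \<Rightarrow> (int \<times> int) set" where
  "Delta_sub m = {(k, r). m + 1 \<le> k \<and> k < r}"

definition Delta_mid :: "int \<Rightarrow> (int \<times> int) set" where
  "Delta_mid m = {(k, r). k \<le> m \<and> m < r}"

definition Delta_sup :: "int \<Rightarrow> (int \<times> int) set" where
  "Delta_sup m = {(k, r). k < r \<and> r \<le> m}"

definition unitri :: "(int \<times> int) set \<Rightarrow> zmat set" where
  "unitri D = {x \<in> BZ. \<forall>k r. k < r \<and> (k, r) \<notin> D \<longrightarrow> x k r = 0}"

definition X_space :: "int \<Rightarrow> (zmat \<times> zmat) set" where
  "X_space m = unitri (Delta_sub m) \<times> unitri (Delta_sup m)"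

definition sect :: "zmat \<times> zmat \<Rightarrow> zmat" where
  "sect x = fst x \<odot> snd x"

text \<open>\<open>s(x)t = h(x,t) s(xt)\<close> with \<open>h(x,t) \<in> B(m)\<close>; both \<open>xt\<close>
  and \<open>h(x,t)\<close> are unique.\<close>

definition act :: "int \<Rightarrow> zmat \<times> zmat \<Rightarrow> zmat \<Rightarrow> zmat \<times> zmat" where
  "act m x t = (THE x'. x' \<in> X_space m \<and>
     (\<exists>h \<in> unitri (Delta_mid m). sect x \<odot> t = h \<odot> sect x'))"

definition cocycle :: "int \<Rightarrow> zmat \<times> zmat \<Rightarrow> zmat \<Rightarrow> zmat" where
  "cocycle m x t = (THE h. h \<in> unitri (Delta_mid m) \<and> sect x \<odot> t = h \<odot> sect (act m x t))"

text \<open>The coordinate \<open>x\<^sub>k\<^sub>n\<close>, and the translation \<open>x + t E\<^sub>k\<^sub>n\<close>,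
  of a point of \<open>X_space m\<close>. They are used only for
  \<open>(k, n) \<in> Delta_sub m \<union> Delta_sup m\<close>, where \<open>n \<le> m\<close> tells the
  two index sets apart.\<close>

definition coord :: "int \<Rightarrow> zmat \<times> zmat \<Rightarrow> int \<Rightarrow> int \<Rightarrow> real" where
  "coord m x k n = (if n \<le> m then snd x k n else fst x k n)"

definition translate :: "int \<Rightarrow> int \<Rightarrow> int \<Rightarrow> real \<Rightarrow> zmat \<times> zmat \<Rightarrow> zmat \<times> zmat" where
  "translate m k n t x =
     (let add = (\<lambda>z i j. z i j + (if i = k \<and> j = n then t else 0))
      in if n \<le> m then (fst x, add (snd x)) else (add (fst x), snd x))"

definition b2_dual :: "zmat \<Rightarrow> zmat set" where
  "b2_dual a = {y. (\<forall>k n. k \<le> n \<longrightarrow> y k n = 0) \<and>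
     (\<lambda>(k, n). \<bar>y k n\<bar>\<^sup>2 * inverse (a n k)) summable_on {(k, n). n < k}}"

text \<open>The series converges absolutely for \<open>y \<in> b2_dual a\<close> and
  \<open>\<Sum> \<bar>x\<^sub>k\<^sub>n\<bar>\<^sup>2 a\<^sub>k\<^sub>n < \<infinity>\<close>, which under the
  summability assumption on \<open>a / b\<close> covers \<open>x = h - I\<close> for almost every value \<open>h\<close>
  of the cocycle above. Elsewhere the pairing has the default value 0.\<close>

definition pairing :: "zmat \<Rightarrow> zmat \<Rightarrow> real" where
  "pairing y x = (\<Sum>\<^sub>\<infinity>(k, n)\<in>{(k, n). k < n}. x k n * y n k)"

definition character :: "zmat \<Rightarrow> zmat \<Rightarrow> complex" where
  "character y h = exp (2 * complex_of_real pi * \<i> * complex_of_real (pairing y (\<lambda>i j. h i j - mat_id i j)))"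

definition gauss :: "real \<Rightarrow> real measure" where
  "gauss \<beta> = density lborel (\<lambda>x. ennreal (sqrt (\<beta> / pi) * exp (- \<beta> * x\<^sup>2)))"

text \<open>The product measure on real families indexed by \<open>D\<close> is transported to the
  matrix group \<open>unitri D\<close> along the coordinate bijection.\<close>

definition unitri_borel :: "(int \<times> int) set \<Rightarrow> zmat measure" where
  "unitri_borel D = vimage_algebra (unitri D) (\<lambda>x. \<lambda>(k, n)\<in>D. x k n) (\<Pi>\<^sub>M p\<in>D. borel)"

definition of_coords :: "(int \<times> int) set \<Rightarrow> (int \<times> int \<Rightarrow> real) \<Rightarrow> zmat" where
  "of_coords D v k n = (if k = n then 1 else if (k, n) \<in> D then v (k, n) else 0)"

definition gauss_unitri :: "(int \<times> int) set \<Rightarrow> zmat \<Rightarrow> zmat measure" where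
  "gauss_unitri D b = distr (\<Pi>\<^sub>M (k, n)\<in>D. gauss (b k n)) (unitri_borel D) (of_coords D)"

definition mu :: "int \<Rightarrow> zmat \<Rightarrow> (zmat \<times> zmat) measure" where
  "mu m b = gauss_unitri (Delta_sub m) b \<Otimes>\<^sub>M gauss_unitri (Delta_sup m) b"

definition right_ergodic :: "int \<Rightarrow> zmat \<Rightarrow> bool" where
  "right_ergodic m b \<longleftrightarrow>
     (\<forall>f :: zmat \<times> zmat \<Rightarrow> complex. f \<in> borel_measurable (mu m b) \<longrightarrow>
        (\<forall>t1 \<in> unitri (Delta_sub m) \<inter> B0Z. \<forall>t2 \<in> unitri (Delta_sup m) \<inter> B0Z.
           AE x in mu m b. f (fst x \<odot> t1, snd x \<odot> t2) = f x) \<longrightarrow>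
        (\<exists>c. AE x in mu m b. f x = c))"

text \<open>Elements of the Hilbert space \<open>L\<^sup>2(M)\<close> are represented by functions; equality in the
  Hilbert space is equality almost everywhere.\<close>

definition L2 :: "'a measure \<Rightarrow> ('a \<Rightarrow> complex) set" where
  "L2 M = {f \<in> borel_measurable M. integrable M (\<lambda>x. (cmod (f x))\<^sup>2)}"

definition L2_tendsto ::
  "'a measure \<Rightarrow> ('i \<Rightarrow> 'a \<Rightarrow> complex) \<Rightarrow> ('a \<Rightarrow> complex) \<Rightarrow> 'i filter \<Rightarrow> bool" where
  "L2_tendsto M F g \<FF> \<longleftrightarrow> (\<forall>\<^sub>F i in \<FF>. F i \<in> L2 M) \<and> g \<in> L2 M \<and>
     ((\<lambda>i. LINT x|M. (cmod (F i x - g x))\<^sup>2) \<longlongrightarrow> 0) \<FF>"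

text \<open>Being closed under limits, such a \<open>V\<close> is also closed under equality almost
  everywhere.\<close>

definition L2_closed_subspace :: "'a measure \<Rightarrow> ('a \<Rightarrow> complex) set \<Rightarrow> bool" where
  "L2_closed_subspace M V \<longleftrightarrow> V \<subseteq> L2 M \<and> (\<lambda>_. 0) \<in> V \<and>
     (\<forall>f\<in>V. \<forall>g\<in>V. (\<lambda>x. f x + g x) \<in> V) \<and>
     (\<forall>c. \<forall>f\<in>V. (\<lambda>x. c * f x) \<in> V) \<and>
     (\<forall>F g. (\<forall>n::nat. F n \<in> V) \<and> L2_tendsto M F g sequentially \<longrightarrow> g \<in> V)"

text \<open>For a group \<open>G\<close>, surjectivity of each operator follows from the
  homomorphism property, and compatibility with equality almost everywhere from linearity and
  isometry.\<close>

definition unitary_rep ::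
  "('g, 'r) monoid_scheme \<Rightarrow> 'a measure \<Rightarrow> ('g \<Rightarrow> ('a \<Rightarrow> complex) \<Rightarrow> 'a \<Rightarrow> complex) \<Rightarrow> bool" where
  "unitary_rep G M T \<longleftrightarrow>
     (\<forall>t\<in>carrier G. \<forall>f\<in>L2 M. T t f \<in> L2 M \<and>
        (LINT x|M. (cmod (T t f x))\<^sup>2) = (LINT x|M. (cmod (f x))\<^sup>2)) \<and>
     (\<forall>t\<in>carrier G. \<forall>f\<in>L2 M. \<forall>g\<in>L2 M. \<forall>c.
        AE x in M. T t (\<lambda>x. c * f x + g x) x = c * T t f x + T t g x) \<and>
     (\<forall>f\<in>L2 M. AE x in M. T \<one>\<^bsub>G\<^esub> f x = f x) \<and>
     (\<forall>s\<in>carrier G. \<forall>t\<in>carrier G. \<forall>f\<in>L2 M.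
        AE x in M. T (s \<otimes>\<^bsub>G\<^esub> t) f x = T s (T t f) x)"

definition irreducible_unitary_rep ::
  "('g, 'r) monoid_scheme \<Rightarrow> 'a measure \<Rightarrow> ('g \<Rightarrow> ('a \<Rightarrow> complex) \<Rightarrow> 'a \<Rightarrow> complex) \<Rightarrow> bool" where
  "irreducible_unitary_rep G M T \<longleftrightarrow> unitary_rep G M T \<and>
     (\<exists>f\<in>L2 M. \<not> (AE x in M. f x = 0)) \<and>
     (\<forall>V. L2_closed_subspace M V \<and> (\<forall>t\<in>carrier G. \<forall>f\<in>V. T t f \<in> V) \<longrightarrow>
        V = {f \<in> L2 M. AE x in M. f x = 0} \<or> V = L2 M)"

text \<open>\<open>f\<close> lies in the domain of the infinitesimal generator \<open>d/dt U\<^sub>t\<close> at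
  \<open>t = 0\<close>, and the generator maps \<open>f\<close> to \<open>g\<close>.\<close>

definition generator_maps ::
  "'a measure \<Rightarrow> (real \<Rightarrow> ('a \<Rightarrow> complex) \<Rightarrow> 'a \<Rightarrow> complex) \<Rightarrow>
     ('a \<Rightarrow> complex) \<Rightarrow> ('a \<Rightarrow> complex) \<Rightarrow> bool" where
  "generator_maps M U f g \<longleftrightarrow> f \<in> L2 M \<and>
     L2_tendsto M (\<lambda>t x. (U t f x - f x) / complex_of_real t) g (at 0)"

text \<open>\<open>d\<mu>(xt)/d\<mu>(x)\<close> is the density of the measure
  \<open>A \<mapsto> \<mu>(At)\<close>, the image of \<open>\<mu>\<close> under
  \<open>x \<mapsto> x t\<^sup>-\<^sup>1\<close>.\<close>

definition rn_factor :: "int \<Rightarrow> zmat \<Rightarrow> zmat \<Rightarrow> zmat \<times> zmat \<Rightarrow> real" where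
  "rn_factor m b t x =
     enn2real (RN_deriv (mu m b) (distr (mu m b) (mu m b) (\<lambda>x. act m x (mat_inv t))) x)"

definition T_rep :: "int \<Rightarrow> zmat \<Rightarrow> zmat \<Rightarrow> zmat \<Rightarrow>
    (zmat \<times> zmat \<Rightarrow> complex) \<Rightarrow> zmat \<times> zmat \<Rightarrow> complex" where
  "T_rep m b y t f x =
     character y (cocycle m x t) * complex_of_real (sqrt (rn_factor m b t x)) * f (act m x t)"

definition S_fun :: "int \<Rightarrow> zmat \<Rightarrow> int \<Rightarrow> int \<Rightarrow> zmat \<times> zmat \<Rightarrow> real" where
  "S_fun m y k r x = pairing y (\<lambda>i j. cocycle m x (mat_elem k r 1) i j - mat_id i j)"

definition D_op :: "int \<Rightarrow> zmat \<Rightarrow> int \<Rightarrow> int \<Rightarrow>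
    (zmat \<times> zmat \<Rightarrow> complex) \<Rightarrow> zmat \<times> zmat \<Rightarrow> complex" where
  "D_op m b k n f x =
     vector_derivative (\<lambda>t. f (translate m k n t x)) (at 0) - complex_of_real (b k n * coord m x k n) * f x"

definition partial_deriv ::
  "'i \<Rightarrow> (('i \<Rightarrow> real) \<Rightarrow> complex) \<Rightarrow> ('i \<Rightarrow> real) \<Rightarrow> complex" where
  "partial_deriv i \<phi> v = vector_derivative (\<lambda>t. \<phi> (v(i := t))) (at (v i))"

text \<open>All iterated partial derivatives in the directions of \<open>F\<close> exist and are continuous.
  For \<open>\<phi>\<close> depending only on the finitely many coordinates in \<open>F\<close>, continuity in the
  product topology is continuity on the finite-dimensional space of these coordinates.\<close>

definition smooth_along :: "'i set \<Rightarrow> (('i \<Rightarrow> real) \<Rightarrow> complex) \<Rightarrow> bool" where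
  "smooth_along F \<phi> \<longleftrightarrow> (\<forall>is \<in> lists F.
     continuous_on UNIV (foldr partial_deriv is \<phi>) \<and>
     (\<forall>i\<in>F. \<forall>v. (\<lambda>t. foldr partial_deriv is \<phi> (v(i := t))) differentiable (at (v i))))"

definition cylinder_test_fun :: "int \<Rightarrow> (zmat \<times> zmat \<Rightarrow> complex) \<Rightarrow> bool" where
  "cylinder_test_fun m f \<longleftrightarrow> (\<exists>F \<phi>. finite F \<and> F \<subseteq> Delta_sub m \<union> Delta_sup m \<and>
     (\<forall>v w. (\<forall>i\<in>F. v i = w i) \<longrightarrow> \<phi> v = \<phi> w) \<and>
     smooth_along F \<phi> \<and>
     (\<exists>R. \<forall>v. \<phi> v \<noteq> 0 \<longrightarrow> (\<forall>i\<in>F. \<bar>v i\<bar> \<le> R)) \<and>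
     f = (\<lambda>x. \<phi> (\<lambda>(k, n). coord m x k n)))"

end

theory Submission
  imports Defs
begin

text \<open>Cut every matrix at \<open>m\<close> into blocks. The action becomes right multiplication of
  \<open>x\<^sub>m\<close> and \<open>x\<^sup>(\<^sup>m\<^sup>)\<close> by the diagonal blocks of \<open>t\<close>, and the cocycle is a finite sum of products
  of a column of \<open>x\<^sup>(\<^sup>m\<^sup>)\<close> with a row of the inverse of \<open>x\<^sub>m\<close>.

  An elementary \<open>t\<close> in a diagonal block shifts one column of Gaussian coordinates by a multiple of
  another one, and the density of the shifted measure is \<open>exp(- 2 u P - u\<^sup>2 Q)\<close>, where \<open>P\<close> is the
  almost sure limit of partial sums of an orthogonal series. Fatou's lemma gives one inequality
  between the two measures; the inverse shift gives the other one.

  An elementary \<open>t\<close> in the off-diagonal block acts as multiplication by \<open>exp(2 \<pi> i \<tau> S\<^sub>k\<^sub>r)\<close>. The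
  matrix \<open>D\<^sup>-\<^sup>1 y A\<close> of all \<open>S\<^sub>k\<^sub>r\<close> determines \<open>D\<close> and \<open>A\<close> in \<open>B\<^sub>2(a)\<close>, because
  \<open>D\<^sup>-\<^sup>1 y A = D'\<^sup>-\<^sup>1 y A'\<close> gives \<open>(D' D\<^sup>-\<^sup>1) y = y (A' A\<^sup>-\<^sup>1)\<close> with one side upper and the other side
  lower triangular. Hence every Borel set is, up to a null set, measurable with respect to the
  \<open>S\<^sub>k\<^sub>r\<close>, a closed invariant subspace is \<open>L\<^sup>2(E)\<close> for some \<open>E\<close>, and \<open>E\<close> is invariant under the
  diagonal blocks, so that ergodicity applies.

  For a test function \<open>f\<close> the path \<open>T\<^sub>t f(x)\<close> is differentiable in \<open>t\<close> with derivative \<open>T\<^sub>t (A f)(x)\<close>.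
  Since \<open>T\<^sub>t\<close> is isometric, the difference quotients have norm at most that of \<open>A f\<close>, and almost
  everywhere convergence with this bound is convergence in \<open>L\<^sup>2\<close>.\<close>

section \<open>The group of unitriangular matrices and the action\<close>

text \<open>Both standing assumptions are finite second moments: (i) is, up to a factor 1/2, the
  expected squared weighted norm of the coordinates, and (ii) bounds the variance of
  \<open>P\<close>, whose summand for a row \<open>s < k\<close> has second moment
  \<open>b_sr / (4 b_sk)\<close>. The unit diagonal entry counts as one more coordinate, with a
  Dirac measure, so that the term \<open>D_kr\<close> is the summand with source
  \<open>x_kk = 1\<close>. The finite shears have densities that converge only almost everywhere,
  with no majorant at hand. Hence one inequality on closed sets is taken to the limit instead of an
  identity, and the group law of the shear restores equality. Irreducibility is argued on an
  invariant subspace itself: the bounded functions that multiply it into itself form an algebra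
  closed under bounded pointwise limits, which grows from exponentials of \<open>S_kr\<close> to all
  indicators. Injectivity of \<open>S\<close> is available only on the points with both components
  in \<open>B_2(a)\<close>, which have full measure but no given topology; this is why compact
  pieces of its graph are projected.\<close>

lemma BZ_diag: "x \<in> BZ \<Longrightarrow> x k k = 1"
  by (simp add: BZ_def)

lemma BZ_below: "x \<in> BZ \<Longrightarrow> n < k \<Longrightarrow> x k n = 0"
  by (simp add: BZ_def)

lemma mat_mult_finite:
  assumes "finite S" "\<And>l. l \<notin> S \<Longrightarrow> A k l * B l n = 0"
  shows "(A \<odot> B) k n = (\<Sum>l\<in>S. A k l * B l n)"
proof -
  have "(A \<odot> B) k n = (\<Sum>\<^sub>\<infinity>l\<in>S. A k l * B l n)"
    unfolding mat_mult_def by (rule infsum_cong_neutral) (use assms in auto)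
  then show ?thesis using assms(1) by simp
qed

text \<open>Any finite set containing the interval may serve as range, so that several products can
  share one range when sums are interchanged.\<close>

lemma mat_mult_superset:
  assumes "A \<in> BZ" "B \<in> BZ" "finite S" "{k..n} \<subseteq> S"
  shows "(A \<odot> B) k n = (\<Sum>l\<in>S. A k l * B l n)"
proof (rule mat_mult_finite[OF assms(3)])
  fix l assume "l \<notin> S"
  then have "l < k \<or> n < l" using assms(4) by (meson atLeastAtMost_iff in_mono not_le)
  then show "A k l * B l n = 0" using assms(1,2) by (auto simp: BZ_def)
qed

lemmas mat_mult_BZ = mat_mult_superset[OF _ _ finite_atLeastAtMost_int order_refl]

lemma mat_id_BZ [simp]: "mat_id \<in> BZ"
  by (auto simp: BZ_def mat_id_def)

lemma mat_mult_closed [simp]: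
  assumes "A \<in> BZ" "B \<in> BZ" shows "A \<odot> B \<in> BZ"
proof -
  have "(A \<odot> B) k k = 1" for k using mat_mult_BZ[OF assms, of k k] assms by (simp add: BZ_def)
  moreover have "(A \<odot> B) k n = 0" if "n < k" for k n
    using mat_mult_BZ[OF assms, of k n] that by simp
  ultimately show ?thesis by (simp add: BZ_def)
qed

lemma mat_mult_assoc:
  assumes A: "A \<in> BZ" and B: "B \<in> BZ" and C: "C \<in> BZ"
  shows "A \<odot> B \<odot> C = A \<odot> (B \<odot> C)"
proof (intro ext)
  fix k n
  have "(A \<odot> B \<odot> C) k n = (\<Sum>l\<in>{k..n}. (\<Sum>j\<in>{k..n}. A k j * B j l) * C l n)"
    using assms by (subst mat_mult_BZ) (auto intro!: sum.cong simp: mat_mult_superset[of _ _ "{k..n}"])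
  also have "\<dots> = (\<Sum>l\<in>{k..n}. \<Sum>j\<in>{k..n}. A k j * (B j l * C l n))"
    by (simp add: sum_distrib_right mult.assoc)
  also have "\<dots> = (\<Sum>j\<in>{k..n}. \<Sum>l\<in>{k..n}. A k j * (B j l * C l n))"
    by (rule sum.swap)
  also have "\<dots> = (\<Sum>j\<in>{k..n}. A k j * (\<Sum>l\<in>{k..n}. (B j l * C l n)))"
    by (simp add: sum_distrib_left)
  also have "\<dots> = (\<Sum>j\<in>{k..n}. A k j * (B \<odot> C) j n)"
  proof (rule sum.cong[OF refl])
    fix j assume "j \<in> {k..n}"
    then show "A k j * (\<Sum>l\<in>{k..n}. (B j l * C l n)) = A k j * (B \<odot> C) j n"
      by (subst mat_mult_superset[OF B C, of "{k..n}"]) auto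
  qed
  also have "\<dots> = (A \<odot> (B \<odot> C)) k n"
    using assms by (simp add: mat_mult_BZ[of A "B \<odot> C"])
  finally show "(A \<odot> B \<odot> C) k n = (A \<odot> (B \<odot> C)) k n" .
qed

lemma mat_id_left [simp]: "mat_id \<odot> A = A"
proof (intro ext)
  fix k n show "(mat_id \<odot> A) k n = A k n"
    by (subst mat_mult_finite[of "{k}"]) (auto simp: mat_id_def)
qed

lemma mat_id_right [simp]: "A \<odot> mat_id = A"
proof (intro ext)
  fix k n show "(A \<odot> mat_id) k n = A k n"
    by (subst mat_mult_finite[of "{n}"]) (auto simp: mat_id_def)
qed

section \<open>Inverses of unitriangular matrices by recursion along rows\<close>

fun inv_row :: "zmat \<Rightarrow> int \<Rightarrow> nat \<Rightarrow> real" where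
  "inv_row x r d = (if d = 0 then 1 else - (\<Sum>e<d. inv_row x r e * x (r + int e) (r + int d)))"

declare inv_row.simps [simp del]

text \<open>The recursion solves \<open>z x = I\<close> in each row: the unit diagonal of
  \<open>x\<close> lets the entry at distance \<open>d\<close> be read off from those at smaller
  distance. This explicit form later gives measurability of the inverse, which the description
  defining \<open>mat_inv\<close> does not show.\<close>

definition left_inv :: "zmat \<Rightarrow> zmat" where
  "left_inv x k n = (if n < k then 0 else inv_row x k (nat (n - k)))"

lemma left_inv_BZ: "left_inv x \<in> BZ"
  by (auto simp: BZ_def left_inv_def inv_row.simps)

lemma sum_int_interval: "(\<Sum>l\<in>{k..<k + int d}. f l) = (\<Sum>e<d. f (k + int e))"
  by (rule sum.reindex_bij_witness[of _ "\<lambda>e. k + int e" "\<lambda>l. nat (l - k)"]) auto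

lemma left_inv_mult:
  assumes x: "x \<in> BZ" shows "left_inv x \<odot> x = mat_id"
proof (intro ext)
  fix k n
  show "(left_inv x \<odot> x) k n = mat_id k n"
  proof (cases "k < n")
    case False
    then show ?thesis using mat_mult_closed[OF left_inv_BZ x] by (cases "k = n") (auto simp: BZ_def mat_id_def)
  next
    case True
    define d where "d = nat (n - k)"
    have d: "n = k + int d" "d > 0" using True by (auto simp: d_def)
    have "(left_inv x \<odot> x) k n = (\<Sum>l\<in>{k..n}. left_inv x k l * x l n)"
      by (rule mat_mult_BZ[OF left_inv_BZ x])
    also have "{k..n} = insert n {k..<k + int d}" using d by auto
    also have "(\<Sum>l\<in>\<dots>. left_inv x k l * x l n) = left_inv x k n * x n n + (\<Sum>l\<in>{k..<k + int d}. left_inv x k l * x l n)"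
      using d by (subst sum.insert) auto
    also have "(\<Sum>l\<in>{k..<k + int d}. left_inv x k l * x l n) = (\<Sum>e<d. inv_row x k e * x (k + int e) (k + int d))"
      by (subst sum_int_interval) (simp add: left_inv_def d)
    also have "left_inv x k n = - \<dots>" using d by (simp add: left_inv_def inv_row.simps[of x k d])
    finally show ?thesis using True x by (simp add: mat_id_def BZ_diag)
  qed
qed

text \<open>By associativity the left inverse of the left inverse is the matrix itself, so left
  inverses that exist everywhere are two-sided.\<close>

lemma right_inv_mult:
  assumes x: "x \<in> BZ" shows "x \<odot> left_inv x = mat_id"
proof -
  let ?L = "left_inv x" and ?L' = "left_inv (left_inv x)"
  have "x = ?L' \<odot> ?L \<odot> x" by (simp add: left_inv_mult left_inv_BZ)
  also have "\<dots> = ?L'"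
    unfolding mat_mult_assoc[OF left_inv_BZ left_inv_BZ x] left_inv_mult[OF x] by simp
  finally have "?L' = x" by simp
  then show ?thesis using left_inv_mult[OF left_inv_BZ[of x]] by simp
qed

lemma mat_inv_eqI:
  assumes "x \<in> BZ" "z \<in> BZ" "x \<odot> z = mat_id" shows "mat_inv x = z"
proof -
  have u: "w = w'" if "w \<in> BZ" "w' \<in> BZ" "w \<odot> x = mat_id" "x \<odot> w' = mat_id" for w w'
  proof -
    have "w = w \<odot> (x \<odot> w')" using that by simp
    also have "\<dots> = w'" using that(3) mat_mult_assoc[OF that(1) assms(1) that(2)] by simp
    finally show ?thesis .
  qed
  have "left_inv x = z" using u[OF left_inv_BZ assms(2) left_inv_mult assms(3)] assms(1) by simp
  then have "z \<odot> x = mat_id" using left_inv_mult[OF assms(1)] by simp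
  then show ?thesis unfolding mat_inv_def
    by (intro the_equality) (use assms u in auto)
qed

lemma mat_inv_left_inv: "x \<in> BZ \<Longrightarrow> mat_inv x = left_inv x"
  by (rule mat_inv_eqI) (auto simp: left_inv_BZ right_inv_mult)

lemma mat_inv_BZ [simp]: "x \<in> BZ \<Longrightarrow> mat_inv x \<in> BZ"
  by (simp add: mat_inv_left_inv left_inv_BZ)

lemma mat_inv_right [simp]: "x \<in> BZ \<Longrightarrow> x \<odot> mat_inv x = mat_id"
  by (simp add: mat_inv_left_inv right_inv_mult)

lemma mat_inv_left [simp]: "x \<in> BZ \<Longrightarrow> mat_inv x \<odot> x = mat_id"
  by (simp add: mat_inv_left_inv left_inv_mult)

lemma mat_inv_mult:
  assumes "x \<in> BZ" "z \<in> BZ" shows "mat_inv (x \<odot> z) = mat_inv z \<odot> mat_inv x"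
proof (rule mat_inv_eqI)
  have "x \<odot> z \<odot> (mat_inv z \<odot> mat_inv x) = x \<odot> (z \<odot> mat_inv z) \<odot> mat_inv x"
    using assms by (simp add: mat_mult_assoc del: mat_inv_right)
  then show "x \<odot> z \<odot> (mat_inv z \<odot> mat_inv x) = mat_id" using assms by simp
qed (use assms in auto)

lemma mat_inv_id [simp]: "mat_inv mat_id = mat_id"
  by (rule mat_inv_eqI) auto

lemma mat_inv_inv [simp]: "x \<in> BZ \<Longrightarrow> mat_inv (mat_inv x) = x"
  by (rule mat_inv_eqI) auto

lemma mat_inv_solve:
  assumes "z \<in> BZ" "h \<in> BZ" "s \<in> BZ" shows "z = h \<odot> s \<longleftrightarrow> h = z \<odot> mat_inv s"
  using assms by (auto simp: mat_mult_assoc)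

section \<open>Diagonal blocks and the decomposition along B(m)\<close>

definition lower_block :: "int \<Rightarrow> zmat \<Rightarrow> zmat" where
  "lower_block m z k n = (if k = n \<or> m < k then z k n else 0)"

text \<open>For a nonzero entry of an upper triangular matrix, \<open>n \<le> m\<close> forces
  \<open>k \<le> m\<close>, and \<open>m < k\<close> in \<open>lower_block\<close> forces
  \<open>m < n\<close>. One index therefore cuts out each diagonal block.\<close>

definition upper_block :: "int \<Rightarrow> zmat \<Rightarrow> zmat" where
  "upper_block m z k n = (if k = n \<or> n \<le> m then z k n else 0)"

lemma lower_block_unitri: "z \<in> BZ \<Longrightarrow> lower_block m z \<in> unitri (Delta_sub m)"
  by (auto simp: unitri_def BZ_def lower_block_def Delta_sub_def)

lemma upper_block_unitri: "z \<in> BZ \<Longrightarrow> upper_block m z \<in> unitri (Delta_sup m)"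
  by (auto simp: unitri_def BZ_def upper_block_def Delta_sup_def)

lemma unitri_BZ: "x \<in> unitri D \<Longrightarrow> x \<in> BZ"
  by (simp add: unitri_def)

lemma lower_block_BZ [simp]: "z \<in> BZ \<Longrightarrow> lower_block m z \<in> BZ" and upper_block_BZ [simp]: "z \<in> BZ \<Longrightarrow> upper_block m z \<in> BZ"
  using lower_block_unitri upper_block_unitri unitri_BZ by blast+

text \<open>A path \<open>k \<le> l \<le> n\<close> that starts beyond \<open>m\<close> stays beyond
  \<open>m\<close>, so no other block contributes and cutting out the block is a homomorphism. For
  \<open>upper_block\<close> the end point of the path plays the same part.\<close>

lemma lower_block_mult:
  assumes "A \<in> BZ" "B \<in> BZ" shows "lower_block m (A \<odot> B) = lower_block m A \<odot> lower_block m B"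
proof (intro ext)
  fix k n
  have "(lower_block m A \<odot> lower_block m B) k n = (\<Sum>l\<in>{k..n}. lower_block m A k l * lower_block m B l n)"
    by (rule mat_mult_BZ) (use assms in auto)
  also have "\<dots> = lower_block m (A \<odot> B) k n"
  proof (cases "k = n \<or> m < k")
    case True
    then have "lower_block m (A \<odot> B) k n = (\<Sum>l\<in>{k..n}. A k l * B l n)"
      using assms by (simp add: lower_block_def mat_mult_BZ)
    also have "\<dots> = (\<Sum>l\<in>{k..n}. lower_block m A k l * lower_block m B l n)"
      using True by (intro sum.cong) (auto simp: lower_block_def)
    finally show ?thesis by simp
  next
    case False
    then have "(\<Sum>l\<in>{k..n}. lower_block m A k l * lower_block m B l n) = 0"
      by (intro sum.neutral) (auto simp: lower_block_def)
    then show ?thesis using False by (simp add: lower_block_def)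
  qed
  finally show "lower_block m (A \<odot> B) k n = (lower_block m A \<odot> lower_block m B) k n" by simp
qed

lemma upper_block_mult:
  assumes "A \<in> BZ" "B \<in> BZ" shows "upper_block m (A \<odot> B) = upper_block m A \<odot> upper_block m B"
proof (intro ext)
  fix k n
  have "(upper_block m A \<odot> upper_block m B) k n = (\<Sum>l\<in>{k..n}. upper_block m A k l * upper_block m B l n)"
    by (rule mat_mult_BZ) (use assms in auto)
  also have "\<dots> = upper_block m (A \<odot> B) k n"
  proof (cases "k = n \<or> n \<le> m")
    case True
    then have "upper_block m (A \<odot> B) k n = (\<Sum>l\<in>{k..n}. A k l * B l n)"
      using assms by (simp add: upper_block_def mat_mult_BZ)
    also have "\<dots> = (\<Sum>l\<in>{k..n}. upper_block m A k l * upper_block m B l n)"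
      using True by (intro sum.cong) (auto simp: upper_block_def)
    finally show ?thesis by simp
  next
    case False
    then have "(\<Sum>l\<in>{k..n}. upper_block m A k l * upper_block m B l n) = 0"
      by (intro sum.neutral) (auto simp: upper_block_def)
    then show ?thesis using False by (simp add: upper_block_def)
  qed
  finally show "upper_block m (A \<odot> B) k n = (upper_block m A \<odot> upper_block m B) k n" by simp
qed

lemma unitri_entry: "x \<in> unitri D \<Longrightarrow> (k, n) \<notin> D \<Longrightarrow> x k n = mat_id k n"
  by (cases "k < n"; cases "k = n") (auto simp: unitri_def BZ_def mat_id_def)

lemma lower_block_sub: "x \<in> unitri (Delta_sub m) \<Longrightarrow> lower_block m x = x"
  by (intro ext) (auto simp: lower_block_def unitri_entry Delta_sub_def mat_id_def)

lemma upper_block_sub: "x \<in> unitri (Delta_sub m) \<Longrightarrow> upper_block m x = mat_id"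
  by (intro ext) (auto simp: upper_block_def unitri_entry Delta_sub_def mat_id_def)

lemma lower_block_sup: "x \<in> unitri (Delta_sup m) \<Longrightarrow> lower_block m x = mat_id"
  by (intro ext) (auto simp: lower_block_def unitri_entry Delta_sup_def mat_id_def)

lemma upper_block_sup: "x \<in> unitri (Delta_sup m) \<Longrightarrow> upper_block m x = x"
  by (intro ext) (auto simp: upper_block_def unitri_entry Delta_sup_def mat_id_def)

text \<open>\<open>B(m)\<close> is the common kernel of the two block homomorphisms, so membership
  becomes a pair of equations that products preserve.\<close>

lemma unitri_mid_iff: "h \<in> unitri (Delta_mid m) \<longleftrightarrow> h \<in> BZ \<and> lower_block m h = mat_id \<and> upper_block m h = mat_id"
proof
  assume h: "h \<in> unitri (Delta_mid m)"
  have "lower_block m h = mat_id" by (intro ext) (auto simp: lower_block_def unitri_entry[OF h] Delta_mid_def mat_id_def)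
  moreover have "upper_block m h = mat_id" by (intro ext) (auto simp: upper_block_def unitri_entry[OF h] Delta_mid_def mat_id_def)
  ultimately show "h \<in> BZ \<and> lower_block m h = mat_id \<and> upper_block m h = mat_id" using unitri_BZ[OF h] by simp
next
  assume h: "h \<in> BZ \<and> lower_block m h = mat_id \<and> upper_block m h = mat_id"
  have "h k r = 0" if "k < r" "(k, r) \<notin> Delta_mid m" for k r
  proof -
    have "lower_block m h k r = 0" "upper_block m h k r = 0" using h that by (simp_all add: mat_id_def)
    then show ?thesis using that by (auto simp: lower_block_def upper_block_def Delta_mid_def split: if_splits)
  qed
  then show "h \<in> unitri (Delta_mid m)" using h by (simp add: unitri_def)
qed

lemma X_space_iff: "x \<in> X_space m \<longleftrightarrow> fst x \<in> unitri (Delta_sub m) \<and> snd x \<in> unitri (Delta_sup m)"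
  by (cases x) (simp add: X_space_def)

lemma sect_BZ: "x \<in> X_space m \<Longrightarrow> sect x \<in> BZ"
  by (auto simp: sect_def X_space_iff unitri_BZ)

lemma lower_block_sect: "x \<in> X_space m \<Longrightarrow> lower_block m (sect x) = fst x"
  by (auto simp: sect_def X_space_iff unitri_BZ lower_block_mult lower_block_sub lower_block_sup)

lemma upper_block_sect: "x \<in> X_space m \<Longrightarrow> upper_block m (sect x) = snd x"
  by (auto simp: sect_def X_space_iff unitri_BZ upper_block_mult upper_block_sub upper_block_sup)

lemma decomp_X_space:
  assumes "z \<in> BZ" shows "(lower_block m z, upper_block m z) \<in> X_space m"
  using assms by (simp add: X_space_iff lower_block_unitri upper_block_unitri)

lemma decomp_mid:
  assumes z: "z \<in> BZ"
  shows "z \<odot> mat_inv (sect (lower_block m z, upper_block m z)) \<in> unitri (Delta_mid m)"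
proof -
  let ?s = "sect (lower_block m z, upper_block m z)"
  have X: "(lower_block m z, upper_block m z) \<in> X_space m" by (rule decomp_X_space[OF z])
  have s: "?s \<in> BZ" by (rule sect_BZ[OF X])
  have "lower_block m z = lower_block m ?s" "upper_block m z = upper_block m ?s" using lower_block_sect[OF X] upper_block_sect[OF X] by auto
  then have "lower_block m (z \<odot> mat_inv ?s) = lower_block m (?s \<odot> mat_inv ?s)" "upper_block m (z \<odot> mat_inv ?s) = upper_block m (?s \<odot> mat_inv ?s)"
    using s z by (simp_all only: lower_block_mult upper_block_mult mat_inv_BZ)
  moreover have "lower_block m mat_id = mat_id" "upper_block m mat_id = mat_id"
    by (auto simp: lower_block_def upper_block_def mat_id_def fun_eq_iff)
  ultimately show ?thesis using s z by (simp add: unitri_mid_iff)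
qed

lemma decomp_unique:
  assumes z: "z \<in> BZ" and x: "x \<in> X_space m" and h: "h \<in> unitri (Delta_mid m)" and eq: "z = h \<odot> sect x"
  shows "x = (lower_block m z, upper_block m z)"
proof -
  have "lower_block m z = fst x" "upper_block m z = snd x"
    using h x unfolding eq unitri_mid_iff by (auto simp: lower_block_mult upper_block_mult sect_BZ lower_block_sect upper_block_sect)
  then show ?thesis by simp
qed

text \<open>The block homomorphisms kill \<open>h\<close> in \<open>s(x) t = h s(x')\<close> and
  return the two components of \<open>x'\<close>, which determines \<open>x'\<close> without knowing
  \<open>h\<close>.\<close>

lemma act_eq:
  assumes x: "x \<in> X_space m" and t: "t \<in> BZ"
  shows "act m x t = (fst x \<odot> lower_block m t, snd x \<odot> upper_block m t)"
proof -
  let ?z = "sect x \<odot> t"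
  have z: "?z \<in> BZ" using sect_BZ[OF x] t by simp
  have "act m x t = (lower_block m ?z, upper_block m ?z)"
    unfolding act_def
  proof (rule the_equality)
    have "?z = (?z \<odot> mat_inv (sect (lower_block m ?z, upper_block m ?z))) \<odot> sect (lower_block m ?z, upper_block m ?z)"
      using z sect_BZ[OF decomp_X_space[OF z]] by (simp add: mat_mult_assoc)
    then show "(lower_block m ?z, upper_block m ?z) \<in> X_space m \<and> (\<exists>h\<in>unitri (Delta_mid m). ?z = h \<odot> sect (lower_block m ?z, upper_block m ?z))"
      using decomp_X_space[OF z] decomp_mid[OF z] by blast
  qed (use decomp_unique[OF z] in blast)
  then show ?thesis using sect_BZ[OF x] t lower_block_sect[OF x] upper_block_sect[OF x] by (simp add: lower_block_mult upper_block_mult)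
qed

lemma act_X_space:
  assumes "x \<in> X_space m" "t \<in> BZ" shows "act m x t \<in> X_space m"
proof -
  have "(lower_block m (sect x \<odot> t), upper_block m (sect x \<odot> t)) \<in> X_space m"
    by (rule decomp_X_space) (use sect_BZ[OF assms(1)] assms(2) in simp)
  then show ?thesis using assms sect_BZ[OF assms(1)]
    by (simp add: act_eq lower_block_mult upper_block_mult lower_block_sect[OF assms(1)] upper_block_sect[OF assms(1)])
qed

lemma act_mult:
  assumes "x \<in> X_space m" "s \<in> BZ" "t \<in> BZ"
  shows "act m x (s \<odot> t) = act m (act m x s) t"
proof -
  have "fst x \<in> BZ" "snd x \<in> BZ" using assms by (auto simp: X_space_iff unitri_BZ)
  then show ?thesis using assms act_X_space[OF assms(1,2)]
    by (simp add: act_eq lower_block_mult upper_block_mult mat_mult_assoc)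
qed

lemma lower_block_id [simp]: "lower_block m mat_id = mat_id" and upper_block_id [simp]: "upper_block m mat_id = mat_id"
  by (auto simp: lower_block_def upper_block_def mat_id_def fun_eq_iff)

lemma act_id [simp]: "x \<in> X_space m \<Longrightarrow> act m x mat_id = x"
  by (simp add: act_eq)

lemma cocycle_char:
  assumes x: "x \<in> X_space m" and t: "t \<in> BZ"
  shows "cocycle m x t \<in> unitri (Delta_mid m)"
    and "sect x \<odot> t = cocycle m x t \<odot> sect (act m x t)"
    and "h \<in> unitri (Delta_mid m) \<Longrightarrow> sect x \<odot> t = h \<odot> sect (act m x t) \<Longrightarrow> cocycle m x t = h"
proof -
  let ?z = "sect x \<odot> t"
  have z: "?z \<in> BZ" using sect_BZ[OF x] t by simp
  have a: "act m x t = (lower_block m ?z, upper_block m ?z)"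
    using sect_BZ[OF x] t lower_block_sect[OF x] upper_block_sect[OF x] by (simp add: act_eq[OF x t] lower_block_mult upper_block_mult)
  have s: "sect (act m x t) \<in> BZ" by (rule sect_BZ[OF act_X_space[OF x t]])
  have u: "h = ?z \<odot> mat_inv (sect (act m x t))" if "h \<in> unitri (Delta_mid m)" "?z = h \<odot> sect (act m x t)" for h
    using mat_inv_solve[OF z _ s, of h] that unitri_BZ by auto
  have ex: "?z \<odot> mat_inv (sect (act m x t)) \<in> unitri (Delta_mid m)"
    unfolding a by (rule decomp_mid[OF z])
  have eq: "?z = ?z \<odot> mat_inv (sect (act m x t)) \<odot> sect (act m x t)" using z s by (simp add: mat_mult_assoc)
  have c: "cocycle m x t = ?z \<odot> mat_inv (sect (act m x t))"
    unfolding cocycle_def by (rule the_equality) (use ex eq u in auto)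
  show "cocycle m x t \<in> unitri (Delta_mid m)" "sect x \<odot> t = cocycle m x t \<odot> sect (act m x t)"
    using ex eq c by auto
  show "h \<in> unitri (Delta_mid m) \<Longrightarrow> sect x \<odot> t = h \<odot> sect (act m x t) \<Longrightarrow> cocycle m x t = h"
    using u c by auto
qed

text \<open>Two off-diagonal steps inside \<open>Delta_mid m\<close> cannot be composed: the first
  ends beyond \<open>m\<close>, the second starts at or before \<open>m\<close>. So products in
  \<open>B(m)\<close> add the off-diagonal parts, and this is what makes \<open>character\<close>
  multiplicative.\<close>

lemma mid_mult:
  assumes g: "g \<in> unitri (Delta_mid m)" and h: "h \<in> unitri (Delta_mid m)"
  shows "g \<odot> h \<in> unitri (Delta_mid m)"
    and "(g \<odot> h) k n - mat_id k n = (g k n - mat_id k n) + (h k n - mat_id k n)"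
proof -
  show gh: "g \<odot> h \<in> unitri (Delta_mid m)"
    using g h unfolding unitri_mid_iff by (auto simp: lower_block_mult upper_block_mult)
  show "(g \<odot> h) k n - mat_id k n = (g k n - mat_id k n) + (h k n - mat_id k n)"
  proof (cases "(k, n) \<in> Delta_mid m")
    case False
    then show ?thesis using unitri_entry[OF g] unitri_entry[OF h] unitri_entry[OF gh] by simp
  next
    case True
    then have kn: "k < n" "k \<le> m" "m < n" by (auto simp: Delta_mid_def)
    have z: "g k l * h l n = 0" if "l \<in> {k..n} - {k, n}" for l
    proof (cases "l \<le> m")
      case True
      then show ?thesis using unitri_entry[OF g, of k l] that by (auto simp: Delta_mid_def mat_id_def)
    next
      case False
      then show ?thesis using unitri_entry[OF h, of l n] that by (auto simp: Delta_mid_def mat_id_def)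
    qed
    have "(g \<odot> h) k n = (\<Sum>l\<in>{k..n}. g k l * h l n)" by (rule mat_mult_BZ) (use g h unitri_BZ in auto)
    also have "\<dots> = (\<Sum>l\<in>{k, n}. g k l * h l n)" by (rule sum.mono_neutral_right) (use z kn in auto)
    also have "\<dots> = h k n + g k n" using kn g h by (simp add: BZ_diag unitri_BZ)
    finally show ?thesis using kn by (simp add: mat_id_def)
  qed
qed

lemma cocycle_mult:
  assumes x: "x \<in> X_space m" and s: "s \<in> BZ" and t: "t \<in> BZ"
  shows "cocycle m x (s \<odot> t) = cocycle m x s \<odot> cocycle m (act m x s) t"
proof (rule cocycle_char(3)[OF x])
  note xs = act_X_space[OF x s]
  show "cocycle m x s \<odot> cocycle m (act m x s) t \<in> unitri (Delta_mid m)"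
    by (rule mid_mult(1)[OF cocycle_char(1)[OF x s] cocycle_char(1)[OF xs t]])
  have st: "s \<odot> t \<in> BZ" using s t by simp
  have B: "sect x \<in> BZ" "sect (act m x s) \<in> BZ" "sect (act m x (s \<odot> t)) \<in> BZ"
    "cocycle m x s \<in> BZ" "cocycle m (act m x s) t \<in> BZ"
    using sect_BZ[OF x] sect_BZ[OF xs] sect_BZ[OF act_X_space[OF x st]]
      unitri_BZ[OF cocycle_char(1)[OF x s]] unitri_BZ[OF cocycle_char(1)[OF xs t]] by auto
  have "sect x \<odot> (s \<odot> t) = (cocycle m x s \<odot> sect (act m x s)) \<odot> t"
    using B s t cocycle_char(2)[OF x s] by (simp add: mat_mult_assoc[symmetric])
  also have "\<dots> = cocycle m x s \<odot> (cocycle m (act m x s) t \<odot> sect (act m (act m x s) t))"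
    using B s t cocycle_char(2)[OF xs t] by (simp add: mat_mult_assoc)
  also have "\<dots> = cocycle m x s \<odot> cocycle m (act m x s) t \<odot> sect (act m x (s \<odot> t))"
    using B act_mult[OF x s t] by (simp add: mat_mult_assoc)
  finally show "sect x \<odot> (s \<odot> t) = cocycle m x s \<odot> cocycle m (act m x s) t \<odot> sect (act m x (s \<odot> t))" .
qed (use s t in simp)

lemma sect_entry:
  assumes x: "x \<in> X_space m"
  shows "k \<le> m \<Longrightarrow> m < n \<Longrightarrow> sect x k n = 0" and "m < k \<Longrightarrow> sect x k n = fst x k n"
    and "n \<le> m \<Longrightarrow> sect x k n = snd x k n"
proof -
  have D: "fst x \<in> unitri (Delta_sub m)" and A: "snd x \<in> unitri (Delta_sup m)" using x by (auto simp: X_space_iff)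
  show "k \<le> m \<Longrightarrow> m < n \<Longrightarrow> sect x k n = 0" unfolding sect_def
    by (subst mat_mult_finite[of "{}"])
       (use unitri_entry[OF D] unitri_entry[OF A] in \<open>auto simp: Delta_sub_def Delta_sup_def mat_id_def\<close>)
  show "m < k \<Longrightarrow> sect x k n = fst x k n" using fun_cong[OF fun_cong[OF lower_block_sect[OF x], of k], of n]
    by (simp add: lower_block_def)
  show "n \<le> m \<Longrightarrow> sect x k n = snd x k n" using fun_cong[OF fun_cong[OF upper_block_sect[OF x], of k], of n]
    by (simp add: upper_block_def)
qed

text \<open>Comparing the upper right blocks of \<open>s(x) t = h s(x')\<close> gives
  \<open>A t' = h' D'\<close>, with \<open>A\<close> the component \<open>snd x\<close>,
  \<open>D'\<close> the component \<open>fst x'\<close> and \<open>t'\<close>, \<open>h'\<close> the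
  blocks of \<open>t\<close> and \<open>h\<close>; multiply by the inverse of \<open>D'\<close>. The
  set \<open>F\<close> may be any finite set carrying the block of \<open>t\<close>: its support in
  general, a singleton or the empty set for elementary \<open>t\<close>.\<close>

lemma cocycle_entry:
  assumes x: "x \<in> X_space m" and t: "t \<in> BZ" and kn: "k \<le> m" "m < n"
    and F: "finite F" "F \<subseteq> Delta_mid m" "\<And>i l. (i, l) \<in> Delta_mid m \<Longrightarrow> t i l \<noteq> 0 \<Longrightarrow> (i, l) \<in> F"
  shows "cocycle m x t k n = (\<Sum>(i, l)\<in>F. t i l * (snd x k i * mat_inv (fst (act m x t)) l n))"
proof -
  define h where "h = cocycle m x t"
  define D' where "D' = fst (act m x t)"
  have x': "act m x t \<in> X_space m" by (rule act_X_space[OF x t])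
  have h: "h \<in> BZ" "sect x \<odot> t = h \<odot> sect (act m x t)"
    using cocycle_char(1,2)[OF x t] unitri_BZ by (auto simp: h_def)
  have D': "D' \<in> BZ" "D' \<in> unitri (Delta_sub m)" using x' by (auto simp: D'_def X_space_iff unitri_BZ)
  have D: "fst x \<in> unitri (Delta_sub m)" and A: "snd x \<in> unitri (Delta_sup m)" using x by (auto simp: X_space_iff)
  have z1: "(sect x \<odot> t) k l = (\<Sum>i\<in>{k..m}. snd x k i * t i l)" if l: "m < l" "l \<le> n" for l
  proof -
    have "(sect x \<odot> t) k l = (\<Sum>i\<in>{k..m}. sect x k i * t i l)"
    proof (rule mat_mult_finite)
      fix i assume "i \<notin> {k..m}"
      then have "sect x k i = 0"
        using sect_BZ[OF x] sect_entry(1)[OF x, of k i] kn by (auto simp: not_le BZ_below)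
      then show "sect x k i * t i l = 0" by simp
    qed simp
    then show ?thesis using sect_entry(3)[OF x] by simp
  qed
  have z2: "(h \<odot> sect (act m x t)) k l = (\<Sum>j\<in>{m+1..n}. h k j * D' j l)" if l: "m < l" "l \<le> n" for l
  proof -
    have "(h \<odot> sect (act m x t)) k l = (\<Sum>j\<in>{m+1..n}. h k j * sect (act m x t) j l)"
    proof (rule mat_mult_finite)
      fix j assume "j \<notin> {m+1..n}"
      then have "sect (act m x t) j l = 0"
        using sect_BZ[OF x'] sect_entry(1)[OF x', of j l] l by (auto simp: not_le BZ_below)
      then show "h k j * sect (act m x t) j l = 0" by simp
    qed simp
    then show ?thesis using sect_entry(2)[OF x'] by (simp add: D'_def)
  qed
  have "h k n = (\<Sum>j\<in>{m+1..n}. h k j * mat_id j n)"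
    using kn by (subst sum.remove[of _ n]) (auto intro!: sum.neutral simp: mat_id_def)
  also have "\<dots> = (\<Sum>j\<in>{m+1..n}. h k j * (\<Sum>l\<in>{m+1..n}. D' j l * mat_inv D' l n))"
  proof (rule sum.cong[OF refl])
    fix j assume "j \<in> {m+1..n}"
    then have "(D' \<odot> mat_inv D') j n = (\<Sum>l\<in>{m+1..n}. D' j l * mat_inv D' l n)"
      using D' by (intro mat_mult_superset) auto
    then show "h k j * mat_id j n = h k j * (\<Sum>l\<in>{m+1..n}. D' j l * mat_inv D' l n)" using D' by simp
  qed
  also have "\<dots> = (\<Sum>l\<in>{m+1..n}. (\<Sum>j\<in>{m+1..n}. h k j * D' j l) * mat_inv D' l n)"
    unfolding sum_distrib_left sum_distrib_right by (subst sum.swap) (simp add: mult.assoc)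
  also have "\<dots> = (\<Sum>l\<in>{m+1..n}. (\<Sum>i\<in>{k..m}. snd x k i * t i l) * mat_inv D' l n)"
    using z1 z2 h(2) by (intro sum.cong) auto
  also have "\<dots> = (\<Sum>(i, l)\<in>{k..m} \<times> {m+1..n}. t i l * (snd x k i * mat_inv D' l n))"
    unfolding sum_distrib_right by (subst sum.swap) (simp add: sum.cartesian_product ac_simps)
  also have "\<dots> = (\<Sum>(i, l)\<in>F. t i l * (snd x k i * mat_inv D' l n))"
  proof -
    have 1: "snd x k i * mat_inv D' l n = 0" if "(i, l) \<in> F - {k..m} \<times> {m+1..n}" for i l
    proof -
      have "i < k \<or> n < l" using that F(2) by (auto simp: Delta_mid_def not_le)
      then show ?thesis using D' unitri_BZ[OF A] by (auto simp: BZ_below)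
    qed
    have 2: "t i l = 0" if "(i, l) \<in> {k..m} \<times> {m+1..n} - F" for i l
      using that F(3)[of i l] by (auto simp: Delta_mid_def)
    show ?thesis
    proof (rule sum.mono_neutral_cong)
      show "(case p of (i, l) \<Rightarrow> t i l * (snd x k i * mat_inv D' l n)) = 0"
        if "p \<in> F - {k..m} \<times> {m+1..n}" for p using 1[of "fst p" "snd p"] that by (cases p) simp
      show "(case p of (i, l) \<Rightarrow> t i l * (snd x k i * mat_inv D' l n)) = 0"
        if "p \<in> {k..m} \<times> {m+1..n} - F" for p using 2[of "fst p" "snd p"] that by (cases p) simp
    qed (use F(1) in auto)
  qed
  finally show ?thesis by (simp add: h_def D'_def)
qed

section \<open>Elementary matrices and the finitary group\<close>

lemma mat_elem_BZ [simp]: "k < r \<Longrightarrow> mat_elem k r t \<in> BZ"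
  by (auto simp: BZ_def mat_elem_def mat_id_def)

lemma mat_mult_elem:
  assumes "k < r" shows "(A \<odot> mat_elem k r t) i j = A i j + (if j = r then t * A i k else 0)"
proof (cases "j = r")
  case True
  then have "(A \<odot> mat_elem k r t) i j = (\<Sum>l\<in>{k, r}. A i l * mat_elem k r t l j)"
    by (intro mat_mult_finite) (auto simp: mat_elem_def mat_id_def)
  then show ?thesis using assms True by (simp add: mat_elem_def mat_id_def)
next
  case False
  then have "(A \<odot> mat_elem k r t) i j = (\<Sum>l\<in>{j}. A i l * mat_elem k r t l j)"
    by (intro mat_mult_finite) (auto simp: mat_elem_def mat_id_def)
  then show ?thesis using assms False by (simp add: mat_elem_def mat_id_def)
qed

lemma mat_elem_mult:
  assumes "k < r" shows "mat_elem k r s \<odot> mat_elem k r t = mat_elem k r (s + t)"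
  using assms by (intro ext) (auto simp: mat_mult_elem, auto simp: mat_elem_def mat_id_def)

lemma mat_elem_0: "mat_elem k r 0 = mat_id"
  by (intro ext) (simp add: mat_elem_def)

lemma mat_inv_elem: "k < r \<Longrightarrow> mat_inv (mat_elem k r t) = mat_elem k r (- t)"
  by (rule mat_inv_eqI) (auto simp: mat_elem_mult mat_elem_0)

lemma lower_block_elem: "k < r \<Longrightarrow> lower_block m (mat_elem k r t) = (if m < k then mat_elem k r t else mat_id)"
  and upper_block_elem: "k < r \<Longrightarrow> upper_block m (mat_elem k r t) = (if r \<le> m then mat_elem k r t else mat_id)"
  by (auto simp: lower_block_def upper_block_def mat_elem_def mat_id_def fun_eq_iff)

lemma B0Z_BZ: "t \<in> B0Z \<Longrightarrow> t \<in> BZ"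
  by (simp add: B0Z_def)

lemma mat_id_B0Z: "mat_id \<in> B0Z"
  by (simp add: B0Z_def mat_id_def)

lemma mat_elem_B0Z: "k < r \<Longrightarrow> mat_elem k r t \<in> B0Z"
  unfolding B0Z_def by (auto intro: finite_subset[of _ "{(k, r)}"] simp: mat_elem_def mat_id_def)

lemma mat_elem_mult_row:
  assumes "k < r" "\<And>n. n \<noteq> r \<Longrightarrow> A r n = 0" "A r r = 1"
  shows "mat_elem k r t \<odot> A = (\<lambda>i j. A i j + (if i = k \<and> j = r then t else 0))"
proof (intro ext)
  fix i j
  have "(mat_elem k r t \<odot> A) i j = (\<Sum>l\<in>{i, r}. mat_elem k r t i l * A l j)"
    by (intro mat_mult_finite) (auto simp: mat_elem_def mat_id_def)
  then show "(mat_elem k r t \<odot> A) i j = A i j + (if i = k \<and> j = r then t else 0)"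
    using assms by (cases "i = r"; cases "j = r") (auto simp: mat_elem_def mat_id_def)
qed

text \<open>An elementary factor is split off on the left at the largest column index
  \<open>r\<close> that carries an off-diagonal entry. Row \<open>r\<close> is then trivial, so
  multiplying by \<open>I + s E_kr\<close> changes the entry \<open>(k, r)\<close> alone and the
  number of off-diagonal entries drops by one.\<close>

lemma B0Z_induct [consumes 1, case_names id mult]:
  assumes t: "t \<in> B0Z" and P1: "P mat_id"
    and step: "\<And>k r s t. k < r \<Longrightarrow> t \<in> B0Z \<Longrightarrow> P t \<Longrightarrow> P (mat_elem k r s \<odot> t)"
  shows "P t"
  using t
proof (induction "card {(k, n). k \<noteq> n \<and> t k n \<noteq> 0}" arbitrary: t rule: less_induct)
  case less
  let ?N = "\<lambda>t. {(k, n). k \<noteq> n \<and> (t::zmat) k n \<noteq> 0}"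
  have fin: "finite (?N t)" and B: "t \<in> BZ" using less.prems by (auto simp: B0Z_def)
  show ?case
  proof (cases "?N t = {}")
    case True
    have "t k n = mat_id k n" for k n
    proof (cases "k = n")
      case False
      then have "t k n = 0" using True by blast
      then show ?thesis using False by (simp add: mat_id_def)
    qed (use B in \<open>simp add: BZ_diag mat_id_def\<close>)
    then have "t = mat_id" by (intro ext)
    then show ?thesis using P1 by simp
  next
    case False
    define r where "r = Max (snd ` ?N t)"
    have "r \<in> snd ` ?N t" unfolding r_def using fin False by (intro Max_in) auto
    then obtain k where k: "(k, r) \<in> ?N t" by force
    then have kr: "k < r" using B by (auto simp: BZ_def) (metis linorder_neqE)
    define t' where "t' = (\<lambda>i j. if i = k \<and> j = r then 0 else t i j)"
    have N': "?N t' = ?N t - {(k, r)}" by (auto simp: t'_def)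
    have t'B: "t' \<in> B0Z" using less.prems kr N' fin unfolding B0Z_def BZ_def by (auto simp: t'_def)
    have "card (?N t') < card (?N t)" unfolding N' using k fin by (intro psubset_card_mono) auto
    then have P': "P t'" using less.hyps t'B by blast
    have "t' r n = 0" if "n \<noteq> r" for n
    proof (rule ccontr)
      assume "t' r n \<noteq> 0"
      then have "\<not> n < r" using BZ_below[OF B0Z_BZ[OF t'B]] by blast
      with \<open>t' r n \<noteq> 0\<close> have "(r, n) \<in> ?N t" "r < n" using that
        by (auto simp: t'_def split: if_splits)
      moreover from this(1) have "n \<le> r" unfolding r_def using fin by (intro Max_ge) force+
      ultimately show False by simp
    qed
    moreover have "t' r r = 1" using B0Z_BZ[OF t'B] by (simp add: BZ_diag)
    ultimately have "mat_elem k r (t k r) \<odot> t' = t"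
      using kr by (subst mat_elem_mult_row) (auto simp: t'_def fun_eq_iff)
    then show ?thesis using step[OF kr t'B P', of "t k r"] by simp
  qed
qed

lemma B0Z_mult:
  assumes s: "s \<in> B0Z" and t: "t \<in> B0Z" shows "s \<odot> t \<in> B0Z"
proof -
  let ?N = "\<lambda>t. {(k, n). k \<noteq> n \<and> (t::zmat) k n \<noteq> 0}"
  have "?N (s \<odot> t) \<subseteq> ?N s \<union> ?N t \<union> fst ` ?N s \<times> snd ` ?N t"
  proof (rule subsetI, rule ccontr)
    fix p assume p: "p \<in> ?N (s \<odot> t)" "p \<notin> ?N s \<union> ?N t \<union> fst ` ?N s \<times> snd ` ?N t"
    obtain k n where kn_def: "p = (k, n)" by (cases p)
    have kn: "k \<noteq> n" "(s \<odot> t) k n \<noteq> 0" and z: "s k n = 0" "t k n = 0"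
      and no: "(k, n) \<notin> fst ` ?N s \<times> snd ` ?N t" using p by (auto simp: kn_def)
    have "(s \<odot> t) k n = (\<Sum>l\<in>{k..n}. s k l * t l n)" by (rule mat_mult_BZ) (use s t B0Z_BZ in auto)
    moreover have "\<dots> = 0" if "\<nexists>l. s k l * t l n \<noteq> 0" using that by (intro sum.neutral) blast
    ultimately have "\<exists>l. s k l * t l n \<noteq> 0" using kn(2) by metis
    then obtain l where l: "s k l * t l n \<noteq> 0" ..
    then have "l \<noteq> k" "l \<noteq> n" using z by auto
    then have "(k, l) \<in> ?N s" "(l, n) \<in> ?N t" using l by auto
    then have "k \<in> fst ` ?N s" "n \<in> snd ` ?N t" by (force intro: image_eqI)+
    then show False using no by blast
  qed
  moreover have "finite (?N s)" using s unfolding B0Z_def mem_Collect_eq by (rule conjunct2)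
  moreover have "finite (?N t)" using t unfolding B0Z_def mem_Collect_eq by (rule conjunct2)
  ultimately have "finite (?N (s \<odot> t))"
    by (elim finite_subset) (intro finite_UnI finite_cartesian_product finite_imageI)
  moreover have "s \<odot> t \<in> BZ" using s t by (intro mat_mult_closed B0Z_BZ)
  ultimately show ?thesis unfolding B0Z_def by simp
qed

lemma B0Z_inv: "t \<in> B0Z \<Longrightarrow> mat_inv t \<in> B0Z"
proof (induction rule: B0Z_induct)
  case id then show ?case by (simp add: mat_id_B0Z)
next
  case (mult k r s t)
  then show ?case by (simp add: mat_inv_mult B0Z_BZ mat_inv_elem B0Z_mult mat_elem_B0Z)
qed

section \<open>Coordinates and the Gaussian measure\<close>

text \<open>Because of its default value 0 the unconditional sum is not simply a limit of partial
  sums: it equals the series on the measurable set where the sum of absolute values is finite, and 0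
  elsewhere.\<close>

lemma infsum_nat_measurable:
  fixes f :: "nat \<Rightarrow> 'a \<Rightarrow> real"
  assumes [measurable]: "\<And>p. f p \<in> borel_measurable M"
  shows "(\<lambda>x. infsum (\<lambda>p. f p x) UNIV) \<in> borel_measurable M"
proof -
  have *: "infsum (\<lambda>p. f p x) UNIV = (if (\<Sum>p. ennreal \<bar>f p x\<bar>) < \<infinity> then (\<Sum>p. f p x) else 0)" for x
  proof (cases "summable (\<lambda>p. \<bar>f p x\<bar>)")
    case True
    then have "(\<lambda>p. f p x) summable_on UNIV"
      by (simp add: norm_summable_imp_summable_on)
    then have "((\<lambda>p. f p x) has_sum infsum (\<lambda>p. f p x) UNIV) UNIV" by simp
    then have "(\<lambda>p. f p x) sums infsum (\<lambda>p. f p x) UNIV" by (rule has_sum_imp_sums)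
    moreover have "(\<Sum>p. ennreal \<bar>f p x\<bar>) = ennreal (\<Sum>p. \<bar>f p x\<bar>)"
      using True by (intro suminf_ennreal_eq) (auto simp: summable_sums)
    ultimately show ?thesis by (simp add: sums_unique)
  next
    case False
    have "\<not> (\<lambda>p. f p x) summable_on UNIV"
    proof
      assume "(\<lambda>p. f p x) summable_on UNIV"
      then have "(\<lambda>p. norm (f p x)) summable_on UNIV"
        by (rule summable_on_iff_abs_summable_on_real[THEN iffD1])
      then have "summable (\<lambda>p. norm (f p x))" by (rule summable_on_imp_summable)
      then show False using False by simp
    qed
    moreover have "(\<Sum>p. ennreal \<bar>f p x\<bar>) = \<infinity>"
    proof (rule ccontr)
      assume "(\<Sum>p. ennreal \<bar>f p x\<bar>) \<noteq> \<infinity>"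
      then have "summable (\<lambda>p. \<bar>f p x\<bar>)" by (intro summable_suminf_not_top) auto
      then show False using False by contradiction
    qed
    ultimately show ?thesis by (simp add: infsum_not_exists)
  qed
  show ?thesis unfolding * by measurable
qed

section \<open>Measurability in matrix coordinates\<close>

lemma space_unitri_borel [simp]: "space (unitri_borel D) = unitri D"
  by (simp add: unitri_borel_def)

lemma unitri_coord_measurable: "(\<lambda>x. x k n) \<in> borel_measurable (unitri_borel D)"
proof (cases "(k, n) \<in> D")
  case True
  have "(\<lambda>x. \<lambda>(k, n)\<in>D. x k n) \<in> measurable (unitri_borel D) (\<Pi>\<^sub>M p\<in>D. (borel :: real measure))"
    unfolding unitri_borel_def by (rule measurable_vimage_algebra1) (auto simp: space_PiM)
  from measurable_compose[OF this measurable_component_singleton[OF True]]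
  show ?thesis using True by simp
next
  case False
  then have "x k n = mat_id k n" if "x \<in> space (unitri_borel D)" for x
    using unitri_entry[of x D] that by simp
  then show ?thesis by (subst measurable_cong[where g = "\<lambda>_. mat_id k n"]) auto
qed

lemma measurable_unitri:
  assumes "\<And>x. x \<in> space M \<Longrightarrow> f x \<in> unitri D"
    and "\<And>k n. (k, n) \<in> D \<Longrightarrow> (\<lambda>x. f x k n) \<in> borel_measurable M"
  shows "f \<in> measurable M (unitri_borel D)"
  unfolding unitri_borel_def
proof (rule measurable_vimage_algebra2)
  show "f \<in> space M \<rightarrow> unitri D" using assms(1) by auto
  show "(\<lambda>x. \<lambda>(k, n)\<in>D. f x k n) \<in> measurable M (\<Pi>\<^sub>M p\<in>D. borel)"
  proof (rule measurable_PiM_single')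
    fix p assume "p \<in> D"
    then show "(\<lambda>x. restrict (\<lambda>(k, n). f x k n) D p) \<in> borel_measurable M"
      using assms(2) by (cases p) simp
  qed (auto simp: space_PiM)
qed

lemma of_coords_unitri:
  assumes "D \<subseteq> {(k, n). k < n}" shows "of_coords D v \<in> unitri D"
  using assms by (auto simp: of_coords_def unitri_def BZ_def)

lemma Delta_subsets: "Delta_sub m \<subseteq> {(k, n). k < n}" "Delta_sup m \<subseteq> {(k, n). k < n}"
  by (auto simp: Delta_sub_def Delta_sup_def)

lemma sets_gauss [simp, measurable_cong]: "sets (gauss \<beta>) = sets borel"
  by (simp add: gauss_def)

lemma space_gauss [simp]: "space (gauss \<beta>) = UNIV"
  by (simp add: gauss_def)

lemma gauss_normal:
  assumes "\<beta> > 0" shows "gauss \<beta> = density lborel (normal_density 0 (1 / sqrt (2 * \<beta>)))"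
proof -
  have "sqrt (\<beta> / pi) * exp (- \<beta> * x\<^sup>2) = normal_density 0 (1 / sqrt (2 * \<beta>)) x" for x
    using assms by (simp add: normal_density_def real_sqrt_divide power_divide field_simps)
  then show ?thesis unfolding gauss_def by simp
qed

lemma prob_space_gauss: "\<beta> > 0 \<Longrightarrow> prob_space (gauss \<beta>)"
  unfolding gauss_normal by (rule prob_space_normal_density) simp

lemma sets_PiM_gauss: "sets (\<Pi>\<^sub>M (k, n)\<in>D. gauss (b k n)) = sets (\<Pi>\<^sub>M p\<in>D. borel)"
  by (rule sets_PiM_cong) (auto split: prod.split)

lemma of_coords_measurable:
  assumes "D \<subseteq> {(k, n). k < n}"
  shows "of_coords D \<in> measurable (\<Pi>\<^sub>M p\<in>D. borel) (unitri_borel D)"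
proof (rule measurable_unitri)
  fix k n assume "(k, n) \<in> D"
  moreover then have "k \<noteq> n" using assms by auto
  ultimately show "(\<lambda>v. of_coords D v k n) \<in> borel_measurable (\<Pi>\<^sub>M p\<in>D. borel)"
    by (simp add: of_coords_def)
qed (rule of_coords_unitri[OF assms])

lemma sets_gauss_unitri [simp, measurable_cong]: "sets (gauss_unitri D b) = sets (unitri_borel D)"
  by (simp add: gauss_unitri_def)

lemma space_gauss_unitri [simp]: "space (gauss_unitri D b) = unitri D"
  by (simp add: gauss_unitri_def)

lemma prob_space_gauss_unitri:
  assumes "D \<subseteq> {(k, n). k < n}" "\<And>k n. (k, n) \<in> D \<Longrightarrow> b k n > 0"
  shows "prob_space (gauss_unitri D b)"
proof -
  interpret prob_space "\<Pi>\<^sub>M (k, n)\<in>D. gauss (b k n)"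
    by (rule prob_space_PiM) (use assms(2) prob_space_gauss in auto)
  show ?thesis unfolding gauss_unitri_def
    by (rule prob_space_distr) (use of_coords_measurable[OF assms(1)] in \<open>simp add: sets_PiM_gauss cong: measurable_cong_sets\<close>)
qed

lemma emeasure_gauss_unitri_box:
  assumes D: "D \<subseteq> {(k, n). k < n}" "\<And>k n. (k, n) \<in> D \<Longrightarrow> b k n > 0"
    and J: "finite J" "J \<subseteq> D" and F: "\<And>j. j \<in> J \<Longrightarrow> F j \<in> sets borel"
  shows "emeasure (gauss_unitri D b) {x \<in> unitri D. \<forall>(k, n)\<in>J. x k n \<in> F (k, n)} =
    (\<Prod>(k, n)\<in>J. emeasure (gauss (b k n)) (F (k, n)))"
proof -
  let ?P = "\<Pi>\<^sub>M (k, n)\<in>D. gauss (b k n)"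
  note [measurable] = unitri_coord_measurable
  have of_coords [measurable]: "of_coords D \<in> measurable ?P (unitri_borel D)"
    using of_coords_measurable[OF D(1)] by (simp add: sets_PiM_gauss cong: measurable_cong_sets)
  have [measurable]: "{x \<in> unitri D. \<forall>(k, n)\<in>J. x k n \<in> F (k, n)} \<in> sets (unitri_borel D)"
  proof -
    have "{x \<in> space (unitri_borel D). \<forall>j\<in>J. x (fst j) (snd j) \<in> F j} \<in> sets (unitri_borel D)"
      using J(1) F by measurable
    then show ?thesis by (simp add: case_prod_beta)
  qed
  have "of_coords D -` {x \<in> unitri D. \<forall>(k, n)\<in>J. x k n \<in> F (k, n)} \<inter> space ?P =
    prod_emb D (\<lambda>(k, n). gauss (b k n)) J (\<Pi>\<^sub>E j\<in>J. F j)"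
    using J(2) D(1) of_coords_unitri[OF D(1)]
    by (fastforce simp: prod_emb_def space_PiM PiE_iff of_coords_def split: prod.splits)
  then have "emeasure (gauss_unitri D b) {x \<in> unitri D. \<forall>(k, n)\<in>J. x k n \<in> F (k, n)} =
    emeasure ?P (prod_emb D (\<lambda>(k, n). gauss (b k n)) J (\<Pi>\<^sub>E j\<in>J. F j))"
    unfolding gauss_unitri_def by (subst emeasure_distr) auto
  also have "\<dots> = (\<Prod>j\<in>J. emeasure (case j of (k, n) \<Rightarrow> gauss (b k n)) (F j))"
    by (rule emeasure_PiM_emb) (use D J F prob_space_gauss in \<open>auto split: prod.splits\<close>)
  finally show ?thesis by (simp add: case_prod_beta)
qed

definition Idx :: "int \<Rightarrow> (int \<times> int) set" where "Idx m = Delta_sub m \<union> Delta_sup m"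

definition coords :: "int \<Rightarrow> zmat \<times> zmat \<Rightarrow> int \<times> int \<Rightarrow> real" where
  "coords m x = (\<lambda>(k, n). coord m x k n)"

definition from_coords :: "int \<Rightarrow> (int \<times> int \<Rightarrow> real) \<Rightarrow> zmat \<times> zmat" where
  "from_coords m v = (of_coords (Delta_sub m) v, of_coords (Delta_sup m) v)"

text \<open>Frozen coordinates carry a Dirac mass at the entry of the identity. The product then
  lives on all real functions of two integers, a Polish space whose Borel sets are the product
  sigma-algebra, and the diagonal entries are coordinates like any others.\<close>

definition coordM :: "int \<Rightarrow> zmat \<Rightarrow> int \<times> int \<Rightarrow> real measure" where
  "coordM m b i = (if i \<in> Idx m then gauss (b (fst i) (snd i)) else return borel (mat_id (fst i) (snd i)))"

definition nu :: "int \<Rightarrow> zmat \<Rightarrow> (int \<times> int \<Rightarrow> real) measure" where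
  "nu m b = Pi\<^sub>M UNIV (coordM m b)"

lemma sets_coordM [simp]: "sets (coordM m b i) = sets borel"
  by (simp add: coordM_def)

lemma space_coordM [simp]: "space (coordM m b i) = UNIV"
  by (simp add: coordM_def)

lemma sets_nu [measurable_cong]: "sets (nu m b) = sets (\<Pi>\<^sub>M i\<in>UNIV. borel)"
  unfolding nu_def by (rule sets_PiM_cong) auto

lemma sets_nu_borel: "sets (nu m b) = sets borel"
  by (simp add: sets_nu sets_PiM_equal_borel)

lemma space_nu [simp]: "space (nu m b) = UNIV"
  by (simp add: nu_def space_PiM PiE_UNIV_domain)

lemma coords_off_Idx: "x \<in> X_space m \<Longrightarrow> (k, n) \<notin> Idx m \<Longrightarrow> coords m x (k, n) = mat_id k n"
  unfolding coords_def coord_def Idx_def X_space_iff by (auto simp: unitri_entry)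

lemma from_coords_X_space: "from_coords m v \<in> X_space m"
  by (simp add: X_space_iff from_coords_def of_coords_unitri Delta_subsets)

lemma of_coords_eqI:
  assumes "x \<in> unitri D" "\<And>k n. (k, n) \<in> D \<Longrightarrow> v (k, n) = x k n" shows "of_coords D v = x"
proof (intro ext)
  fix k n show "of_coords D v k n = x k n"
    using assms unitri_entry[OF assms(1), of k n] BZ_diag[OF unitri_BZ[OF assms(1)], of k]
    by (auto simp: of_coords_def mat_id_def)
qed

lemma from_coords_coords: "x \<in> X_space m \<Longrightarrow> from_coords m (coords m x) = x"
  unfolding from_coords_def
  by (rule prod_eqI)
     (auto intro!: of_coords_eqI simp: coords_def coord_def X_space_iff Delta_sub_def Delta_sup_def)

lemma sets_mu: "sets (mu m b) = sets (unitri_borel (Delta_sub m) \<Otimes>\<^sub>M unitri_borel (Delta_sup m))"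
  unfolding mu_def by (rule sets_pair_measure_cong) auto

declare sets_mu [measurable_cong]

lemma space_mu [simp]: "space (mu m b) = X_space m"
  by (simp add: mu_def space_pair_measure X_space_def)

lemma fst_mu [measurable]: "(\<lambda>x. fst x k n) \<in> borel_measurable (mu m b)"
  supply unitri_coord_measurable [measurable] by measurable

lemma snd_mu [measurable]: "(\<lambda>x. snd x k n) \<in> borel_measurable (mu m b)"
  supply unitri_coord_measurable [measurable] by measurable

lemma coord_mu [measurable]: "(\<lambda>x. coord m' x k n) \<in> borel_measurable (mu m b)"
  unfolding coord_def by measurable

lemma coords_measurable [measurable]: "coords m' \<in> measurable (mu m b) (\<Pi>\<^sub>M i\<in>UNIV. borel)"
  by (rule measurable_PiM_single') (auto simp: coords_def space_PiM split: prod.splits)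

lemma measurable_mu:
  assumes "\<And>x. x \<in> space M \<Longrightarrow> f x \<in> X_space m"
    and "\<And>k n. (k, n) \<in> Delta_sub m \<Longrightarrow> (\<lambda>x. fst (f x) k n) \<in> borel_measurable M"
    and "\<And>k n. (k, n) \<in> Delta_sup m \<Longrightarrow> (\<lambda>x. snd (f x) k n) \<in> borel_measurable M"
  shows "f \<in> measurable M (mu m b)"
proof -
  have "(\<lambda>x. fst (f x)) \<in> measurable M (unitri_borel (Delta_sub m))"
    by (rule measurable_unitri) (use assms in \<open>auto simp: X_space_iff\<close>)
  moreover have "(\<lambda>x. snd (f x)) \<in> measurable M (unitri_borel (Delta_sup m))"
    by (rule measurable_unitri) (use assms in \<open>auto simp: X_space_iff\<close>)
  ultimately have "(\<lambda>x. (fst (f x), snd (f x))) \<in> measurable M (unitri_borel (Delta_sub m) \<Otimes>\<^sub>M unitri_borel (Delta_sup m))"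
    by (rule measurable_Pair)
  then show ?thesis by (simp add: sets_mu cong: measurable_cong_sets)
qed

lemma from_coords_measurable [measurable]: "from_coords m \<in> measurable (\<Pi>\<^sub>M i\<in>UNIV. borel) (mu m b)"
proof (rule measurable_mu)
  fix k n
  show "(\<lambda>x. fst (from_coords m x) k n) \<in> borel_measurable (Pi\<^sub>M UNIV (\<lambda>i. borel))"
    "(\<lambda>x. snd (from_coords m x) k n) \<in> borel_measurable (Pi\<^sub>M UNIV (\<lambda>i. borel))"
    by (simp_all add: from_coords_def of_coords_def)
qed (rule from_coords_X_space)

lemma act_measurable [measurable]:
  assumes t: "t \<in> BZ" shows "(\<lambda>x. act m x t) \<in> measurable (mu m b) (mu m b)"
proof (rule measurable_mu)
  fix k n
  have "(\<lambda>x. \<Sum>l\<in>{k..n}. fst x k l * lower_block m t l n) \<in> borel_measurable (mu m b)" by measurable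
  then show "(\<lambda>x. fst (act m x t) k n) \<in> borel_measurable (mu m b)"
    by (rule measurable_cong[THEN iffD1, rotated])
       (use t in \<open>auto simp: act_eq mat_mult_BZ unitri_BZ X_space_iff\<close>)
  have "(\<lambda>x. \<Sum>l\<in>{k..n}. snd x k l * upper_block m t l n) \<in> borel_measurable (mu m b)" by measurable
  then show "(\<lambda>x. snd (act m x t) k n) \<in> borel_measurable (mu m b)"
    by (rule measurable_cong[THEN iffD1, rotated])
       (use t in \<open>auto simp: act_eq mat_mult_BZ unitri_BZ X_space_iff\<close>)
qed (use act_X_space t in simp)

lemma inv_row_measurable [measurable]: "(\<lambda>x. inv_row (fst x) k d) \<in> borel_measurable (mu m b)"
proof (induction d rule: less_induct)
  case (less d)
  have [measurable]: "(\<lambda>x. inv_row (fst x) k e) \<in> borel_measurable (mu m b)" if "e \<in> {..<d}" for e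
    using less that by simp
  show ?case by (subst inv_row.simps) measurable
qed

lemma mat_inv_measurable [measurable]: "(\<lambda>x. mat_inv (fst x) k n) \<in> borel_measurable (mu m b)"
proof -
  have "(\<lambda>x. left_inv (fst x) k n) \<in> borel_measurable (mu m b)" unfolding left_inv_def by measurable
  then show ?thesis
    by (rule measurable_cong[THEN iffD1, rotated]) (auto simp: X_space_iff mat_inv_left_inv unitri_BZ)
qed

definition mid_supp :: "int \<Rightarrow> zmat \<Rightarrow> (int \<times> int) set" where
  "mid_supp m t = {(i, l) \<in> Delta_mid m. t i l \<noteq> 0}"

lemma mid_supp_finite: "t \<in> B0Z \<Longrightarrow> finite (mid_supp m t)"
proof -
  assume "t \<in> B0Z"
  then have "finite {(k, n). k \<noteq> n \<and> t k n \<noteq> 0}" by (simp add: B0Z_def)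
  then show ?thesis by (rule finite_subset[rotated]) (auto simp: mid_supp_def Delta_mid_def)
qed

lemma cocycle_entry_B0Z:
  assumes "x \<in> X_space m" "t \<in> B0Z" "k \<le> m" "m < n"
  shows "cocycle m x t k n = (\<Sum>(i, l)\<in>mid_supp m t. t i l * (snd x k i * mat_inv (fst (act m x t)) l n))"
  by (rule cocycle_entry) (use assms B0Z_BZ mid_supp_finite in \<open>auto simp: mid_supp_def\<close>)

lemma cocycle_measurable:
  assumes t: "t \<in> B0Z" and kn: "k \<le> m" "m < n"
  shows "(\<lambda>x. cocycle m x t k n) \<in> borel_measurable (mu m b)"
proof -
  have [measurable]: "(\<lambda>x. mat_inv (fst (act m x t)) l n) \<in> borel_measurable (mu m b)" for l n
    by (rule measurable_compose[OF act_measurable[OF B0Z_BZ[OF t]] mat_inv_measurable])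
  have "(\<lambda>x. \<Sum>p\<in>mid_supp m t. t (fst p) (snd p) * (snd x k (fst p) * mat_inv (fst (act m x t)) (snd p) n)) \<in> borel_measurable (mu m b)"
    by measurable
  then show ?thesis
    by (rule measurable_cong[THEN iffD1, rotated])
       (use t kn in \<open>auto simp: cocycle_entry_B0Z case_prod_beta\<close>)
qed

section \<open>Pairing with a functional on the antidiagonal\<close>

definition antidiag :: "int \<Rightarrow> zmat \<Rightarrow> bool" where
  "antidiag m y \<longleftrightarrow> (\<forall>i j. (\<nexists>r::nat. i = m + int r + 1 \<and> j = m - int r) \<longrightarrow> y i j = 0)"

lemma pairing_antidiag:
  assumes y: "antidiag m y"
  shows "pairing y x = (\<Sum>\<^sub>\<infinity>p::nat. x (m - int p) (m + int p + 1) * y (m + int p + 1) (m - int p))"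
    and "(\<lambda>(k, n). x k n * y n k) summable_on {(k, n). k < n} \<longleftrightarrow>
      (\<lambda>p::nat. x (m - int p) (m + int p + 1) * y (m + int p + 1) (m - int p)) summable_on UNIV"
proof -
  let ?g = "\<lambda>p::nat. (m - int p, m + int p + 1)"
  have inj: "inj ?g" by (auto simp: inj_def)
  have z: "(case q of (k, n) \<Rightarrow> x k n * y n k) = 0" if "q \<in> {(k, n). k < n} - range ?g" for q
    using y that unfolding antidiag_def by (cases q) force
  show "pairing y x = (\<Sum>\<^sub>\<infinity>p::nat. x (m - int p) (m + int p + 1) * y (m + int p + 1) (m - int p))"
  proof -
    have "pairing y x = infsum (\<lambda>(k, n). x k n * y n k) (range ?g)"
      unfolding pairing_def by (rule infsum_cong_neutral) (use z in auto)
    also have "\<dots> = infsum ((\<lambda>(k, n). x k n * y n k) \<circ> ?g) UNIV"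
      by (rule infsum_reindex[OF inj])
    finally show ?thesis by (simp add: o_def)
  qed
  have "(\<lambda>(k, n). x k n * y n k) summable_on {(k, n). k < n} \<longleftrightarrow> (\<lambda>(k, n). x k n * y n k) summable_on (range ?g)"
    by (rule summable_on_cong_neutral) (use z in auto)
  also have "\<dots> \<longleftrightarrow> ((\<lambda>(k, n). x k n * y n k) \<circ> ?g) summable_on UNIV"
    by (rule summable_on_reindex[OF inj])
  finally show "(\<lambda>(k, n). x k n * y n k) summable_on {(k, n). k < n} \<longleftrightarrow>
      (\<lambda>p::nat. x (m - int p) (m + int p + 1) * y (m + int p + 1) (m - int p)) summable_on UNIV"
    by (simp add: o_def)
qed

lemma pairing_cocycle_measurable:
  assumes t: "t \<in> B0Z" and y: "antidiag m y"
  shows "(\<lambda>x. pairing y (\<lambda>i j. cocycle m x t i j - mat_id i j)) \<in> borel_measurable (mu m b)"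
  unfolding pairing_antidiag(1)[OF y]
  by (intro infsum_nat_measurable borel_measurable_times borel_measurable_diff cocycle_measurable[OF t]) auto

section \<open>The Gaussian measure as a product over the full index set\<close>

locale gauss_mu =
  fixes m :: int and b :: zmat
  assumes b_pos: "\<And>k n. (k, n) \<in> Idx m \<Longrightarrow> 0 < b k n"
begin

lemma prob_coordM: "prob_space (coordM m b i)"
  using b_pos[of "fst i" "snd i"] by (auto simp: coordM_def prob_space_gauss intro: prob_space_return)

sublocale C: prob_space "coordM m b i" for i
  by (rule prob_coordM)

sublocale PC: product_prob_space "coordM m b" UNIV ..

sublocale nu: prob_space "nu m b"
  unfolding nu_def by (rule prob_space_PiM) (rule prob_coordM)

sublocale Gsub: prob_space "gauss_unitri (Delta_sub m) b"
  by (rule prob_space_gauss_unitri) (use Delta_subsets b_pos in \<open>auto simp: Idx_def\<close>)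

sublocale Gsup: prob_space "gauss_unitri (Delta_sup m) b"
  by (rule prob_space_gauss_unitri) (use Delta_subsets b_pos in \<open>auto simp: Idx_def\<close>)

sublocale Gpair: pair_prob_space "gauss_unitri (Delta_sub m) b" "gauss_unitri (Delta_sup m) b" ..

sublocale mu: prob_space "mu m b"
  unfolding mu_def by (rule Gpair.P.prob_space_axioms)

lemma distr_mu_nu: "distr (mu m b) (nu m b) (coords m) = nu m b"
  unfolding nu_def[of m b]
proof (rule PC.PiM_eq)
  fix J F assume J: "finite J" "J \<subseteq> (UNIV::(int\<times>int) set)" and F: "\<And>j. j \<in> J \<Longrightarrow> F j \<in> sets (coordM m b j)"
  note [measurable] = unitri_coord_measurable
  define J1 where "J1 = J \<inter> Delta_sub m"
  define J2 where "J2 = J \<inter> Delta_sup m"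
  define J3 where "J3 = J - Idx m"
  have disj: "Delta_sub m \<inter> Delta_sup m = {}" by (auto simp: Delta_sub_def Delta_sup_def)
  have JJ: "J = J1 \<union> (J2 \<union> J3)" "J1 \<inter> (J2 \<union> J3) = {}" "J2 \<inter> J3 = {}"
    using disj by (auto simp: J1_def J2_def J3_def Idx_def)
  have fin: "finite J1" "finite J2" "finite J3" using J by (auto simp: J1_def J2_def J3_def)
  have bp: "\<And>k n. (k, n) \<in> Delta_sub m \<Longrightarrow> 0 < b k n" "\<And>k n. (k, n) \<in> Delta_sup m \<Longrightarrow> 0 < b k n"
    using b_pos by (auto simp: Idx_def)
  have FB: "F j \<in> sets borel" if "j \<in> J" for j using F[OF that] by simp
  have FB1: "\<And>j. j \<in> J1 \<Longrightarrow> F j \<in> sets borel" and FB2: "\<And>j. j \<in> J2 \<Longrightarrow> F j \<in> sets borel"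
    using FB by (auto simp: J1_def J2_def)
  define A1 where "A1 = {x \<in> unitri (Delta_sub m). \<forall>(k, n)\<in>J1. x k n \<in> F (k, n)}"
  define A2 where "A2 = {x \<in> unitri (Delta_sup m). \<forall>(k, n)\<in>J2. x k n \<in> F (k, n)}"
  define c where "c \<longleftrightarrow> (\<forall>(k, n)\<in>J3. mat_id k n \<in> F (k, n))"
  have A1m: "A1 \<in> sets (unitri_borel (Delta_sub m))"
  proof -
    have "{x \<in> space (unitri_borel (Delta_sub m)). \<forall>j\<in>J1. x (fst j) (snd j) \<in> F j} \<in> sets (unitri_borel (Delta_sub m))"
      using fin(1) FB1 by measurable
    then show ?thesis by (simp add: A1_def case_prod_beta)
  qed
  have A2m: "A2 \<in> sets (unitri_borel (Delta_sup m))"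
  proof -
    have "{x \<in> space (unitri_borel (Delta_sup m)). \<forall>j\<in>J2. x (fst j) (snd j) \<in> F j} \<in> sets (unitri_borel (Delta_sup m))"
      using fin(2) FB2 by measurable
    then show ?thesis by (simp add: A2_def case_prod_beta)
  qed
  have "coords m -` prod_emb UNIV (coordM m b) J (Pi\<^sub>E J F) \<inter> space (mu m b) = {x \<in> X_space m. \<forall>j\<in>J. coords m x j \<in> F j}"
    by (auto simp: prod_emb_def PiE_iff space_PiM)
  also have "\<dots> = (if c then A1 \<times> A2 else {})"
  proof -
    have e1: "(\<forall>j\<in>J. coords m x j \<in> F j) \<longleftrightarrow> (\<forall>j\<in>J1. coords m x j \<in> F j) \<and> (\<forall>j\<in>J2. coords m x j \<in> F j) \<and> (\<forall>j\<in>J3. coords m x j \<in> F j)" for x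
      by (subst JJ(1)) blast
    have e2: "(\<forall>j\<in>J1. coords m x j \<in> F j) \<longleftrightarrow> (\<forall>(k, n)\<in>J1. fst x k n \<in> F (k, n))" for x
      by (fastforce simp: J1_def coords_def coord_def Delta_sub_def)
    have e3: "(\<forall>j\<in>J2. coords m x j \<in> F j) \<longleftrightarrow> (\<forall>(k, n)\<in>J2. snd x k n \<in> F (k, n))" for x
      by (fastforce simp: J2_def coords_def coord_def Delta_sup_def)
    have e4: "(\<forall>j\<in>J3. coords m x j \<in> F j) \<longleftrightarrow> c" if "x \<in> X_space m" for x
    proof -
      have "coords m x j = mat_id (fst j) (snd j)" if "j \<in> J3" for j
        using coords_off_Idx[OF \<open>x \<in> X_space m\<close>, of "fst j" "snd j"] that by (simp add: J3_def)
      then show ?thesis unfolding c_def by auto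
    qed
    have "{x \<in> X_space m. \<forall>j\<in>J. coords m x j \<in> F j} =
      {x \<in> X_space m. (\<forall>(k, n)\<in>J1. fst x k n \<in> F (k, n)) \<and> (\<forall>(k, n)\<in>J2. snd x k n \<in> F (k, n)) \<and> c}"
    proof (intro Collect_cong conj_cong refl)
      fix x assume "x \<in> X_space m"
      then show "(\<forall>j\<in>J. coords m x j \<in> F j) \<longleftrightarrow>
        (\<forall>(k, n)\<in>J1. fst x k n \<in> F (k, n)) \<and> (\<forall>(k, n)\<in>J2. snd x k n \<in> F (k, n)) \<and> c"
        by (simp only: e1 e2 e3 e4)
    qed
    also have "\<dots> = (if c then A1 \<times> A2 else {})"
      unfolding A1_def A2_def by (auto simp: X_space_def)
    finally show ?thesis .
  qed
  finally have vim: "coords m -` prod_emb UNIV (coordM m b) J (Pi\<^sub>E J F) \<inter> space (mu m b) = (if c then A1 \<times> A2 else {})" .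
  have "emeasure (distr (mu m b) (Pi\<^sub>M UNIV (coordM m b)) (coords m)) (prod_emb UNIV (coordM m b) J (Pi\<^sub>E J F)) =
    emeasure (mu m b) (if c then A1 \<times> A2 else {})"
    unfolding vim[symmetric]
  proof (rule emeasure_distr)
    show "coords m \<in> measurable (mu m b) (Pi\<^sub>M UNIV (coordM m b))"
      using coords_measurable[of m m b] by (simp add: nu_def[symmetric] sets_nu cong: measurable_cong_sets)
    show "prod_emb UNIV (coordM m b) J (Pi\<^sub>E J F) \<in> sets (Pi\<^sub>M UNIV (coordM m b))"
      using J F by (intro sets_PiM_I) auto
  qed
  also have "\<dots> = emeasure (gauss_unitri (Delta_sub m) b) A1 * emeasure (gauss_unitri (Delta_sup m) b) A2 * (if c then 1 else 0)"
    using A1m A2m by (simp add: mu_def Gsup.emeasure_pair_measure_Times)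
  also have "emeasure (gauss_unitri (Delta_sub m) b) A1 = (\<Prod>j\<in>J1. emeasure (coordM m b j) (F j))"
    unfolding A1_def using fin FB bp Delta_subsets
    by (subst emeasure_gauss_unitri_box) (auto simp: J1_def coordM_def Idx_def intro!: prod.cong)
  also have "emeasure (gauss_unitri (Delta_sup m) b) A2 = (\<Prod>j\<in>J2. emeasure (coordM m b j) (F j))"
    unfolding A2_def using fin FB bp Delta_subsets
    by (subst emeasure_gauss_unitri_box) (auto simp: J2_def coordM_def Idx_def intro!: prod.cong)
  also have "(if c then 1 else 0) = (\<Prod>j\<in>J3. emeasure (coordM m b j) (F j))"
  proof -
    have e: "emeasure (coordM m b j) (F j) = indicator (F j) (mat_id (fst j) (snd j))" if "j \<in> J3" for j
      using that FB[of j] by (auto simp: coordM_def J3_def)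
    show ?thesis
    proof (cases c)
      case True
      then show ?thesis using e unfolding c_def by (simp add: case_prod_beta)
    next
      case False
      then obtain j where "j \<in> J3" "mat_id (fst j) (snd j) \<notin> F j" unfolding c_def by auto
      then have "(\<Prod>j\<in>J3. emeasure (coordM m b j) (F j)) = 0"
        using fin(3) e[of j] by (intro prod_zero bexI[of _ j]) simp_all
      then show ?thesis using False by simp
    qed
  qed
  also have "(\<Prod>j\<in>J1. emeasure (coordM m b j) (F j)) * (\<Prod>j\<in>J2. emeasure (coordM m b j) (F j)) * (\<Prod>j\<in>J3. emeasure (coordM m b j) (F j))
    = (\<Prod>j\<in>J. emeasure (coordM m b j) (F j))"
  proof -
    have "(\<Prod>j\<in>J. emeasure (coordM m b j) (F j)) =
      (\<Prod>j\<in>J1. emeasure (coordM m b j) (F j)) * (\<Prod>j\<in>J2 \<union> J3. emeasure (coordM m b j) (F j))"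
      by (subst JJ(1), rule prod.union_disjoint) (use fin JJ in auto)
    also have "(\<Prod>j\<in>J2 \<union> J3. emeasure (coordM m b j) (F j)) =
      (\<Prod>j\<in>J2. emeasure (coordM m b j) (F j)) * (\<Prod>j\<in>J3. emeasure (coordM m b j) (F j))"
      by (rule prod.union_disjoint) (use fin JJ in auto)
    finally show ?thesis by (simp add: mult.assoc)
  qed
  finally show "emeasure (distr (mu m b) (Pi\<^sub>M UNIV (coordM m b)) (coords m)) (prod_emb UNIV (coordM m b) J (Pi\<^sub>E J F)) =
    (\<Prod>j\<in>J. emeasure (coordM m b j) (F j))" .
qed simp

lemma coords_nu: "coords m \<in> measurable (mu m b) (nu m b)"
  using coords_measurable by (simp add: sets_nu cong: measurable_cong_sets)

lemma AE_mu_coords: "AE v in nu m b. P v \<Longrightarrow> AE x in mu m b. P (coords m x)"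
  using AE_distrD[OF coords_nu] distr_mu_nu by metis

lemma nn_integral_mu_coords:
  assumes "F \<in> borel_measurable (nu m b)"
  shows "(\<integral>\<^sup>+x. F (coords m x) \<partial>mu m b) = (\<integral>\<^sup>+v. F v \<partial>nu m b)"
proof -
  have "(\<integral>\<^sup>+v. F v \<partial>nu m b) = (\<integral>\<^sup>+v. F v \<partial>distr (mu m b) (nu m b) (coords m))" by (simp only: distr_mu_nu)
  also have "\<dots> = (\<integral>\<^sup>+x. F (coords m x) \<partial>mu m b)" by (rule nn_integral_distr[OF coords_nu]) (use assms in simp)
  finally show ?thesis by simp
qed

end

section \<open>Gaussian shears\<close>

lemma tendsto_fun_coordinatewise:
  fixes f :: "'a \<Rightarrow> 'i \<Rightarrow> 'b::topological_space"
  shows "(f \<longlongrightarrow> l) F \<longleftrightarrow> (\<forall>i. ((\<lambda>x. f x i) \<longlongrightarrow> l i) F)"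
  using limitin_componentwise[of "\<lambda>_. euclidean :: 'b topology" "UNIV::'i set" f l F]
  by (simp add: euclidean_product_topology)

text \<open>Translation invariance of Lebesgue measure, with the quotient of the translated and the
  original Gaussian density collected in the exponential.\<close>

lemma nn_integral_gauss_shift:
  assumes f [measurable]: "f \<in> borel_measurable borel"
  shows "(\<integral>\<^sup>+z. f (z - a) \<partial>gauss \<beta>) = (\<integral>\<^sup>+z. f z * ennreal (exp (- \<beta> * (2 * a * z + a\<^sup>2))) \<partial>gauss \<beta>)"
proof -
  let ?d = "\<lambda>x. ennreal (sqrt (\<beta> / pi) * exp (- \<beta> * x\<^sup>2))"
  have "(\<integral>\<^sup>+z. f (z - a) \<partial>gauss \<beta>) = (\<integral>\<^sup>+z. ?d z * f (z - a) \<partial>lborel)"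
    unfolding gauss_def by (rule nn_integral_density) auto
  also have "\<dots> = (\<integral>\<^sup>+z. ?d (a + z) * f z \<partial>lborel)"
    by (subst nn_integral_real_affine[where c = 1 and t = a]) auto
  also have "\<dots> = (\<integral>\<^sup>+z. ?d z * (f z * ennreal (exp (- \<beta> * (2 * a * z + a\<^sup>2)))) \<partial>lborel)"
  proof (rule nn_integral_cong)
    fix z
    have "?d (a + z) = ?d z * ennreal (exp (- \<beta> * (2 * a * z + a\<^sup>2)))"
    proof (cases "\<beta> / pi \<ge> 0")
      case True
      then show ?thesis
        by (simp add: ennreal_mult'[symmetric] mult_exp_exp power2_sum algebra_simps)
    next
      case False
      \<comment> \<open>The square root of a negative real is negative here, so for negative
        \<open>\<beta>\<close> the density is truncated to 0 and both sides vanish.\<close>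
      then have "sqrt (\<beta> / pi) \<le> 0" by simp
      then have "?d z = 0" "?d (a + z) = 0"
        by (auto intro!: ennreal_neg mult_nonpos_nonneg simp del: real_sqrt_le_0_iff)
      then show ?thesis by simp
    qed
    then show "?d (a + z) * f z = ?d z * (f z * ennreal (exp (- \<beta> * (2 * a * z + a\<^sup>2))))"
      by (simp add: ac_simps)
  qed
  also have "\<dots> = (\<integral>\<^sup>+z. f z * ennreal (exp (- \<beta> * (2 * a * z + a\<^sup>2))) \<partial>gauss \<beta>)"
    unfolding gauss_def by (rule nn_integral_density[symmetric]) auto
  finally show ?thesis .
qed

lemma nn_integral_gauss_affine_square:
  assumes \<beta>: "\<beta> > 0"
  shows "(\<integral>\<^sup>+z. ennreal ((A + c * z)\<^sup>2) \<partial>gauss \<beta>) = ennreal (A\<^sup>2 + c\<^sup>2 / (2 * \<beta>))"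
proof -
  define \<sigma> where "\<sigma> = 1 / sqrt (2 * \<beta>)"
  have \<sigma>: "\<sigma> > 0" "\<sigma>\<^sup>2 = 1 / (2 * \<beta>)" using \<beta> by (auto simp: \<sigma>_def power_divide)
  let ?d = "normal_density 0 \<sigma>"
  have 0: "has_bochner_integral lborel ?d 1"
    using normal_moment_even[OF \<sigma>(1), of 0 0] by simp
  have 1: "has_bochner_integral lborel (\<lambda>z. ?d z * z) 0"
    by (rule normal_moment_nz_1[OF \<sigma>(1)])
  have 2: "has_bochner_integral lborel (\<lambda>z. ?d z * z\<^sup>2) (1 / (2 * \<beta>))"
    using normal_moment_even[OF \<sigma>(1), of 0 1] \<sigma>(2) by (simp add: fact_2)
  have "has_bochner_integral lborel (\<lambda>z. A\<^sup>2 * ?d z + (2 * A * c * (?d z * z) + c\<^sup>2 * (?d z * z\<^sup>2)))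
    (A\<^sup>2 * 1 + (2 * A * c * 0 + c\<^sup>2 * (1 / (2 * \<beta>))))"
    by (intro has_bochner_integral_add has_bochner_integral_mult_right 0 1 2)
  then have I: "has_bochner_integral lborel (\<lambda>z. ?d z * (A + c * z)\<^sup>2) (A\<^sup>2 + c\<^sup>2 / (2 * \<beta>))"
    by (simp add: power2_eq_square algebra_simps)
  have "(\<integral>\<^sup>+z. ennreal ((A + c * z)\<^sup>2) \<partial>gauss \<beta>) = (\<integral>\<^sup>+z. ennreal (?d z) * ennreal ((A + c * z)\<^sup>2) \<partial>lborel)"
    unfolding gauss_normal[OF \<beta>] \<sigma>_def[symmetric] by (rule nn_integral_density) auto
  also have "\<dots> = (\<integral>\<^sup>+z. ennreal (?d z * (A + c * z)\<^sup>2) \<partial>lborel)"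
    by (simp add: ennreal_mult)
  also have "\<dots> = ennreal (A\<^sup>2 + c\<^sup>2 / (2 * \<beta>))"
    using I by (intro nn_integral_eq_integral[THEN trans])
      (auto simp: has_bochner_integral_iff)
  finally show ?thesis .
qed

section \<open>Resampling one coordinate of a product measure\<close>

lemma fun_upd_component_measurable:
  assumes "f \<in> measurable N (\<Pi>\<^sub>M i\<in>UNIV. borel :: real measure)" "g \<in> borel_measurable N"
  shows "(\<lambda>x. (f x)(i := g x)) \<in> measurable N (\<Pi>\<^sub>M i\<in>UNIV. borel)"
proof (rule measurable_PiM_single')
  fix j
  have "(\<lambda>x. f x j) \<in> borel_measurable N"
    by (rule measurable_compose[OF assms(1)]) simp
  then show "(\<lambda>x. ((f x)(i := g x)) j) \<in> borel_measurable N"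
    using assms(2) by (cases "j = i") auto
qed (auto simp: space_PiM)

locale prod_real =
  fixes M :: "'i::countable \<Rightarrow> real measure"
  assumes prob_M: "\<And>i. prob_space (M i)" and sets_M [simp, measurable_cong]: "\<And>i. sets (M i) = sets borel"
begin

definition P :: "('i \<Rightarrow> real) measure" where "P = Pi\<^sub>M UNIV M"

lemma space_M [simp]: "space (M i) = UNIV"
  using sets_eq_imp_space_eq[OF sets_M] by simp

lemma sets_P [measurable_cong]: "sets P = sets (\<Pi>\<^sub>M i\<in>UNIV. borel)"
  unfolding P_def by (rule sets_PiM_cong) auto

lemma sets_P_borel: "sets P = sets borel"
  by (simp add: sets_P sets_PiM_equal_borel)

lemma space_P [simp]: "space P = UNIV"
  by (simp add: P_def space_PiM PiE_UNIV_domain)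

sublocale P: prob_space P
  unfolding P_def by (rule prob_space_PiM) (rule prob_M)

lemma component_P [measurable]: "(\<lambda>v. v i) \<in> borel_measurable P"
  using measurable_component_singleton[of i UNIV "\<lambda>_. borel :: real measure"]
  by (simp cong: measurable_cong_sets add: sets_P)

text \<open>Overwriting coordinate \<open>i\<close> by an independent sample leaves the product
  measure unchanged. Working on the full product avoids a change of index set each time a coordinate
  is integrated out.\<close>

lemma nn_integral_resample:
  assumes F: "F \<in> borel_measurable P"
  shows "(\<integral>\<^sup>+v. F v \<partial>P) = (\<integral>\<^sup>+v. (\<integral>\<^sup>+z. F (v(i := z)) \<partial>M i) \<partial>P)"
proof -
  let ?R = "Pi\<^sub>M (UNIV - {i}) M"
  interpret Mi: prob_space "M i" by (rule prob_M)
  interpret R: prob_space ?R by (rule prob_space_PiM) (rule prob_M)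
  interpret pair_sigma_finite "M i" ?R ..
  have D: "P = distr (M i \<Otimes>\<^sub>M ?R) P (\<lambda>(x, X). X(i := x))"
    using distr_pair_PiM_eq_PiM[of "UNIV - {i}" M i] prob_M by (simp add: P_def insert_absorb)
  have upd [measurable]: "(\<lambda>(x, X). X(i := x)) \<in> measurable (M i \<Otimes>\<^sub>M ?R) P"
    unfolding P_def using measurable_add_dim[of i "UNIV - {i}" M]
    by (simp add: insert_absorb measurable_pair_swap_iff[of _ "M i"] split_beta')
  have updv [measurable]: "(\<lambda>(v, z). v(i := z)) \<in> measurable (P \<Otimes>\<^sub>M M i) P"
    using fun_upd_component_measurable[of fst "P \<Otimes>\<^sub>M M i" snd i]
    by (simp add: split_beta' sets_P cong: measurable_cong_sets)
  have G: "(\<lambda>v. \<integral>\<^sup>+z. F (v(i := z)) \<partial>M i) \<in> borel_measurable P"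
    using measurable_compose[OF updv F] by (intro Mi.borel_measurable_nn_integral) (simp add: split_beta')
  have FM: "(\<lambda>(x, X). F (X(i := x))) \<in> borel_measurable (M i \<Otimes>\<^sub>M ?R)"
    using measurable_compose[OF upd F] by (simp add: split_beta')
  have "(\<integral>\<^sup>+v. (\<integral>\<^sup>+z. F (v(i := z)) \<partial>M i) \<partial>P) = (\<integral>\<^sup>+p. (\<integral>\<^sup>+z. F ((snd p)(i := z)) \<partial>M i) \<partial>(M i \<Otimes>\<^sub>M ?R))"
    by (subst D, subst nn_integral_distr[OF upd]) (use G in \<open>auto simp: split_beta'\<close>)
  also have "\<dots> = (\<integral>\<^sup>+x. \<integral>\<^sup>+X. (\<integral>\<^sup>+z. F (X(i := z)) \<partial>M i) \<partial>?R \<partial>M i)"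
  proof (subst R.nn_integral_fst[symmetric])
    show "(\<lambda>p. \<integral>\<^sup>+z. F ((snd p)(i := z)) \<partial>M i) \<in> borel_measurable (M i \<Otimes>\<^sub>M ?R)"
      using measurable_compose[OF upd G] by (simp add: split_beta')
  qed simp
  also have "\<dots> = (\<integral>\<^sup>+X. (\<integral>\<^sup>+z. F (X(i := z)) \<partial>M i) \<partial>?R)"
    using Mi.emeasure_space_1 by simp
  also have "\<dots> = (\<integral>\<^sup>+z. (\<integral>\<^sup>+X. F (X(i := z)) \<partial>?R) \<partial>M i)"
    by (rule Fubini') (rule FM)
  also have "\<dots> = (\<integral>\<^sup>+p. F ((snd p)(i := fst p)) \<partial>(M i \<Otimes>\<^sub>M ?R))"
    using FM by (subst R.nn_integral_fst[symmetric]) (auto simp: split_beta')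
  also have "\<dots> = (\<integral>\<^sup>+v. F v \<partial>distr (M i \<Otimes>\<^sub>M ?R) P (\<lambda>(x, X). X(i := x)))"
    using F by (subst nn_integral_distr[OF upd]) (auto simp: split_beta')
  also have "\<dots> = (\<integral>\<^sup>+v. F v \<partial>P)" by (rule arg_cong[OF D[symmetric]])
  finally show ?thesis by simp
qed

lemma nn_integral_component:
  assumes f: "f \<in> borel_measurable borel" shows "(\<integral>\<^sup>+v. f (v i) \<partial>P) = (\<integral>\<^sup>+z. f z \<partial>M i)"
proof -
  have "(\<lambda>v. f (v i)) \<in> borel_measurable P" by (rule measurable_compose[OF component_P f])
  then show ?thesis
    using P.emeasure_space_1 by (subst nn_integral_resample[of _ i]) simp_all
qed

end


text \<open>The flow \<open>v(tg j) \<mapsto> v(tg j) + u v(sr j)\<close>: a column of the matrix is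
  shifted by a multiple of another column.\<close>

locale gauss_shear = prod_real M for M :: "'i::countable \<Rightarrow> real measure" +
  fixes J :: "nat set" and tg sr :: "nat \<Rightarrow> 'i" and \<beta> q :: "nat \<Rightarrow> real"
  assumes inj_tg: "inj_on tg J"
    and tg_sr: "\<And>j j'. j \<in> J \<Longrightarrow> j' \<in> J \<Longrightarrow> tg j \<noteq> sr j'"
    and \<beta>_pos: "\<And>j. j \<in> J \<Longrightarrow> 0 < \<beta> j"
    and M_tg: "\<And>j. j \<in> J \<Longrightarrow> M (tg j) = gauss (\<beta> j)"
    and M_sr: "\<And>j. j \<in> J \<Longrightarrow> (\<integral>\<^sup>+z. ennreal (z\<^sup>2) \<partial>M (sr j)) = ennreal (q j)"
    and q_nonneg: "\<And>j. 0 \<le> q j"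
    and summable_\<beta>q: "summable (\<lambda>j. if j \<in> J then \<beta> j * q j else 0)"
begin

definition shear :: "nat set \<Rightarrow> real \<Rightarrow> ('i \<Rightarrow> real) \<Rightarrow> 'i \<Rightarrow> real" where
  "shear S u v i = (if i \<in> tg ` S then v i + u * v (sr (the_inv_into S tg i)) else v i)"

lemma shear_tg: "S \<subseteq> J \<Longrightarrow> j \<in> S \<Longrightarrow> shear S u v (tg j) = v (tg j) + u * v (sr j)"
  by (simp add: shear_def the_inv_into_f_f inj_on_subset[OF inj_tg])

lemma shear_other: "i \<notin> tg ` S \<Longrightarrow> shear S u v i = v i"
  by (simp add: shear_def)

lemma tg_image: "S \<subseteq> J \<Longrightarrow> j \<in> J \<Longrightarrow> tg j \<in> tg ` S \<longleftrightarrow> j \<in> S"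
  using inj_tg by (auto simp: inj_on_def)

lemma sr_notin: "S \<subseteq> J \<Longrightarrow> j \<in> J \<Longrightarrow> sr j \<notin> tg ` S"
  using tg_sr by force

lemma shear_sr: "S \<subseteq> J \<Longrightarrow> j \<in> J \<Longrightarrow> shear S u v (sr j) = v (sr j)"
  by (rule shear_other) (rule sr_notin)

text \<open>By \<open>tg_sr\<close> no source is a target, so a shear fixes all sources and the
  shears form a one-parameter group.\<close>

lemma shear_add: assumes "S \<subseteq> J" shows "shear S u (shear S u' v) = shear S (u + u') v"
proof (rule ext)
  fix i show "shear S u (shear S u' v) i = shear S (u + u') v i"
  proof (cases "i \<in> tg ` S")
    case True
    then obtain j where "j \<in> S" "i = tg j" by blast
    then show ?thesis using assms by (auto simp: shear_tg shear_sr subset_iff algebra_simps)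
  qed (simp add: shear_other)
qed

lemma shear_0: "shear S 0 v = v"
  by (rule ext) (simp add: shear_def)

lemma shear_insert:
  assumes "insert j S \<subseteq> J" "j \<notin> S"
  shows "shear (insert j S) u v = (shear S u v)(tg j := shear S u v (tg j) + u * shear S u v (sr j))"
proof (rule ext)
  fix i
  have S: "S \<subseteq> J" "j \<in> J" using assms by auto
  have j: "shear S u v (tg j) = v (tg j)" using assms S by (intro shear_other) (simp add: tg_image)
  show "shear (insert j S) u v i = ((shear S u v)(tg j := shear S u v (tg j) + u * shear S u v (sr j))) i"
  proof (cases "i \<in> tg ` insert j S")
    case True
    then obtain l where l: "l \<in> insert j S" "i = tg l" by blast
    show ?thesis
    proof (cases "l = j")
      case True
      then show ?thesis using assms(1) l j S by (simp add: shear_tg shear_sr)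
    next
      case False
      then have "tg l \<noteq> tg j" using inj_tg l assms by (auto simp: inj_on_def)
      then show ?thesis using assms(1) l False S by (simp add: shear_tg)
    qed
  qed (auto simp: shear_other)
qed

lemma shear_measurable_pair:
  assumes f: "f \<in> measurable N P" and g: "g \<in> borel_measurable N"
  shows "(\<lambda>x. shear S (g x) (f x)) \<in> measurable N P"
proof -
  have c: "(\<lambda>x. f x i) \<in> borel_measurable N" for i by (rule measurable_compose[OF f component_P])
  have "(\<lambda>x. shear S (g x) (f x)) \<in> measurable N (\<Pi>\<^sub>M i\<in>UNIV. borel)"
  proof (rule measurable_PiM_single')
    fix i
    show "(\<lambda>x. shear S (g x) (f x) i) \<in> borel_measurable N"
      unfolding shear_def using c g by measurable
  qed (auto simp: space_PiM)
  then show ?thesis by (simp cong: measurable_cong_sets add: sets_P)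
qed

lemma shear_measurable [measurable]: "shear S u \<in> measurable P P"
  using shear_measurable_pair[of "\<lambda>v. v" P "\<lambda>_. u" S] by simp

text \<open>With target \<open>z\<close> and source \<open>w\<close> of a row, the difference
  \<open>\<beta> (z + u w)^2 - \<beta> z^2\<close> sums over \<open>S\<close> to
  \<open>2 u Ps + u^2 Qs\<close>. So \<open>Ps\<close> and \<open>Qs\<close> are the coefficients in
  the exponent of the density of a finite shear.\<close>

definition Ps :: "nat set \<Rightarrow> ('i \<Rightarrow> real) \<Rightarrow> real" where
  "Ps S v = (\<Sum>j\<in>S. \<beta> j * v (tg j) * v (sr j))"

definition Qs :: "nat set \<Rightarrow> ('i \<Rightarrow> real) \<Rightarrow> real" where
  "Qs S v = (\<Sum>j\<in>S. \<beta> j * (v (sr j))\<^sup>2)"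

lemma Ps_measurable [measurable]: "Ps S \<in> borel_measurable P"
  unfolding Ps_def[abs_def] by measurable

lemma Qs_measurable [measurable]: "Qs S \<in> borel_measurable P"
  unfolding Qs_def[abs_def] by measurable

lemma Ps_shear: "S \<subseteq> S' \<Longrightarrow> S' \<subseteq> J \<Longrightarrow> Ps S (shear S' u v) = Ps S v + u * Qs S v"
  unfolding Ps_def Qs_def sum_distrib_left sum.distrib[symmetric]
  by (intro sum.cong) (auto simp: shear_sr shear_tg subset_iff algebra_simps power2_eq_square)

lemma Ps_upd: "S \<subseteq> J \<Longrightarrow> j \<in> J \<Longrightarrow> j \<notin> S \<Longrightarrow> Ps S (v(tg j := z)) = Ps S v"
  unfolding Ps_def
proof (intro sum.cong refl)
  fix l assume "S \<subseteq> J" "j \<in> J" "j \<notin> S" "l \<in> S"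
  then have "tg l \<noteq> tg j" "sr l \<noteq> tg j" using inj_tg tg_sr[of j l] by (auto simp: inj_on_def)
  then show "\<beta> l * (v(tg j := z)) (tg l) * (v(tg j := z)) (sr l) = \<beta> l * v (tg l) * v (sr l)" by simp
qed

lemma Qs_upd: "S \<subseteq> J \<Longrightarrow> j \<in> J \<Longrightarrow> Qs S (v(tg j := z)) = Qs S v"
  unfolding Qs_def
proof (intro sum.cong refl)
  fix l assume "S \<subseteq> J" "j \<in> J" "l \<in> S"
  then have "sr l \<noteq> tg j" using tg_sr[of j l] by auto
  then show "\<beta> l * ((v(tg j := z)) (sr l))\<^sup>2 = \<beta> l * (v (sr l))\<^sup>2" by simp
qed

lemma upd_measurable:
  assumes "F \<in> borel_measurable P"
  shows "(\<lambda>z. F (v(i := z))) \<in> borel_measurable borel"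
proof -
  have "(\<lambda>z. v(i := z)) \<in> measurable borel P"
    using fun_upd_component_measurable[of "\<lambda>_. v" "borel :: real measure" "\<lambda>z. z" i]
    by (simp cong: measurable_cong_sets add: sets_P space_PiM)
  from measurable_compose[OF this assms] show ?thesis .
qed

text \<open>Rows are added one at a time. The target of the new row is resampled; its source and the
  density of the old rows do not depend on that coordinate, so the one-dimensional translation
  formula applies with a constant shift.\<close>

lemma nn_integral_shear_finite:
  assumes "finite S" "S \<subseteq> J" "F \<in> borel_measurable P"
  shows "(\<integral>\<^sup>+v. F (shear S (- u) v) \<partial>P) =
    (\<integral>\<^sup>+v. F v * ennreal (exp (- 2 * u * Ps S v - u\<^sup>2 * Qs S v)) \<partial>P)"
  using assms
proof (induction S arbitrary: F rule: finite_induct)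
  case empty
  have "shear {} (- u) v = v" for v by (rule ext) (simp add: shear_def)
  then show ?case by (simp add: Ps_def Qs_def)
next
  case (insert j S)
  have S: "S \<subseteq> J" and j: "j \<in> J" "j \<notin> S" using insert by auto
  note [measurable] = insert.prems(2)
  define G where "G w = F (w(tg j := w (tg j) - u * w (sr j)))" for w
  define E where "E v = ennreal (exp (- 2 * u * Ps S v - u\<^sup>2 * Qs S v))" for v
  have [measurable]: "G \<in> borel_measurable P"
  proof -
    have "(\<lambda>w. w(tg j := w (tg j) - u * w (sr j))) \<in> measurable P P"
      using fun_upd_component_measurable[of "\<lambda>w. w" P "\<lambda>w. w (tg j) - u * w (sr j)" "tg j"]
      by (simp cong: measurable_cong_sets add: sets_P)
    then show ?thesis unfolding G_def[abs_def] by (rule measurable_compose[OF _ insert.prems(2)])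
  qed
  have [measurable]: "E \<in> borel_measurable P" unfolding E_def[abs_def] by measurable
  have E_upd: "E (v(tg j := z)) = E v" for v z
    using S j by (simp add: E_def Ps_upd Qs_upd)
  have tgsr: "sr j \<noteq> tg j" using tg_sr[of j j] j by metis
  have "(\<integral>\<^sup>+v. F (shear (insert j S) (- u) v) \<partial>P) = (\<integral>\<^sup>+v. G (shear S (- u) v) \<partial>P)"
    using insert.hyps insert.prems by (simp add: shear_insert G_def)
  also have "\<dots> = (\<integral>\<^sup>+v. G v * E v \<partial>P)" unfolding E_def by (rule insert.IH[OF S]) measurable
  also have "\<dots> = (\<integral>\<^sup>+v. (\<integral>\<^sup>+z. F (v(tg j := z - u * v (sr j))) * E v \<partial>gauss (\<beta> j)) \<partial>P)"
  proof -
    have GE: "(\<lambda>v. G v * E v) \<in> borel_measurable P" by measurable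
    show ?thesis unfolding nn_integral_resample[OF GE, of "tg j"]
      using tgsr by (simp add: G_def E_upd M_tg j)
  qed
  also have "\<dots> = (\<integral>\<^sup>+v. (\<integral>\<^sup>+z. F (v(tg j := z)) * E v *
      ennreal (exp (- \<beta> j * (2 * (u * v (sr j)) * z + (u * v (sr j))\<^sup>2))) \<partial>gauss (\<beta> j)) \<partial>P)"
  proof (rule nn_integral_cong)
    fix v
    show "(\<integral>\<^sup>+z. F (v(tg j := z - u * v (sr j))) * E v \<partial>gauss (\<beta> j)) =
      (\<integral>\<^sup>+z. F (v(tg j := z)) * E v *
      ennreal (exp (- \<beta> j * (2 * (u * v (sr j)) * z + (u * v (sr j))\<^sup>2))) \<partial>gauss (\<beta> j))"
      by (rule nn_integral_gauss_shift)
        (intro borel_measurable_times_ennreal borel_measurable_const upd_measurable insert.prems)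
  qed
  also have "\<dots> = (\<integral>\<^sup>+v. F v * E v * ennreal (exp (- \<beta> j * (2 * (u * v (sr j)) * v (tg j) + (u * v (sr j))\<^sup>2))) \<partial>P)"
    by (subst (2) nn_integral_resample[of _ "tg j"]) (use tgsr in \<open>auto simp: E_upd M_tg j\<close>)
  also have "\<dots> = (\<integral>\<^sup>+v. F v * ennreal (exp (- 2 * u * Ps (insert j S) v - u\<^sup>2 * Qs (insert j S) v)) \<partial>P)"
  proof (rule nn_integral_cong)
    fix v
    have "Ps (insert j S) v = \<beta> j * v (tg j) * v (sr j) + Ps S v" "Qs (insert j S) v = \<beta> j * (v (sr j))\<^sup>2 + Qs S v"
      using insert.hyps by (simp_all add: Ps_def Qs_def)
    then have "exp (- 2 * u * Ps (insert j S) v - u\<^sup>2 * Qs (insert j S) v) =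
      exp (- 2 * u * Ps S v - u\<^sup>2 * Qs S v) * exp (- \<beta> j * (2 * (u * v (sr j)) * v (tg j) + (u * v (sr j))\<^sup>2))"
      by (simp add: mult_exp_exp algebra_simps power_mult_distrib)
    then show "F v * E v * ennreal (exp (- \<beta> j * (2 * (u * v (sr j)) * v (tg j) + (u * v (sr j))\<^sup>2))) =
      F v * ennreal (exp (- 2 * u * Ps (insert j S) v - u\<^sup>2 * Qs (insert j S) v))"
      by (simp add: E_def ennreal_mult' mult.assoc)
  qed
  finally show ?case .
qed

text \<open>The summands are orthogonal: given all other coordinates, the target of a row is
  centred, so the cross term vanishes. Its second moment \<open>1 / (2 \<beta>)\<close> against the
  coefficient \<open>\<beta>^2 q\<close> leaves \<open>\<beta> q / 2\<close>.\<close>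

lemma nn_integral_Ps_square:
  assumes "finite S" "S \<subseteq> J"
  shows "(\<integral>\<^sup>+v. ennreal ((Ps S v)\<^sup>2) \<partial>P) = ennreal (\<Sum>j\<in>S. \<beta> j * q j / 2)"
  using assms
proof (induction S rule: finite_induct)
  case empty then show ?case by (simp add: Ps_def)
next
  case (insert j S)
  have S: "S \<subseteq> J" and j: "j \<in> J" "j \<notin> S" using insert by auto
  have tgsr: "sr j \<noteq> tg j" using tg_sr[of j j] j by metis
  have "(\<integral>\<^sup>+v. ennreal ((Ps (insert j S) v)\<^sup>2) \<partial>P) = (\<integral>\<^sup>+v. ennreal ((Ps S v + \<beta> j * v (sr j) * v (tg j))\<^sup>2) \<partial>P)"
    using insert.hyps by (simp add: Ps_def ac_simps)
  also have "\<dots> = (\<integral>\<^sup>+v. (\<integral>\<^sup>+z. ennreal ((Ps S v + \<beta> j * v (sr j) * z)\<^sup>2) \<partial>gauss (\<beta> j)) \<partial>P)"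
    by (subst nn_integral_resample[of _ "tg j"]) (use tgsr S j in \<open>auto simp: M_tg Ps_upd\<close>)
  also have "\<dots> = (\<integral>\<^sup>+v. ennreal ((Ps S v)\<^sup>2) + ennreal (\<beta> j / 2) * ennreal ((v (sr j))\<^sup>2) \<partial>P)"
  proof (rule nn_integral_cong)
    fix v
    have "(Ps S v)\<^sup>2 + (\<beta> j * v (sr j))\<^sup>2 / (2 * \<beta> j) = (Ps S v)\<^sup>2 + \<beta> j / 2 * (v (sr j))\<^sup>2"
      using \<beta>_pos[OF j(1)] by (simp add: power2_eq_square)
    then show "(\<integral>\<^sup>+z. ennreal ((Ps S v + \<beta> j * v (sr j) * z)\<^sup>2) \<partial>gauss (\<beta> j)) =
      ennreal ((Ps S v)\<^sup>2) + ennreal (\<beta> j / 2) * ennreal ((v (sr j))\<^sup>2)"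
      unfolding nn_integral_gauss_affine_square[OF \<beta>_pos[OF j(1)]]
      using \<beta>_pos[OF j(1)] by (simp add: ennreal_mult'[symmetric] flip: ennreal_plus)
  qed
  also have "\<dots> = (\<integral>\<^sup>+v. ennreal ((Ps S v)\<^sup>2) \<partial>P) + ennreal (\<beta> j / 2) * (\<integral>\<^sup>+v. ennreal ((v (sr j))\<^sup>2) \<partial>P)"
    by (subst nn_integral_add) (auto simp: nn_integral_cmult)
  also have "(\<integral>\<^sup>+v. ennreal ((v (sr j))\<^sup>2) \<partial>P) = ennreal (q j)"
    using nn_integral_component[of "\<lambda>z. ennreal (z\<^sup>2)" "sr j"] M_sr[OF j(1)] by simp
  also have "(\<integral>\<^sup>+v. ennreal ((Ps S v)\<^sup>2) \<partial>P) + ennreal (\<beta> j / 2) * ennreal (q j) = ennreal (\<Sum>j\<in>insert j S. \<beta> j * q j / 2)"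
  proof -
    have "0 \<le> (\<Sum>j\<in>S. \<beta> j * q j / 2)" using S \<beta>_pos q_nonneg by (intro sum_nonneg) (auto simp: less_imp_le subset_iff)
    then show ?thesis using insert S \<beta>_pos[OF j(1)] q_nonneg[of j]
      by (simp add: ennreal_mult'[symmetric] add.commute flip: ennreal_plus)
  qed
  finally show ?case .
qed

section \<open>Almost sure limits of the exponents\<close>

definition Jn :: "nat \<Rightarrow> nat set" where "Jn n = J \<inter> {..<n}"

lemma Jn_finite [simp]: "finite (Jn n)" and Jn_subset: "Jn n \<subseteq> J" and Jn_mono: "n \<le> n' \<Longrightarrow> Jn n \<subseteq> Jn n'"
  by (auto simp: Jn_def)

definition tail :: "nat \<Rightarrow> real" where
  "tail n = (\<Sum>j. if j + n \<in> J then \<beta> (j + n) * q (j + n) else 0)"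

lemma tail_tendsto: "tail \<longlonglongrightarrow> 0"
proof -
  let ?f = "\<lambda>j. if j \<in> J then \<beta> j * q j else 0"
  have "tail = (\<lambda>n. suminf ?f - sum ?f {..<n})"
    unfolding tail_def using suminf_minus_initial_segment[OF summable_\<beta>q] by auto
  moreover have "(\<lambda>n. suminf ?f - sum ?f {..<n}) \<longlonglongrightarrow> suminf ?f - suminf ?f"
    by (intro tendsto_diff tendsto_const summable_LIMSEQ summable_\<beta>q)
  ultimately show ?thesis by simp
qed

lemma sum_le_tail:
  assumes "n \<le> n'" shows "(\<Sum>j\<in>Jn n' - Jn n. \<beta> j * q j / 2) \<le> tail n"
proof -
  let ?f = "\<lambda>j. if j \<in> J then \<beta> j * q j else 0"
  have nn: "?f j \<ge> 0" for j using \<beta>_pos[of j] q_nonneg[of j] by (cases "j \<in> J") simp_all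
  have "(\<Sum>j\<in>Jn n' - Jn n. \<beta> j * q j / 2) \<le> (\<Sum>j\<in>Jn n' - Jn n. ?f j)"
    using \<beta>_pos q_nonneg by (intro sum_mono) (auto simp: Jn_def less_imp_le)
  also have "\<dots> \<le> (\<Sum>j\<in>{n..<n'}. ?f j)"
    by (rule sum_mono2) (use nn in \<open>auto simp: Jn_def\<close>)
  also have "\<dots> = (\<Sum>j<n' - n. ?f (j + n))"
    using assms by (intro sum.reindex_bij_witness[of _ "\<lambda>j. j + n" "\<lambda>j. j - n"]) auto
  also have "\<dots> \<le> tail n"
    unfolding tail_def using nn by (intro sum_le_suminf summable_ignore_initial_segment[OF summable_\<beta>q]) auto
  finally show ?thesis .
qed

lemma Ps_diff: "n \<le> n' \<Longrightarrow> Ps (Jn n') v - Ps (Jn n) v = Ps (Jn n' - Jn n) v"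
  unfolding Ps_def by (subst sum_diff) (auto dest: Jn_mono)

lemma nn_integral_Ps_diff:
  assumes "n \<le> n'" shows "(\<integral>\<^sup>+v. ennreal ((Ps (Jn n') v - Ps (Jn n) v)\<^sup>2) \<partial>P) \<le> ennreal (tail n)"
proof -
  have "Jn n' - Jn n \<subseteq> J" using Jn_subset by blast
  then show ?thesis unfolding Ps_diff[OF assms]
    by (subst nn_integral_Ps_square) (auto intro!: ennreal_leI sum_le_tail[OF assms])
qed

text \<open>Along this subsequence the tails decay geometrically, which turns \<open>L\<^sup>2\<close> convergence
  into convergence almost everywhere.\<close>

definition fast :: "nat \<Rightarrow> nat" where "fast i = (LEAST n. i \<le> n \<and> (\<forall>n'\<ge>n. tail n' \<le> (1/4) ^ i))"

lemma fast: "i \<le> fast i" "tail (fast i) \<le> (1/4) ^ i" "fast i \<le> fast (Suc i)"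
proof -
  have ex: "\<exists>n. i \<le> n \<and> (\<forall>n'\<ge>n. tail n' \<le> (1/4) ^ i)" for i
  proof -
    have "\<forall>\<^sub>F n in sequentially. tail n < (1/4) ^ i"
      using tail_tendsto by (rule order_tendstoD) simp
    then obtain n where "\<And>n'. n \<le> n' \<Longrightarrow> tail n' < (1/4) ^ i" by (auto simp: eventually_sequentially)
    then show ?thesis by (intro exI[of _ "max i n"]) (auto simp: less_imp_le)
  qed
  have L: "i \<le> fast i \<and> (\<forall>n'\<ge>fast i. tail n' \<le> (1/4) ^ i)" for i
    unfolding fast_def by (rule LeastI_ex[OF ex])
  show "i \<le> fast i" "tail (fast i) \<le> (1/4) ^ i" using L[of i] by auto
  show "fast i \<le> fast (Suc i)" unfolding fast_def[of i]
  proof (rule Least_le)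
    have "(1/4 :: real) ^ Suc i \<le> (1/4) ^ i" by simp
    then have "tail n' \<le> (1/4) ^ i" if "fast (Suc i) \<le> n'" for n'
      using L[of "Suc i"] that order_trans by blast
    then show "i \<le> fast (Suc i) \<and> (\<forall>n'\<ge>fast (Suc i). tail n' \<le> (1/4) ^ i)"
      using L[of "Suc i"] by simp
  qed
qed

text \<open>The pointwise arguments about the limits \<open>Pl\<close> and \<open>Ql\<close> take
  place on this set. It has full measure and every full shear maps it into itself.\<close>

definition good :: "('i \<Rightarrow> real) set" where
  "good = {v. convergent (\<lambda>i. Ps (Jn (fast i)) v) \<and> summable (\<lambda>j. if j \<in> J then \<beta> j * (v (sr j))\<^sup>2 else 0)}"

definition Pl :: "('i \<Rightarrow> real) \<Rightarrow> real" where "Pl v = lim (\<lambda>i. Ps (Jn (fast i)) v)"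

definition Ql :: "('i \<Rightarrow> real) \<Rightarrow> real" where "Ql v = (\<Sum>j. if j \<in> J then \<beta> j * (v (sr j))\<^sup>2 else 0)"

lemma good_sets [measurable]: "good \<in> sets P"
proof -
  have "{v \<in> space P. convergent (\<lambda>i. Ps (Jn (fast i)) v) \<and> convergent (\<lambda>n. \<Sum>j<n. if j \<in> J then \<beta> j * (v (sr j))\<^sup>2 else 0)} \<in> sets P"
    unfolding Cauchy_convergent_iff[symmetric]
    by (intro sets.sets_Collect_conj sets_Collect_Cauchy) measurable
  then show ?thesis by (simp add: good_def summable_iff_convergent)
qed

lemma Pl_measurable [measurable]: "Pl \<in> borel_measurable P"
  unfolding Pl_def[abs_def] by measurable

lemma Ql_measurable [measurable]: "Ql \<in> borel_measurable P"
  unfolding Ql_def[abs_def] by measurable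

text \<open>The squared increments along \<open>fast\<close> have expectation at most
  \<open>4^(-i)\<close>, so they remain summable in expectation after weighting by
  \<open>2^i\<close>. By the inequality of the arithmetic and geometric means,
  \<open>2 |d| \<le> 2^(-i) + 2^i d^2\<close>, and the increments are then absolutely summable
  almost everywhere.\<close>

lemma AE_good: "AE v in P. v \<in> good"
proof -
  let ?d = "\<lambda>i v. Ps (Jn (fast (Suc i))) v - Ps (Jn (fast i)) v"
  have "(\<integral>\<^sup>+v. (\<Sum>i. ennreal (2 ^ i * (?d i v)\<^sup>2)) \<partial>P) = (\<Sum>i. \<integral>\<^sup>+v. ennreal (2 ^ i * (?d i v)\<^sup>2) \<partial>P)"
    by (rule nn_integral_suminf) measurable
  also have "\<dots> \<le> (\<Sum>i. ennreal ((1/2) ^ i))"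
  proof (intro suminf_le allI)
    fix i
    have "(\<integral>\<^sup>+v. ennreal (2 ^ i * (?d i v)\<^sup>2) \<partial>P) = ennreal (2 ^ i) * (\<integral>\<^sup>+v. ennreal ((?d i v)\<^sup>2) \<partial>P)"
      by (subst nn_integral_cmult[symmetric]) (auto simp: ennreal_mult' simp flip: ennreal_power)
    also have "\<dots> \<le> ennreal (2 ^ i) * ennreal ((1/4) ^ i)"
      by (intro mult_left_mono order_trans[OF nn_integral_Ps_diff[OF fast(3)]] ennreal_leI fast(2)) simp
    also have "\<dots> = ennreal ((1/2) ^ i)"
      by (subst ennreal_mult'[symmetric]) (auto simp flip: power_mult_distrib)
    finally show "(\<integral>\<^sup>+v. ennreal (2 ^ i * (?d i v)\<^sup>2) \<partial>P) \<le> ennreal ((1/2) ^ i)" .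
  qed auto
  also have "\<dots> = ennreal (\<Sum>i. (1/2) ^ i)"
    by (rule suminf_ennreal_eq) (auto intro: summable_sums simp: summable_geometric)
  finally have "(\<integral>\<^sup>+v. (\<Sum>i. ennreal (2 ^ i * (?d i v)\<^sup>2)) \<partial>P) \<noteq> \<infinity>" by (auto simp: top_unique)
  then have 1: "AE v in P. (\<Sum>i. ennreal (2 ^ i * (?d i v)\<^sup>2)) \<noteq> \<infinity>"
    by (intro nn_integral_PInf_AE) measurable
  let ?Q = "\<lambda>j v. if j \<in> J then \<beta> j * (v (sr j))\<^sup>2 else 0"
  have "(\<integral>\<^sup>+v. (\<Sum>j. ennreal (?Q j v)) \<partial>P) = (\<Sum>j. \<integral>\<^sup>+v. ennreal (?Q j v) \<partial>P)"
    by (rule nn_integral_suminf) measurable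
  also have "\<dots> = (\<Sum>j. ennreal (if j \<in> J then \<beta> j * q j else 0))"
  proof (intro suminf_cong)
    fix j show "(\<integral>\<^sup>+v. ennreal (?Q j v) \<partial>P) = ennreal (if j \<in> J then \<beta> j * q j else 0)"
    proof (cases "j \<in> J")
      case True
      then show ?thesis using \<beta>_pos[OF True] nn_integral_component[of "\<lambda>z. ennreal (z\<^sup>2)" "sr j"] M_sr[OF True]
        by (simp add: ennreal_mult' nn_integral_cmult)
    qed simp
  qed
  also have "\<dots> \<noteq> \<infinity>"
    using suminf_ennreal_eq[OF _ summable_sums[OF summable_\<beta>q]] \<beta>_pos q_nonneg by (simp add: less_imp_le)
  finally have 2: "AE v in P. (\<Sum>j. ennreal (?Q j v)) \<noteq> \<infinity>"
    by (intro nn_integral_PInf_AE) measurable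
  show ?thesis using 1 2
  proof eventually_elim
    case (elim v)
    have "summable (\<lambda>i. 2 ^ i * (?d i v)\<^sup>2)" by (rule summable_suminf_not_top) (use elim(1) in auto)
    then have "summable (\<lambda>i. (1/2) ^ i + 2 ^ i * (?d i v)\<^sup>2)" by (intro summable_add) (auto simp: summable_geometric)
    then have "summable (\<lambda>i. ?d i v)"
    proof (rule summable_comparison_test'[of _ 0])
      fix i :: nat
      define t where "t = (2::real) ^ i"
      define d where "d = \<bar>?d i v\<bar>"
      have t: "t > 0" "(1/2) ^ i = 1 / t" by (simp_all add: t_def power_one_over)
      have "0 \<le> (1 - t * d)\<^sup>2" by simp
      then have "2 * (t * d) \<le> 1 + t\<^sup>2 * d\<^sup>2" by (simp add: power2_diff power_mult_distrib)
      then have "2 * d \<le> 1 / t + t * d\<^sup>2" using t(1) by (simp add: field_simps power2_eq_square)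
      then have "2 * \<bar>?d i v\<bar> \<le> (1/2) ^ i + 2 ^ i * (?d i v)\<^sup>2"
        by (simp only: t(2)) (simp add: d_def t_def)
      then show "norm (?d i v) \<le> (1/2) ^ i + 2 ^ i * (?d i v)\<^sup>2"
        unfolding real_norm_def by (rule order_trans[rotated]) simp
    qed
    then have "convergent (\<lambda>n. \<Sum>i<n. ?d i v)" by (simp add: summable_iff_convergent)
    then have "convergent (\<lambda>n. (\<Sum>i<n. ?d i v) + Ps (Jn (fast 0)) v)"
      by (intro convergent_add convergent_const)
    then have "convergent (\<lambda>n. Ps (Jn (fast n)) v)"
      unfolding sum_lessThan_telescope[of "\<lambda>i. Ps (Jn (fast i)) v"] by simp
    moreover have "summable (\<lambda>j. ?Q j v)"
      by (rule summable_suminf_not_top) (use elim(2) \<beta>_pos in \<open>auto simp: less_imp_le\<close>)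
    ultimately show ?case by (simp add: good_def)
  qed
qed

lemma Ps_lim: "v \<in> good \<Longrightarrow> (\<lambda>i. Ps (Jn (fast i)) v) \<longlonglongrightarrow> Pl v"
  unfolding good_def Pl_def by (simp add: convergent_LIMSEQ_iff)

lemma Qs_lim: assumes "v \<in> good" shows "(\<lambda>i. Qs (Jn (fast i)) v) \<longlonglongrightarrow> Ql v"
proof -
  let ?f = "\<lambda>j. if j \<in> J then \<beta> j * (v (sr j))\<^sup>2 else 0"
  have "(\<lambda>n. sum ?f {..<n}) \<longlonglongrightarrow> Ql v"
    unfolding Ql_def using assms by (intro summable_LIMSEQ) (simp add: good_def)
  moreover have "filterlim fast at_top sequentially"
    using fast(1) by (intro filterlim_at_top_mono[OF filterlim_ident]) auto
  ultimately have "(\<lambda>i. sum ?f {..<fast i}) \<longlonglongrightarrow> Ql v" by (rule filterlim_compose)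
  moreover have "sum ?f {..<n} = Qs (Jn n) v" for n
    unfolding Qs_def Jn_def by (subst Int_commute, subst sum.inter_restrict) simp_all
  ultimately show ?thesis by simp
qed

text \<open>Sources are fixed and each target moves by \<open>u\<close> times its source, so each
  partial sum moves by \<open>u Qs\<close>; this passes to the limit. It is the source of both the
  cocycle identity for the density and the differential equation for the flow.\<close>

lemma good_shear:
  assumes v: "v \<in> good" shows "shear J u v \<in> good" "Pl (shear J u v) = Pl v + u * Ql v" "Ql (shear J u v) = Ql v"
proof -
  have l: "(\<lambda>i. Ps (Jn (fast i)) (shear J u v)) \<longlonglongrightarrow> Pl v + u * Ql v"
    using tendsto_add[OF Ps_lim[OF v] tendsto_mult_left[OF Qs_lim[OF v], of u]]
    by (simp add: Ps_shear Jn_subset)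
  have Q: "(\<lambda>j. if j \<in> J then \<beta> j * (shear J u v (sr j))\<^sup>2 else 0) = (\<lambda>j. if j \<in> J then \<beta> j * (v (sr j))\<^sup>2 else 0)"
    by (auto simp: shear_sr)
  show "shear J u v \<in> good" using l v by (auto simp: good_def Q convergent_def)
  show "Pl (shear J u v) = Pl v + u * Ql v" unfolding Pl_def[of "shear J u v"] by (rule limI[OF l])
  show "Ql (shear J u v) = Ql v" unfolding Ql_def Q ..
qed

section \<open>The density of the infinite shear\<close>

definition \<rho> :: "real \<Rightarrow> ('i \<Rightarrow> real) \<Rightarrow> real" where
  "\<rho> u v = exp (- 2 * u * Pl v - u\<^sup>2 * Ql v)"

lemma \<rho>_pos [simp]: "0 < \<rho> u v" by (simp add: \<rho>_def)

lemma \<rho>_measurable [measurable]: "\<rho> u \<in> borel_measurable P"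
  unfolding \<rho>_def[abs_def] by measurable

text \<open>Fatou's lemma along the finite shears, whose densities converge almost everywhere.\<close>

lemma emeasure_shear_closed:
  assumes C: "closed C"
  shows "(\<integral>\<^sup>+v. indicator C v * ennreal (\<rho> u v) \<partial>P) \<le> emeasure P {v. shear J (- u) v \<in> C}"
proof -
  have [measurable]: "C \<in> sets P" using C by (simp add: sets_P_borel)
  let ?E = "\<lambda>i v. ennreal (exp (- 2 * u * Ps (Jn (fast i)) v - u\<^sup>2 * Qs (Jn (fast i)) v))"
  let ?s = "\<lambda>i. shear (Jn (fast i)) (- u)"
  have "(\<integral>\<^sup>+v. indicator C v * ennreal (\<rho> u v) \<partial>P) = (\<integral>\<^sup>+v. liminf (\<lambda>i. indicator C v * ?E i v) \<partial>P)"
  proof (rule nn_integral_cong_AE, use AE_good in eventually_elim)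
    case (elim v)
    have "(\<lambda>i. ?E i v) \<longlonglongrightarrow> ennreal (\<rho> u v)"
      unfolding \<rho>_def by (intro tendsto_intros Ps_lim Qs_lim elim)
    then have "(\<lambda>i. indicator C v * ?E i v) \<longlonglongrightarrow> indicator C v * ennreal (\<rho> u v)"
      by (cases "v \<in> C") auto
    then show ?case by (rule lim_imp_Liminf[symmetric, rotated]) simp
  qed
  also have "\<dots> \<le> liminf (\<lambda>i. \<integral>\<^sup>+v. indicator C v * ?E i v \<partial>P)"
    by (rule nn_integral_liminf) measurable
  also have "\<dots> = liminf (\<lambda>i. \<integral>\<^sup>+v. indicator C (?s i v) \<partial>P)"
    by (subst nn_integral_shear_finite) (auto simp: Jn_subset)
  also have "\<dots> \<le> limsup (\<lambda>i. \<integral>\<^sup>+v. indicator C (?s i v) \<partial>P)"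
    by (rule Liminf_le_Limsup) simp
  also have "\<dots> \<le> (\<integral>\<^sup>+v. limsup (\<lambda>i. indicator C (?s i v)) \<partial>P)"
    by (rule nn_integral_limsup[where w = "\<lambda>_. 1"]) (auto simp: P.emeasure_space_1[simplified] split: split_indicator)
  also have "\<dots> \<le> (\<integral>\<^sup>+v. indicator {v. shear J (- u) v \<in> C} v \<partial>P)"
  proof (rule nn_integral_mono)
    fix v
    show "limsup (\<lambda>i. indicator C (?s i v)) \<le> (indicator {v. shear J (- u) v \<in> C} v :: ennreal)"
    proof (cases "shear J (- u) v \<in> C")
      case True
      have "limsup (\<lambda>i. indicator C (?s i v)) \<le> limsup (\<lambda>_. 1 :: ennreal)"
        by (intro Limsup_mono always_eventually) (auto split: split_indicator)
      then show ?thesis using True by (simp add: Limsup_const)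
    next
      case False
      \<comment> \<open>Each coordinate is eventually constant, so the finite shears converge in the
        product topology. If the limit avoids the closed set, so do almost all of them; this is
        where closedness enters.\<close>
      have "(\<lambda>i. ?s i v) \<longlonglongrightarrow> shear J (- u) v"
        unfolding tendsto_fun_coordinatewise
      proof
        fix k
        show "(\<lambda>i. ?s i v k) \<longlonglongrightarrow> shear J (- u) v k"
        proof (cases "k \<in> tg ` J")
          case True
          then obtain j where j: "j \<in> J" "k = tg j" by blast
          have "\<forall>\<^sub>F i in sequentially. ?s i v k = shear J (- u) v k"
            unfolding eventually_sequentially
          proof (intro exI allI impI)
            fix i assume "Suc j \<le> i"
            then have "j \<in> Jn (fast i)" using fast(1)[of i] j by (simp add: Jn_def)
            then show "?s i v k = shear J (- u) v k" using j by (simp add: shear_tg Jn_subset)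
          qed
          then show ?thesis by (rule tendsto_eventually)
        next
          case False
          then have "?s i v k = shear J (- u) v k" for i
            using Jn_subset by (subst (1 2) shear_other) auto
          then show ?thesis by simp
        qed
      qed
      moreover have "open (- C)" using C by (rule open_Compl)
      ultimately have "\<forall>\<^sub>F i in sequentially. ?s i v \<in> - C" using False by (intro topological_tendstoD) auto
      then have "\<forall>\<^sub>F i in sequentially. indicator C (?s i v) \<le> (0 :: ennreal)"
        by eventually_elim simp
      then have "limsup (\<lambda>i. indicator C (?s i v)) \<le> (0 :: ennreal)"
        by (rule Limsup_bounded)
      then show ?thesis by simp
    qed
  qed
  also have "\<dots> = emeasure P {v. shear J (- u) v \<in> C}"
  proof (rule nn_integral_indicator)
    have "shear J (- u) -` C \<inter> space P \<in> sets P" by measurable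
    then show "{v. shear J (- u) v \<in> C} \<in> sets P" by (simp add: vimage_def)
  qed
  finally show ?thesis .
qed

text \<open>The measure with density \<open>\<rho> u\<close> is finite on a Polish space and compact
  sets are closed, so inner regularity carries the bound from closed sets to Borel sets, and from
  there to functions.\<close>

lemma nn_integral_shear_ge:
  assumes F: "F \<in> borel_measurable P"
  shows "(\<integral>\<^sup>+v. F v * ennreal (\<rho> u v) \<partial>P) \<le> (\<integral>\<^sup>+v. F (shear J (- u) v) \<partial>P)"
proof -
  define D where "D = density P (\<lambda>v. ennreal (\<rho> u v))"
  have D: "emeasure D A = (\<integral>\<^sup>+v. indicator A v * ennreal (\<rho> u v) \<partial>P)" if "A \<in> sets P" for A
    unfolding D_def using that by (simp add: emeasure_density mult.commute)
  have R: "emeasure (distr P P (shear J (- u))) A = emeasure P {v. shear J (- u) v \<in> A}" if "A \<in> sets P" for A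
    using that by (subst emeasure_distr) (auto simp: vimage_def)
  have sD: "sets D = sets borel" by (simp add: D_def sets_P_borel)
  have cl: "emeasure D C \<le> emeasure (distr P P (shear J (- u))) C" if "closed C" for C
    using emeasure_shear_closed[OF that, of u] that by (simp add: D R sets_P_borel)
  have "D \<le> distr P P (shear J (- u))"
  proof (subst le_measure)
    show "sets D = sets (distr P P (shear J (- u)))" by (simp add: D_def)
    show "\<forall>A\<in>sets D. emeasure D A \<le> emeasure (distr P P (shear J (- u))) A"
    proof
      fix A assume "A \<in> sets D"
      then have A: "A \<in> sets borel" by (simp add: sD)
      have "emeasure D (space D) \<le> emeasure (distr P P (shear J (- u))) UNIV"
        using cl[of UNIV] by (simp add: D_def)
      also have "\<dots> \<le> 1"
        using P.prob_space_distr[OF shear_measurable[of J "- u"]] prob_space.emeasure_space_1 by fastforce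
      finally have fin: "emeasure D (space D) \<noteq> \<infinity>" by (auto simp: top_unique)
      show "emeasure D A \<le> emeasure (distr P P (shear J (- u))) A"
        unfolding inner_regular[OF sD fin A]
      proof (rule SUP_least, clarify)
        fix K assume K: "K \<subseteq> A" "compact K"
        then have "emeasure D K \<le> emeasure (distr P P (shear J (- u))) K" by (intro cl compact_imp_closed)
        also have "\<dots> \<le> emeasure (distr P P (shear J (- u))) A"
          using K A by (intro emeasure_mono) (auto simp: sets_P_borel)
        finally show "emeasure D K \<le> emeasure (distr P P (shear J (- u))) A" .
      qed
    qed
  qed
  then have "integral\<^sup>N D F \<le> integral\<^sup>N (distr P P (shear J (- u))) F"
    by (intro nn_integral_mono_measure) (auto simp: D_def)
  also have "\<dots> = (\<integral>\<^sup>+v. F (shear J (- u) v) \<partial>P)"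
    using F by (intro nn_integral_distr) auto
  also have "integral\<^sup>N D F = (\<integral>\<^sup>+v. F v * ennreal (\<rho> u v) \<partial>P)"
    unfolding D_def using F by (subst nn_integral_density) (auto simp: mult.commute)
  finally show ?thesis .
qed

text \<open>The reverse inequality is the same one for \<open>-u\<close>, by the cocycle identity
  \<open>\<rho> u v * \<rho> (- u) (shear J u v) = 1\<close>.\<close>

theorem nn_integral_shear:
  assumes F: "F \<in> borel_measurable P"
  shows "(\<integral>\<^sup>+v. F (shear J (- u) v) \<partial>P) = (\<integral>\<^sup>+v. F v * ennreal (\<rho> u v) \<partial>P)"
proof (rule antisym[OF _ nn_integral_shear_ge[OF F]])
  have [measurable]: "(\<lambda>v. F (shear J (- u) v)) \<in> borel_measurable P" by (rule measurable_compose[OF shear_measurable F])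
  \<comment> \<open>Dividing by \<open>\<rho> (- u)\<close> creates the weight with which the
    inequality for \<open>- u\<close> can be applied.\<close>
  let ?H = "\<lambda>v. F (shear J (- u) v) * ennreal (1 / \<rho> (- u) v)"
  have "(\<integral>\<^sup>+v. F (shear J (- u) v) \<partial>P) = (\<integral>\<^sup>+v. ?H v * ennreal (\<rho> (- u) v) \<partial>P)"
    by (simp add: mult.assoc ennreal_mult'[symmetric] less_imp_le less_imp_neq[THEN not_sym])
  also have "\<dots> \<le> (\<integral>\<^sup>+v. ?H (shear J (- (- u)) v) \<partial>P)"
    by (rule nn_integral_shear_ge) measurable
  also have "\<dots> = (\<integral>\<^sup>+v. F v * ennreal (\<rho> u v) \<partial>P)"
  proof (rule nn_integral_cong_AE, use AE_good in eventually_elim)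
    case (elim v)
    have "1 / \<rho> (- u) (shear J u v) = \<rho> u v"
      using good_shear[OF elim, of u] by (simp add: \<rho>_def exp_minus[symmetric] inverse_eq_divide[symmetric] algebra_simps power2_eq_square)
    then show ?case by (simp add: shear_add shear_0)
  qed
  finally show "(\<integral>\<^sup>+v. F (shear J (- u) v) \<partial>P) \<le> (\<integral>\<^sup>+v. F v * ennreal (\<rho> u v) \<partial>P)" .
qed

end

section \<open>The Hilbert-Lie group\<close>

definition weight :: "zmat \<Rightarrow> zmat \<Rightarrow> int \<Rightarrow> int \<Rightarrow> real" where
  "weight a x k n = (if k < n then (x k n)\<^sup>2 * a k n else 0)"

text \<open>\<open>B\<^sub>2(a)\<close>, with square summability expressed by bounded sums over finite squares.\<close>

definition B2 :: "zmat \<Rightarrow> zmat set" where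
  "B2 a = {x \<in> BZ. \<exists>N. \<forall>K. finite K \<longrightarrow> (\<Sum>k\<in>K. \<Sum>n\<in>K. weight a x k n) \<le> N}"

text \<open>Passing to absolute values keeps the weighted norm, so products of such matrices stay in
  \<open>B2 a\<close> and dominate the sums that have to be interchanged.\<close>

definition abs_mat :: "zmat \<Rightarrow> zmat" where "abs_mat x k n = \<bar>x k n\<bar>"

lemma abs_mat_BZ: "x \<in> BZ \<Longrightarrow> abs_mat x \<in> BZ"
  by (simp add: BZ_def abs_mat_def)

lemma abs_mat_B2: "x \<in> B2 a \<Longrightarrow> abs_mat x \<in> B2 a"
proof -
  have "weight a (abs_mat x) = weight a x" by (intro ext) (simp add: weight_def abs_mat_def)
  then show "x \<in> B2 a \<Longrightarrow> abs_mat x \<in> B2 a" by (simp add: B2_def abs_mat_BZ)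
qed

lemma B2_BZ: "x \<in> B2 a \<Longrightarrow> x \<in> BZ"
  by (simp add: B2_def)

locale weights =
  fixes a :: zmat and C :: real
  assumes a_pos: "\<And>k n. k < n \<Longrightarrow> 0 < a k n" and C_pos: "0 < C"
    and a_mult: "\<And>k l n. k < l \<Longrightarrow> l < n \<Longrightarrow> a k n \<le> C * a k l * a l n"
begin

lemma weight_nonneg: "0 \<le> weight a x k n"
  using a_pos[of k n] by (cases "k < n") (simp_all add: weight_def)

lemma B2_bound:
  assumes "x \<in> B2 a"
  obtains N where "0 \<le> N" "\<And>K L. finite K \<Longrightarrow> finite L \<Longrightarrow> (\<Sum>k\<in>K. \<Sum>n\<in>L. weight a x k n) \<le> N"
proof -
  obtain N where N: "\<And>K. finite K \<Longrightarrow> (\<Sum>k\<in>K. \<Sum>n\<in>K. weight a x k n) \<le> N"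
    using assms by (auto simp: B2_def)
  show ?thesis
  proof (rule that)
    show "0 \<le> N" using N[of "{}"] by simp
    fix K L :: "int set" assume "finite K" "finite L"
    then have "(\<Sum>k\<in>K. \<Sum>n\<in>L. weight a x k n) \<le> (\<Sum>k\<in>K \<union> L. \<Sum>n\<in>K \<union> L. weight a x k n)"
      using weight_nonneg
      by (intro order_trans[OF sum_mono[OF sum_mono2[of "K \<union> L" L]] sum_mono2]) (auto intro: sum_nonneg)
    also have "\<dots> \<le> N" using N \<open>finite K\<close> \<open>finite L\<close> by simp
    finally show "(\<Sum>k\<in>K. \<Sum>n\<in>L. weight a x k n) \<le> N" .
  qed
qed

lemma B2I:
  assumes "x \<in> BZ" "\<And>M::nat. (\<Sum>k\<in>{-int M..int M}. \<Sum>n\<in>{-int M..int M}. weight a x k n) \<le> N"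
  shows "x \<in> B2 a"
proof -
  have "(\<Sum>k\<in>K. \<Sum>n\<in>K. weight a x k n) \<le> N" if K: "finite K" for K
  proof -
    have "finite ((\<lambda>k. nat \<bar>k\<bar>) ` K)" using K by simp
    then obtain M where M: "\<And>k. k \<in> K \<Longrightarrow> nat \<bar>k\<bar> \<le> M"
      by (metis finite_nat_set_iff_bounded_le imageI)
    have "K \<subseteq> {-int M..int M}" using M by force
    then have "(\<Sum>k\<in>K. \<Sum>n\<in>K. weight a x k n) \<le> (\<Sum>k\<in>{-int M..int M}. \<Sum>n\<in>{-int M..int M}. weight a x k n)"
      using weight_nonneg
      by (intro order_trans[OF sum_mono[OF sum_mono2[of "{-int M..int M}" K]] sum_mono2]) (auto intro: sum_nonneg)
    then show ?thesis using assms(2)[of M] by linarith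
  qed
  then show ?thesis using assms(1) by (auto simp: B2_def)
qed

text \<open>Cauchy-Schwarz after distributing the weight: by \<open>a_mult\<close>,
  \<open>sqrt (a k n)\<close> is at most \<open>sqrt C\<close> times the product of the square roots
  belonging to the two steps from \<open>k\<close> to \<open>l\<close> and from \<open>l\<close> to
  \<open>n\<close>.\<close>

lemma conv_bound:
  assumes L: "L \<subseteq> {k<..<n}"
  shows "a k n * (\<Sum>l\<in>L. x k l * z l n)\<^sup>2 \<le> C * (\<Sum>l\<in>L. weight a x k l) * (\<Sum>l\<in>L. weight a z l n)"
proof (cases "L = {}")
  case False
  then have kn: "k < n" using L by fastforce
  have "sqrt (a k n) * \<bar>\<Sum>l\<in>L. x k l * z l n\<bar> \<le> (\<Sum>l\<in>L. sqrt (a k n) * \<bar>x k l * z l n\<bar>)"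
    unfolding sum_distrib_left[symmetric] using a_pos[OF kn] by (intro mult_left_mono sum_abs) auto
  also have "\<dots> \<le> (\<Sum>l\<in>L. (sqrt (a k l) * \<bar>x k l\<bar>) * (sqrt C * (sqrt (a l n) * \<bar>z l n\<bar>)))"
  proof (rule sum_mono)
    fix l assume "l \<in> L"
    then have l: "k < l" "l < n" using L by auto
    have "sqrt (a k n) \<le> sqrt (C * a k l * a l n)" using a_mult[OF l] by simp
    then have "sqrt (a k n) * \<bar>x k l * z l n\<bar> \<le> sqrt (C * a k l * a l n) * \<bar>x k l * z l n\<bar>"
      by (rule mult_right_mono) simp
    then show "sqrt (a k n) * \<bar>x k l * z l n\<bar> \<le> (sqrt (a k l) * \<bar>x k l\<bar>) * (sqrt C * (sqrt (a l n) * \<bar>z l n\<bar>))"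
      by (simp add: real_sqrt_mult abs_mult ac_simps)
  qed
  finally have "(sqrt (a k n) * \<bar>\<Sum>l\<in>L. x k l * z l n\<bar>)\<^sup>2 \<le>
    (\<Sum>l\<in>L. (sqrt (a k l) * \<bar>x k l\<bar>) * (sqrt C * (sqrt (a l n) * \<bar>z l n\<bar>)))\<^sup>2"
    using a_pos[OF kn] by (intro power_mono) auto
  also have "\<dots> \<le> (\<Sum>l\<in>L. (sqrt (a k l) * \<bar>x k l\<bar>)\<^sup>2) * (\<Sum>l\<in>L. (sqrt C * (sqrt (a l n) * \<bar>z l n\<bar>))\<^sup>2)"
    by (rule Cauchy_Schwarz_ineq_sum)
  also have "(\<Sum>l\<in>L. (sqrt (a k l) * \<bar>x k l\<bar>)\<^sup>2) = (\<Sum>l\<in>L. weight a x k l)"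
    using L a_pos by (intro sum.cong) (auto simp: weight_def power_mult_distrib subset_iff less_imp_le)
  also have "(\<Sum>l\<in>L. (sqrt C * (sqrt (a l n) * \<bar>z l n\<bar>))\<^sup>2) = (\<Sum>l\<in>L. C * weight a z l n)"
    using L a_pos C_pos by (intro sum.cong) (auto simp: weight_def power_mult_distrib subset_iff less_imp_le)
  finally show ?thesis using a_pos[OF kn] by (simp add: power_mult_distrib sum_distrib_left[symmetric] ac_simps)
qed simp

lemma square_sum3: "(p + q + r)\<^sup>2 \<le> 3 * (p\<^sup>2 + q\<^sup>2 + (r::real)\<^sup>2)"
  using sum_squares_ge_zero[of "p - q" "q - r"] zero_le_power2[of "p - r"]
  by (simp add: power2_eq_square algebra_simps)

text \<open>Above the diagonal the product is the sum of the two factors and a strict convolution.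
  By \<open>conv_bound\<close> the latter is controlled by a row sum of \<open>x\<close> times a
  column sum of \<open>z\<close>, and the double sum of such products factorizes.\<close>

lemma B2_mult:
  assumes x: "x \<in> B2 a" and z: "z \<in> B2 a" shows "x \<odot> z \<in> B2 a"
proof -
  obtain Nx where Nx: "0 \<le> Nx" "\<And>K L. finite K \<Longrightarrow> finite L \<Longrightarrow> (\<Sum>k\<in>K. \<Sum>n\<in>L. weight a x k n) \<le> Nx"
    using B2_bound[OF x] by blast
  obtain Nz where Nz: "0 \<le> Nz" "\<And>K L. finite K \<Longrightarrow> finite L \<Longrightarrow> (\<Sum>k\<in>K. \<Sum>n\<in>L. weight a z k n) \<le> Nz"
    using B2_bound[OF z] by blast
  have BZ: "x \<in> BZ" "z \<in> BZ" using x z B2_BZ by auto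
  show ?thesis
  proof (rule B2I)
    show "x \<odot> z \<in> BZ" using BZ by simp
    fix M :: nat
    let ?K = "{-int M..int M}"
    have e: "weight a (x \<odot> z) k n \<le> 3 * weight a x k n + 3 * weight a z k n + 3 * C * ((\<Sum>l\<in>?K. weight a x k l) * (\<Sum>l\<in>?K. weight a z l n))"
      if "k \<in> ?K" "n \<in> ?K" for k n
    proof (cases "k < n")
      case True
      have "{k..n} = insert k (insert n {k<..<n})" using True by auto
      then have "(x \<odot> z) k n = (\<Sum>l\<in>insert k (insert n {k<..<n}). x k l * z l n)"
        using mat_mult_BZ[OF BZ, of k n] by simp
      also have "\<dots> = z k n + x k n + (\<Sum>l\<in>{k<..<n}. x k l * z l n)"
        using True BZ by (subst sum.insert, simp, simp, subst sum.insert) (auto simp: BZ_diag)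
      finally have "((x \<odot> z) k n)\<^sup>2 \<le> 3 * ((z k n)\<^sup>2 + (x k n)\<^sup>2 + (\<Sum>l\<in>{k<..<n}. x k l * z l n)\<^sup>2)"
        using square_sum3 by metis
      then have "weight a (x \<odot> z) k n \<le> 3 * ((z k n)\<^sup>2 + (x k n)\<^sup>2 + (\<Sum>l\<in>{k<..<n}. x k l * z l n)\<^sup>2) * a k n"
        unfolding weight_def using True a_pos[OF True] by (simp add: mult_right_mono)
      also have "\<dots> = 3 * weight a x k n + 3 * weight a z k n + 3 * (a k n * (\<Sum>l\<in>{k<..<n}. x k l * z l n)\<^sup>2)"
        using True by (simp add: weight_def algebra_simps)
      also have "\<dots> \<le> 3 * weight a x k n + 3 * weight a z k n + 3 * (C * (\<Sum>l\<in>{k<..<n}. weight a x k l) * (\<Sum>l\<in>{k<..<n}. weight a z l n))"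
        by (intro add_left_mono mult_left_mono conv_bound) auto
      also have "\<dots> \<le> 3 * weight a x k n + 3 * weight a z k n + 3 * (C * (\<Sum>l\<in>?K. weight a x k l) * (\<Sum>l\<in>?K. weight a z l n))"
        using that C_pos weight_nonneg
        by (intro add_left_mono mult_left_mono mult_mono sum_mono2 mult_nonneg_nonneg sum_nonneg) auto
      finally show ?thesis by (simp add: mult.assoc)
    next
      case False
      then show ?thesis using weight_nonneg C_pos by (simp add: weight_def[of a "x \<odot> z"] sum_nonneg)
    qed
    have "(\<Sum>k\<in>?K. \<Sum>n\<in>?K. weight a (x \<odot> z) k n) \<le>
      (\<Sum>k\<in>?K. \<Sum>n\<in>?K. 3 * weight a x k n + 3 * weight a z k n + 3 * C * ((\<Sum>l\<in>?K. weight a x k l) * (\<Sum>l\<in>?K. weight a z l n)))"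
      by (intro sum_mono e)
    also have "\<dots> = 3 * (\<Sum>k\<in>?K. \<Sum>n\<in>?K. weight a x k n) + 3 * (\<Sum>k\<in>?K. \<Sum>n\<in>?K. weight a z k n) +
      3 * C * ((\<Sum>k\<in>?K. \<Sum>l\<in>?K. weight a x k l) * (\<Sum>n\<in>?K. \<Sum>l\<in>?K. weight a z l n))"
      by (simp add: sum.distrib sum_distrib_left[symmetric] sum_product)
    also have "(\<Sum>n\<in>?K. \<Sum>l\<in>?K. weight a z l n) = (\<Sum>k\<in>?K. \<Sum>n\<in>?K. weight a z k n)" by (rule sum.swap)
    also have "3 * (\<Sum>k\<in>?K. \<Sum>n\<in>?K. weight a x k n) + 3 * (\<Sum>k\<in>?K. \<Sum>n\<in>?K. weight a z k n) +
      3 * C * ((\<Sum>k\<in>?K. \<Sum>l\<in>?K. weight a x k l) * (\<Sum>k\<in>?K. \<Sum>n\<in>?K. weight a z k n)) \<le> 3 * Nx + 3 * Nz + 3 * C * (Nx * Nz)"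
      using C_pos Nx Nz weight_nonneg by (intro add_mono mult_left_mono mult_mono sum_nonneg) auto
    finally show "(\<Sum>k\<in>?K. \<Sum>n\<in>?K. weight a (x \<odot> z) k n) \<le> 3 * Nx + 3 * Nz + 3 * C * (Nx * Nz)" .
  qed
qed

text \<open>The recursion for a row of the inverse is a discrete Volterra equation; Gronwall's
  argument bounds its weighted norm.\<close>

lemma inv_row_bound:
  assumes x: "x \<in> BZ" and N: "\<And>K L. finite K \<Longrightarrow> finite L \<Longrightarrow> (\<Sum>k\<in>K. \<Sum>n\<in>L. weight a x k n) \<le> N"
  shows "(\<Sum>e<d. weight a (mat_inv x) r (r + int e)) \<le> 2 * (\<Sum>e<d. weight a x r (r + int e)) * exp (2 * C * N)"
proof -
  define z where "z = mat_inv x"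
  \<comment> \<open>The kernel of the Volterra equation: the weight of \<open>x\<close> in one
    column. Different \<open>e\<close> use different columns, so the total is bounded by
    \<open>N\<close> for every row \<open>r\<close>.\<close>
  define \<gamma> where "\<gamma> e = (\<Sum>l\<in>{r<..<r + int e}. weight a x l (r + int e))" for e :: nat
  have z: "z \<in> BZ" "z \<odot> x = mat_id" using x by (auto simp: z_def)
  have step: "weight a z r (r + int d) \<le> 2 * weight a x r (r + int d) + 2 * C * (\<Sum>e<d. weight a z r (r + int e)) * \<gamma> d" for d
  proof (cases "d = 0")
    case False
    let ?n = "r + int d" and ?L = "{r<..<r + int d}"
    have n: "r < ?n" using False by simp
    have "0 = (\<Sum>l\<in>{r..?n}. z r l * x l ?n)"
      using mat_mult_BZ[OF z(1) x, of r ?n] z(2) False by (simp add: mat_id_def)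
    also have "{r..?n} = insert r (insert ?n ?L)" using n by auto
    also have "(\<Sum>l\<in>insert r (insert ?n ?L). z r l * x l ?n) = x r ?n + z r ?n + (\<Sum>l\<in>?L. z r l * x l ?n)"
      using n x z(1) by (subst sum.insert, simp, simp, subst sum.insert) (auto simp: BZ_diag)
    finally have "z r ?n = - (x r ?n + (\<Sum>l\<in>?L. z r l * x l ?n))" by simp
    then have "(z r ?n)\<^sup>2 = (x r ?n + (\<Sum>l\<in>?L. z r l * x l ?n))\<^sup>2" by (simp only: power2_minus)
    then have "(z r ?n)\<^sup>2 \<le> 2 * (x r ?n)\<^sup>2 + 2 * (\<Sum>l\<in>?L. z r l * x l ?n)\<^sup>2"
      using zero_le_power2[of "x r ?n - (\<Sum>l\<in>?L. z r l * x l ?n)"]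
      by (simp add: power2_sum power2_diff)
    then have "weight a z r ?n \<le> (2 * (x r ?n)\<^sup>2 + 2 * (\<Sum>l\<in>?L. z r l * x l ?n)\<^sup>2) * a r ?n"
      unfolding weight_def using n a_pos[OF n] by (simp add: mult_right_mono)
    also have "\<dots> = 2 * weight a x r ?n + 2 * (a r ?n * (\<Sum>l\<in>?L. z r l * x l ?n)\<^sup>2)"
      using n by (simp add: weight_def algebra_simps)
    also have "\<dots> \<le> 2 * weight a x r ?n + 2 * (C * (\<Sum>l\<in>?L. weight a z r l) * (\<Sum>l\<in>?L. weight a x l ?n))"
      by (intro add_left_mono mult_left_mono conv_bound) auto
    also have "(\<Sum>l\<in>?L. weight a z r l) \<le> (\<Sum>l\<in>{r..<r + int d}. weight a z r l)"
      using weight_nonneg by (intro sum_mono2) auto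
    also have "\<dots> = (\<Sum>e<d. weight a z r (r + int e))" by (rule sum_int_interval)
    finally show ?thesis using C_pos weight_nonneg by (simp add: \<gamma>_def mult_left_mono mult_right_mono sum_nonneg mult.assoc)
  qed (simp add: weight_def \<gamma>_def)
  have \<gamma>: "0 \<le> \<gamma> e" for e unfolding \<gamma>_def by (intro sum_nonneg weight_nonneg)
  have "(\<Sum>e<d. weight a z r (r + int e)) \<le> 2 * (\<Sum>e<d. weight a x r (r + int e)) * exp (2 * C * (\<Sum>e<d. \<gamma> e))"
  proof (induction d)
    case (Suc d)
    let ?U = "\<Sum>e<d. weight a z r (r + int e)" and ?X = "\<Sum>e<d. weight a x r (r + int e)" and ?w = "weight a x r (r + int d)"
      and ?E = "exp (2 * C * (\<Sum>e<d. \<gamma> e))"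
    have E: "1 \<le> exp (2 * C * (\<Sum>e<Suc d. \<gamma> e))" using C_pos \<gamma> by (simp add: sum_nonneg del: sum.lessThan_Suc)
    have "(\<Sum>e<Suc d. weight a z r (r + int e)) \<le> 2 * ?w + ?U * (1 + 2 * C * \<gamma> d)"
      using step[of d] by (simp add: algebra_simps)
    also have "\<dots> \<le> 2 * ?w + (2 * ?X * ?E) * exp (2 * C * \<gamma> d)"
      using Suc weight_nonneg C_pos \<gamma> exp_ge_add_one_self[of "2 * C * \<gamma> d"]
      by (intro add_left_mono mult_mono mult_nonneg_nonneg sum_nonneg) (auto intro!: mult_nonneg_nonneg sum_nonneg add_nonneg_nonneg)
    also have "(2 * ?X * ?E) * exp (2 * C * \<gamma> d) = 2 * ?X * exp (2 * C * (\<Sum>e<Suc d. \<gamma> e))"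
      by (simp add: exp_add[symmetric] algebra_simps)
    also have "2 * ?w \<le> 2 * ?w * exp (2 * C * (\<Sum>e<Suc d. \<gamma> e))"
      using mult_left_mono[OF E, of "2 * ?w"] weight_nonneg by simp
    finally show ?case by (simp add: algebra_simps)
  qed simp
  also have "(\<Sum>e<d. \<gamma> e) \<le> N"
  proof -
    have "(\<Sum>e<d. \<gamma> e) \<le> (\<Sum>e<d. \<Sum>l\<in>{r..<r + int d}. weight a x l (r + int e))"
      unfolding \<gamma>_def using weight_nonneg by (intro sum_mono sum_mono2) auto
    also have "\<dots> = (\<Sum>l\<in>{r..<r + int d}. \<Sum>n\<in>{r..<r + int d}. weight a x l n)"
      by (subst sum.swap) (simp add: sum_int_interval)
    also have "\<dots> \<le> N" by (rule N) auto
    finally show ?thesis .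
  qed
  finally show ?thesis unfolding z_def
    using C_pos weight_nonneg by (simp add: mult_left_mono sum_nonneg)
qed

text \<open>The constant \<open>exp (2 C N)\<close> in the bound for a row of the inverse is the
  same for all rows, so the row bounds can be summed.\<close>

lemma B2_inv:
  assumes x: "x \<in> B2 a" shows "mat_inv x \<in> B2 a"
proof -
  obtain N where N: "0 \<le> N" "\<And>K L. finite K \<Longrightarrow> finite L \<Longrightarrow> (\<Sum>k\<in>K. \<Sum>n\<in>L. weight a x k n) \<le> N"
    using B2_bound[OF x] by blast
  have BZ: "x \<in> BZ" using x by (rule B2_BZ)
  show ?thesis
  proof (rule B2I)
    show "mat_inv x \<in> BZ" using BZ by simp
    fix M :: nat
    let ?K = "{-int M..int M}"
    have "(\<Sum>n\<in>?K. weight a (mat_inv x) k n) \<le> 2 * exp (2 * C * N) * (\<Sum>n\<in>?K. weight a x k n)" if k: "k \<in> ?K" for k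
    proof -
      define d where "d = nat (int M + 1 - k)"
      have d: "k + int d = int M + 1" using k by (simp add: d_def)
      have K: "(\<Sum>n\<in>?K. weight a x' k n) = (\<Sum>e<d. weight a x' k (k + int e))" for x'
      proof -
        have "(\<Sum>n\<in>?K. weight a x' k n) = (\<Sum>n\<in>{k..<k + int d}. weight a x' k n)"
          using k d by (intro sum.mono_neutral_right) (auto simp: weight_def)
        then show ?thesis by (simp add: sum_int_interval)
      qed
      show ?thesis using inv_row_bound[OF BZ N(2), where d = d and r = k] unfolding K by (simp add: ac_simps)
    qed
    then have "(\<Sum>k\<in>?K. \<Sum>n\<in>?K. weight a (mat_inv x) k n) \<le> (\<Sum>k\<in>?K. 2 * exp (2 * C * N) * (\<Sum>n\<in>?K. weight a x k n))"
      by (rule sum_mono)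
    also have "\<dots> \<le> 2 * exp (2 * C * N) * N"
      unfolding sum_distrib_left[symmetric] using N(2) by (intro mult_left_mono) auto
    finally show "(\<Sum>k\<in>?K. \<Sum>n\<in>?K. weight a (mat_inv x) k n) \<le> 2 * exp (2 * C * N) * N" .
  qed
qed

end

section \<open>Triple products with y and the injectivity of S\<close>

locale dual_weights = weights +
  fixes m :: int and y :: zmat
  assumes y_dual: "y \<in> b2_dual a" and y_anti: "antidiag m y"
    and y_nz: "\<And>r::nat. y (m + int r + 1) (m - int r) \<noteq> 0"
begin

abbreviation yy :: "nat \<Rightarrow> real" where "yy p \<equiv> y (m + int p + 1) (m - int p)"

lemma yy_summable: "summable (\<lambda>p. (yy p)\<^sup>2 * inverse (a (m - int p) (m + int p + 1)))"
proof -
  let ?f = "\<lambda>(k, n). \<bar>y k n\<bar>\<^sup>2 * inverse (a n k)" and ?g = "\<lambda>p::nat. (m + int p + 1, m - int p)"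
  have "?f summable_on {(k, n). n < k}" using y_dual by (simp add: b2_dual_def)
  then have "?f summable_on range ?g" by (rule summable_on_subset_banach) auto
  moreover have "inj ?g" by (auto simp: inj_def)
  ultimately have "(?f \<circ> ?g) summable_on UNIV" by (simp add: summable_on_reindex)
  then have "summable (?f \<circ> ?g)" by (rule summable_on_imp_summable)
  then show ?thesis by (simp add: o_def)
qed

text \<open>For large \<open>p\<close> one has \<open>m - p < k < r < m + p + 1\<close>, and two
  uses of \<open>a_mult\<close> split the weight at \<open>(m - p, m + p + 1)\<close> over the three
  gaps. The square of a term is then a constant times \<open>Z_p Y_p\<close>, with \<open>Z\<close>
  the weights in row \<open>r\<close> of \<open>z\<close> and \<open>Y\<close> the terms of the dual
  norm of \<open>y\<close>; both are summable, and
  \<open>Z_p Y_p \<le> (Z_p + Y_p)^2\<close>.\<close>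

lemma triple_summable:
  assumes z: "z \<in> B2 a" and x: "x \<in> B2 a" and r: "m < r" and k: "k \<le> m"
  shows "summable (\<lambda>p. \<bar>z r (m + int p + 1) * yy p * x (m - int p) k\<bar>)"
proof -
  obtain Nx where Nx: "0 \<le> Nx" "\<And>K L. finite K \<Longrightarrow> finite L \<Longrightarrow> (\<Sum>k\<in>K. \<Sum>n\<in>L. weight a x k n) \<le> Nx"
    using B2_bound[OF x] by blast
  obtain Nz where Nz: "0 \<le> Nz" "\<And>K L. finite K \<Longrightarrow> finite L \<Longrightarrow> (\<Sum>k\<in>K. \<Sum>n\<in>L. weight a z k n) \<le> Nz"
    using B2_bound[OF z] by blast
  let ?Z = "\<lambda>p. weight a z r (m + int p + 1)" and ?Y = "\<lambda>p. (yy p)\<^sup>2 * inverse (a (m - int p) (m + int p + 1))"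
  have "summable ?Z"
  proof (rule summableI_nonneg_bounded)
    fix n
    have "(\<Sum>p<n. ?Z p) = (\<Sum>l\<in>{m + 1..<m + 1 + int n}. weight a z r l)"
      unfolding sum_int_interval by (intro sum.cong refl) (simp add: ac_simps)
    also have "\<dots> \<le> Nz" using Nz(2)[of "{r}" "{m + 1..<m + 1 + int n}"] by simp
    finally show "(\<Sum>p<n. ?Z p) \<le> Nz" .
  qed (rule weight_nonneg)
  \<comment> \<open>Collects two uses of submultiplicativity, the weight of the middle gap, and the
    bound for a single weighted entry of \<open>x\<close>.\<close>
  define D where "D = C\<^sup>2 * a k r * Nx"
  have D: "0 \<le> D" using a_pos[of k r] r k Nx by (simp add: D_def)
  have "summable (\<lambda>p. sqrt D * (?Z p + ?Y p))"
    by (intro summable_mult summable_add \<open>summable ?Z\<close> yy_summable)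
  then show ?thesis
  proof (rule summable_comparison_test'[of _ "nat (max (m - k) (r - m)) + 1"])
    fix p assume "nat (max (m - k) (r - m)) + 1 \<le> p"
    then have p: "m - int p < k" "r < m + int p + 1" by linarith+
    let ?i = "m - int p" and ?j = "m + int p + 1"
    have kr: "k < r" using r k by simp
    have A: "a ?i ?j \<le> C\<^sup>2 * a ?i k * a k r * a r ?j"
    proof -
      have "a ?i ?j \<le> C * a ?i k * a k ?j" by (rule a_mult) (use p kr in auto)
      also have "\<dots> \<le> C * a ?i k * (C * a k r * a r ?j)"
        using C_pos a_pos[OF p(1)] by (intro mult_left_mono a_mult) (use p kr in auto)
      finally show ?thesis by (simp add: power2_eq_square ac_simps)
    qed
    have pos: "0 < a ?i ?j" by (rule a_pos) (use p kr in simp)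
    have X: "weight a x ?i k \<le> Nx" using Nx(2)[of "{?i}" "{k}"] by simp
    have "(z r ?j * yy p * x ?i k)\<^sup>2 = ((z r ?j)\<^sup>2 * (x ?i k)\<^sup>2 * ?Y p) * a ?i ?j"
      using pos by (simp add: power_mult_distrib)
    also have "\<dots> \<le> ((z r ?j)\<^sup>2 * (x ?i k)\<^sup>2 * ?Y p) * (C\<^sup>2 * a ?i k * a k r * a r ?j)"
      using pos by (intro mult_left_mono A) auto
    also have "\<dots> = (C\<^sup>2 * a k r * ?Z p * ?Y p) * weight a x ?i k"
      using p by (simp add: weight_def ac_simps)
    also have "\<dots> \<le> (C\<^sup>2 * a k r * ?Z p * ?Y p) * Nx"
      using pos a_pos[OF kr] weight_nonneg by (intro mult_left_mono X mult_nonneg_nonneg) auto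
    also have "\<dots> = D * (?Z p * ?Y p)" by (simp add: D_def ac_simps)
    also have "\<dots> \<le> D * (?Z p + ?Y p)\<^sup>2"
      using D weight_nonneg[of z] pos by (intro mult_left_mono) (simp_all add: power2_sum)
    finally have "sqrt ((z r ?j * yy p * x ?i k)\<^sup>2) \<le> sqrt (D * (?Z p + ?Y p)\<^sup>2)"
      by (rule real_sqrt_le_mono)
    moreover have "0 \<le> ?Z p + ?Y p" using weight_nonneg[of z] pos by simp
    ultimately show "norm \<bar>z r ?j * yy p * x ?i k\<bar> \<le> sqrt D * (?Z p + ?Y p)"
      by (simp add: real_sqrt_mult)
  qed
qed

lemma triple_summable_on:
  assumes z: "z \<in> B2 a" and x: "x \<in> B2 a" and r: "m < r" and k: "k \<le> m"
  shows "(\<lambda>p. z r (m + int p + 1) * yy p * x (m - int p) k) summable_on UNIV"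
  using norm_summable_imp_summable_on[of "\<lambda>p. z r (m + int p + 1) * yy p * x (m - int p) k"]
    triple_summable[OF assms] by simp

lemma infsum_block:
  assumes D: "D1 \<in> BZ" "D2 \<in> BZ" and A: "A1 \<in> BZ" "A2 \<in> BZ" and rl: "m < r" "l \<le> m"
  shows "((\<lambda>(j, k). (D1 r j * D2 j n) * (A1 q k * A2 k l)) has_sum (D1 \<odot> D2) r n * (A1 \<odot> A2) q l) ({m<..} \<times> {..m})"
proof -
  have "((\<lambda>(j, k). (D1 r j * D2 j n) * (A1 q k * A2 k l)) has_sum
    (\<Sum>(j, k)\<in>{r..n} \<times> {q..l}. (D1 r j * D2 j n) * (A1 q k * A2 k l))) ({r..n} \<times> {q..l})"
    by (rule has_sum_finite) simp
  also have "(\<Sum>(j, k)\<in>{r..n} \<times> {q..l}. (D1 r j * D2 j n) * (A1 q k * A2 k l)) = (D1 \<odot> D2) r n * (A1 \<odot> A2) q l"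
    using D A by (simp add: mat_mult_BZ sum_product sum.cartesian_product)
  also have "((\<lambda>(j, k). (D1 r j * D2 j n) * (A1 q k * A2 k l)) has_sum (D1 \<odot> D2) r n * (A1 \<odot> A2) q l) ({r..n} \<times> {q..l}) \<longleftrightarrow> ?thesis"
  proof (rule has_sum_cong_neutral)
    fix p assume "p \<in> {m<..} \<times> {..m} - {r..n} \<times> {q..l}"
    then have "fst p < r \<or> n < fst p \<or> snd p < q \<or> l < snd p" by (cases p) (auto simp: not_le)
    then show "(case p of (j, k) \<Rightarrow> D1 r j * D2 j n * (A1 q k * A2 k l)) = 0"
      using D A by (cases p) (auto simp: BZ_below)
  qed (use rl in auto)
  finally show ?thesis .
qed

text \<open>Associativity of \<open>D1 (D2 y A1) A2\<close> is not automatic, as infinite sums are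
  interchanged. Absolute convergence follows from \<open>triple_summable_on\<close> for the products
  of the matrices of absolute values, which again lie in \<open>B2 a\<close>.\<close>

lemma infsum_triple:
  assumes D: "D1 \<in> B2 a" "D2 \<in> B2 a" and A: "A1 \<in> B2 a" "A2 \<in> B2 a" and rl: "m < r" "l \<le> m"
  shows "(\<Sum>\<^sub>\<infinity>(j, k)\<in>{m<..} \<times> {..m}. D1 r j * (\<Sum>\<^sub>\<infinity>p. D2 j (m + int p + 1) * yy p * A1 (m - int p) k) * A2 k l) =
    (\<Sum>\<^sub>\<infinity>p. (D1 \<odot> D2) r (m + int p + 1) * yy p * (A1 \<odot> A2) (m - int p) l)"
proof -
  let ?S = "{m<..} \<times> {..m}"
  let ?f = "\<lambda>p jk. yy p * ((D1 r (fst jk) * D2 (fst jk) (m + int p + 1)) * (A1 (m - int p) (snd jk) * A2 (snd jk) l))"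
  have BZ: "D1 \<in> BZ" "D2 \<in> BZ" "A1 \<in> BZ" "A2 \<in> BZ" using D A B2_BZ by auto
  have inner: "((\<lambda>jk. ?f p jk) has_sum yy p * ((D1 \<odot> D2) r (m + int p + 1) * (A1 \<odot> A2) (m - int p) l)) ?S" for p
    using has_sum_cmult_right[OF infsum_block[OF BZ rl]] by (simp add: case_prod_beta)
  have inner_abs: "((\<lambda>jk. norm (?f p jk)) has_sum
      \<bar>yy p\<bar> * ((abs_mat D1 \<odot> abs_mat D2) r (m + int p + 1) * (abs_mat A1 \<odot> abs_mat A2) (m - int p) l)) ?S" for p
    using has_sum_cmult_right[OF infsum_block[OF BZ[THEN abs_mat_BZ] rl], of "\<bar>yy p\<bar>"]
    by (simp add: case_prod_beta abs_mat_def abs_mult)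
  have ab: "(\<lambda>q. norm (?f (fst q) (snd q))) summable_on (UNIV \<times> ?S)"
  proof (subst Infinite_Sum.abs_summable_on_Sigma_iff, intro conjI ballI)
    fix p show "(\<lambda>jk. norm (?f (fst (p, jk)) (snd (p, jk)))) summable_on ?S"
      using inner_abs[of p] by (auto simp: summable_on_def)
  next
    have "(\<lambda>p. norm ((abs_mat D1 \<odot> abs_mat D2) r (m + int p + 1) * yy p * (abs_mat A1 \<odot> abs_mat A2) (m - int p) l)) summable_on UNIV"
      by (rule summable_on_iff_abs_summable_on_real[THEN iffD1])
         (intro triple_summable_on B2_mult abs_mat_B2 D A rl)
    moreover have "norm ((abs_mat D1 \<odot> abs_mat D2) r (m + int p + 1) * yy p * (abs_mat A1 \<odot> abs_mat A2) (m - int p) l) =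
      norm (infsum (\<lambda>jk. norm (?f p jk)) ?S)" for p
      unfolding infsumI[OF inner_abs] by (simp add: abs_mult)
    ultimately show "(\<lambda>p. norm (\<Sum>\<^sub>\<infinity>jk\<in>?S. norm (?f (fst (p, jk)) (snd (p, jk))))) summable_on UNIV" by simp
  qed
  have "(\<Sum>\<^sub>\<infinity>p. (D1 \<odot> D2) r (m + int p + 1) * yy p * (A1 \<odot> A2) (m - int p) l) = (\<Sum>\<^sub>\<infinity>p. \<Sum>\<^sub>\<infinity>jk\<in>?S. ?f p jk)"
    unfolding infsumI[OF inner] by (simp add: ac_simps)
  also have "\<dots> = (\<Sum>\<^sub>\<infinity>jk\<in>?S. \<Sum>\<^sub>\<infinity>p. ?f p jk)"
    using abs_summable_summable[OF ab] by (intro infsum_swap_banach) (simp add: case_prod_beta')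
  also have "\<dots> = (\<Sum>\<^sub>\<infinity>(j, k)\<in>?S. D1 r j * (\<Sum>\<^sub>\<infinity>p. D2 j (m + int p + 1) * yy p * A1 (m - int p) k) * A2 k l)"
  proof (rule infsum_cong)
    fix jk :: "int \<times> int"
    obtain j k where jk: "jk = (j, k)" by (cases jk)
    have "(\<Sum>\<^sub>\<infinity>p. ?f p jk) = (\<Sum>\<^sub>\<infinity>p. (D1 r j * A2 k l) * (D2 j (m + int p + 1) * yy p * A1 (m - int p) k))"
      by (simp add: jk ac_simps)
    also have "\<dots> = (D1 r j * A2 k l) * (\<Sum>\<^sub>\<infinity>p. D2 j (m + int p + 1) * yy p * A1 (m - int p) k)"
      by (rule infsum_cmult_right')
    finally show "(\<Sum>\<^sub>\<infinity>p. ?f p jk) = (case jk of (j, k) \<Rightarrow> D1 r j * (\<Sum>\<^sub>\<infinity>p. D2 j (m + int p + 1) * yy p * A1 (m - int p) k) * A2 k l)"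
      by (simp add: jk ac_simps)
  qed
  finally show ?thesis by simp
qed

lemma infsum_single:
  fixes f :: "nat \<Rightarrow> real" assumes "\<And>p. p \<noteq> q \<Longrightarrow> f p = 0" shows "infsum f UNIV = f q"
proof -
  have "infsum f UNIV = infsum f {q}" by (rule infsum_cong_neutral) (use assms in auto)
  then show ?thesis by simp
qed

text \<open>With \<open>E = D' D\<^sup>-\<^sup>1\<close> and \<open>F = A' A\<^sup>-\<^sup>1\<close>, equality of the two products
  gives \<open>E y = y F\<close>, where the left side is upper and the right side lower triangular
  with respect to the antidiagonal.\<close>

lemma S_injective:
  assumes D: "D \<in> B2 a" "D \<in> unitri (Delta_sub m)" "D' \<in> B2 a" "D' \<in> unitri (Delta_sub m)"
    and A: "A \<in> B2 a" "A \<in> unitri (Delta_sup m)" "A' \<in> B2 a" "A' \<in> unitri (Delta_sup m)"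
    and eq: "\<And>k r. k \<le> m \<Longrightarrow> m < r \<Longrightarrow>
      (\<Sum>\<^sub>\<infinity>p. mat_inv D r (m + int p + 1) * yy p * A (m - int p) k) =
      (\<Sum>\<^sub>\<infinity>p. mat_inv D' r (m + int p + 1) * yy p * A' (m - int p) k)"
  shows "D' = D" "A' = A"
proof -
  define E where "E = D' \<odot> mat_inv D"
  define F where "F = A' \<odot> mat_inv A"
  have BZ: "D \<in> BZ" "D' \<in> BZ" "A \<in> BZ" "A' \<in> BZ" "E \<in> BZ" "F \<in> BZ"
    using D A unitri_BZ by (auto simp: E_def F_def)
  \<comment> \<open>The assumed equality is multiplied by \<open>D'\<close> on the left and by the
    inverse of \<open>A\<close> on the right. The only entry of \<open>y\<close> in column
    \<open>l\<close> is in row \<open>2 m + 1 - l\<close>, so each side has one surviving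
    term.\<close>
  have key: "E r (2 * m + 1 - l) * yy (nat (m - l)) = yy (nat (r - m - 1)) * F (2 * m + 1 - r) l"
    if rl: "m < r" "l \<le> m" for r l
  proof -
    have "(\<Sum>\<^sub>\<infinity>p. (D' \<odot> mat_inv D) r (m + int p + 1) * yy p * (A \<odot> mat_inv A) (m - int p) l) =
      (\<Sum>\<^sub>\<infinity>p. (D' \<odot> mat_inv D') r (m + int p + 1) * yy p * (A' \<odot> mat_inv A) (m - int p) l)"
      unfolding infsum_triple[OF D(3) B2_inv[OF D(1)] A(1) B2_inv[OF A(1)] rl, symmetric]
        infsum_triple[OF D(3) B2_inv[OF D(3)] A(3) B2_inv[OF A(1)] rl, symmetric]
      by (rule infsum_cong) (auto simp: eq)
    moreover have "(\<Sum>\<^sub>\<infinity>p. (D' \<odot> mat_inv D) r (m + int p + 1) * yy p * (A \<odot> mat_inv A) (m - int p) l) =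
      E r (2 * m + 1 - l) * yy (nat (m - l))"
      using rl BZ by (subst infsum_single[of "nat (m - l)"]) (auto simp: mat_id_def E_def algebra_simps)
    moreover have "(\<Sum>\<^sub>\<infinity>p. (D' \<odot> mat_inv D') r (m + int p + 1) * yy p * (A' \<odot> mat_inv A) (m - int p) l) =
      yy (nat (r - m - 1)) * F (2 * m + 1 - r) l"
      using rl BZ by (subst infsum_single[of "nat (r - m - 1)"]) (auto simp: mat_id_def F_def algebra_simps)
    ultimately show ?thesis by simp
  qed
  \<comment> \<open>Reflection at the antidiagonal reverses the order of indices: an entry of
    \<open>E\<close> above the diagonal is matched with one of \<open>F\<close> below it. Dividing
    by the nonzero entry of \<open>y\<close> gives zero.\<close>
  have E0: "E r n = 0" if "m < r" "r < n" for r n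
  proof -
    have "F (2 * m + 1 - r) (2 * m + 1 - n) = 0" by (rule BZ_below[OF BZ(6)]) (use that in simp)
    then show ?thesis using key[of r "2 * m + 1 - n"] that y_nz[of "nat (n - m - 1)"] by simp
  qed
  have F0: "F i l = 0" if "l \<le> m" "i < l" for i l
  proof -
    have "E (2 * m + 1 - i) (2 * m + 1 - l) = 0" by (rule BZ_below[OF BZ(5)]) (use that in simp)
    then show ?thesis using key[of "2 * m + 1 - i" l] that y_nz[of "nat (m - i)"] by simp
  qed
  have loE: "lower_block m E = mat_id"
  proof (intro ext)
    fix k n show "lower_block m E k n = mat_id k n"
      using E0[of k n] BZ_diag[OF BZ(5), of k] BZ_below[OF BZ(5), of n k]
      by (cases "k < n"; cases "k = n") (auto simp: lower_block_def mat_id_def)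
  qed
  have upF: "upper_block m F = mat_id"
  proof (intro ext)
    fix k n show "upper_block m F k n = mat_id k n"
      using F0[of n k] BZ_diag[OF BZ(6), of k] BZ_below[OF BZ(6), of n k]
      by (cases "k < n"; cases "k = n") (auto simp: upper_block_def mat_id_def)
  qed
  have "E \<odot> D = D'" "F \<odot> A = A'" using BZ by (simp_all add: E_def F_def mat_mult_assoc)
  then have "lower_block m E \<odot> lower_block m D = lower_block m D'" "upper_block m F \<odot> upper_block m A = upper_block m A'"
    using BZ by (metis lower_block_mult, metis upper_block_mult)
  then show "D' = D" "A' = A" using loE upF D A by (simp_all add: lower_block_sub upper_block_sup)
qed

lemma summable_on_sum_finite:
  fixes f :: "'b \<Rightarrow> 'c \<Rightarrow> real"
  assumes "finite S" "\<And>q. q \<in> S \<Longrightarrow> f q summable_on A"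
  shows "(\<lambda>p. \<Sum>q\<in>S. f q p) summable_on A"
  using assms by (induction S rule: finite_induct) (auto intro: summable_on_add)

text \<open>By the entry formula the series is a finite combination of triple series formed with
  \<open>snd x\<close> and the inverse of the first component of \<open>xt\<close>; hence the two
  memberships in \<open>B2 a\<close>.\<close>

lemma pairing_cocycle_summable:
  assumes x: "x \<in> X_space m" and t: "t \<in> B0Z" and A: "snd x \<in> B2 a" and D: "fst (act m x t) \<in> B2 a"
  shows "(\<lambda>p. (cocycle m x t (m - int p) (m + int p + 1) - mat_id (m - int p) (m + int p + 1)) * yy p) summable_on UNIV"
proof -
  have "(\<lambda>p. \<Sum>q\<in>mid_supp m t. t (fst q) (snd q) * (mat_inv (fst (act m x t)) (snd q) (m + int p + 1) * yy p * snd x (m - int p) (fst q))) summable_on UNIV"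
    by (intro summable_on_sum_finite mid_supp_finite t summable_on_cmult_right triple_summable_on B2_inv A D)
       (auto simp: mid_supp_def Delta_mid_def)
  moreover have "(cocycle m x t (m - int p) (m + int p + 1) - mat_id (m - int p) (m + int p + 1)) * yy p =
    (\<Sum>q\<in>mid_supp m t. t (fst q) (snd q) * (mat_inv (fst (act m x t)) (snd q) (m + int p + 1) * yy p * snd x (m - int p) (fst q)))" for p
    by (subst cocycle_entry_B0Z[OF x t]) (auto simp: mat_id_def case_prod_beta sum_distrib_right intro!: sum.cong)
  ultimately show ?thesis by simp
qed

end

section \<open>Closed subspaces of \<open>L\<^sup>2\<close> and multiplication operators\<close>

text \<open>The supremum of the measures of compact subsets is attained along a sequence, whose
  union therefore fills the set up to a null set.\<close>

lemma inner_regular_sequence: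
  fixes N :: "'a::{second_countable_topology, complete_space} measure"
  assumes N: "sets N = sets borel" "finite_measure N" and A: "A \<in> sets borel"
  shows "\<exists>K :: nat \<Rightarrow> 'a set. (\<forall>n. compact (K n)) \<and> (\<forall>n. K n \<subseteq> A) \<and> emeasure N (A - (\<Union>n. K n)) = 0"
proof -
  interpret finite_measure N by fact
  let ?C = "{K. K \<subseteq> A \<and> compact K}"
  have "?C \<noteq> {}" by auto
  then have "\<exists>f::nat \<Rightarrow> ennreal. range f \<subseteq> emeasure N ` ?C \<and> Sup (emeasure N ` ?C) = Sup (range f)"
    by (rule ennreal_SUP_countable_SUP)
  then obtain f :: "nat \<Rightarrow> ennreal" where f: "range f \<subseteq> emeasure N ` ?C" "Sup (emeasure N ` ?C) = Sup (range f)"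
    by blast
  have "\<forall>n. \<exists>K. K \<in> ?C \<and> f n = emeasure N K" using f(1) by blast
  then obtain K where K: "\<And>n. K n \<in> ?C" "\<And>n. f n = emeasure N (K n)" by metis
  have K_sets: "K n \<in> sets N" for n using K(1)[of n] N(1) by (auto intro: borel_compact)
  have "emeasure N A = Sup (range f)"
    using inner_regular[OF N(1) _ A] f(2) by simp
  also have "\<dots> \<le> emeasure N (\<Union>n. K n)"
    by (rule SUP_least) (use K_sets in \<open>auto simp: K(2) intro!: emeasure_mono\<close>)
  finally have "emeasure N A \<le> emeasure N (\<Union>n. K n)" .
  then have "emeasure N (A - (\<Union>n. K n)) = 0"
    using A K_sets K(1) N(1) by (subst emeasure_Diff) (auto simp: diff_eq_0_iff_ennreal less_top[symmetric])
  then show ?thesis using K(1) by (intro exI[of _ K]) auto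
qed

text \<open>The Lusin-Souslin theorem up to null sets: restrict to compact subsets of the graph
  of \<open>S\<close> and project.\<close>

lemma AE_factor_through:
  fixes M :: "'a::polish_space measure" and S :: "'a \<Rightarrow> 'b::polish_space"
  assumes M: "sets M = sets borel" "finite_measure M" and S: "S \<in> borel_measurable M"
    and ae: "AE x in M. x \<in> \<Omega>" and E: "E \<in> sets M"
    and sep: "\<And>x x'. x \<in> \<Omega> \<Longrightarrow> x' \<in> \<Omega> \<Longrightarrow> S x = S x' \<Longrightarrow> x \<in> E \<Longrightarrow> x' \<in> E"
  obtains B where "B \<in> sets borel" "AE x in M. x \<in> E \<longleftrightarrow> S x \<in> B"
proof -
  interpret finite_measure M by fact
  have spM: "space M = UNIV" using sets_eq_imp_space_eq[OF M(1)] by simp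
  obtain N where N: "{x \<in> space M. x \<notin> \<Omega>} \<subseteq> N" "emeasure M N = 0" "N \<in> sets M"
    using AE_E[OF ae] by metis
  define W where "W = - N"
  have W: "W \<in> sets M" "W \<subseteq> \<Omega>" "AE x in M. x \<in> W"
    using N spM sets.compl_sets[OF N(3)] AE_not_in[of N M] by (auto simp: W_def Compl_eq_Diff_UNIV null_setsI)
  define G where "G x = (x, S x)" for x
  have Sm [measurable]: "S \<in> borel_measurable borel" using S M(1) by (simp cong: measurable_cong_sets)
  have G [measurable]: "G \<in> measurable M borel"
    unfolding G_def[abs_def] borel_prod[symmetric] using S M(1)
    by (intro measurable_Pair measurable_ident_sets) auto
  define Q where "Q = distr M borel G"
  have Q: "sets Q = sets borel" "finite_measure Q" by (auto simp: Q_def intro: finite_measure_distr[OF G])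
  define gr where "gr A = {p :: 'a \<times> 'b. fst p \<in> A \<and> snd p = S (fst p)}" for A
  have gr_sets: "gr A \<in> sets borel" if "A \<in> sets borel" for A
  proof -
    have [measurable]: "A \<in> sets borel" by fact
    have "{p \<in> space (borel \<Otimes>\<^sub>M borel). fst p \<in> A \<and> snd p = S (fst p)} \<in> sets (borel \<Otimes>\<^sub>M borel :: ('a \<times> 'b) measure)"
      by measurable
    then have "gr A \<in> sets (borel \<Otimes>\<^sub>M borel)" by (simp add: gr_def space_pair_measure)
    then show ?thesis by (simp only: borel_prod)
  qed
  have cover: "\<exists>K::nat \<Rightarrow> ('a \<times> 'b) set. (\<forall>n. compact (K n)) \<and> (\<forall>n. K n \<subseteq> gr A) \<and> (AE x in M. x \<in> A \<longrightarrow> (\<exists>n. G x \<in> K n))"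
    if A: "A \<in> sets borel" for A
  proof -
    obtain K where K: "\<And>n::nat. compact (K n)" "\<And>n. K n \<subseteq> gr A" "emeasure Q (gr A - (\<Union>n. K n)) = 0"
      using inner_regular_sequence[OF Q gr_sets[OF A]] by auto
    have s: "gr A - (\<Union>n. K n) \<in> sets borel" using gr_sets[OF A] K(1) by (auto intro: borel_compact)
    have "emeasure M (G -` (gr A - (\<Union>n. K n)) \<inter> space M) = 0"
      using K(3) s by (simp add: Q_def emeasure_distr)
    then have "AE x in M. x \<notin> G -` (gr A - (\<Union>n. K n)) \<inter> space M"
      by (intro AE_not_in null_setsI measurable_sets[OF G s])
    then have "AE x in M. x \<in> A \<longrightarrow> (\<exists>n. G x \<in> K n)"
      by eventually_elim (auto simp: gr_def G_def spM)
    then show ?thesis using K by blast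
  qed
  obtain K1 where K1: "\<And>n::nat. compact (K1 n)" "\<And>n. K1 n \<subseteq> gr (W \<inter> E)" "AE x in M. x \<in> W \<inter> E \<longrightarrow> (\<exists>n. G x \<in> K1 n)"
    using cover[of "W \<inter> E"] W(1) E M(1) by auto
  \<comment> \<open>Continuous images of Borel sets need not be Borel, but those of compact sets are
    compact; \<open>B\<close> is a countable union of them.\<close>
  define B where "B = (\<Union>n. snd ` K1 n)"
  have "snd ` K1 n \<in> sets borel" for n
    by (intro borel_compact compact_continuous_image continuous_on_snd continuous_on_id K1(1))
  then have "B \<in> sets borel" unfolding B_def by blast
  moreover have "AE x in M. x \<in> E \<longleftrightarrow> S x \<in> B"
    using K1(3) W(3)
  proof eventually_elim
    case (elim x)
    show ?case
    proof
      assume "x \<in> E"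
      then obtain n where "G x \<in> K1 n" using elim by blast
      then show "S x \<in> B" unfolding B_def G_def by force
    next
      assume "S x \<in> B"
      then obtain n p where p: "p \<in> K1 n" "snd p = S x" unfolding B_def by auto
      then have "fst p \<in> W \<inter> E" "S (fst p) = S x" using K1(2)[of n] by (auto simp: gr_def)
      then show "x \<in> E" using sep[of "fst p" x] W(2) elim by auto
    qed
  qed
  ultimately show ?thesis by (rule that)
qed

section \<open>Square integrable functions and dominated convergence\<close>

lemma L2_measurable: "f \<in> L2 M \<Longrightarrow> f \<in> borel_measurable M"
  by (simp add: L2_def)

lemma L2_iff_nn:
  "f \<in> L2 M \<longleftrightarrow> f \<in> borel_measurable M \<and> (\<integral>\<^sup>+x. ennreal ((cmod (f x))\<^sup>2) \<partial>M) < \<infinity>"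
  unfolding L2_def by (auto simp: integrable_iff_bounded)

lemma L2_add:
  assumes "f \<in> L2 M" "g \<in> L2 M" shows "(\<lambda>x. f x + g x) \<in> L2 M"
proof -
  have [measurable]: "f \<in> borel_measurable M" "g \<in> borel_measurable M" using assms by (auto simp: L2_def)
  have "integrable M (\<lambda>x. (cmod (f x + g x))\<^sup>2)"
  proof (rule Bochner_Integration.integrable_bound)
    show "integrable M (\<lambda>x. 2 * (cmod (f x))\<^sup>2 + 2 * (cmod (g x))\<^sup>2)" using assms by (auto simp: L2_def)
    show "AE x in M. norm ((cmod (f x + g x))\<^sup>2) \<le> norm (2 * (cmod (f x))\<^sup>2 + 2 * (cmod (g x))\<^sup>2)"
    proof (rule AE_I2)
      fix x
      have "(cmod (f x + g x))\<^sup>2 \<le> (cmod (f x) + cmod (g x))\<^sup>2" by (intro power_mono norm_triangle_ineq) simp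
      also have "\<dots> \<le> 2 * (cmod (f x))\<^sup>2 + 2 * (cmod (g x))\<^sup>2"
        using zero_le_power2[of "cmod (f x) - cmod (g x)"] by (simp add: power2_sum power2_diff)
      finally show "norm ((cmod (f x + g x))\<^sup>2) \<le> norm (2 * (cmod (f x))\<^sup>2 + 2 * (cmod (g x))\<^sup>2)" by simp
    qed
  qed measurable
  then show ?thesis by (simp add: L2_def)
qed

lemma L2_bound:
  assumes f: "f \<in> L2 M" and g: "g \<in> borel_measurable M" and le: "AE x in M. cmod (g x) \<le> K * cmod (f x)"
  shows "g \<in> L2 M"
proof -
  have [measurable]: "f \<in> borel_measurable M" "g \<in> borel_measurable M" using assms by (auto simp: L2_def)
  have "integrable M (\<lambda>x. (cmod (g x))\<^sup>2)"
  proof (rule Bochner_Integration.integrable_bound)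
    show "integrable M (\<lambda>x. K\<^sup>2 * (cmod (f x))\<^sup>2)" using f by (auto simp: L2_def)
    show "AE x in M. norm ((cmod (g x))\<^sup>2) \<le> norm (K\<^sup>2 * (cmod (f x))\<^sup>2)"
      using le by eventually_elim (simp add: power_mono flip: power_mult_distrib)
  qed measurable
  then show ?thesis by (simp add: L2_def)
qed

lemma L2_cmult: "f \<in> L2 M \<Longrightarrow> (\<lambda>x. c * f x) \<in> L2 M"
  by (rule L2_bound[where K = "cmod c"]) (auto simp: L2_def norm_mult)

lemma L2_diff: "f \<in> L2 M \<Longrightarrow> g \<in> L2 M \<Longrightarrow> (\<lambda>x. f x - g x) \<in> L2 M"
  using L2_add[of f M "\<lambda>x. -1 * g x"] L2_cmult[of g M "-1"] by simp

lemma L2_tendsto_dominated: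
  assumes F: "\<And>n. F n \<in> borel_measurable M" and h: "h \<in> L2 M" and g: "g \<in> borel_measurable M"
    and le: "\<And>n. AE x in M. cmod (F n x) \<le> K * cmod (h x)"
    and lim: "AE x in M. (\<lambda>n. F n x) \<longlonglongrightarrow> g x"
  shows "L2_tendsto M F g sequentially"
proof -
  have leA: "AE x in M. \<forall>n. cmod (F n x) \<le> K * cmod (h x)" using le by (simp add: AE_all_countable)
  have g_le: "AE x in M. cmod (g x) \<le> K * cmod (h x)"
    using leA lim
  proof eventually_elim
    case (elim x)
    then show ?case by (intro Lim_bounded[OF tendsto_norm[OF elim(2)], of 0]) auto
  qed
  have Fn: "F n \<in> L2 M" for n by (rule L2_bound[OF h F le])
  have gL: "g \<in> L2 M" by (rule L2_bound[OF h g g_le])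
  note [measurable] = F g L2_measurable[OF h]
  have "(\<lambda>n. LINT x|M. (cmod (F n x - g x))\<^sup>2) \<longlonglongrightarrow> (LINT x|M. 0)"
  proof (rule integral_dominated_convergence[where w = "\<lambda>x. 4 * K\<^sup>2 * (cmod (h x))\<^sup>2"])
    show "integrable M (\<lambda>x. 4 * K\<^sup>2 * (cmod (h x))\<^sup>2)" using h by (auto simp: L2_def)
    show "AE x in M. (\<lambda>n. (cmod (F n x - g x))\<^sup>2) \<longlonglongrightarrow> 0"
      using lim by eventually_elim (auto intro!: tendsto_eq_intros LIM_zero)
    fix n
    show "AE x in M. norm ((cmod (F n x - g x))\<^sup>2) \<le> 4 * K\<^sup>2 * (cmod (h x))\<^sup>2"
      using leA g_le
    proof eventually_elim
      case (elim x)
      have "cmod (F n x - g x) \<le> cmod (F n x) + cmod (g x)" by (rule norm_triangle_ineq4)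
      also have "\<dots> \<le> 2 * (K * cmod (h x))" using spec[OF elim(1), of n] elim(2) by simp
      finally have "(cmod (F n x - g x))\<^sup>2 \<le> (2 * (K * cmod (h x)))\<^sup>2" by (intro power_mono) auto
      then show ?case by (simp add: power_mult_distrib)
    qed
  qed measurable
  then show ?thesis using Fn gL by (simp add: L2_tendsto_def)
qed

section \<open>Bounded multipliers of a closed subspace\<close>

locale L2_sub = finite_measure M for M :: "'a measure" +
  fixes V :: "('a \<Rightarrow> complex) set"
  assumes V: "L2_closed_subspace M V"
begin

lemma V_L2: "f \<in> V \<Longrightarrow> f \<in> L2 M" and V_0: "(\<lambda>_. 0) \<in> V"
  and V_add: "f \<in> V \<Longrightarrow> g \<in> V \<Longrightarrow> (\<lambda>x. f x + g x) \<in> V"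
  and V_cmult: "f \<in> V \<Longrightarrow> (\<lambda>x. c * f x) \<in> V"
  and V_lim: "(\<And>n. F n \<in> V) \<Longrightarrow> L2_tendsto M F g sequentially \<Longrightarrow> g \<in> V"
  using V unfolding L2_closed_subspace_def by blast+

lemma V_cong_AE:
  assumes f: "f \<in> V" and g: "g \<in> borel_measurable M" and eq: "AE x in M. f x = g x" shows "g \<in> V"
proof (rule V_lim[of "\<lambda>_. f"])
  show "L2_tendsto M (\<lambda>_. f) g sequentially"
    by (rule L2_tendsto_dominated[OF _ V_L2[OF f] g, where K = 1])
       (use L2_measurable[OF V_L2[OF f]] eq in auto)
qed (rule f)

text \<open>The multipliers contain the constants, form an algebra, and are closed under pointwise
  limits with a common bound. All later growth of this set uses these closure properties.\<close>

definition mult :: "('a \<Rightarrow> complex) \<Rightarrow> bool" where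
  "mult \<psi> \<longleftrightarrow> \<psi> \<in> borel_measurable M \<and> (\<exists>K. \<forall>x\<in>space M. cmod (\<psi> x) \<le> K) \<and> (\<forall>f\<in>V. (\<lambda>x. \<psi> x * f x) \<in> V)"

lemma multD: "mult \<psi> \<Longrightarrow> f \<in> V \<Longrightarrow> (\<lambda>x. \<psi> x * f x) \<in> V"
  by (simp add: mult_def)

lemma mult_measurable: "mult \<psi> \<Longrightarrow> \<psi> \<in> borel_measurable M"
  by (simp add: mult_def)

lemma mult_const: "mult (\<lambda>_. c)"
  using V_cmult by (auto simp: mult_def)

lemma mult_add: assumes "mult \<phi>" "mult \<psi>" shows "mult (\<lambda>x. \<phi> x + \<psi> x)"
proof -
  obtain K L where "\<forall>x\<in>space M. cmod (\<phi> x) \<le> K" "\<forall>x\<in>space M. cmod (\<psi> x) \<le> L"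
    using assms by (auto simp: mult_def)
  then have "\<forall>x\<in>space M. cmod (\<phi> x + \<psi> x) \<le> K + L" by (meson add_mono norm_triangle_le)
  moreover have "(\<lambda>x. (\<phi> x + \<psi> x) * f x) \<in> V" if "f \<in> V" for f
    using V_add[OF multD[OF assms(1) that] multD[OF assms(2) that]] by (simp add: distrib_right)
  ultimately show ?thesis using assms by (auto simp: mult_def)
qed

lemma mult_mult: assumes "mult \<phi>" "mult \<psi>" shows "mult (\<lambda>x. \<phi> x * \<psi> x)"
proof -
  obtain K L where "\<forall>x\<in>space M. cmod (\<phi> x) \<le> K" "\<forall>x\<in>space M. cmod (\<psi> x) \<le> L"
    using assms by (auto simp: mult_def)
  then have "\<forall>x\<in>space M. cmod (\<phi> x * \<psi> x) \<le> \<bar>K\<bar> * \<bar>L\<bar>"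
    unfolding norm_mult by (intro ballI mult_mono) (auto intro: order_trans)
  moreover have "(\<lambda>x. (\<phi> x * \<psi> x) * f x) \<in> V" if "f \<in> V" for f
    using multD[OF assms(1) multD[OF assms(2) that]] by (simp add: mult.assoc)
  ultimately show ?thesis using assms by (auto simp: mult_def)
qed

lemma mult_lim:
  assumes \<psi>: "\<And>n::nat. mult (\<psi> n)" and K: "\<And>n x. x \<in> space M \<Longrightarrow> cmod (\<psi> n x) \<le> K"
    and lim: "\<And>x. x \<in> space M \<Longrightarrow> (\<lambda>n. \<psi> n x) \<longlonglongrightarrow> \<phi> x"
  shows "mult \<phi>"
proof -
  have meas: "\<phi> \<in> borel_measurable M"
    by (rule borel_measurable_LIMSEQ_metric[OF mult_measurable[OF \<psi>] lim])
  moreover have "cmod (\<phi> x) \<le> K" if "x \<in> space M" for x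
    using Lim_bounded[OF tendsto_norm[OF lim[OF that]], of 0 K] K that by auto
  moreover have "(\<lambda>x. \<phi> x * f x) \<in> V" if f: "f \<in> V" for f
  proof (rule V_lim[of "\<lambda>n x. \<psi> n x * f x"])
    show "(\<lambda>x. \<psi> n x * f x) \<in> V" for n by (rule multD[OF \<psi> f])
    have [measurable]: "f \<in> borel_measurable M" using V_L2[OF f] by (rule L2_measurable)
    note [measurable] = mult_measurable[OF \<psi>] meas
    show "L2_tendsto M (\<lambda>n x. \<psi> n x * f x) (\<lambda>x. \<phi> x * f x) sequentially"
    proof (rule L2_tendsto_dominated[OF _ V_L2[OF f], where K = K])
      show "AE x in M. (\<lambda>n. \<psi> n x * f x) \<longlonglongrightarrow> \<phi> x * f x"
        using lim by (intro AE_I2 tendsto_intros) auto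
      show "AE x in M. cmod (\<psi> n x * f x) \<le> K * cmod (f x)" for n
        using K by (intro AE_I2) (auto simp: norm_mult mult_right_mono)
    qed measurable
  qed
  ultimately show ?thesis by (auto simp: mult_def)
qed

lemma mult_real_polynomial:
  fixes s :: "'a \<Rightarrow> real"
  assumes s: "mult (\<lambda>x. complex_of_real (s x))" and p: "real_polynomial_function p"
  shows "mult (\<lambda>x. complex_of_real (p (s x)))"
  using p
proof (induction rule: real_polynomial_function.induct)
  case (linear f)
  then have "f (s x) = f 1 * s x" for x
    using linear_simps(5)[of f "s x" 1] by (simp add: mult.commute)
  then show ?case using mult_mult[OF mult_const[of "complex_of_real (f 1)"] s] by simp
next
  case (const c) then show ?case by (rule mult_const)
next
  case (add f g) then show ?case using mult_add by simp
next
  case (mult f g) then show ?case using mult_mult by simp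
qed

text \<open>The ramps \<open>min 1 (max 0 (n z))\<close> tend pointwise to the indicator of
  \<open>z > 0\<close>. On \<open>[-1, 1]\<close> the \<open>n\<close>-th ramp is within
  \<open>1 / (n + 1)\<close> of a polynomial by Weierstrass, and polynomials in a multiplier are
  multipliers.\<close>

lemma mult_indicator_pos:
  fixes s :: "'a \<Rightarrow> real"
  assumes s: "mult (\<lambda>x. complex_of_real (s x))" and bd: "\<And>x. x \<in> space M \<Longrightarrow> \<bar>s x\<bar> \<le> 1"
  shows "mult (\<lambda>x. indicator {x. 0 < s x} x)"
proof -
  define h where "h n z = min 1 (max 0 (real n * z))" for n and z :: real
  have "\<exists>p. real_polynomial_function p \<and> (\<forall>z\<in>{-1..1}. \<bar>h n z - p z\<bar> < inverse (real (Suc n)))" for n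
  proof -
    have "continuous_on {-1..1} (h n)" unfolding h_def by (intro continuous_intros)
    moreover have "0 < inverse (real (Suc n))" by simp
    ultimately show ?thesis
      using Stone_Weierstrass_real_polynomial_function[of "{-1..1 :: real}" "h n"] by (metis compact_Icc)
  qed
  then obtain p where p: "\<And>n. real_polynomial_function (p n)"
    "\<And>n z. z \<in> {-1..1} \<Longrightarrow> \<bar>h n z - p n z\<bar> < inverse (real (Suc n))" by metis
  show ?thesis
  proof (rule mult_lim[where \<psi> = "\<lambda>n x. complex_of_real (p n (s x))" and K = 2])
    show "mult (\<lambda>x. complex_of_real (p n (s x)))" for n by (rule mult_real_polynomial[OF s p(1)])
    fix x assume x: "x \<in> space M"
    then have sx: "s x \<in> {-1..1}" using bd by (simp add: abs_le_iff) 
    show "cmod (complex_of_real (p n (s x))) \<le> 2" for n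
    proof -
      have "inverse (real (Suc n)) \<le> 1" by (simp add: field_simps)
      moreover have "\<bar>h n (s x)\<bar> \<le> 1" by (auto simp: h_def)
      ultimately show ?thesis using p(2)[OF sx, of n] by simp
    qed
    have h: "(\<lambda>n. h n (s x)) \<longlonglongrightarrow> (if 0 < s x then 1 else 0)"
    proof (cases "0 < s x")
      case True
      obtain n0 where n0: "1 < real n0 * s x" using reals_Archimedean3[OF True] by metis
      have "\<forall>\<^sub>F n in sequentially. h n (s x) = 1"
        unfolding eventually_sequentially
      proof (intro exI allI impI)
        fix n assume "n0 \<le> n"
        then have "real n0 * s x \<le> real n * s x" using True by (intro mult_right_mono) auto
        then show "h n (s x) = 1" using n0 by (simp add: h_def)
      qed
      then show ?thesis using True by (simp add: tendsto_eventually)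
    next
      case False
      then have "real n * s x \<le> 0" for n by (simp add: mult_nonneg_nonpos)
      then have "h n (s x) = 0" for n by (simp add: h_def)
      then show ?thesis using False by simp
    qed
    have d: "(\<lambda>n. h n (s x) - p n (s x)) \<longlonglongrightarrow> 0"
      by (rule Lim_null_comparison[OF _ LIMSEQ_inverse_real_of_nat])
         (use p(2)[OF sx] in \<open>auto intro!: always_eventually less_imp_le\<close>)
    have "(\<lambda>n. p n (s x)) \<longlonglongrightarrow> (if 0 < s x then 1 else 0)"
      using tendsto_diff[OF h d] by simp
    then have "(\<lambda>n. complex_of_real (p n (s x))) \<longlonglongrightarrow> complex_of_real (if 0 < s x then 1 else 0)"
      by (rule tendsto_of_real)
    then show "(\<lambda>n. complex_of_real (p n (s x))) \<longlonglongrightarrow> indicator {x. 0 < s x} x"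
      by (simp split: if_splits)
  qed
qed

text \<open>Two exponentials combine to \<open>sin ((s - c) / (n + 1))\<close>, a multiplier bounded
  by 1. As soon as \<open>|s - c| / (n + 1) < pi\<close>, this sine has the sign of
  \<open>s - c\<close>, so its positivity sets tend pointwise to the set where
  \<open>c < s\<close>.\<close>

lemma mult_indicator_greater:
  fixes s :: "'a \<Rightarrow> real"
  assumes s: "\<And>\<tau>::real. mult (\<lambda>x. exp (\<i> * complex_of_real (\<tau> * s x)))"
  shows "mult (\<lambda>x. indicator {x. c < s x} x)"
proof (rule mult_lim[where K = 1])
  fix n :: nat
  let ?t = "1 / real (Suc n)"
  let ?s = "\<lambda>x. sin (?t * (s x - c))"
  have "mult (\<lambda>x. (exp (\<i> * complex_of_real (- ?t * c)) / (2 * \<i>)) * exp (\<i> * complex_of_real (?t * s x)) +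
    (- exp (\<i> * complex_of_real (?t * c)) / (2 * \<i>)) * exp (\<i> * complex_of_real (- ?t * s x)))"
    by (intro mult_add mult_mult mult_const s)
  also have "(\<lambda>x. (exp (\<i> * complex_of_real (- ?t * c)) / (2 * \<i>)) * exp (\<i> * complex_of_real (?t * s x)) +
    (- exp (\<i> * complex_of_real (?t * c)) / (2 * \<i>)) * exp (\<i> * complex_of_real (- ?t * s x))) = (\<lambda>x. complex_of_real (?s x))"
  proof
    fix x
    have "(exp (\<i> * complex_of_real (- ?t * c)) / (2 * \<i>)) * exp (\<i> * complex_of_real (?t * s x)) +
      (- exp (\<i> * complex_of_real (?t * c)) / (2 * \<i>)) * exp (\<i> * complex_of_real (- ?t * s x)) =
      (exp (\<i> * complex_of_real (?t * (s x - c))) - exp (- (\<i> * complex_of_real (?t * (s x - c))))) / (2 * \<i>)"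
      by (simp add: mult_exp_exp diff_divide_distrib algebra_simps)
    also have "\<dots> = sin (complex_of_real (?t * (s x - c)))" by (simp only: sin_exp_eq)
    also have "\<dots> = complex_of_real (?s x)" by (rule sin_of_real)
    finally show "(exp (\<i> * complex_of_real (- ?t * c)) / (2 * \<i>)) * exp (\<i> * complex_of_real (?t * s x)) +
      (- exp (\<i> * complex_of_real (?t * c)) / (2 * \<i>)) * exp (\<i> * complex_of_real (- ?t * s x)) = complex_of_real (?s x)" .
  qed
  finally show "mult (\<lambda>x. indicator {x. 0 < ?s x} x)" by (rule mult_indicator_pos) simp
next
  fix x
  define d where "d = s x - c"
  obtain n0 :: nat where n0: "\<bar>d\<bar> / pi < real n0" using reals_Archimedean2 by blast
  have "\<forall>\<^sub>F n in sequentially. (0 < sin (1 / real (Suc n) * d)) = (0 < d)"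
    unfolding eventually_sequentially
  proof (intro exI allI impI)
    fix n assume n: "n0 \<le> n"
    let ?u = "1 / real (Suc n) * d"
    have "\<bar>d\<bar> < real n0 * pi" using n0 by (simp add: pos_divide_less_eq)
    also have "\<dots> \<le> real (Suc n) * pi" using n by simp
    finally have "\<bar>?u\<bar> < pi" by (simp add: abs_mult pos_divide_less_eq mult.commute)
    then have "sin ?u > 0" if "d > 0" using that by (intro sin_gt_zero) auto
    moreover have "sin ?u \<le> 0" if "d \<le> 0"
    proof -
      have "sin (- ?u) \<ge> 0" using that \<open>\<bar>?u\<bar> < pi\<close> by (intro sin_ge_zero) (auto simp: divide_nonpos_pos abs_less_iff)
      then show ?thesis by simp
    qed
    ultimately show "(0 < sin ?u) = (0 < d)" by force
  qed
  then have "\<forall>\<^sub>F n in sequentially. indicator {x. 0 < sin (1 / real (Suc n) * (s x - c))} x = (indicator {x. c < s x} x :: complex)"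
    by eventually_elim (auto simp: d_def split: split_indicator)
  then show "(\<lambda>n. indicator {x. 0 < sin (1 / real (Suc n) * (s x - c))} x) \<longlonglongrightarrow> (indicator {x. c < s x} x :: complex)"
    by (rule tendsto_eventually)
qed (auto split: split_indicator)

lemma mult_cong: "mult \<phi> \<Longrightarrow> (\<And>x. x \<in> space M \<Longrightarrow> \<phi> x = \<psi> x) \<Longrightarrow> mult \<psi>"
  by (rule mult_lim[of "\<lambda>_. \<phi>" "SOME K. \<forall>x\<in>space M. cmod (\<phi> x) \<le> K"])
     (auto simp: mult_def intro: someI2_ex)

text \<open>The measurable sets with a multiplier as indicator form a sigma-algebra. It contains the
  half-line preimages of every coordinate of \<open>S\<close>, so \<open>S\<close> is measurable
  with respect to it; countability of the index set makes coordinatewise measurability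
  suffice.\<close>

lemma mult_indicator_vimage:
  fixes S :: "'a \<Rightarrow> 'i::countable \<Rightarrow> real"
  assumes S: "\<And>i \<tau>. mult (\<lambda>x. exp (\<i> * complex_of_real (\<tau> * S x i)))" and B: "B \<in> sets borel"
    and Sm: "\<And>i. (\<lambda>x. S x i) \<in> borel_measurable M"
  shows "mult (\<lambda>x. indicator B (S x))"
proof -
  define \<G> where "\<G> = {E \<in> sets M. mult (indicator E)}"
  have alg: "sigma_algebra (space M) \<G>"
    unfolding sigma_algebra_iff2
  proof (intro conjI ballI allI impI)
    show "\<G> \<subseteq> Pow (space M)" using sets.space_closed by (auto simp: \<G>_def)
    show "{} \<in> \<G>" using mult_const[of 0] by (simp add: \<G>_def indicator_def[abs_def])
    fix E assume E: "E \<in> \<G>"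
    then have "mult (\<lambda>x. 1 + (- 1) * indicator E x)" by (intro mult_add mult_mult mult_const) (simp add: \<G>_def)
    then have "mult (indicator (space M - E))" by (rule mult_cong) (auto split: split_indicator)
    then show "space M - E \<in> \<G>" using E by (auto simp: \<G>_def)
  next
    fix A :: "nat \<Rightarrow> 'a set" assume A: "range A \<subseteq> \<G>"
    have fin: "mult (\<lambda>x. indicator (\<Union>i<n. A i) x)" for n
    proof (induction n)
      case 0 then show ?case using mult_const[of 0] by simp
    next
      case (Suc n)
      have "mult (\<lambda>x. indicator (\<Union>i<n. A i) x + (1 + (- 1) * indicator (\<Union>i<n. A i) x) * indicator (A n) x)"
        using A by (intro mult_add mult_mult mult_const Suc) (auto simp: \<G>_def)
      then show ?case by (rule mult_cong) (auto simp: lessThan_Suc split: split_indicator)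
    qed
    have "mult (indicator (\<Union>i. A i))"
    proof (rule mult_lim[where K = 1, OF fin])
      fix x
      show "(\<lambda>n. indicator (\<Union>i<n. A i) x) \<longlonglongrightarrow> (indicator (\<Union>i. A i) x :: complex)"
        by (rule LIMSEQ_indicator_UN)
    qed (auto split: split_indicator)
    then show "\<Union> (range A) \<in> \<G>" using A by (auto simp: \<G>_def)
  qed
  define N where "N = sigma (space M) \<G>"
  have N: "space N = space M" "sets N = \<G>"
  proof -
    interpret G: sigma_algebra "space M" \<G> by (rule alg)
    show "space N = space M" "sets N = \<G>"
      using G.space_closed by (simp_all add: N_def space_measure_of_conv sets_measure_of_conv G.sigma_sets_eq)
  qed
  have "(\<lambda>x. S x i) \<in> borel_measurable N" for i
  proof (subst borel_measurable_iff_greater, intro allI)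
    fix c
    have "mult (\<lambda>x. indicator {x. c < S x i} x)" by (rule mult_indicator_greater[OF S])
    then have "mult (indicator {x \<in> space M. c < S x i})" by (rule mult_cong) (auto split: split_indicator)
    moreover have "{x \<in> space M. c < S x i} \<in> sets M" using Sm[of i] by measurable
    ultimately show "{w \<in> space N. c < S w i} \<in> sets N" by (simp add: N \<G>_def)
  qed
  then have "S \<in> borel_measurable N" by (rule measurable_coordinatewise_then_product)
  then have "S -` B \<inter> space N \<in> sets N" using B by (rule measurable_sets)
  then have "mult (indicator (S -` B \<inter> space M))" by (simp add: N \<G>_def)
  then show ?thesis by (rule mult_cong) (auto split: split_indicator)
qed

end

section \<open>Closed subspaces stable under all bounded multipliers\<close>

locale L2_ideal = L2_sub +
  assumes ind: "\<And>E. E \<in> sets M \<Longrightarrow> mult (indicator E)"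
begin

lemma mult_bounded:
  assumes \<psi>: "\<psi> \<in> borel_measurable M" and K: "\<And>x. x \<in> space M \<Longrightarrow> cmod (\<psi> x) \<le> K"
  shows "mult \<psi>"
proof -
  have "\<exists>F. (\<forall>i::nat. simple_function M (F i)) \<and> (\<forall>x\<in>space M. (\<lambda>i. F i x) \<longlonglongrightarrow> \<psi> x) \<and>
    (\<forall>i. \<forall>x\<in>space M. dist (F i x) 0 \<le> 2 * dist (\<psi> x) 0)"
    using borel_measurable_implies_sequence_metric[OF \<psi>, of 0] by metis
  then obtain F where F: "\<And>i::nat. simple_function M (F i)" "\<And>x. x \<in> space M \<Longrightarrow> (\<lambda>i. F i x) \<longlonglongrightarrow> \<psi> x"
    "\<And>i x. x \<in> space M \<Longrightarrow> cmod (F i x) \<le> 2 * cmod (\<psi> x)"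
    unfolding dist_norm diff_zero by blast
  show ?thesis
  proof (rule mult_lim[OF _ _ F(2), where K = "2 * K"])
    fix i
    have fin: "finite (F i ` space M)" using F(1) by (simp add: simple_function_def)
    have sets: "F i -` {c} \<inter> space M \<in> sets M" for c
      using F(1)[of i] by (rule simple_functionD(2))
    have "mult (\<lambda>x. \<Sum>c\<in>A. c * indicator (F i -` {c} \<inter> space M) x)" if "finite A" for A
      using that
    proof (induction A rule: finite_induct)
      case empty then show ?case using mult_const[of 0] by simp
    next
      case (insert c A)
      then show ?case using mult_add[OF mult_mult[OF mult_const[of c] ind[OF sets[of c]]] insert.IH] by (simp only: sum.insert[OF insert.hyps])
    qed
    from this[OF fin] show "mult (F i)"
    proof (rule mult_cong)
      fix x assume x: "x \<in> space M"
      have "(\<Sum>c\<in>F i ` space M. c * indicator (F i -` {c} \<inter> space M) x) = (\<Sum>c\<in>{F i x}. c)"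
        using fin x by (intro sum.mono_neutral_cong_right) (auto split: split_indicator)
      then show "(\<Sum>c\<in>F i ` space M. c * indicator (F i -` {c} \<inter> space M) x) = F i x" by simp
    qed
  next
    fix i x assume "x \<in> space M"
    then show "cmod (F i x) \<le> 2 * K" using F(3)[of x i] K[of x] by simp
  qed auto
qed

text \<open>Where \<open>|f| > 1 / (n + 1)\<close> the reciprocal of \<open>f\<close> is bounded and
  so a multiplier; multiplying \<open>f\<close> by it gives the indicators of these sets, which
  increase to the indicator of the support.\<close>

lemma support_V:
  assumes f: "f \<in> V" shows "indicator {x \<in> space M. f x \<noteq> 0} \<in> V"
proof -
  have [measurable]: "f \<in> borel_measurable M" using V_L2[OF f] by (rule L2_measurable)
  let ?A = "\<lambda>n::nat. {x \<in> space M. 1 / real (Suc n) < cmod (f x)}"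
  let ?F = "\<lambda>n::nat. \<lambda>x. (indicator (?A n) x / f x) * f x"
  show ?thesis
  proof (rule V_lim[of ?F])
    fix n
    have "mult (\<lambda>x. indicator (?A n) x / f x)"
    proof (rule mult_bounded)
      fix x show "cmod (indicator (?A n) x / f x) \<le> real (Suc n)"
      proof (cases "x \<in> ?A n")
        case True
        then have "1 / real (Suc n) < cmod (f x)" by simp
        moreover have "0 < 1 / real (Suc n)" by simp
        ultimately have "0 < cmod (f x)" by (rule less_trans[rotated])
        moreover note \<open>1 / real (Suc n) < cmod (f x)\<close>
        ultimately show ?thesis using True by (simp add: norm_divide field_simps)
      qed simp
    qed measurable
    then show "?F n \<in> V" using f by (rule multD)
  next
    show "L2_tendsto M ?F (indicator {x \<in> space M. f x \<noteq> 0}) sequentially"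
    proof (rule L2_tendsto_dominated[where h = "\<lambda>_. 1" and K = 1])
      show "(\<lambda>_. 1) \<in> L2 M" by (simp add: L2_def)
      show "AE x in M. cmod (?F n x) \<le> 1 * cmod 1" for n
        by (intro AE_I2) (auto simp: norm_mult norm_divide split: split_indicator)
      show "AE x in M. (\<lambda>n. ?F n x) \<longlonglongrightarrow> indicator {x \<in> space M. f x \<noteq> 0} x"
      proof (rule AE_I2)
        fix x assume x: "x \<in> space M"
        show "(\<lambda>n. ?F n x) \<longlonglongrightarrow> indicator {x \<in> space M. f x \<noteq> 0} x"
        proof (cases "f x = 0")
          case False
          have "\<forall>\<^sub>F n in sequentially. 1 / real (Suc n) < cmod (f x)"
            using LIMSEQ_inverse_real_of_nat False by (intro order_tendstoD) (auto simp: inverse_eq_divide)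
          then have "\<forall>\<^sub>F n in sequentially. ?F n x = indicator {x \<in> space M. f x \<noteq> 0} x"
            by eventually_elim (use x False in simp)
          then show ?thesis by (rule tendsto_eventually)
        qed simp
      qed
    qed measurable
  qed
qed

text \<open>Exhaustion: \<open>E\<close> is a countable union of sets with indicator in
  \<open>V\<close> whose measures approach the supremum. Maximality puts the support of every
  \<open>f\<close> in \<open>V\<close> inside \<open>E\<close> up to a null set; conversely
  truncations of \<open>f\<close> are multipliers applied to the indicator of
  \<open>E\<close>.\<close>

lemma V_eq_L2_on:
  obtains E where "E \<in> sets M" "V = {f \<in> L2 M. AE x in M. x \<notin> E \<longrightarrow> f x = 0}"
proof -
  define \<E> where "\<E> = {E \<in> sets M. indicator E \<in> V}"
  have empty: "{} \<in> \<E>" using V_0 by (simp add: \<E>_def indicator_def[abs_def])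
  have Un: "A \<union> B \<in> \<E>" if "A \<in> \<E>" "B \<in> \<E>" for A B
  proof -
    have AB: "A \<in> sets M" "B \<in> sets M" "indicator A \<in> V" "indicator B \<in> V" using that by (simp_all add: \<E>_def)
    have "mult (indicator (space M - A))" using AB by (intro ind) auto
    then have 1: "(\<lambda>x. indicator A x + indicator (space M - A) x * indicator B x) \<in> V"
      using AB by (intro V_add multD)
    have 2: "AE x in M. indicator A x + indicator (space M - A) x * indicator B x = (indicator (A \<union> B) x :: complex)"
      by (intro AE_I2) (auto split: split_indicator)
    have 3: "(indicator (A \<union> B) :: _ \<Rightarrow> complex) \<in> borel_measurable M" using AB by simp
    have "indicator (A \<union> B) \<in> V" by (rule V_cong_AE[OF 1 3 2])
    then show ?thesis using AB by (simp add: \<E>_def)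
  qed
  have bdd: "bdd_above (measure M ` \<E>)" by (intro bdd_aboveI[of _ "measure M (space M)"]) (auto intro: bounded_measure)
  define \<alpha> where "\<alpha> = (SUP E\<in>\<E>. measure M E)"
  have "\<exists>E\<in>\<E>. \<alpha> - 1 / real (Suc n) < measure M E" for n
    unfolding \<alpha>_def using empty bdd by (intro less_cSUP_iff[THEN iffD1]) auto
  then obtain A where A: "\<And>n. A n \<in> \<E>" "\<And>n. \<alpha> - 1 / real (Suc n) < measure M (A n)" by metis
  define E where "E = (\<Union>n. A n)"
  have A_sets: "A n \<in> sets M" for n using A(1) by (simp add: \<E>_def)
  then have E_sets: "E \<in> sets M" by (auto simp: E_def)
  have fin: "(\<Union>i<n. A i) \<in> \<E>" for n
    by (induction n) (auto simp: lessThan_Suc empty intro: Un A(1))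
  have "indicator E \<in> V"
  proof (rule V_lim[of "\<lambda>n. indicator (\<Union>i<n. A i)"])
    show "indicator (\<Union>i<n. A i) \<in> V" for n using fin by (simp add: \<E>_def)
    show "L2_tendsto M (\<lambda>n. indicator (\<Union>i<n. A i)) (indicator E) sequentially"
    proof (rule L2_tendsto_dominated[where h = "\<lambda>_. 1" and K = 1])
      show "(\<lambda>_. 1) \<in> L2 M" by (simp add: L2_def)
      show "AE x in M. (\<lambda>n. indicator (\<Union>i<n. A i) x) \<longlonglongrightarrow> (indicator E x :: complex)"
        unfolding E_def by (intro AE_I2 LIMSEQ_indicator_UN)
    qed (use A_sets E_sets in \<open>auto split: split_indicator intro!: borel_measurable_indicator\<close>)
  qed
  then have E: "E \<in> \<E>" using E_sets by (simp add: \<E>_def)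
  have max: "measure M B \<le> measure M E" if "B \<in> \<E>" for B
  proof -
    have "measure M B \<le> \<alpha>" unfolding \<alpha>_def using that bdd by (rule cSUP_upper)
    also have "\<alpha> \<le> measure M E"
    proof (rule field_le_epsilon)
      fix e :: real assume "0 < e"
      then obtain n where "1 / real (Suc n) < e" using nat_approx_posE by blast
      moreover have "measure M (A n) \<le> measure M E" using E_sets by (intro finite_measure_mono) (auto simp: E_def)
      ultimately show "\<alpha> \<le> measure M E + e" using A(2)[of n] by simp
    qed
    finally show ?thesis .
  qed
  have "V = {f \<in> L2 M. AE x in M. x \<notin> E \<longrightarrow> f x = 0}"
  proof (rule Set.set_eqI, rule iffI)
    fix f assume f: "f \<in> V"
    have [measurable]: "f \<in> borel_measurable M" using V_L2[OF f] by (rule L2_measurable)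
    let ?F = "{x \<in> space M. f x \<noteq> 0}"
    have F: "?F \<in> \<E>" using support_V[OF f] by (simp add: \<E>_def)
    have "measure M (?F \<union> E) \<le> measure M E" by (intro max Un F E)
    moreover have "?F \<in> sets M" by measurable
    moreover have "measure M (?F \<union> E) = measure M E + measure M (?F - E)"
    proof -
      have "measure M (E \<union> (?F - E)) = measure M E + measure M (?F - E)"
        by (rule finite_measure_Union) (use E_sets \<open>?F \<in> sets M\<close> in auto)
      moreover have "E \<union> (?F - E) = ?F \<union> E" by blast
      ultimately show ?thesis by (simp only:)
    qed
    ultimately have "measure M (?F - E) = 0"
      using measure_nonneg[of M "?F - E"] by linarith
    then have "AE x in M. x \<notin> ?F - E"
      using F E_sets by (intro AE_not_in null_setsI) (auto simp: \<E>_def emeasure_eq_measure)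
    then have "AE x in M. x \<notin> E \<longrightarrow> f x = 0" using AE_space by eventually_elim auto
    then show "f \<in> {f \<in> L2 M. AE x in M. x \<notin> E \<longrightarrow> f x = 0}" using V_L2[OF f] by simp
  next
    fix f assume "f \<in> {f \<in> L2 M. AE x in M. x \<notin> E \<longrightarrow> f x = 0}"
    then have f: "f \<in> L2 M" and f0: "AE x in M. x \<notin> E \<longrightarrow> f x = 0" by auto
    note [measurable] = L2_measurable[OF f] E_sets
    let ?F = "\<lambda>n::nat. \<lambda>x. (indicator {x \<in> space M. cmod (f x) \<le> real n} x * f x) * indicator E x"
    show "f \<in> V"
    proof (rule V_lim[of ?F])
      show "?F n \<in> V" for n
        by (rule multD[OF mult_bounded[where K = "real n"] \<open>indicator E \<in> V\<close>])
           (auto simp: norm_mult split: split_indicator)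
      show "L2_tendsto M ?F f sequentially"
      proof (rule L2_tendsto_dominated[OF _ f, where K = 1])
        show "AE x in M. cmod (?F n x) \<le> 1 * cmod (f x)" for n
          by (intro AE_I2) (auto simp: norm_mult split: split_indicator)
        show "AE x in M. (\<lambda>n. ?F n x) \<longlonglongrightarrow> f x"
          using f0 AE_space
        proof eventually_elim
          case (elim x)
          obtain n0 :: nat where n0: "cmod (f x) < real n0" using reals_Archimedean2 by blast
          have "\<forall>\<^sub>F n in sequentially. ?F n x = f x"
            unfolding eventually_sequentially
            by (intro exI[of _ n0]) (use elim n0 in \<open>auto split: split_indicator\<close>)
          then show ?case by (rule tendsto_eventually)
        qed
      qed measurable
    qed
  qed
  then show ?thesis using E_sets by (intro that)
qed

end

section \<open>The representation\<close>

locale setting = gauss_mu m b + dual_weights a C m y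
  for m :: int and a b y :: zmat and C :: real +
  assumes ab_summable: "(\<lambda>(k, n). a k n / b k n) summable_on Idx m"
    and b_summable: "\<And>k n. k < n \<Longrightarrow> n \<le> m \<Longrightarrow> (\<lambda>s. b s n / b s k) summable_on {..<k}"
begin

lemma Idx_less: "(k, n) \<in> Idx m \<Longrightarrow> k < n"
  by (auto simp: Idx_def Delta_sub_def Delta_sup_def)

sublocale PR: prod_real "coordM m b"
  by unfold_locales (auto intro: prob_coordM)

lemma PR_P: "PR.P = nu m b"
  by (simp add: PR.P_def nu_def)

lemma coord_second_moment:
  assumes "(k, n) \<in> Idx m" shows "(\<integral>\<^sup>+z. ennreal (z\<^sup>2) \<partial>coordM m b (k, n)) = ennreal (1 / (2 * b k n))"
  using nn_integral_gauss_affine_square[OF b_pos[OF assms], of 0 1] assms by (simp add: coordM_def)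

text \<open>By Tonelli against counting measure and the second moment \<open>1 / (2 b)\<close>, the
  expectation of the series is half of the sum in \<open>ab_summable\<close>; a finite expectation
  makes the series finite almost everywhere.\<close>

lemma AE_weighted_summable: "AE v in nu m b. (\<lambda>(k, n). (v (k, n))\<^sup>2 * a k n) summable_on Idx m"
proof -
  let ?f = "\<lambda>i v. ennreal ((v i)\<^sup>2 * a (fst i) (snd i))"
  have [measurable]: "(\<lambda>v. v i) \<in> borel_measurable (nu m b)" for i
    using PR.component_P PR_P by metis
  have pos: "0 < a (fst i) (snd i)" "0 < b (fst i) (snd i)" if "i \<in> Idx m" for i
    using that Idx_less a_pos b_pos by (cases i; force)+
  have "(\<integral>\<^sup>+v. \<integral>\<^sup>+i. ?f i v \<partial>count_space (Idx m) \<partial>nu m b) = (\<integral>\<^sup>+i. \<integral>\<^sup>+v. ?f i v \<partial>nu m b \<partial>count_space (Idx m))"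
    by (rule nn_integral_count_space_nn_integral) auto
  also have "\<dots> = (\<integral>\<^sup>+i. ennreal (1/2 * (a (fst i) (snd i) / b (fst i) (snd i))) \<partial>count_space (Idx m))"
  proof (rule nn_integral_cong)
    fix i assume "i \<in> space (count_space (Idx m))"
    then have i: "(fst i, snd i) \<in> Idx m" "i \<in> Idx m" by auto
    have "(\<integral>\<^sup>+v. ?f i v \<partial>nu m b) = (\<integral>\<^sup>+v. ennreal (a (fst i) (snd i)) * ennreal ((v i)\<^sup>2) \<partial>nu m b)"
      using pos[OF i(2)] by (simp add: ennreal_mult'[symmetric] mult.commute)
    also have "\<dots> = ennreal (a (fst i) (snd i)) * (\<integral>\<^sup>+v. ennreal ((v i)\<^sup>2) \<partial>nu m b)"
      by (rule nn_integral_cmult) measurable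
    also have "(\<integral>\<^sup>+v. ennreal ((v i)\<^sup>2) \<partial>nu m b) = ennreal (1 / (2 * b (fst i) (snd i)))"
      using PR.nn_integral_component[of "\<lambda>z. ennreal (z\<^sup>2)" i] coord_second_moment[OF i(1)] by (simp add: PR_P)
    finally show "(\<integral>\<^sup>+v. ?f i v \<partial>nu m b) = ennreal (1/2 * (a (fst i) (snd i) / b (fst i) (snd i)))"
      using pos[OF i(2)] by (simp add: ennreal_mult'[symmetric])
  qed
  also have "\<dots> < \<infinity>"
  proof -
    have "(\<lambda>i. 1/2 * (a (fst i) (snd i) / b (fst i) (snd i))) summable_on Idx m"
      using summable_on_cmult_right[OF ab_summable, of "1/2"] by (simp add: case_prod_beta')
    then have "Infinite_Set_Sum.abs_summable_on (\<lambda>i. 1/2 * (a (fst i) (snd i) / b (fst i) (snd i))) (Idx m)"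
      unfolding abs_summable_equivalent[symmetric] by (rule summable_on_iff_abs_summable_on_real[THEN iffD1])
    then have "integrable (count_space (Idx m)) (\<lambda>i. 1/2 * (a (fst i) (snd i) / b (fst i) (snd i)))"
      by (simp only: Infinite_Set_Sum.abs_summable_on_def)
    then show ?thesis using pos
      by (subst nn_integral_eq_integral) (auto simp: AE_count_space less_imp_le)
  qed
  finally have fin: "(\<integral>\<^sup>+v. \<integral>\<^sup>+i. ?f i v \<partial>count_space (Idx m) \<partial>nu m b) \<noteq> \<infinity>" by simp
  interpret cs: sigma_finite_measure "count_space (Idx m)"
    by (rule sigma_finite_measure_count_space_countable) auto
  have "(\<lambda>(i, v). ?f i v) \<in> borel_measurable (count_space (Idx m) \<Otimes>\<^sub>M nu m b)"
    by (rule measurable_pair_measure_countable1) auto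
  then have "(\<lambda>(v, i). ?f i v) \<in> borel_measurable (nu m b \<Otimes>\<^sub>M count_space (Idx m))"
    by (subst measurable_pair_swap_iff) (simp add: case_prod_beta')
  then have "(\<lambda>v. \<integral>\<^sup>+i. ?f i v \<partial>count_space (Idx m)) \<in> borel_measurable (nu m b)"
    by (rule cs.borel_measurable_nn_integral)
  then have "AE v in nu m b. (\<integral>\<^sup>+i. ?f i v \<partial>count_space (Idx m)) \<noteq> \<infinity>"
    using fin by (rule nn_integral_PInf_AE)
  then show ?thesis
  proof eventually_elim
    case (elim v)
    have "integrable (count_space (Idx m)) (\<lambda>i. (v i)\<^sup>2 * a (fst i) (snd i))"
      using elim pos by (intro integrableI_nonneg) (auto simp: AE_count_space less_top less_imp_le)
    then have "Infinite_Set_Sum.abs_summable_on (\<lambda>i. (v i)\<^sup>2 * a (fst i) (snd i)) (Idx m)"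
      by (simp only: Infinite_Set_Sum.abs_summable_on_def)
    then have "(\<lambda>i. (v i)\<^sup>2 * a (fst i) (snd i)) summable_on Idx m"
      unfolding abs_summable_equivalent[symmetric] by (rule abs_summable_summable)
    then show ?case by (simp add: case_prod_beta')
  qed
qed

lemma B2_of_coords:
  assumes x: "x \<in> X_space m" and s: "(\<lambda>(k, n). (coords m x (k, n))\<^sup>2 * a k n) summable_on Idx m"
  shows "fst x \<in> B2 a" "snd x \<in> B2 a"
proof -
  let ?g = "\<lambda>(k, n). (coords m x (k, n))\<^sup>2 * a k n"
  have pos: "0 \<le> ?g i" if "i \<in> Idx m" for i
    using that a_pos[OF Idx_less[of "fst i" "snd i"]] by (cases i) simp
  have bound: "(\<Sum>k\<in>K. \<Sum>n\<in>K. weight a z k n) \<le> infsum ?g (Idx m)"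
    if K: "finite K" and z: "\<And>k n. (k, n) \<notin> Idx m \<Longrightarrow> k < n \<Longrightarrow> z k n = 0"
      "\<And>k n. (k, n) \<in> Idx m \<Longrightarrow> z k n = 0 \<or> z k n = coords m x (k, n)" for K z
  proof -
    have "(\<Sum>k\<in>K. \<Sum>n\<in>K. weight a z k n) = (\<Sum>i\<in>K \<times> K. weight a z (fst i) (snd i))"
      by (simp add: sum.cartesian_product case_prod_beta)
    also have "\<dots> = (\<Sum>i\<in>(K \<times> K) \<inter> Idx m. weight a z (fst i) (snd i))"
      using K z(1) by (intro sum.mono_neutral_right) (auto simp: weight_def)
    also have "\<dots> \<le> (\<Sum>i\<in>(K \<times> K) \<inter> Idx m. ?g i)"
    proof (rule sum_mono)
      fix i assume "i \<in> (K \<times> K) \<inter> Idx m"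
      then have i: "(fst i, snd i) \<in> Idx m" by auto
      show "weight a z (fst i) (snd i) \<le> ?g i"
        using z(2)[OF i] pos[of i] i Idx_less[OF i] by (auto simp: weight_def case_prod_beta)
    qed
    also have "\<dots> \<le> infsum ?g (Idx m)"
      using K pos by (intro finite_sum_le_infsum s) auto
    finally show ?thesis .
  qed
  have D: "fst x \<in> unitri (Delta_sub m)" and A: "snd x \<in> unitri (Delta_sup m)" using x by (auto simp: X_space_iff)
  show "fst x \<in> B2 a" unfolding B2_def mem_Collect_eq
  proof (intro conjI exI allI impI)
    show "fst x \<in> BZ" using D by (rule unitri_BZ)
    fix K :: "int set" assume "finite K"
    then show "(\<Sum>k\<in>K. \<Sum>n\<in>K. weight a (fst x) k n) \<le> infsum ?g (Idx m)"
    proof (rule bound)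
      fix k n show "(k, n) \<notin> Idx m \<Longrightarrow> k < n \<Longrightarrow> fst x k n = 0"
        using unitri_entry[OF D, of k n] by (auto simp: Idx_def mat_id_def)
      show "(k, n) \<in> Idx m \<Longrightarrow> fst x k n = 0 \<or> fst x k n = coords m x (k, n)"
        using unitri_entry[OF D, of k n]
        by (auto simp: Idx_def mat_id_def coords_def coord_def Delta_sub_def Delta_sup_def)
    qed
  qed
  show "snd x \<in> B2 a" unfolding B2_def mem_Collect_eq
  proof (intro conjI exI allI impI)
    show "snd x \<in> BZ" using A by (rule unitri_BZ)
    fix K :: "int set" assume "finite K"
    then show "(\<Sum>k\<in>K. \<Sum>n\<in>K. weight a (snd x) k n) \<le> infsum ?g (Idx m)"
    proof (rule bound)
      fix k n show "(k, n) \<notin> Idx m \<Longrightarrow> k < n \<Longrightarrow> snd x k n = 0"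
        using unitri_entry[OF A, of k n] by (auto simp: Idx_def mat_id_def)
      show "(k, n) \<in> Idx m \<Longrightarrow> snd x k n = 0 \<or> snd x k n = coords m x (k, n)"
        using unitri_entry[OF A, of k n]
        by (auto simp: Idx_def mat_id_def coords_def coord_def Delta_sub_def Delta_sup_def)
    qed
  qed
qed

lemma AE_B2: "AE x in mu m b. fst x \<in> B2 a \<and> snd x \<in> B2 a"
  using AE_mu_coords[OF AE_weighted_summable] AE_space
  by eventually_elim (use B2_of_coords in auto)

section \<open>The elementary action as a Gaussian shear\<close>

definition shear_rows :: "int \<Rightarrow> int \<Rightarrow> nat set" where "shear_rows k r = {j. (k - int j, r) \<in> Idx m}"
definition shear_index :: "int \<Rightarrow> int \<Rightarrow> nat \<Rightarrow> int \<times> int" where "shear_index k r j = (k - int j, r)"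
definition shear_prec :: "int \<Rightarrow> int \<Rightarrow> nat \<Rightarrow> real" where "shear_prec k r j = b (k - int j) r"
text \<open>Offset \<open>j\<close> stands for matrix row \<open>k - j\<close>, with target in
  column \<open>r\<close> and source in column \<open>k\<close>. At \<open>j = 0\<close> the source
  is the diagonal entry 1, with second moment 1; the other sources are Gaussian with second moment
  \<open>1 / (2 b)\<close>.\<close>

definition shear_var :: "int \<Rightarrow> int \<Rightarrow> nat \<Rightarrow> real" where
  "shear_var k r j = (if j \<in> shear_rows k r then if j = 0 then 1 else 1 / (2 * b (k - int j) k) else 0)"

lemma src_Idx: "(k, r) \<in> Idx m \<Longrightarrow> j \<in> shear_rows k r \<Longrightarrow> j \<noteq> 0 \<Longrightarrow> (k - int j, k) \<in> Idx m"
  by (auto simp: shear_rows_def Idx_def Delta_sub_def Delta_sup_def)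

lemma gauss_shear:
  assumes kr: "(k, r) \<in> Idx m"
  shows "gauss_shear (coordM m b) (shear_rows k r) (shear_index k r) (shear_index k k) (shear_prec k r) (shear_var k r)"
proof
  show "inj_on (shear_index k r) (shear_rows k r)" by (auto simp: inj_on_def shear_index_def)
  show "shear_index k r j \<noteq> shear_index k k j'" for j j' using Idx_less[OF kr] by (simp add: shear_index_def)
  show "0 < shear_prec k r j" if "j \<in> shear_rows k r" for j using that b_pos by (simp add: shear_prec_def shear_rows_def)
  show "coordM m b (shear_index k r j) = gauss (shear_prec k r j)" if "j \<in> shear_rows k r" for j
    using that by (simp add: coordM_def shear_prec_def shear_rows_def shear_index_def)
  show "0 \<le> shear_var k r j" for j
    using src_Idx[OF kr] b_pos by (auto simp: shear_var_def intro!: less_imp_le)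
  show "(\<integral>\<^sup>+z. ennreal (z\<^sup>2) \<partial>coordM m b (shear_index k k j)) = ennreal (shear_var k r j)" if j: "j \<in> shear_rows k r" for j
  proof (cases "j = 0")
    case True
    have "(k, k) \<notin> Idx m" using Idx_less by blast
    then have "coordM m b (k, k) = return borel 1" by (simp add: coordM_def mat_id_def)
    then show ?thesis using True j by (simp add: shear_index_def shear_var_def nn_integral_return)
  next
    case False
    then show ?thesis using coord_second_moment[OF src_Idx[OF kr j False]] j by (simp add: shear_index_def shear_var_def)
  qed
  show "summable (\<lambda>j. if j \<in> shear_rows k r then shear_prec k r j * shear_var k r j else 0)"
  proof (cases "r \<le> m")
    case False
    \<comment> \<open>In the block beyond \<open>m\<close> only the rows from \<open>m + 1\<close>
      to \<open>k\<close> take part, so the series is a finite sum.\<close>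
    have "shear_rows k r \<subseteq> {..nat (k - m)}"
    proof
      fix j assume "j \<in> shear_rows k r"
      then have "m + 1 \<le> k - int j" using False by (simp add: shear_rows_def Idx_def Delta_sub_def Delta_sup_def)
      then show "j \<in> {..nat (k - m)}" by simp
    qed
    then have "finite (shear_rows k r)" by (rule finite_subset) simp
    then show ?thesis by (rule summable_If_finite_set)
  next
    case True
    have "(\<lambda>s. b s r / b s k) summable_on {..<k}" using b_summable[OF Idx_less[OF kr] True] .
    \<comment> \<open>\<open>b_summable\<close> covers the rows \<open>s < k\<close>, that is the
      offsets \<open>j + 1\<close>; the single term at offset 0 is added by the shift
      \<open>summable_Suc_iff\<close>.\<close>
    moreover have "{..<k} = range (\<lambda>j. k - 1 - int j)"
    proof (intro equalityI subsetI)
      fix s assume "s \<in> {..<k}"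
      then have "s = k - 1 - int (nat (k - 1 - s))" by simp
      then show "s \<in> range (\<lambda>j. k - 1 - int j)" by blast
    qed auto
    ultimately have "((\<lambda>s. b s r / b s k) \<circ> (\<lambda>j. k - 1 - int j)) summable_on UNIV"
      by (subst summable_on_reindex[symmetric]) (auto simp: inj_def)
    then have "summable (\<lambda>j. 1/2 * (b (k - 1 - int j) r / b (k - 1 - int j) k))"
      by (intro summable_mult summable_on_imp_summable) (simp add: o_def)
    moreover have "(if Suc j \<in> shear_rows k r then shear_prec k r (Suc j) * shear_var k r (Suc j) else 0) =
      1/2 * (b (k - 1 - int j) r / b (k - 1 - int j) k)" for j
    proof -
      have "Suc j \<in> shear_rows k r" using kr True by (auto simp: shear_rows_def Idx_def Delta_sub_def Delta_sup_def)
      then show ?thesis by (simp add: shear_prec_def shear_var_def diff_diff_eq)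
    qed
    ultimately show ?thesis by (subst summable_Suc_iff[symmetric]) simp
  qed
qed

definition dens :: "int \<Rightarrow> int \<Rightarrow> real \<Rightarrow> zmat \<times> zmat \<Rightarrow> real" where
  "dens k r u x = gauss_shear.\<rho> (shear_rows k r) (shear_index k r) (shear_index k k) (shear_prec k r) (shear_var k r) u (coords m x)"

text \<open>Right multiplication by \<open>I + u E_kr\<close> adds \<open>u\<close> times column
  \<open>k\<close> to column \<open>r\<close>, which is the shear just set up once the rows without
  a free target are seen to have a vanishing source.\<close>

lemma coords_act_elem:
  assumes kr: "(k, r) \<in> Idx m" and x: "x \<in> X_space m"
  shows "coords m (act m x (mat_elem k r u)) = gauss_shear.shear (shear_index k r) (shear_index k k) (shear_rows k r) u (coords m x)"
proof -
  interpret S: gauss_shear "coordM m b" "shear_rows k r" "shear_index k r" "shear_index k k" "shear_prec k r" "shear_var k r" by (rule gauss_shear[OF kr])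
  have k_r: "k < r" by (rule Idx_less[OF kr])
  have D: "fst x \<in> unitri (Delta_sub m)" and A: "snd x \<in> unitri (Delta_sup m)" using x by (auto simp: X_space_iff)
  have BZ: "fst x \<in> BZ" "snd x \<in> BZ" using D A unitri_BZ by auto
  have split: "m < k \<or> r \<le> m" using kr by (auto simp: Idx_def Delta_sub_def Delta_sup_def)
  have E: "coords m (act m x (mat_elem k r u)) (i, n) = coords m x (i, n) + (if n = r then u * coords m x (i, k) else 0)" for i n
    using split k_r by (auto simp: act_eq[OF x] lower_block_elem upper_block_elem mat_mult_elem coords_def coord_def)
  show ?thesis
  proof (rule ext, clarify)
    fix i n
    show "coords m (act m x (mat_elem k r u)) (i, n) = S.shear (shear_rows k r) u (coords m x) (i, n)"
    proof (cases "(i, n) \<in> shear_index k r ` shear_rows k r")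
      case True
      then obtain j where j: "j \<in> shear_rows k r" "i = k - int j" "n = r" by (auto simp: shear_index_def)
      have "S.shear (shear_rows k r) u (coords m x) (shear_index k r j) = coords m x (shear_index k r j) + u * coords m x (shear_index k k j)"
        by (rule S.shear_tg) (use j in auto)
      then show ?thesis using E[of i n] j by (simp add: shear_index_def)
    next
      case False
      \<comment> \<open>A row without target in column \<open>r\<close> either lies below row
        \<open>k\<close>, or satisfies \<open>i \<le> m < k\<close> and so meets column
        \<open>k\<close> outside both diagonal blocks.\<close>
      have "coords m x (i, k) = 0" if "n = r"
      proof (cases "k < i")
        case True
        then show ?thesis using BZ by (simp add: coords_def coord_def BZ_below)
      next
        case F: False
        have "nat (k - i) \<notin> shear_rows k r"
          using False that F by (auto simp: shear_index_def image_iff)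
        then have "(i, r) \<notin> Idx m" using F by (simp add: shear_rows_def)
        then have "i \<le> m" "m < k" using F k_r split by (auto simp: Idx_def Delta_sub_def Delta_sup_def)
        then show ?thesis using unitri_entry[OF D, of i k] by (simp add: coords_def coord_def Delta_sub_def mat_id_def)
      qed
      then show ?thesis using E[of i n] S.shear_other[OF False] by simp
    qed
  qed
qed

lemma dens_measurable [measurable]: "(k, r) \<in> Idx m \<Longrightarrow> dens k r u \<in> borel_measurable (mu m b)"
proof -
  assume kr: "(k, r) \<in> Idx m"
  interpret S: gauss_shear "coordM m b" "shear_rows k r" "shear_index k r" "shear_index k k" "shear_prec k r" "shear_var k r" by (rule gauss_shear[OF kr])
  show ?thesis unfolding dens_def[abs_def]
    by (rule measurable_compose[OF coords_nu S.\<rho>_measurable[unfolded PR_P]])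
qed

lemma dens_pos: "(k, r) \<in> Idx m \<Longrightarrow> 0 < dens k r u x"
proof -
  assume kr: "(k, r) \<in> Idx m"
  interpret S: gauss_shear "coordM m b" "shear_rows k r" "shear_index k r" "shear_index k k" "shear_prec k r" "shear_var k r" by (rule gauss_shear[OF kr])
  show ?thesis by (simp add: dens_def)
qed

lemma nn_integral_act_elem:
  assumes kr: "(k, r) \<in> Idx m" and F: "F \<in> borel_measurable (mu m b)"
  shows "(\<integral>\<^sup>+x. F (act m x (mat_elem k r (- u))) \<partial>mu m b) = (\<integral>\<^sup>+x. F x * ennreal (dens k r u x) \<partial>mu m b)"
proof -
  interpret S: gauss_shear "coordM m b" "shear_rows k r" "shear_index k r" "shear_index k k" "shear_prec k r" "shear_var k r" by (rule gauss_shear[OF kr])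
  have G: "(\<lambda>v. F (from_coords m v)) \<in> borel_measurable (nu m b)"
    by (rule measurable_compose[OF _ F]) (simp add: sets_nu cong: measurable_cong_sets)
  have BZ: "mat_elem k r (- u) \<in> BZ" using Idx_less[OF kr] by simp
  have "(\<integral>\<^sup>+x. F (act m x (mat_elem k r (- u))) \<partial>mu m b) = (\<integral>\<^sup>+x. F (from_coords m (S.shear (shear_rows k r) (- u) (coords m x))) \<partial>mu m b)"
    by (rule nn_integral_cong) (simp add: coords_act_elem[OF kr, symmetric] from_coords_coords act_X_space[OF _ BZ])
  also have "\<dots> = (\<integral>\<^sup>+v. F (from_coords m (S.shear (shear_rows k r) (- u) v)) \<partial>nu m b)"
    by (rule nn_integral_mu_coords) (use measurable_compose[OF S.shear_measurable, unfolded PR_P, OF G] in simp)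
  also have "\<dots> = (\<integral>\<^sup>+v. F (from_coords m v) * ennreal (S.\<rho> u v) \<partial>nu m b)"
    using S.nn_integral_shear[unfolded PR_P, OF G] .
  also have "\<dots> = (\<integral>\<^sup>+x. F (from_coords m (coords m x)) * ennreal (S.\<rho> u (coords m x)) \<partial>mu m b)"
    by (intro nn_integral_mu_coords[symmetric] borel_measurable_times_ennreal G
        measurable_compose[OF S.\<rho>_measurable[unfolded PR_P] measurable_ennreal])
  also have "\<dots> = (\<integral>\<^sup>+x. F x * ennreal (dens k r u x) \<partial>mu m b)"
    by (rule nn_integral_cong) (simp add: from_coords_coords dens_def)
  finally show ?thesis .
qed

lemma act_elem_mid: "x \<in> X_space m \<Longrightarrow> k \<le> m \<Longrightarrow> m < r \<Longrightarrow> act m x (mat_elem k r u) = x"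
  by (simp add: act_eq lower_block_elem upper_block_elem)

lemma emeasure_distr_act:
  assumes "t \<in> BZ" "A \<in> sets (mu m b)"
  shows "emeasure (distr (mu m b) (mu m b) (\<lambda>x. act m x t)) A = (\<integral>\<^sup>+x. indicator A (act m x t) \<partial>mu m b)"
proof -
  have "emeasure (distr (mu m b) (mu m b) (\<lambda>x. act m x t)) A =
    (\<integral>\<^sup>+x. indicator A x \<partial>distr (mu m b) (mu m b) (\<lambda>x. act m x t))" using assms(2) by simp
  also have "\<dots> = (\<integral>\<^sup>+x. indicator A (act m x t) \<partial>mu m b)"
    by (rule nn_integral_distr[OF act_measurable[OF assms(1)]]) (use assms(2) in simp)
  finally show ?thesis .
qed

lemma distr_act_elem:
  assumes kr: "(k, r) \<in> Idx m"
  shows "distr (mu m b) (mu m b) (\<lambda>x. act m x (mat_elem k r (- u))) = density (mu m b) (\<lambda>x. ennreal (dens k r u x))"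
proof (rule measure_eqI)
  fix A assume "A \<in> sets (distr (mu m b) (mu m b) (\<lambda>x. act m x (mat_elem k r (- u))))"
  then have A: "A \<in> sets (mu m b)" by simp
  then have "(\<integral>\<^sup>+x. indicator A (act m x (mat_elem k r (- u))) \<partial>mu m b) = (\<integral>\<^sup>+x. indicator A x * ennreal (dens k r u x) \<partial>mu m b)"
    by (intro nn_integral_act_elem[OF kr]) simp
  then show "emeasure (distr (mu m b) (mu m b) (\<lambda>x. act m x (mat_elem k r (- u)))) A =
    emeasure (density (mu m b) (\<lambda>x. ennreal (dens k r u x))) A"
    using A Idx_less[OF kr] kr by (simp add: emeasure_distr_act emeasure_density mult.commute)
qed simp

section \<open>Quasi-invariance and the density factor\<close>

definition quasi_inv :: "zmat \<Rightarrow> bool" where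
  "quasi_inv t \<longleftrightarrow> absolutely_continuous (mu m b) (distr (mu m b) (mu m b) (\<lambda>x. act m x t))"

lemma quasi_inv_AE:
  assumes t: "t \<in> BZ" and q: "quasi_inv t" and ae: "AE x in mu m b. Q x" shows "AE x in mu m b. Q (act m x t)"
proof (rule AE_distrD[OF act_measurable[OF t]])
  show "AE x in distr (mu m b) (mu m b) (\<lambda>x. act m x t). Q x"
    by (rule absolutely_continuous_AE[OF _ q[unfolded quasi_inv_def] ae]) simp
qed

lemma quasi_inv_elem: assumes k: "k < r" shows "quasi_inv (mat_elem k r u)"
proof (cases "(k, r) \<in> Idx m")
  case True
  show ?thesis unfolding quasi_inv_def using distr_act_elem[OF True, of "- u"] True
    by (simp add: absolutely_continuousI_density)
next
  case False
  then have "k \<le> m" "m < r" using k by (auto simp: Idx_def Delta_sub_def Delta_sup_def)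
  then have "distr (mu m b) (mu m b) (\<lambda>x. act m x (mat_elem k r u)) = distr (mu m b) (mu m b) (\<lambda>x. x)"
    by (intro distr_cong) (auto simp: act_elem_mid)
  then show ?thesis by (simp add: quasi_inv_def absolutely_continuous_def distr_id2)
qed

lemma quasi_inv_mult:
  assumes "s \<in> BZ" "t \<in> BZ" "quasi_inv s" "quasi_inv t" shows "quasi_inv (s \<odot> t)"
  unfolding quasi_inv_def absolutely_continuous_def
proof
  fix N assume N: "N \<in> null_sets (mu m b)"
  have "AE x in mu m b. act m (act m x s) t \<notin> N"
    by (intro quasi_inv_AE[OF assms(1,3), of "\<lambda>x. act m x t \<notin> N"] quasi_inv_AE[OF assms(2,4), of "\<lambda>x. x \<notin> N"] AE_not_in N)
  then have "AE x in mu m b. act m x (s \<odot> t) \<notin> N"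
    using AE_space by eventually_elim (simp add: act_mult assms)
  then have "AE x in mu m b. indicator N (act m x (s \<odot> t)) = (0 :: ennreal)"
    by eventually_elim simp
  then have "(\<integral>\<^sup>+x. indicator N (act m x (s \<odot> t)) \<partial>mu m b) = (\<integral>\<^sup>+x. 0 \<partial>mu m b)"
    by (rule nn_integral_cong_AE)
  then show "N \<in> null_sets (distr (mu m b) (mu m b) (\<lambda>x. act m x (s \<odot> t)))"
    using N assms by (auto simp: null_sets_def emeasure_distr_act)
qed

text \<open>Induction over elementary factors: in a diagonal block such a factor is a shear with an
  explicit density, in the off-diagonal block it fixes every point.\<close>

lemma quasi_inv_B0Z: "t \<in> B0Z \<Longrightarrow> quasi_inv t"
proof (induction rule: B0Z_induct)
  case id
  have "distr (mu m b) (mu m b) (\<lambda>x. act m x mat_id) = distr (mu m b) (mu m b) (\<lambda>x. x)"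
    by (intro distr_cong) auto
  then show ?case by (simp add: quasi_inv_def absolutely_continuous_def distr_id2)
next
  case (mult k r s t)
  then show ?case by (intro quasi_inv_mult quasi_inv_elem) (auto intro: B0Z_BZ)
qed

lemma act_inv:
  assumes "x \<in> X_space m" "t \<in> BZ"
  shows "act m (act m x t) (mat_inv t) = x" "act m (act m x (mat_inv t)) t = x"
  using act_mult[OF assms(1,2), of "mat_inv t"] act_mult[OF assms(1), of "mat_inv t" t] assms by simp_all

lemma rn_measurable [measurable]: "rn_factor m b t \<in> borel_measurable (mu m b)"
  unfolding rn_factor_def[abs_def] by measurable

text \<open>\<open>enn2real\<close> sends infinity to 0, but the Radon-Nikodym derivative of a
  finite measure is finite almost everywhere, so nothing is lost.\<close>

lemma density_rn:
  assumes t: "t \<in> B0Z"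
  shows "density (mu m b) (\<lambda>x. ennreal (rn_factor m b t x)) = distr (mu m b) (mu m b) (\<lambda>x. act m x (mat_inv t))"
proof -
  let ?N = "distr (mu m b) (mu m b) (\<lambda>x. act m x (mat_inv t))"
  have ac: "absolutely_continuous (mu m b) ?N"
    using quasi_inv_B0Z[OF B0Z_inv[OF t]] by (simp add: quasi_inv_def)
  interpret N: prob_space ?N
    by (rule mu.prob_space_distr) (use act_measurable B0Z_BZ[OF t] in simp)
  have "AE x in mu m b. RN_deriv (mu m b) ?N x \<noteq> \<infinity>"
    by (rule mu.RN_deriv_finite) (use ac in \<open>auto intro: N.sigma_finite_measure_axioms\<close>)
  then have "AE x in mu m b. ennreal (rn_factor m b t x) = RN_deriv (mu m b) ?N x"
    by eventually_elim (simp add: rn_factor_def less_top)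
  then have "density (mu m b) (\<lambda>x. ennreal (rn_factor m b t x)) = density (mu m b) (RN_deriv (mu m b) ?N)"
    by (intro density_cong) auto
  also have "\<dots> = ?N" by (rule mu.density_RN_deriv[OF ac]) simp
  finally show ?thesis .
qed

text \<open>The factor is only determined up to null sets, so its values are found by exhibiting a
  density of the image measure.\<close>

lemma rn_unique:
  assumes t: "t \<in> B0Z" and g: "g \<in> borel_measurable (mu m b)" "\<And>x. 0 \<le> g x"
    and eq: "density (mu m b) (\<lambda>x. ennreal (g x)) = distr (mu m b) (mu m b) (\<lambda>x. act m x (mat_inv t))"
  shows "AE x in mu m b. rn_factor m b t x = g x"
proof -
  have "density (mu m b) (\<lambda>x. ennreal (rn_factor m b t x)) = density (mu m b) (\<lambda>x. ennreal (g x))"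
    using density_rn[OF t] eq by simp
  then have "AE x in mu m b. ennreal (rn_factor m b t x) = ennreal (g x)"
    using g by (subst (asm) mu.density_unique_iff) auto
  then show ?thesis
    by eventually_elim (use g(2) in \<open>simp add: rn_factor_def\<close>)
qed

lemma nn_integral_rn:
  assumes t: "t \<in> B0Z" and H: "H \<in> borel_measurable (mu m b)"
  shows "(\<integral>\<^sup>+x. H (act m x (mat_inv t)) \<partial>mu m b) = (\<integral>\<^sup>+x. H x * ennreal (rn_factor m b t x) \<partial>mu m b)"
proof -
  have "(\<integral>\<^sup>+x. H (act m x (mat_inv t)) \<partial>mu m b) = integral\<^sup>N (distr (mu m b) (mu m b) (\<lambda>x. act m x (mat_inv t))) H"
    using H B0Z_BZ[OF t] by (subst nn_integral_distr) auto
  also have "\<dots> = (\<integral>\<^sup>+x. H x * ennreal (rn_factor m b t x) \<partial>mu m b)"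
    using H by (subst density_rn[OF t, symmetric], subst nn_integral_density) (auto simp: mult.commute)
  finally show ?thesis .
qed

lemma nn_integral_act_rn:
  assumes t: "t \<in> B0Z" and G: "G \<in> borel_measurable (mu m b)"
  shows "(\<integral>\<^sup>+x. G (act m x t) * ennreal (rn_factor m b t x) \<partial>mu m b) = (\<integral>\<^sup>+x. G x \<partial>mu m b)"
proof -
  have "(\<lambda>x. G (act m x t)) \<in> borel_measurable (mu m b)"
    by (rule measurable_compose[OF act_measurable[OF B0Z_BZ[OF t]] G])
  from nn_integral_rn[OF t this] show ?thesis
    using act_inv(2) B0Z_BZ[OF t] by (simp cong: nn_integral_cong_simp)
qed

lemma rn_nonneg: "0 \<le> rn_factor m b t x"
  by (simp add: rn_factor_def)

lemma rn_id: "AE x in mu m b. rn_factor m b mat_id x = 1"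
proof (rule rn_unique[OF mat_id_B0Z])
  have "distr (mu m b) (mu m b) (\<lambda>x. act m x (mat_inv mat_id)) = distr (mu m b) (mu m b) (\<lambda>x. x)"
    by (intro distr_cong) auto
  then show "density (mu m b) (\<lambda>x. ennreal 1) = distr (mu m b) (mu m b) (\<lambda>x. act m x (mat_inv mat_id))"
    by (simp add: distr_id2 density_1)
qed auto

text \<open>Two changes of variables, first by the inverse of \<open>t\<close> and then by that of
  \<open>s\<close>, exhibit the product as a density of the image measure.\<close>

lemma rn_mult:
  assumes s: "s \<in> B0Z" and t: "t \<in> B0Z"
  shows "AE x in mu m b. rn_factor m b (s \<odot> t) x = rn_factor m b s x * rn_factor m b t (act m x s)"
proof (rule rn_unique[OF B0Z_mult[OF s t]])
  have BZ: "s \<in> BZ" "t \<in> BZ" using s t B0Z_BZ by auto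
  note [measurable] = act_measurable[OF BZ(1)] act_measurable[OF mat_inv_BZ[OF BZ(2)]] act_measurable[OF mat_inv_BZ[OF BZ(1)]]
  show m: "(\<lambda>x. rn_factor m b s x * rn_factor m b t (act m x s)) \<in> borel_measurable (mu m b)" by measurable
  show "0 \<le> rn_factor m b s x * rn_factor m b t (act m x s)" for x by (simp add: rn_nonneg)
  show "density (mu m b) (\<lambda>x. ennreal (rn_factor m b s x * rn_factor m b t (act m x s))) =
    distr (mu m b) (mu m b) (\<lambda>x. act m x (mat_inv (s \<odot> t)))"
  proof (rule measure_eqI)
    fix A assume "A \<in> sets (density (mu m b) (\<lambda>x. ennreal (rn_factor m b s x * rn_factor m b t (act m x s))))"
    then have A [measurable]: "A \<in> sets (mu m b)" by simp
    have "emeasure (distr (mu m b) (mu m b) (\<lambda>x. act m x (mat_inv (s \<odot> t)))) A =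
      (\<integral>\<^sup>+x. indicator A (act m (act m x (mat_inv t)) (mat_inv s)) \<partial>mu m b)"
      using A BZ by (subst emeasure_distr_act) (auto simp: mat_inv_mult act_mult intro!: nn_integral_cong)
    also have "\<dots> = (\<integral>\<^sup>+x. indicator A (act m x (mat_inv s)) * ennreal (rn_factor m b t x) \<partial>mu m b)"
      by (rule nn_integral_rn[OF t]) measurable
    also have "\<dots> = (\<integral>\<^sup>+x. indicator A (act m x (mat_inv s)) * ennreal (rn_factor m b t (act m (act m x (mat_inv s)) s)) \<partial>mu m b)"
      using act_inv(2)[OF _ BZ(1)] by (intro nn_integral_cong) simp
    also have "\<dots> = (\<integral>\<^sup>+x. indicator A x * ennreal (rn_factor m b t (act m x s)) * ennreal (rn_factor m b s x) \<partial>mu m b)"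
      by (rule nn_integral_rn[OF s, of "\<lambda>x. indicator A x * ennreal (rn_factor m b t (act m x s))"]) measurable
    also have "\<dots> = emeasure (density (mu m b) (\<lambda>x. ennreal (rn_factor m b s x * rn_factor m b t (act m x s)))) A"
      using A m by (subst emeasure_density) (auto simp: ennreal_mult' rn_nonneg ac_simps intro!: nn_integral_cong)
    finally show "emeasure (density (mu m b) (\<lambda>x. ennreal (rn_factor m b s x * rn_factor m b t (act m x s)))) A =
      emeasure (distr (mu m b) (mu m b) (\<lambda>x. act m x (mat_inv (s \<odot> t)))) A" by simp
  qed simp
qed

text \<open>The cocycle identity for \<open>t\<close> and its inverse writes the constant 1 as a
  product containing this factor.\<close>

lemma rn_pos:
  assumes t: "t \<in> B0Z" shows "AE x in mu m b. 0 < rn_factor m b t x"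
  using rn_mult[OF t B0Z_inv[OF t]] rn_id
proof eventually_elim
  case (elim x)
  then have "rn_factor m b t x \<noteq> 0" using B0Z_BZ[OF t] by auto
  then show ?case using rn_nonneg[of t x] by simp
qed

lemma rn_elem: assumes kr: "(k, r) \<in> Idx m" shows "AE x in mu m b. rn_factor m b (mat_elem k r u) x = dens k r u x"
  by (rule rn_unique)
     (use kr Idx_less[OF kr] dens_pos[OF kr] distr_act_elem[OF kr, of u] in \<open>auto simp: mat_elem_B0Z mat_inv_elem less_imp_le\<close>)

lemma rn_elem_mid:
  assumes "k \<le> m" "m < r" shows "AE x in mu m b. rn_factor m b (mat_elem k r u) x = 1"
proof (rule rn_unique)
  show "mat_elem k r u \<in> B0Z" using assms by (intro mat_elem_B0Z) simp
  have "distr (mu m b) (mu m b) (\<lambda>x. act m x (mat_inv (mat_elem k r u))) = distr (mu m b) (mu m b) (\<lambda>x. x)"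
    using assms by (intro distr_cong) (auto simp: act_elem_mid mat_inv_elem)
  then show "density (mu m b) (\<lambda>x. ennreal 1) = distr (mu m b) (mu m b) (\<lambda>x. act m x (mat_inv (mat_elem k r u)))"
    by (simp add: distr_id2 density_1)
qed auto

section \<open>Unitarity of the representation\<close>

lemma character_measurable:
  assumes t: "t \<in> B0Z" shows "(\<lambda>x. character y (cocycle m x t)) \<in> borel_measurable (mu m b)"
  unfolding character_def using pairing_cocycle_measurable[OF t y_anti] by measurable

lemma cmod_character: "cmod (character y h) = 1"
  unfolding character_def by (simp add: norm_exp_eq_Re)

lemma T_measurable:
  assumes t: "t \<in> B0Z" and f: "f \<in> borel_measurable (mu m b)"
  shows "T_rep m b y t f \<in> borel_measurable (mu m b)"
proof -
  have "(\<lambda>x. f (act m x t)) \<in> borel_measurable (mu m b)"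
    by (rule measurable_compose[OF act_measurable[OF B0Z_BZ[OF t]] f])
  then show ?thesis unfolding T_rep_def[abs_def] using character_measurable[OF t] by measurable
qed

lemma T_norm:
  assumes t: "t \<in> B0Z" and f: "f \<in> borel_measurable (mu m b)"
  shows "(\<integral>\<^sup>+x. ennreal ((cmod (T_rep m b y t f x))\<^sup>2) \<partial>mu m b) = (\<integral>\<^sup>+x. ennreal ((cmod (f x))\<^sup>2) \<partial>mu m b)"
proof -
  have "(\<integral>\<^sup>+x. ennreal ((cmod (T_rep m b y t f x))\<^sup>2) \<partial>mu m b) =
    (\<integral>\<^sup>+x. ennreal ((cmod (f (act m x t)))\<^sup>2) * ennreal (rn_factor m b t x) \<partial>mu m b)"
    by (intro nn_integral_cong)
       (simp add: T_rep_def norm_mult cmod_character power_mult_distrib rn_nonneg ennreal_mult'[symmetric] mult.commute)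
  also have "\<dots> = (\<integral>\<^sup>+x. ennreal ((cmod (f x))\<^sup>2) \<partial>mu m b)"
    by (rule nn_integral_act_rn[OF t]) (use f in measurable)
  finally show ?thesis .
qed

lemma T_L2:
  assumes t: "t \<in> B0Z" and f: "f \<in> L2 (mu m b)"
  shows "T_rep m b y t f \<in> L2 (mu m b)"
    and "(LINT x|mu m b. (cmod (T_rep m b y t f x))\<^sup>2) = (LINT x|mu m b. (cmod (f x))\<^sup>2)"
proof -
  have fm: "f \<in> borel_measurable (mu m b)" using f by (rule L2_measurable)
  show "T_rep m b y t f \<in> L2 (mu m b)"
    using f T_measurable[OF t fm] T_norm[OF t fm] by (simp add: L2_iff_nn)
  show "(LINT x|mu m b. (cmod (T_rep m b y t f x))\<^sup>2) = (LINT x|mu m b. (cmod (f x))\<^sup>2)"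
    using T_measurable[OF t fm] fm T_norm[OF t fm] by (subst (1 2) integral_eq_nn_integral) auto
qed

lemma cocycle_id: assumes x: "x \<in> X_space m" shows "cocycle m x mat_id = mat_id"
  by (rule cocycle_char(3)[OF x]) (auto simp: unitri_mid_iff x)

lemma AE_act_B2:
  assumes t: "t \<in> B0Z" shows "AE x in mu m b. fst (act m x t) \<in> B2 a \<and> snd (act m x t) \<in> B2 a"
  by (rule quasi_inv_AE[OF B0Z_BZ[OF t] quasi_inv_B0Z[OF t] AE_B2])

lemma AE_pairing_summable:
  assumes t: "t \<in> B0Z"
  shows "AE x in mu m b. (\<lambda>p. (cocycle m x t (m - int p) (m + int p + 1) - mat_id (m - int p) (m + int p + 1)) * yy p) summable_on UNIV"
  using AE_space AE_B2 AE_act_B2[OF t]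
  by eventually_elim (rule pairing_cocycle_summable, use t in auto)

text \<open>Off-diagonal parts add in \<open>B(m)\<close>, and the pairing is additive where both
  series converge; elsewhere its default value 0 could break additivity. Convergence at the moved
  point \<open>xs\<close> comes from quasi-invariance.\<close>

lemma character_cocycle_mult:
  assumes s: "s \<in> B0Z" and t: "t \<in> B0Z"
  shows "AE x in mu m b. character y (cocycle m x (s \<odot> t)) = character y (cocycle m x s) * character y (cocycle m (act m x s) t)"
  using AE_space AE_pairing_summable[OF s] quasi_inv_AE[OF B0Z_BZ[OF s] quasi_inv_B0Z[OF s] AE_pairing_summable[OF t]]
proof eventually_elim
  case (elim x)
  have BZ: "s \<in> BZ" "t \<in> BZ" using s t B0Z_BZ by auto
  have x: "x \<in> X_space m" using elim by simp
  have d: "(\<lambda>i j. cocycle m x (s \<odot> t) i j - mat_id i j) =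
    (\<lambda>i j. (cocycle m x s i j - mat_id i j) + (cocycle m (act m x s) t i j - mat_id i j))"
    unfolding cocycle_mult[OF x BZ]
    by (intro ext mid_mult(2)[OF cocycle_char(1)[OF x BZ(1)] cocycle_char(1)[OF act_X_space[OF x BZ(1)] BZ(2)]])
  have "pairing y (\<lambda>i j. cocycle m x (s \<odot> t) i j - mat_id i j) =
    pairing y (\<lambda>i j. cocycle m x s i j - mat_id i j) + pairing y (\<lambda>i j. cocycle m (act m x s) t i j - mat_id i j)"
    unfolding d pairing_antidiag(1)[OF y_anti] distrib_right
    by (rule infsum_add) (use elim in auto)
  then show ?case by (simp add: character_def distrib_left exp_add)
qed

lemma character_id: "character y mat_id = 1"
  by (simp add: character_def pairing_def case_prod_beta')

lemma unitary: "unitary_rep B0Z_group (mu m b) (T_rep m b y)"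
  unfolding unitary_rep_def
proof (intro conjI ballI allI)
  fix t f assume "t \<in> carrier B0Z_group" "f \<in> L2 (mu m b)"
  then show "T_rep m b y t f \<in> L2 (mu m b)"
    "(LINT x|mu m b. (cmod (T_rep m b y t f x))\<^sup>2) = (LINT x|mu m b. (cmod (f x))\<^sup>2)"
    using T_L2 by (auto simp: B0Z_group_def)
next
  fix t f g c
  show "AE x in mu m b. T_rep m b y t (\<lambda>x. c * f x + g x) x = c * T_rep m b y t f x + T_rep m b y t g x"
    by (simp add: T_rep_def algebra_simps)
next
  fix f
  show "AE x in mu m b. T_rep m b y \<one>\<^bsub>B0Z_group\<^esub> f x = f x"
    using rn_id AE_space
    by eventually_elim (simp add: T_rep_def B0Z_group_def cocycle_id character_id)
next
  fix s t f assume "s \<in> carrier B0Z_group" "t \<in> carrier B0Z_group"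
  then have st: "s \<in> B0Z" "t \<in> B0Z" by (auto simp: B0Z_group_def)
  show "AE x in mu m b. T_rep m b y (s \<otimes>\<^bsub>B0Z_group\<^esub> t) f x = T_rep m b y s (T_rep m b y t f) x"
    using character_cocycle_mult[OF st] rn_mult[OF st] AE_space
    by eventually_elim (simp add: T_rep_def B0Z_group_def real_sqrt_mult act_mult st B0Z_BZ)
qed

end

section \<open>Irreducibility\<close>

text \<open>Fatou's lemma for \<open>|F n - g|^2\<close>: its lower limit vanishes almost everywhere
  and equals \<open>|G - g|^2\<close>.\<close>

lemma L2_tendsto_AE_unique:
  assumes F: "\<And>n. F n \<in> borel_measurable M" and lim: "L2_tendsto M F g sequentially"
    and ae: "AE x in M. (\<lambda>n. F n x) \<longlonglongrightarrow> G x"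
  shows "AE x in M. g x = G x"
proof -
  have g: "g \<in> borel_measurable M" using lim by (simp add: L2_tendsto_def L2_def)
  note [measurable] = F g
  have ev: "\<forall>\<^sub>F n in sequentially. F n \<in> L2 M" using lim by (simp add: L2_tendsto_def)
  have "(\<integral>\<^sup>+x. liminf (\<lambda>n. ennreal ((cmod (F n x - g x))\<^sup>2)) \<partial>M) \<le> liminf (\<lambda>n. \<integral>\<^sup>+x. ennreal ((cmod (F n x - g x))\<^sup>2) \<partial>M)"
    by (rule nn_integral_liminf) measurable
  also have "(\<lambda>n. \<integral>\<^sup>+x. ennreal ((cmod (F n x - g x))\<^sup>2) \<partial>M) \<longlonglongrightarrow> ennreal 0"
  proof (rule Lim_transform_eventually)
    show "(\<lambda>n. ennreal (LINT x|M. (cmod (F n x - g x))\<^sup>2)) \<longlonglongrightarrow> ennreal 0"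
      using lim by (intro tendsto_ennrealI) (simp add: L2_tendsto_def)
    show "\<forall>\<^sub>F n in sequentially. ennreal (LINT x|M. (cmod (F n x - g x))\<^sup>2) = (\<integral>\<^sup>+x. ennreal ((cmod (F n x - g x))\<^sup>2) \<partial>M)"
      using ev
    proof eventually_elim
      case (elim n)
      have "(\<lambda>x. F n x - g x) \<in> L2 M" using lim by (intro L2_diff elim) (simp add: L2_tendsto_def)
      then show ?case by (intro nn_integral_eq_integral[symmetric]) (auto simp: L2_def)
    qed
  qed
  then have "liminf (\<lambda>n. \<integral>\<^sup>+x. ennreal ((cmod (F n x - g x))\<^sup>2) \<partial>M) = 0"
    by (simp add: lim_imp_Liminf)
  finally have "(\<integral>\<^sup>+x. liminf (\<lambda>n. ennreal ((cmod (F n x - g x))\<^sup>2)) \<partial>M) = 0" by simp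
  then have "AE x in M. liminf (\<lambda>n. ennreal ((cmod (F n x - g x))\<^sup>2)) = 0"
    by (subst (asm) nn_integral_0_iff_AE) measurable
  then show ?thesis using ae
  proof eventually_elim
    case (elim x)
    have "(\<lambda>n. ennreal ((cmod (F n x - g x))\<^sup>2)) \<longlonglongrightarrow> ennreal ((cmod (G x - g x))\<^sup>2)"
      by (intro tendsto_intros elim)
    then have "liminf (\<lambda>n. ennreal ((cmod (F n x - g x))\<^sup>2)) = ennreal ((cmod (G x - g x))\<^sup>2)"
      by (rule lim_imp_Liminf[rotated]) simp
    then have "(cmod (G x - g x))\<^sup>2 = 0" using elim(1) by simp
    then show ?case by simp
  qed
qed

text \<open>Generators are limits over reals tending to 0, while the limit theorems for integrals
  used here speak of sequences.\<close>

lemma L2_tendsto_at_iff: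
  fixes F :: "real \<Rightarrow> 'a \<Rightarrow> complex"
  assumes "\<And>t. F t \<in> L2 M"
  shows "L2_tendsto M F g (at 0) \<longleftrightarrow> (\<forall>X. (\<forall>i. X i \<noteq> 0) \<longrightarrow> X \<longlonglongrightarrow> 0 \<longrightarrow> L2_tendsto M (\<lambda>n. F (X n)) g sequentially)"
proof
  assume "L2_tendsto M F g (at 0)"
  then show "\<forall>X. (\<forall>i. X i \<noteq> 0) \<longrightarrow> X \<longlonglongrightarrow> 0 \<longrightarrow> L2_tendsto M (\<lambda>n. F (X n)) g sequentially"
    using assms by (auto simp: L2_tendsto_def tendsto_at_iff_sequentially o_def)
next
  assume *: "\<forall>X. (\<forall>i. X i \<noteq> 0) \<longrightarrow> X \<longlonglongrightarrow> 0 \<longrightarrow> L2_tendsto M (\<lambda>n. F (X n)) g sequentially"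
  have "L2_tendsto M (\<lambda>n. F (inverse (real (Suc n)))) g sequentially"
    using *[rule_format, of "\<lambda>n. inverse (real (Suc n))"] LIMSEQ_inverse_real_of_nat by simp
  then have "g \<in> L2 M" by (simp add: L2_tendsto_def)
  moreover have "((\<lambda>t. LINT x|M. (cmod (F t x - g x))\<^sup>2) \<longlongrightarrow> 0) (at 0)"
    unfolding tendsto_at_iff_sequentially using * by (auto simp: L2_tendsto_def o_def)
  ultimately show "L2_tendsto M F g (at 0)" using assms by (simp add: L2_tendsto_def)
qed

lemma L2_tendsto_cong_AE:
  assumes F: "\<And>n. F' n \<in> borel_measurable M" "\<And>n. AE x in M. F n x = F' n x" "\<And>n. F n \<in> borel_measurable M"
    and lim: "L2_tendsto M F g \<FF>"
  shows "L2_tendsto M F' g \<FF>"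
proof -
  have L2: "F' n \<in> L2 M" if "F n \<in> L2 M" for n
    using F(2)[of n] by (intro L2_bound[OF that F(1), where K = 1]) auto
  have g: "g \<in> borel_measurable M" using lim by (simp add: L2_tendsto_def L2_def)
  note [measurable] = F g
  have "(LINT x|M. (cmod (F' n x - g x))\<^sup>2) = (LINT x|M. (cmod (F n x - g x))\<^sup>2)" for n
    using F(2)[of n] by (intro integral_cong_AE) (auto elim: eventually_mono)
  then show ?thesis using lim L2 unfolding L2_tendsto_def by (auto elim: eventually_mono)
qed

context setting begin

section \<open>The off-diagonal block acts by multiplication\<close>

lemma pairing_elem:
  assumes x: "x \<in> X_space m" and kr: "k \<le> m" "m < r"
  shows "pairing y (\<lambda>i j. cocycle m x (mat_elem k r u) i j - mat_id i j) =
    (\<Sum>\<^sub>\<infinity>p. u * (mat_inv (fst x) r (m + int p + 1) * yy p * snd x (m - int p) k))"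
proof -
  have t: "mat_elem k r u \<in> BZ" using kr by simp
  have "cocycle m x (mat_elem k r u) (m - int p) (m + int p + 1) - mat_id (m - int p) (m + int p + 1) =
    u * (snd x (m - int p) k * mat_inv (fst x) r (m + int p + 1))" for p
    by (subst cocycle_entry[OF x t, where F = "{(k, r)}"])
       (use kr x in \<open>auto simp: mat_elem_def mat_id_def Delta_mid_def act_elem_mid split: if_splits\<close>)
  then show ?thesis unfolding pairing_antidiag(1)[OF y_anti] by (simp add: ac_simps)
qed

lemma S_fun_eq:
  assumes x: "x \<in> X_space m" and kr: "k \<le> m" "m < r"
  shows "S_fun m y k r x = (\<Sum>\<^sub>\<infinity>p. mat_inv (fst x) r (m + int p + 1) * yy p * snd x (m - int p) k)"
  unfolding S_fun_def pairing_elem[OF assms] by simp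

lemma S_fun_measurable: "k \<le> m \<Longrightarrow> m < r \<Longrightarrow> S_fun m y k r \<in> borel_measurable (mu m b)"
  unfolding S_fun_def[abs_def] by (intro pairing_cocycle_measurable mat_elem_B0Z y_anti) simp

text \<open>The point is fixed and the density factor is 1, so only the character remains. Pulling
  \<open>u\<close> out of the series is harmless also where the series takes its default value,
  since \<open>infsum\<close> is homogeneous there too.\<close>

lemma T_mid:
  assumes kr: "k \<le> m" "m < r"
  shows "AE x in mu m b. T_rep m b y (mat_elem k r u) f x = exp (\<i> * complex_of_real (2 * pi * u * S_fun m y k r x)) * f x"
  using rn_elem_mid[OF kr, of u] AE_space
proof eventually_elim
  case (elim x)
  then have x: "x \<in> X_space m" by simp
  have "pairing y (\<lambda>i j. cocycle m x (mat_elem k r u) i j - mat_id i j) = u * S_fun m y k r x"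
    unfolding pairing_elem[OF x kr] S_fun_eq[OF x kr] by (rule infsum_cmult_right')
  then show ?case using elim kr x by (simp add: T_rep_def act_elem_mid character_def ac_simps)
qed

text \<open>The product with \<open>y\<close> has at most one nonzero term per entry, as column
  \<open>l\<close> of \<open>y\<close> is supported in row \<open>2 m + 1 - l\<close>. The remaining
  sum over columns is the series over the antidiagonal, convergent for points of
  \<open>B_2(a)\<close>.\<close>

lemma S_fun_sums:
  assumes kr: "k \<le> m" "m < r"
  shows "AE x in mu m b.
    ((\<lambda>p::nat. mat_inv (fst x) r (m + int p + 1) * y (m + int p + 1) (m - int p) * snd x (m - int p) k) has_sum S_fun m y k r x) UNIV \<and>
    S_fun m y k r x = (mat_inv (fst x) \<odot> y \<odot> snd x) r k"
  using AE_B2 AE_space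
proof eventually_elim
  case (elim x)
  then have x: "x \<in> X_space m" and B2: "fst x \<in> B2 a" "snd x \<in> B2 a" by auto
  let ?f = "\<lambda>p. mat_inv (fst x) r (m + int p + 1) * yy p * snd x (m - int p) k"
  have "?f summable_on UNIV" by (intro triple_summable_on B2_inv B2 kr)
  then have hs: "(?f has_sum S_fun m y k r x) UNIV" unfolding S_fun_eq[OF x kr] by simp
  have e: "(mat_inv (fst x) \<odot> y) r l = (if l \<le> m then mat_inv (fst x) r (2 * m + 1 - l) * y (2 * m + 1 - l) l else 0)" for l
  proof -
    have z: "y j l = 0" if "l > m \<or> j \<noteq> 2 * m + 1 - l" for j
      using y_anti that unfolding antidiag_def by force
    show ?thesis
    proof (cases "l \<le> m")
      case True
      then show ?thesis using z by (subst mat_mult_finite[of "{2 * m + 1 - l}"]) auto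
    next
      case False
      then show ?thesis using z by (subst mat_mult_finite[of "{}"]) auto
    qed
  qed
  have inj: "inj (\<lambda>p::nat. m - int p)" by (auto simp: inj_def)
  have "(mat_inv (fst x) \<odot> y \<odot> snd x) r k = infsum (\<lambda>l. (mat_inv (fst x) \<odot> y) r l * snd x l k) (range (\<lambda>p::nat. m - int p))"
    unfolding mat_mult_def[of "mat_inv (fst x) \<odot> y"]
  proof (rule infsum_cong_neutral)
    fix l assume "l \<in> UNIV - range (\<lambda>p::nat. m - int p)"
    then have "l \<noteq> m - int (nat (m - l))" by blast
    then have "m < l" by (cases "l \<le> m") auto
    then show "(mat_inv (fst x) \<odot> y) r l * snd x l k = 0" by (simp add: e)
  qed auto
  also have "\<dots> = infsum ((\<lambda>l. (mat_inv (fst x) \<odot> y) r l * snd x l k) \<circ> (\<lambda>p::nat. m - int p)) UNIV"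
    by (rule infsum_reindex[OF inj])
  also have "\<dots> = infsum ?f UNIV"
    by (rule infsum_cong) (auto simp: e algebra_simps)
  also have "\<dots> = S_fun m y k r x" by (rule infsumI[OF hs])
  finally show ?case using hs by simp
qed

text \<open>The quotients converge pointwise to the product with \<open>2 pi i S\<close>. If they
  also converge in \<open>L2\<close>, the limits agree almost everywhere; conversely
  \<open>|exp (i s) - 1| \<le> |s|\<close> bounds them by \<open>|g|\<close>, and dominated
  convergence applies. This identifies the whole domain of the generator.\<close>

lemma generator_mid:
  assumes kr: "k \<le> m" "m < r" and f: "f \<in> L2 (mu m b)" and g: "g \<in> L2 (mu m b)"
  shows "generator_maps (mu m b) (\<lambda>t. T_rep m b y (mat_elem k r t)) f g \<longleftrightarrow>
    (AE x in mu m b. g x = 2 * complex_of_real pi * \<i> * complex_of_real (S_fun m y k r x) * f x)"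
proof -
  let ?S = "S_fun m y k r"
  let ?F = "\<lambda>t x. (T_rep m b y (mat_elem k r t) f x - f x) / complex_of_real t"
  let ?G = "\<lambda>x. 2 * complex_of_real pi * \<i> * complex_of_real (?S x) * f x"
  have F_L2: "?F t \<in> L2 (mu m b)" for t
  proof -
    have "(\<lambda>x. inverse (complex_of_real t) * (T_rep m b y (mat_elem k r t) f x - f x)) \<in> L2 (mu m b)"
      using kr by (intro L2_cmult L2_diff f T_L2 mat_elem_B0Z) simp
    then show ?thesis by (simp add: divide_inverse mult.commute)
  qed
  have Fm: "?F t \<in> borel_measurable (mu m b)" for t using F_L2 by (rule L2_measurable)
  have F_eq: "AE x in mu m b. ?F t x = (exp (\<i> * complex_of_real (2 * pi * t * ?S x)) - 1) / complex_of_real t * f x" for t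
    using T_mid[OF kr, of t f] by eventually_elim (simp add: algebra_simps)
  have lim: "AE x in mu m b. (\<lambda>n. ?F (X n) x) \<longlonglongrightarrow> ?G x" if X: "\<And>i::nat. X i \<noteq> 0" "X \<longlonglongrightarrow> 0" for X
  proof -
    have "AE x in mu m b. \<forall>n. ?F (X n) x = (exp (\<i> * complex_of_real (2 * pi * X n * ?S x)) - 1) / complex_of_real (X n) * f x"
      using F_eq by (simp add: AE_all_countable)
    then show ?thesis
    proof eventually_elim
      case (elim x)
      let ?c = "2 * complex_of_real pi * \<i> * complex_of_real (?S x)"
      have "((\<lambda>z. exp (?c * z)) has_field_derivative ?c) (at 0)"
        by (auto intro!: derivative_eq_intros)
      then have "((\<lambda>z. (exp (?c * z) - 1) / z) \<longlongrightarrow> ?c) (at 0)"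
        by (simp add: DERIV_def)
      moreover have "filterlim (\<lambda>n. complex_of_real (X n)) (at 0) sequentially"
        using X by (auto simp: filterlim_at intro!: tendsto_eq_intros always_eventually)
      ultimately have "(\<lambda>n. (exp (?c * complex_of_real (X n)) - 1) / complex_of_real (X n)) \<longlonglongrightarrow> ?c"
        by (rule filterlim_compose)
      then have "(\<lambda>n. (exp (?c * complex_of_real (X n)) - 1) / complex_of_real (X n) * f x) \<longlonglongrightarrow> ?c * f x"
        by (rule tendsto_mult_right)
      moreover have "?F (X n) x = (exp (?c * complex_of_real (X n)) - 1) / complex_of_real (X n) * f x" for n
      proof -
        have "\<i> * complex_of_real (2 * pi * X n * ?S x) = ?c * complex_of_real (X n)" by simp
        then show ?thesis using elim by (simp only:)
      qed
      ultimately show ?case by (simp only:)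
    qed
  qed
  show ?thesis
  proof
    assume "generator_maps (mu m b) (\<lambda>t. T_rep m b y (mat_elem k r t)) f g"
    then have "L2_tendsto (mu m b) ?F g (at 0)" by (simp add: generator_maps_def)
    then have L: "L2_tendsto (mu m b) (\<lambda>n. ?F (inverse (real (Suc n)))) g sequentially"
      unfolding L2_tendsto_at_iff[OF F_L2] using LIMSEQ_inverse_real_of_nat
      by (elim allE[of _ "\<lambda>n. inverse (real (Suc n))"]) simp
    show "AE x in mu m b. g x = ?G x"
      by (rule L2_tendsto_AE_unique[OF Fm L lim]) (use LIMSEQ_inverse_real_of_nat in auto)
  next
    assume gG: "AE x in mu m b. g x = ?G x"
    have "L2_tendsto (mu m b) ?F g (at 0)"
      unfolding L2_tendsto_at_iff[OF F_L2]
    proof (intro allI impI)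
      fix X :: "nat \<Rightarrow> real" assume X: "\<forall>i. X i \<noteq> 0" "X \<longlonglongrightarrow> 0"
      show "L2_tendsto (mu m b) (\<lambda>n. ?F (X n)) g sequentially"
      proof (rule L2_tendsto_dominated[OF Fm g L2_measurable[OF g], where K = 1])
        show "AE x in mu m b. (\<lambda>n. ?F (X n) x) \<longlonglongrightarrow> g x"
          using lim[of X] gG X by (auto elim: eventually_elim2)
        fix n
        show "AE x in mu m b. cmod (?F (X n) x) \<le> 1 * cmod (g x)"
          using F_eq[of "X n"] gG
        proof eventually_elim
          case (elim x)
          have "cmod (exp (\<i> * complex_of_real (2 * pi * X n * ?S x)) - 1) \<le> \<bar>2 * pi * X n * ?S x\<bar>"
            using iexp_approx1[of "2 * pi * X n * ?S x" 0] by simp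
          then have "cmod (exp (\<i> * complex_of_real (2 * pi * X n * ?S x)) - 1) / \<bar>X n\<bar> \<le> 2 * pi * \<bar>?S x\<bar>"
            using X(1) by (simp add: pos_divide_le_eq abs_mult ac_simps)
          then have "cmod (exp (\<i> * complex_of_real (2 * pi * X n * ?S x)) - 1) / \<bar>X n\<bar> * cmod (f x) \<le> 2 * pi * \<bar>?S x\<bar> * cmod (f x)"
            by (rule mult_right_mono) simp
          then show ?case unfolding elim by (simp add: norm_mult norm_divide)
        qed
      qed
    qed
    then show "generator_maps (mu m b) (\<lambda>t. T_rep m b y (mat_elem k r t)) f g"
      using f by (simp add: generator_maps_def)
  qed
qed

section \<open>Invariant subspaces and ergodicity\<close>

definition S_vec :: "zmat \<times> zmat \<Rightarrow> int \<times> int \<Rightarrow> real" where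
  "S_vec x i = (if i \<in> Delta_mid m then S_fun m y (fst i) (snd i) x else 0)"

lemma S_vec_measurable: "(\<lambda>x. S_vec x i) \<in> borel_measurable (mu m b)"
  unfolding S_vec_def using S_fun_measurable[of "fst i" "snd i"]
  by (cases "i \<in> Delta_mid m") (auto simp: Delta_mid_def)

lemma S_vec_injective:
  assumes x: "x \<in> X_space m" "fst x \<in> B2 a" "snd x \<in> B2 a"
    and x': "x' \<in> X_space m" "fst x' \<in> B2 a" "snd x' \<in> B2 a" and eq: "S_vec x = S_vec x'"
  shows "x' = x"
proof -
  have "S_fun m y k r x = S_fun m y k r x'" if "k \<le> m" "m < r" for k r
    using fun_cong[OF eq, of "(k, r)"] that by (simp add: S_vec_def Delta_mid_def)
  then have e: "(\<Sum>\<^sub>\<infinity>p. mat_inv (fst x) r (m + int p + 1) * yy p * snd x (m - int p) k) =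
    (\<Sum>\<^sub>\<infinity>p. mat_inv (fst x') r (m + int p + 1) * yy p * snd x' (m - int p) k)" if "k \<le> m" "m < r" for k r
    using that S_fun_eq[OF x(1) that] S_fun_eq[OF x'(1) that] by simp
  have u: "fst x \<in> unitri (Delta_sub m)" "snd x \<in> unitri (Delta_sup m)"
    "fst x' \<in> unitri (Delta_sub m)" "snd x' \<in> unitri (Delta_sup m)" using x x' by (auto simp: X_space_iff)
  note S_injective[OF x(2) u(1) x'(2) u(3) x(3) u(2) x'(3) u(4) e]
  then show ?thesis by (simp add: prod_eq_iff)
qed

text \<open>The factorization needs Polish spaces, so it is carried out on the coordinate space of
  \<open>nu\<close> and transported back. Separation holds on the points both of whose components
  lie in \<open>B2 a\<close>.\<close>

lemma AE_factor_S_vec: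
  assumes E: "E \<in> sets (mu m b)"
  obtains B where "B \<in> sets borel" "AE x in mu m b. x \<in> E \<longleftrightarrow> S_vec x \<in> B"
proof -
  let ?c = "from_coords m" and ?\<Omega> = "{v. fst (from_coords m v) \<in> B2 a \<and> snd (from_coords m v) \<in> B2 a}"
  have c: "?c \<in> measurable (nu m b) (mu m b)"
    using from_coords_measurable by (simp add: sets_nu cong: measurable_cong_sets)
  have S: "(\<lambda>v. S_vec (?c v)) \<in> borel_measurable (nu m b)"
    by (rule measurable_coordinatewise_then_product) (rule measurable_compose[OF c S_vec_measurable])
  have ae: "AE v in nu m b. v \<in> ?\<Omega>"
    using AE_weighted_summable
  proof eventually_elim
    case (elim v)
    have "coords m (?c v) (k, n) = v (k, n)" if "(k, n) \<in> Idx m" for k n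
      using that by (auto simp: coords_def coord_def from_coords_def of_coords_def Idx_def Delta_sub_def Delta_sup_def)
    then have "(\<lambda>(k, n). (coords m (?c v) (k, n))\<^sup>2 * a k n) summable_on Idx m"
      using elim by (subst summable_on_cong[where g = "\<lambda>(k, n). (v (k, n))\<^sup>2 * a k n"]) auto
    then show ?case using B2_of_coords[OF from_coords_X_space] by simp
  qed
  have E': "{v. ?c v \<in> E} \<in> sets (nu m b)"
    using measurable_sets[OF c E] by (simp add: vimage_def)
  have fin: "finite_measure (nu m b)" by (rule nu.finite_measure_axioms)
  have sep: "v' \<in> {v. ?c v \<in> E}"
    if "v \<in> ?\<Omega>" "v' \<in> ?\<Omega>" "S_vec (?c v) = S_vec (?c v')" "v \<in> {v. ?c v \<in> E}" for v v'
    using S_vec_injective[of "?c v" "?c v'"] that from_coords_X_space by auto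
  obtain B where B: "B \<in> sets borel" "AE v in nu m b. v \<in> {v. ?c v \<in> E} \<longleftrightarrow> S_vec (?c v) \<in> B"
    by (rule AE_factor_through[OF sets_nu_borel fin S ae E' sep])
  have "AE x in mu m b. x \<in> E \<longleftrightarrow> S_vec x \<in> B"
    using AE_mu_coords[OF B(2)] AE_space by eventually_elim (simp add: from_coords_coords)
  with B(1) show ?thesis by (rule that)
qed

text \<open>The operators of the off-diagonal block supply the exponentials of \<open>S\<close> as
  multipliers, hence the indicators of all sets measurable with respect to \<open>S\<close>. Every
  measurable set is one of these up to a null set, and a closed subspace does not see null
  sets.\<close>

lemma invariant_ideal:
  assumes V: "L2_closed_subspace (mu m b) V" and inv: "\<And>t f. t \<in> B0Z \<Longrightarrow> f \<in> V \<Longrightarrow> T_rep m b y t f \<in> V"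
  shows "L2_ideal (mu m b) V"
proof -
  interpret L2_sub "mu m b" V by unfold_locales (rule V)
  have S: "mult (\<lambda>x. exp (\<i> * complex_of_real (\<tau> * S_vec x i)))" for \<tau> i
  proof (cases "i \<in> Delta_mid m")
    case False
    then show ?thesis using mult_const[of 1] by (simp add: S_vec_def)
  next
    case True
    then have kr: "fst i \<le> m" "m < snd i" by (auto simp: Delta_mid_def)
    \<comment> \<open>Dividing by \<open>2 pi\<close> cancels the factor in the exponent of
      \<open>character\<close>.\<close>
    let ?t = "mat_elem (fst i) (snd i) (\<tau> / (2 * pi))"
    have t: "?t \<in> B0Z" using kr by (intro mat_elem_B0Z) simp
    have meas: "(\<lambda>x. exp (\<i> * complex_of_real (\<tau> * S_vec x i))) \<in> borel_measurable (mu m b)"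
      using S_vec_measurable[of i] by measurable
    show ?thesis unfolding mult_def
    proof (intro conjI ballI exI[of _ 1])
      fix f assume f: "f \<in> V"
      have fm: "f \<in> borel_measurable (mu m b)" using V_L2[OF f] by (rule L2_measurable)
      have ae: "AE x in mu m b. T_rep m b y ?t f x = exp (\<i> * complex_of_real (\<tau> * S_vec x i)) * f x"
        using T_mid[OF kr, of "\<tau> / (2 * pi)" f] True by (simp add: S_vec_def)
      show "(\<lambda>x. exp (\<i> * complex_of_real (\<tau> * S_vec x i)) * f x) \<in> V"
        by (rule V_cong_AE[OF inv[OF t f] _ ae]) (use meas fm in measurable)
    qed (use meas in \<open>auto simp: norm_exp_eq_Re\<close>)
  qed
  show ?thesis
  proof
    fix E assume E: "E \<in> sets (mu m b)"
    obtain B where B: "B \<in> sets borel" "AE x in mu m b. x \<in> E \<longleftrightarrow> S_vec x \<in> B"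
      using AE_factor_S_vec[OF E] .
    have SB: "mult (\<lambda>x. indicator B (S_vec x))"
      by (rule mult_indicator_vimage[OF S B(1) S_vec_measurable])
    show "mult (indicator E)" unfolding mult_def
    proof (intro conjI ballI exI[of _ 1])
      show "(indicator E :: _ \<Rightarrow> complex) \<in> borel_measurable (mu m b)" using E by simp
      fix f assume f: "f \<in> V"
      have fm: "f \<in> borel_measurable (mu m b)" using V_L2[OF f] by (rule L2_measurable)
      have ae: "AE x in mu m b. indicator B (S_vec x) * f x = indicator E x * f x"
        using B(2) by eventually_elim (auto split: split_indicator)
      show "(\<lambda>x. indicator E x * f x) \<in> V"
        by (rule V_cong_AE[OF multD[OF SB f] _ ae]) (use E fm in measurable)
    qed (auto split: split_indicator)
  qed
qed

theorem irreducible: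
  assumes erg: "right_ergodic m b"
  shows "irreducible_unitary_rep B0Z_group (mu m b) (T_rep m b y)"
  unfolding irreducible_unitary_rep_def
proof (intro conjI unitary allI impI)
  show "\<exists>f\<in>L2 (mu m b). \<not> (AE x in mu m b. f x = 0)"
  proof (rule bexI[of _ "\<lambda>_. 1"])
    show "\<not> (AE x in mu m b. (1::complex) = 0)" using mu.AE_False by simp
  qed (simp add: L2_def)
next
  fix V assume "L2_closed_subspace (mu m b) V \<and> (\<forall>t\<in>carrier B0Z_group. \<forall>f\<in>V. T_rep m b y t f \<in> V)"
  then have V: "L2_closed_subspace (mu m b) V" and inv: "\<And>t f. t \<in> B0Z \<Longrightarrow> f \<in> V \<Longrightarrow> T_rep m b y t f \<in> V"
    by (auto simp: B0Z_group_def)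
  interpret L2_ideal "mu m b" V by (rule invariant_ideal[OF V inv])
  obtain E where E: "E \<in> sets (mu m b)" "V = {f \<in> L2 (mu m b). AE x in mu m b. x \<notin> E \<longrightarrow> f x = 0}"
    by (rule V_eq_L2_on)
  have L2E: "indicator E \<in> L2 (mu m b)"
    by (rule L2_bound[of "\<lambda>_. 1" _ _ 1]) (use E(1) in \<open>auto simp: L2_def split: split_indicator\<close>)
  have IE: "indicator E \<in> V" unfolding E(2) using L2E by auto
  \<comment> \<open>The image of the indicator of \<open>E\<close> vanishes off \<open>E\<close>,
    and the other two factors of \<open>T_rep\<close> are nonzero almost everywhere. The reverse
    implication will be this one for the inverse of \<open>t\<close>, moved to the point
    \<open>xt\<close> by quasi-invariance.\<close>
  have sub: "AE x in mu m b. x \<notin> E \<longrightarrow> act m x t \<notin> E" if t: "t \<in> B0Z" for t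
  proof -
    have "AE x in mu m b. x \<notin> E \<longrightarrow> T_rep m b y t (indicator E) x = 0"
      using inv[OF t IE] unfolding E(2) by simp
    then show ?thesis using rn_pos[OF t]
    proof eventually_elim
      case (elim x)
      have "character y (cocycle m x t) \<noteq> 0" using cmod_character[of "cocycle m x t"] by auto
      then show ?case using elim by (auto simp: T_rep_def split: split_indicator_asm)
    qed
  qed
  have "AE x in mu m b. (indicator E (fst x \<odot> t1, snd x \<odot> t2) :: complex) = indicator E x"
    if t: "t1 \<in> unitri (Delta_sub m) \<inter> B0Z" "t2 \<in> unitri (Delta_sup m) \<inter> B0Z" for t1 t2
  proof -
    \<comment> \<open>Ergodicity speaks of pairs, which are realized by the single group element
      with diagonal blocks \<open>t1\<close> and \<open>t2\<close>.\<close>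
    have t12: "t1 \<odot> t2 \<in> B0Z" using t by (intro B0Z_mult) auto
    have a: "act m x (t1 \<odot> t2) = (fst x \<odot> t1, snd x \<odot> t2)" if "x \<in> X_space m" for x
    proof -
      have u: "t1 \<in> unitri (Delta_sub m)" "t2 \<in> unitri (Delta_sup m)" using t by auto
      note BZ = u[THEN unitri_BZ]
      show ?thesis using act_eq[OF that B0Z_BZ[OF t12]]
        unfolding lower_block_mult[OF BZ] upper_block_mult[OF BZ] lower_block_sub[OF u(1)] upper_block_sub[OF u(1)] lower_block_sup[OF u(2)] upper_block_sup[OF u(2)] by simp
    qed
    show ?thesis
      using sub[OF t12] quasi_inv_AE[OF B0Z_BZ[OF t12] quasi_inv_B0Z[OF t12] sub[OF B0Z_inv[OF t12]]] AE_space
    proof eventually_elim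
      case (elim x)
      then have x: "x \<in> X_space m" by simp
      have "act m x (t1 \<odot> t2) \<in> E \<longleftrightarrow> x \<in> E"
        using elim act_inv(1)[OF x B0Z_BZ[OF t12]] by auto
      then show ?case unfolding a[OF x] by (simp split: split_indicator)
    qed
  qed
  then have "\<forall>t1\<in>unitri (Delta_sub m) \<inter> B0Z. \<forall>t2\<in>unitri (Delta_sup m) \<inter> B0Z.
    AE x in mu m b. (indicator E (fst x \<odot> t1, snd x \<odot> t2) :: complex) = indicator E x" by blast
  moreover have "(indicator E :: _ \<Rightarrow> complex) \<in> borel_measurable (mu m b)" using E(1) by simp
  ultimately have "\<exists>c::complex. AE x in mu m b. indicator E x = c"
    by (intro erg[unfolded right_ergodic_def, THEN spec[of _ "indicator E"], THEN mp, THEN mp])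
  then obtain c :: complex where c: "AE x in mu m b. indicator E x = c" ..
  show "V = {f \<in> L2 (mu m b). AE x in mu m b. f x = 0} \<or> V = L2 (mu m b)"
  proof (cases "c = 0")
    case True
    have ae: "AE x in mu m b. x \<notin> E" using c by eventually_elim (simp add: True split: split_indicator_asm)
    have "(AE x in mu m b. x \<notin> E \<longrightarrow> f x = 0) \<longleftrightarrow> (AE x in mu m b. f x = 0)" for f :: "zmat \<times> zmat \<Rightarrow> complex"
      using ae by (auto elim: eventually_elim2)
    then show ?thesis unfolding E(2) by simp
  next
    case False
    have "AE x in mu m b. x \<in> E" using c by eventually_elim (use False in \<open>auto split: split_indicator_asm\<close>)
    then have "AE x in mu m b. x \<notin> E \<longrightarrow> f x = 0" for f :: "zmat \<times> zmat \<Rightarrow> complex"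
      by eventually_elim simp
    then show ?thesis unfolding E(2) by simp
  qed
qed

end

section \<open>Generators\<close>

lemma has_vector_derivative_quotient:
  assumes "(f has_vector_derivative d) (at 0)"
  shows "((\<lambda>h. (f h - f 0) /\<^sub>R h) \<longlongrightarrow> d) (at 0)"
proof -
  have "((\<lambda>h. norm (f (0 + h) - f 0 - h *\<^sub>R d) / norm h) \<longlongrightarrow> 0) (at 0)"
    using assms by (simp add: has_vector_derivative_def has_derivative_at)
  moreover have "\<forall>\<^sub>F h in at 0. norm (f (0 + h) - f 0 - h *\<^sub>R d) / norm h = norm ((f h - f 0) /\<^sub>R h - d)"
  proof (rule eventually_at_filter[THEN iffD2], rule always_eventually, intro allI impI)
    fix h :: real assume h: "h \<noteq> 0"
    have "(f (0 + h) - f 0 - h *\<^sub>R d) /\<^sub>R h = (f (0 + h) - f 0) /\<^sub>R h - (h *\<^sub>R d) /\<^sub>R h"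
      by (rule scaleR_diff_right)
    moreover have "(h *\<^sub>R d) /\<^sub>R h = d" using h by simp
    ultimately have "(f h - f 0) /\<^sub>R h - d = (f (0 + h) - f 0 - h *\<^sub>R d) /\<^sub>R h" by (simp only: add_0)
    then have "norm ((f h - f 0) /\<^sub>R h - d) = inverse (norm h) * norm (f (0 + h) - f 0 - h *\<^sub>R d)"
      by (simp only: norm_scaleR norm_inverse real_norm_def abs_inverse)
    then show "norm (f (0 + h) - f 0 - h *\<^sub>R d) / norm h = norm ((f h - f 0) /\<^sub>R h - d)"
      by (simp only: divide_inverse mult.commute)
  qed
  ultimately have "((\<lambda>h. norm ((f h - f 0) /\<^sub>R h - d)) \<longlongrightarrow> 0) (at 0)" by (rule Lim_transform_eventually)
  then show ?thesis by (rule LIM_zero_cancel[OF tendsto_norm_zero_cancel])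
qed

lemma smooth_along_deriv:
  assumes "smooth_along F \<phi>" "i \<in> F"
  shows "((\<lambda>t. \<phi> (v(i := t))) has_vector_derivative partial_deriv i \<phi> v) (at (v i))"
proof -
  have "(\<lambda>t. \<phi> (v(i := t))) differentiable (at (v i))"
    using assms unfolding smooth_along_def by (elim ballE[of _ _ "[]"]) auto
  then show ?thesis unfolding partial_deriv_def by (simp add: vector_derivative_works)
qed

lemma smooth_along_cont: "smooth_along F \<phi> \<Longrightarrow> continuous_on UNIV \<phi>"
  unfolding smooth_along_def by (elim ballE[of _ _ "[]"]) auto

lemma smooth_along_cont_deriv: "smooth_along F \<phi> \<Longrightarrow> i \<in> F \<Longrightarrow> continuous_on UNIV (partial_deriv i \<phi>)"
  unfolding smooth_along_def by (elim ballE[of _ _ "[i]"]) auto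

text \<open>The partial derivatives are continuous, but the domain is an infinite product without a
  norm. The chain rule is therefore built up one coordinate at a time, each step being a statement
  about a function on the plane.\<close>

lemma smooth_along_line:
  assumes sm: "smooth_along F \<phi>" and S: "finite S" "S \<subseteq> F"
  shows "((\<lambda>u. \<phi> (\<lambda>j. v j + (if j \<in> S then u * c j else 0))) has_vector_derivative
    (\<Sum>i\<in>S. complex_of_real (c i) * partial_deriv i \<phi> (\<lambda>j. v j + (if j \<in> S then u * c j else 0)))) (at u)"
  using S
proof (induction S arbitrary: v rule: finite_induct)
  case empty then show ?case by simp
next
  case (insert i S)
  define w where "w p = (\<lambda>j. v j + (if j \<in> S then p * c j else 0))" for p
  \<comment> \<open>\<open>p\<close> moves the coordinates in \<open>S\<close> and \<open>q\<close>
    the new one; on the diagonal \<open>p = q = u\<close> this is the function to be differentiated.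
    One partial derivative at the point and a continuous second one give differentiability
    there.\<close>
  define H where "H p q = \<phi> ((w p)(i := w p i + q * c i))" for p q
  have i: "i \<in> F" and S: "S \<subseteq> F" using insert.prems by auto
  have eq: "(w p)(i := w p i + q * c i) = (\<lambda>j. (v(i := v i + q * c i)) j + (if j \<in> S then p * c j else 0))" for p q
    using insert.hyps by (auto simp: w_def)
  have eq': "(w u)(i := w u i + u * c i) = (\<lambda>j. v j + (if j \<in> insert i S then u * c j else 0))" for u
    using insert.hyps by (auto simp: w_def)
  let ?z = "(w u)(i := w u i + u * c i)"
  let ?D = "\<Sum>i\<in>S. complex_of_real (c i) * partial_deriv i \<phi> ?z"
  let ?fy = "\<lambda>p q. blinfun_scaleR_left (c i *\<^sub>R partial_deriv i \<phi> ((w p)(i := w p i + q * c i)))"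
  have "((\<lambda>(p, q). H p q) has_derivative (\<lambda>(tp, tq). tp *\<^sub>R ?D + ?fy u u tq)) (at (u, u) within UNIV \<times> UNIV)"
  proof (rule has_derivative_partialsI[where fy = ?fy])
    show "((\<lambda>p. H p u) has_derivative (\<lambda>tp. tp *\<^sub>R ?D)) (at u within UNIV)"
      using insert.IH[OF S, of "v(i := v i + u * c i)"] unfolding H_def eq has_vector_derivative_def by simp
    show "(H p has_derivative blinfun_apply (?fy p q)) (at q within UNIV)" for p q
    proof -
      let ?y = "(w p)(i := w p i + q * c i)"
      have "((\<lambda>t. \<phi> (?y(i := t))) has_vector_derivative partial_deriv i \<phi> ?y) (at (w p i + q * c i))"
        using smooth_along_deriv[OF sm i, of ?y] by simp
      moreover have "((\<lambda>q. w p i + q * c i) has_vector_derivative c i) (at q)"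
        by (auto intro!: derivative_eq_intros simp: has_real_derivative_iff_has_vector_derivative[symmetric])
      ultimately have "((\<lambda>t. \<phi> (?y(i := t))) \<circ> (\<lambda>q. w p i + q * c i) has_vector_derivative c i *\<^sub>R partial_deriv i \<phi> ?y) (at q)"
        by (rule vector_diff_chain_at[rotated])
      then show ?thesis by (simp add: has_vector_derivative_def o_def H_def[abs_def])
    qed
    have "continuous_on UNIV (\<lambda>x. partial_deriv i \<phi> ((w (fst x))(i := w (fst x) i + snd x * c i)))"
    proof (rule continuous_on_compose2[OF smooth_along_cont_deriv[OF sm i]])
      show "continuous_on UNIV (\<lambda>x. (w (fst x))(i := w (fst x) i + snd x * c i))"
      proof (rule continuous_on_coordinatewise_then_product)
        fix j show "continuous_on UNIV (\<lambda>x. ((w (fst x))(i := w (fst x) i + snd x * c i)) j)"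
          unfolding w_def by (cases "j = i"; cases "j \<in> S"; cases "i \<in> S") (auto intro!: continuous_intros)
      qed
    qed auto
    then have "continuous_on UNIV (\<lambda>x. ?fy (fst x) (snd x))"
      by (intro bounded_linear.continuous_on[OF bounded_linear_blinfun_scaleR_left] continuous_intros)
    then show "continuous (at (u, u) within UNIV \<times> UNIV) (\<lambda>(p, q). ?fy p q)"
      by (simp add: continuous_on_eq_continuous_within case_prod_beta')
  qed auto
  moreover have "((\<lambda>u. (u, u)) has_derivative (\<lambda>t. (t, t))) (at u)"
    by (auto intro!: derivative_eq_intros)
  ultimately have "((\<lambda>(p, q). H p q) \<circ> (\<lambda>u. (u, u)) has_derivative ((\<lambda>(tp, tq). tp *\<^sub>R ?D + ?fy u u tq) \<circ> (\<lambda>t. (t, t)))) (at u)"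
    by (intro diff_chain_at) auto
  then have "((\<lambda>u. H u u) has_vector_derivative (?D + c i *\<^sub>R partial_deriv i \<phi> ?z)) (at u)"
    by (simp add: has_vector_derivative_def o_def scaleR_add_right)
  then show ?case using insert.hyps unfolding H_def eq'
    by (simp add: scaleR_conv_of_real add.commute)
qed

text \<open>Setting the coordinates outside \<open>F\<close> to 0 does not change the value and
  moves the support into a cube that is compact by Tychonoff's theorem.\<close>

lemma bounded_test:
  fixes \<psi> :: "('i \<Rightarrow> real) \<Rightarrow> complex"
  assumes cont: "continuous_on UNIV \<psi>" and dep: "\<And>v w. (\<forall>i\<in>F. v i = w i) \<Longrightarrow> \<psi> v = \<psi> w"
    and supp: "\<And>v. \<psi> v \<noteq> 0 \<Longrightarrow> \<forall>i\<in>F. \<bar>v i\<bar> \<le> R"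
  shows "\<exists>B\<ge>0. \<forall>v. cmod (\<psi> v) \<le> B"
proof -
  let ?K = "Pi\<^sub>E UNIV (\<lambda>i. if i \<in> F then {-R..R} else {0})"
  have "compactin (product_topology (\<lambda>_. euclidean) UNIV) ?K"
    unfolding compactin_PiE by (auto simp: compact_Icc)
  then have "compact ?K" by (simp add: euclidean_product_topology)
  then have "bounded (\<psi> ` ?K)"
    by (intro compact_imp_bounded compact_continuous_image continuous_on_subset[OF cont]) auto
  then obtain B where B: "\<And>v. v \<in> ?K \<Longrightarrow> cmod (\<psi> v) \<le> B" by (auto simp: bounded_iff)
  show ?thesis
  proof (intro exI[of _ "max B 0"] conjI allI)
    fix v :: "'i \<Rightarrow> real"
    let ?v = "\<lambda>i. if i \<in> F then v i else 0"
    have e: "\<psi> v = \<psi> ?v" by (rule dep) simp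
    show "cmod (\<psi> v) \<le> max B 0"
    proof (cases "\<psi> v = 0")
      case False
      then have "\<forall>i\<in>F. \<bar>v i\<bar> \<le> R" by (rule supp)
      then have "?v \<in> ?K" by (auto simp: PiE_iff abs_le_iff)
      then show ?thesis unfolding e using B by (simp add: le_max_iff_disj)
    qed simp
  qed simp
qed

lemma partial_deriv_dep:
  assumes dep: "\<And>v w. (\<forall>i\<in>F. v i = w i) \<Longrightarrow> \<phi> v = \<phi> w" and i: "i \<in> F" and vw: "\<forall>i\<in>F. v i = w i"
  shows "partial_deriv i \<phi> v = partial_deriv i \<phi> w"
proof -
  have "(\<lambda>t. \<phi> (v(i := t))) = (\<lambda>t. \<phi> (w(i := t)))" by (rule ext, rule dep) (use vw in auto)
  then show ?thesis using vw i by (simp add: partial_deriv_def)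
qed

lemma partial_deriv_indep:
  assumes dep: "\<And>v w. (\<forall>i\<in>F. v i = w i) \<Longrightarrow> \<phi> v = \<phi> w" and i: "i \<notin> F"
  shows "partial_deriv i \<phi> v = 0"
proof -
  have "(\<lambda>t. \<phi> (v(i := t))) = (\<lambda>t. \<phi> v)" by (rule ext, rule dep) (use i in auto)
  then show ?thesis by (simp add: partial_deriv_def)
qed

text \<open>Outside the box some strict inequality \<open>R < |v j|\<close> holds and survives small
  changes of coordinate \<open>i\<close>, so the function vanishes near the point along that
  line.\<close>

lemma partial_deriv_supp:
  assumes supp: "\<And>v. \<phi> v \<noteq> 0 \<Longrightarrow> \<forall>i\<in>F. \<bar>v i\<bar> \<le> R" and i: "i \<in> F" and nz: "partial_deriv i \<phi> v \<noteq> 0"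
  shows "\<forall>j\<in>F. \<bar>v j\<bar> \<le> R"
proof (rule ccontr)
  assume "\<not> ?thesis"
  then obtain j where j: "j \<in> F" "R < \<bar>v j\<bar>" by (auto simp: not_le)
  have "\<forall>\<^sub>F t in nhds (v i). \<phi> (v(i := t)) = 0"
  proof (cases "j = i")
    case True
    have "open {t. R < \<bar>t\<bar>}" by (intro open_Collect_less continuous_intros)
    then have "\<forall>\<^sub>F t in nhds (v i). t \<in> {t. R < \<bar>t\<bar>}" using j True by (intro eventually_nhds_in_open) auto
    then show ?thesis
      by eventually_elim (use supp i in force)
  next
    case False
    then have "\<phi> (v(i := t)) = 0" for t using supp[of "v(i := t)"] j by force
    then show ?thesis by simp
  qed
  then have "((\<lambda>t. \<phi> (v(i := t))) has_vector_derivative 0) (at (v i))"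
    by (subst has_vector_derivative_cong_ev[where g = "\<lambda>_. 0"])
       (auto elim: eventually_mono dest: eventually_nhds_x_imp_x)
  then have "partial_deriv i \<phi> v = 0" unfolding partial_deriv_def by (rule vector_derivative_at)
  then show False using nz by contradiction
qed

text \<open>The function \<open>2 |F n|^2 + 2 |f|^2 - |F n - f|^2\<close> is nonnegative and tends
  to \<open>4 |f|^2\<close>. Fatou's lemma and the norm bound then leave no mass for
  \<open>|F n - f|^2\<close> in the limit.\<close>

lemma L2_tendsto_norm_le:
  assumes F: "\<And>n. F n \<in> L2 M" and f: "f \<in> L2 M" and lim: "AE x in M. (\<lambda>n. F n x) \<longlonglongrightarrow> f x"
    and le: "\<And>n. (\<integral>\<^sup>+x. ennreal ((cmod (F n x))\<^sup>2) \<partial>M) \<le> (\<integral>\<^sup>+x. ennreal ((cmod (f x))\<^sup>2) \<partial>M)"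
  shows "L2_tendsto M F f sequentially"
proof -
  note [measurable] = F[THEN L2_measurable] L2_measurable[OF f]
  define I where "I = (LINT x|M. (cmod (f x))\<^sup>2)"
  define e where "e n = (LINT x|M. (cmod (F n x - f x))\<^sup>2)" for n
  have int: "integrable M (\<lambda>x. (cmod (f x))\<^sup>2)" "integrable M (\<lambda>x. (cmod (F n x))\<^sup>2)"
    "integrable M (\<lambda>x. (cmod (F n x - f x))\<^sup>2)" for n
    using F[of n] f L2_diff[OF F f, of n] by (auto simp: L2_def)
  have I: "0 \<le> I" "\<And>n. (LINT x|M. (cmod (F n x))\<^sup>2) \<le> I" "\<And>n. 0 \<le> e n"
    using le int by (auto simp: I_def e_def nn_integral_eq_integral)
  have par: "(cmod (F n x - f x))\<^sup>2 \<le> 2 * (cmod (F n x))\<^sup>2 + 2 * (cmod (f x))\<^sup>2" for n x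
  proof -
    have "(cmod (F n x - f x))\<^sup>2 \<le> (cmod (F n x) + cmod (f x))\<^sup>2" by (intro power_mono norm_triangle_ineq4) simp
    also have "\<dots> \<le> 2 * (cmod (F n x))\<^sup>2 + 2 * (cmod (f x))\<^sup>2"
      using zero_le_power2[of "cmod (F n x) - cmod (f x)"] by (simp add: power2_sum power2_diff)
    finally show ?thesis .
  qed
  let ?h = "\<lambda>n x. 2 * (cmod (F n x))\<^sup>2 + 2 * (cmod (f x))\<^sup>2 - (cmod (F n x - f x))\<^sup>2"
  have h_int: "(LINT x|M. ?h n x) = 2 * (LINT x|M. (cmod (F n x))\<^sup>2) + 2 * I - e n" for n
    unfolding I_def e_def using int by (subst Bochner_Integration.integral_diff, auto)+
  have e_le: "e n \<le> 4 * I" for n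
  proof -
    have "0 \<le> (LINT x|M. ?h n x)" using par by (intro integral_nonneg_AE AE_I2) (simp add: algebra_simps)
    then show ?thesis using h_int[of n] I(2)[of n] by simp
  qed
  have "ennreal (4 * I) = (\<integral>\<^sup>+x. ennreal (4 * (cmod (f x))\<^sup>2) \<partial>M)"
    using int unfolding I_def by (subst nn_integral_eq_integral) auto
  also have "\<dots> = (\<integral>\<^sup>+x. liminf (\<lambda>n. ennreal (?h n x)) \<partial>M)"
  proof (rule nn_integral_cong_AE, use lim in eventually_elim)
    case (elim x)
    have "(\<lambda>n. ennreal (?h n x)) \<longlonglongrightarrow> ennreal (2 * (cmod (f x))\<^sup>2 + 2 * (cmod (f x))\<^sup>2 - (cmod (f x - f x))\<^sup>2)"
      by (intro tendsto_intros elim)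
    then have "liminf (\<lambda>n. ennreal (?h n x)) = ennreal (2 * (cmod (f x))\<^sup>2 + 2 * (cmod (f x))\<^sup>2 - (cmod (f x - f x))\<^sup>2)"
      by (rule lim_imp_Liminf[rotated]) simp
    then show ?case by simp
  qed
  also have "\<dots> \<le> liminf (\<lambda>n. \<integral>\<^sup>+x. ennreal (?h n x) \<partial>M)"
    by (rule nn_integral_liminf) measurable
  also have "\<dots> \<le> liminf (\<lambda>n. ennreal (4 * I - e n))"
  proof (intro Liminf_mono always_eventually allI)
    fix n
    have "(\<integral>\<^sup>+x. ennreal (?h n x) \<partial>M) = ennreal (LINT x|M. ?h n x)"
      using int par by (intro nn_integral_eq_integral) (auto simp: algebra_simps)
    also have "\<dots> \<le> ennreal (4 * I - e n)" unfolding h_int using I(2)[of n] by (intro ennreal_leI) simp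
    finally show "(\<integral>\<^sup>+x. ennreal (?h n x) \<partial>M) \<le> ennreal (4 * I - e n)" .
  qed
  finally have liminf: "ennreal (4 * I) \<le> liminf (\<lambda>n. ennreal (4 * I - e n))" .
  have "e \<longlonglongrightarrow> 0"
  proof (rule tendstoI)
    fix \<epsilon> :: real assume \<epsilon>: "0 < \<epsilon>"
    show "\<forall>\<^sub>F n in sequentially. dist (e n) 0 < \<epsilon>"
    proof (cases "4 * I < \<epsilon>")
      case True
      then show ?thesis using e_le I(3) by (auto intro!: always_eventually simp: dist_real_def intro: le_less_trans)
    next
      case False
      then have "ennreal (4 * I - \<epsilon>) < ennreal (4 * I)" using \<epsilon> by (intro ennreal_lessI) auto
      then have "ennreal (4 * I - \<epsilon>) < liminf (\<lambda>n. ennreal (4 * I - e n))" using liminf by (rule less_le_trans)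
      then have "\<forall>\<^sub>F n in sequentially. ennreal (4 * I - \<epsilon>) < ennreal (4 * I - e n)" by (rule less_LiminfD)
      then show ?thesis
      proof eventually_elim
        case (elim n)
        then have "4 * I - \<epsilon> < 4 * I - e n" using False by (simp add: ennreal_less_iff)
        then show ?case using I(3)[of n] by (simp add: dist_real_def)
      qed
    qed
  qed
  then show ?thesis using F f by (simp add: L2_tendsto_def e_def[abs_def])
qed

lemma nn_integral_real_mult_le:
  assumes X: "X \<in> borel_measurable M" and B: "\<And>x. cmod (\<psi> x) \<le> B"
  shows "(\<integral>\<^sup>+x. ennreal ((cmod (complex_of_real (X x) * \<psi> x))\<^sup>2) \<partial>M) \<le> ennreal (B\<^sup>2) * (\<integral>\<^sup>+x. ennreal ((X x)\<^sup>2) \<partial>M)"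
proof -
  have "(\<integral>\<^sup>+x. ennreal ((cmod (complex_of_real (X x) * \<psi> x))\<^sup>2) \<partial>M) \<le> (\<integral>\<^sup>+x. ennreal (B\<^sup>2) * ennreal ((X x)\<^sup>2) \<partial>M)"
  proof (rule nn_integral_mono)
    fix x
    have "(cmod (\<psi> x))\<^sup>2 \<le> B\<^sup>2" by (intro power_mono B) simp
    then have "(X x)\<^sup>2 * (cmod (\<psi> x))\<^sup>2 \<le> (X x)\<^sup>2 * B\<^sup>2"
      by (rule mult_left_mono) simp
    then have "(cmod (complex_of_real (X x) * \<psi> x))\<^sup>2 \<le> B\<^sup>2 * (X x)\<^sup>2"
      by (simp add: norm_mult power_mult_distrib mult.commute)
    then show "ennreal ((cmod (complex_of_real (X x) * \<psi> x))\<^sup>2) \<le> ennreal (B\<^sup>2) * ennreal ((X x)\<^sup>2)"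
      by (simp add: ennreal_mult'[symmetric] ennreal_leI)
  qed
  also have "\<dots> = ennreal (B\<^sup>2) * (\<integral>\<^sup>+x. ennreal ((X x)\<^sup>2) \<partial>M)"
    using X by (intro nn_integral_cmult) measurable
  finally show ?thesis .
qed

lemma L2_real_mult:
  assumes X: "X \<in> borel_measurable M" "(\<integral>\<^sup>+x. ennreal ((X x)\<^sup>2) \<partial>M) < \<infinity>"
    and \<psi>: "\<psi> \<in> borel_measurable M" "\<And>x. cmod (\<psi> x) \<le> B"
  shows "(\<lambda>x. complex_of_real (X x) * \<psi> x) \<in> L2 M"
  unfolding L2_iff_nn
proof
  show "(\<lambda>x. complex_of_real (X x) * \<psi> x) \<in> borel_measurable M" using X \<psi> by measurable
  have "ennreal (B\<^sup>2) * (\<integral>\<^sup>+x. ennreal ((X x)\<^sup>2) \<partial>M) < \<infinity>" using X(2) by (simp add: ennreal_mult_less_top)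
  then show "(\<integral>\<^sup>+x. ennreal ((cmod (complex_of_real (X x) * \<psi> x))\<^sup>2) \<partial>M) < \<infinity>"
    using nn_integral_real_mult_le[OF X(1), of \<psi> B] \<psi>(2) by (auto intro: le_less_trans)
qed

lemma L2_sum:
  assumes "finite S" "\<And>i. i \<in> S \<Longrightarrow> f i \<in> L2 M" shows "(\<lambda>x. \<Sum>i\<in>S. f i x) \<in> L2 M"
  using assms
proof (induction S rule: finite_induct)
  case (insert i S)
  then have "(\<lambda>x. f i x + (\<Sum>i\<in>S. f i x)) \<in> L2 M" by (intro L2_add) auto
  then show ?case using insert.hyps by simp
qed (simp add: L2_def)

section \<open>The generator of a Gaussian shear flow\<close>

locale shear_test = gauss_shear M J tg sr \<beta> q
  for M :: "'i::countable \<Rightarrow> real measure" and J tg sr \<beta> q +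
  fixes F :: "'i set" and \<phi> :: "('i \<Rightarrow> real) \<Rightarrow> complex" and R :: real
  assumes F: "finite F" and dep: "\<And>v w. (\<forall>i\<in>F. v i = w i) \<Longrightarrow> \<phi> v = \<phi> w"
    and smooth: "smooth_along F \<phi>" and supp: "\<And>v. \<phi> v \<noteq> 0 \<Longrightarrow> \<forall>i\<in>F. \<bar>v i\<bar> \<le> R"
begin

definition JF :: "nat set" where "JF = {j \<in> J. tg j \<in> F}"

lemma JF: "finite JF" "JF \<subseteq> J" "\<And>j. j \<in> JF \<Longrightarrow> tg j \<in> F"
proof -
  have "tg ` JF \<subseteq> F" "inj_on tg JF" using inj_on_subset[OF inj_tg] by (auto simp: JF_def)
  then show "finite JF" using F finite_imageD finite_subset by metis
qed (auto simp: JF_def)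

abbreviation pd :: "nat \<Rightarrow> ('i \<Rightarrow> real) \<Rightarrow> complex" where "pd j \<equiv> partial_deriv (tg j) \<phi>"

lemma \<phi>_cont: "continuous_on UNIV \<phi>" using smooth by (rule smooth_along_cont)
lemma pd_cont: "j \<in> JF \<Longrightarrow> continuous_on UNIV (pd j)" using JF smooth by (intro smooth_along_cont_deriv) auto

lemma measurable_cont: "continuous_on UNIV \<psi> \<Longrightarrow> \<psi> \<in> borel_measurable P" for \<psi> :: "('i \<Rightarrow> real) \<Rightarrow> complex"
  using borel_measurable_continuous_onI[of \<psi>] by (simp add: sets_P_borel cong: measurable_cong_sets)

lemma \<phi>_measurable [measurable]: "\<phi> \<in> borel_measurable P" by (rule measurable_cont[OF \<phi>_cont])

lemma pd_measurable: "j \<in> JF \<Longrightarrow> pd j \<in> borel_measurable P" by (rule measurable_cont[OF pd_cont])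

lemma pd_0: "j \<in> J \<Longrightarrow> j \<notin> JF \<Longrightarrow> pd j v = 0"
  using dep by (intro partial_deriv_indep[of F]) (auto simp: JF_def)

lemma \<phi>_bound: "\<exists>B\<ge>0. \<forall>v. cmod (\<phi> v) \<le> B"
  by (rule bounded_test[OF \<phi>_cont dep supp])

lemma pd_bound: assumes "j \<in> JF" shows "\<exists>B\<ge>0. \<forall>v. cmod (pd j v) \<le> B"
  by (rule bounded_test[OF pd_cont[OF assms] partial_deriv_dep[OF dep JF(3)[OF assms]]
        partial_deriv_supp[OF supp JF(3)[OF assms]]])

definition gen :: "('i \<Rightarrow> real) \<Rightarrow> complex" where
  "gen v = (\<Sum>j\<in>JF. complex_of_real (v (sr j)) * pd j v) - complex_of_real (Pl v) * \<phi> v"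

text \<open>The truncated operators of the theorem: summand \<open>j\<close> is
  \<open>x_sk D_sr\<close> with \<open>s = k - j\<close>, and \<open>j = 0\<close> gives
  \<open>D_kr\<close>. Collecting the multiplication terms turns them into \<open>Ps\<close>, while
  only finitely many derivatives survive.\<close>

definition gen_n :: "nat \<Rightarrow> ('i \<Rightarrow> real) \<Rightarrow> complex" where
  "gen_n n v = (\<Sum>j\<in>Jn n. complex_of_real (v (sr j)) * (pd j v - complex_of_real (\<beta> j * v (tg j)) * \<phi> v))"

lemma gen_n_eq:
  assumes "JF \<subseteq> Jn n"
  shows "gen_n n v = (\<Sum>j\<in>JF. complex_of_real (v (sr j)) * pd j v) - complex_of_real (Ps (Jn n) v) * \<phi> v"
proof -
  have "gen_n n v = (\<Sum>j\<in>Jn n. complex_of_real (v (sr j)) * pd j v) - complex_of_real (Ps (Jn n) v) * \<phi> v"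
    by (simp add: gen_n_def Ps_def right_diff_distrib sum_subtractf sum_distrib_left sum_distrib_right ac_simps)
  also have "(\<Sum>j\<in>Jn n. complex_of_real (v (sr j)) * pd j v) = (\<Sum>j\<in>JF. complex_of_real (v (sr j)) * pd j v)"
    using assms Jn_subset[of n] by (intro sum.mono_neutral_right) (auto simp: pd_0 subset_iff)
  finally show ?thesis .
qed

lemma eventually_JF: "\<forall>\<^sub>F n in sequentially. JF \<subseteq> Jn n"
proof -
  obtain n0 where "JF \<subseteq> {..<n0}" using JF(1) by (metis finite_nat_iff_bounded)
  then have "JF \<subseteq> Jn n" if "n0 \<le> n" for n using that JF(2) by (auto simp: Jn_def)
  then show ?thesis by (auto simp: eventually_sequentially)
qed

text \<open>\<open>Pl\<close> is a limit along the subsequence \<open>fast\<close> only, but Fatou's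
  lemma bounds its distance to every partial sum, so the full sequence converges to it in
  \<open>L2\<close>.\<close>

lemma nn_integral_Ps_Pl: "(\<integral>\<^sup>+v. ennreal ((Ps (Jn n) v - Pl v)\<^sup>2) \<partial>P) \<le> ennreal (tail n)"
proof -
  have "(\<integral>\<^sup>+v. ennreal ((Ps (Jn n) v - Pl v)\<^sup>2) \<partial>P) = (\<integral>\<^sup>+v. liminf (\<lambda>i. ennreal ((Ps (Jn (fast i)) v - Ps (Jn n) v)\<^sup>2)) \<partial>P)"
  proof (rule nn_integral_cong_AE, use AE_good in eventually_elim)
    case (elim v)
    have "(\<lambda>i. ennreal ((Ps (Jn (fast i)) v - Ps (Jn n) v)\<^sup>2)) \<longlonglongrightarrow> ennreal ((Pl v - Ps (Jn n) v)\<^sup>2)"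
      by (intro tendsto_intros Ps_lim elim)
    then have "liminf (\<lambda>i. ennreal ((Ps (Jn (fast i)) v - Ps (Jn n) v)\<^sup>2)) = ennreal ((Pl v - Ps (Jn n) v)\<^sup>2)"
      by (rule lim_imp_Liminf[rotated]) simp
    then show ?case by (simp add: power2_commute)
  qed
  also have "\<dots> \<le> liminf (\<lambda>i. \<integral>\<^sup>+v. ennreal ((Ps (Jn (fast i)) v - Ps (Jn n) v)\<^sup>2) \<partial>P)"
    by (rule nn_integral_liminf) measurable
  also have "\<dots> \<le> liminf (\<lambda>i. ennreal (tail n))"
  proof (rule Liminf_mono, unfold eventually_sequentially, intro exI allI impI)
    fix i assume "n \<le> i"
    then have "n \<le> fast i" using fast(1)[of i] by simp
    then show "(\<integral>\<^sup>+v. ennreal ((Ps (Jn (fast i)) v - Ps (Jn n) v)\<^sup>2) \<partial>P) \<le> ennreal (tail n)"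
      by (rule nn_integral_Ps_diff)
  qed
  also have "\<dots> = ennreal (tail n)" by (simp add: Liminf_const)
  finally show ?thesis .
qed

lemma nn_integral_sr_square: "j \<in> J \<Longrightarrow> (\<integral>\<^sup>+v. ennreal ((v (sr j))\<^sup>2) \<partial>P) < \<infinity>"
  using nn_integral_component[of "\<lambda>z. ennreal (z\<^sup>2)" "sr j"] M_sr by simp

lemma sum_pd_L2: "(\<lambda>v. \<Sum>j\<in>JF. complex_of_real (v (sr j)) * pd j v) \<in> L2 P"
proof (rule L2_sum[OF JF(1)])
  fix j assume j: "j \<in> JF"
  obtain B where "0 \<le> B" "\<And>v. cmod (pd j v) \<le> B" using pd_bound[OF j] by blast
  then show "(\<lambda>v. complex_of_real (v (sr j)) * pd j v) \<in> L2 P"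
    using j JF(2) pd_measurable[OF j] by (intro L2_real_mult nn_integral_sr_square) auto
qed

lemma diff_L2: "(\<lambda>v. complex_of_real (Ps (Jn n) v - Pl v) * \<phi> v) \<in> L2 P"
proof -
  obtain B where "0 \<le> B" "\<And>v. cmod (\<phi> v) \<le> B" using \<phi>_bound by blast
  then show ?thesis using nn_integral_Ps_Pl[of n]
    by (intro L2_real_mult[where B = B]) (auto intro: le_less_trans)
qed

lemma Ps_\<phi>_L2: "(\<lambda>v. complex_of_real (Ps (Jn n) v) * \<phi> v) \<in> L2 P"
proof -
  obtain B where "0 \<le> B" "\<And>v. cmod (\<phi> v) \<le> B" using \<phi>_bound by blast
  then show ?thesis using nn_integral_Ps_square[OF Jn_finite Jn_subset, of n]
    by (intro L2_real_mult[where B = B]) auto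
qed

lemma gen_L2: "gen \<in> L2 P"
proof -
  have "(\<lambda>v. complex_of_real (Pl v) * \<phi> v) \<in> L2 P"
    using L2_diff[OF Ps_\<phi>_L2[of 0] diff_L2[of 0]] by (simp add: algebra_simps)
  then show ?thesis unfolding gen_def[abs_def] by (intro L2_diff sum_pd_L2)
qed

lemma gen_n_tendsto: "L2_tendsto P gen_n gen sequentially"
  unfolding L2_tendsto_def
proof (intro conjI gen_L2)
  show "\<forall>\<^sub>F n in sequentially. gen_n n \<in> L2 P"
    using eventually_JF
  proof eventually_elim
    case (elim n)
    then have "gen_n n = (\<lambda>v. (\<Sum>j\<in>JF. complex_of_real (v (sr j)) * pd j v) - complex_of_real (Ps (Jn n) v) * \<phi> v)"
      by (intro ext gen_n_eq)
    then show ?case using L2_diff[OF sum_pd_L2 Ps_\<phi>_L2] by simp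
  qed
  obtain B where B: "0 \<le> B" "\<And>v. cmod (\<phi> v) \<le> B" using \<phi>_bound by blast
  show "(\<lambda>n. LINT v|P. (cmod (gen_n n v - gen v))\<^sup>2) \<longlonglongrightarrow> 0"
  proof (rule Lim_null_comparison)
    show "(\<lambda>n. B\<^sup>2 * tail n) \<longlonglongrightarrow> 0" using tendsto_mult_left[OF tail_tendsto, of "B\<^sup>2"] by simp
    show "\<forall>\<^sub>F n in sequentially. norm (LINT v|P. (cmod (gen_n n v - gen v))\<^sup>2) \<le> B\<^sup>2 * tail n"
      using eventually_JF
    proof eventually_elim
      case (elim n)
      have t0: "0 \<le> tail n" unfolding tail_def
        using \<beta>_pos q_nonneg summable_ignore_initial_segment[OF summable_\<beta>q, of n]
        by (intro suminf_nonneg) (auto simp: less_imp_le)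
      have e: "cmod (gen_n n v - gen v) = cmod (complex_of_real (Ps (Jn n) v - Pl v) * \<phi> v)" for v
        unfolding gen_n_eq[OF elim] gen_def
        by (subst norm_minus_commute) (simp add: algebra_simps)
      have "(LINT v|P. (cmod (gen_n n v - gen v))\<^sup>2) =
        enn2real (\<integral>\<^sup>+v. ennreal ((cmod (complex_of_real (Ps (Jn n) v - Pl v) * \<phi> v))\<^sup>2) \<partial>P)"
        unfolding e by (rule integral_eq_nn_integral) auto
      also have "\<dots> \<le> enn2real (ennreal (B\<^sup>2) * ennreal (tail n))"
      proof (rule enn2real_mono)
        show "(\<integral>\<^sup>+v. ennreal ((cmod (complex_of_real (Ps (Jn n) v - Pl v) * \<phi> v))\<^sup>2) \<partial>P) \<le> ennreal (B\<^sup>2) * ennreal (tail n)"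
          using nn_integral_Ps_Pl[of n] B
          by (intro order_trans[OF nn_integral_real_mult_le[where B = B]] mult_left_mono) auto
      qed (simp add: ennreal_mult_less_top)
      also have "\<dots> = B\<^sup>2 * tail n" using t0 by (simp add: ennreal_mult'[symmetric])
      finally show ?case by simp
    qed
  qed
qed

definition U :: "real \<Rightarrow> (('i \<Rightarrow> real) \<Rightarrow> complex) \<Rightarrow> ('i \<Rightarrow> real) \<Rightarrow> complex" where
  "U u f v = complex_of_real (sqrt (\<rho> u v)) * f (shear J u v)"

lemma sqrt_\<rho>: "sqrt (\<rho> u v) = exp (- u * Pl v - u\<^sup>2 * Ql v / 2)"
proof -
  have "\<rho> u v = (exp (- u * Pl v - u\<^sup>2 * Ql v / 2))\<^sup>2"
    by (simp add: \<rho>_def exp_double[symmetric])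
  then show ?thesis by (simp add: real_sqrt_abs)
qed

lemma U_measurable: "f \<in> borel_measurable P \<Longrightarrow> U u f \<in> borel_measurable P"
proof -
  assume "f \<in> borel_measurable P"
  then have [measurable]: "(\<lambda>v. f (shear J u v)) \<in> borel_measurable P"
    by (rule measurable_compose[OF shear_measurable])
  have "(\<lambda>v. complex_of_real (sqrt (\<rho> u v)) * f (shear J u v)) \<in> borel_measurable P"
    using \<rho>_measurable[of u] by simp
  then show ?thesis by (simp add: U_def[abs_def])
qed

lemma U_norm:
  assumes f: "f \<in> borel_measurable P"
  shows "(\<integral>\<^sup>+v. ennreal ((cmod (U u f v))\<^sup>2) \<partial>P) = (\<integral>\<^sup>+v. ennreal ((cmod (f v))\<^sup>2) \<partial>P)"
proof -
  have m: "(\<lambda>v. ennreal ((cmod (f (shear J u v)))\<^sup>2)) \<in> borel_measurable P"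
    using measurable_compose[OF shear_measurable f, of J u] by measurable
  have "(\<integral>\<^sup>+v. ennreal ((cmod (U u f v))\<^sup>2) \<partial>P) = (\<integral>\<^sup>+v. ennreal ((cmod (f (shear J u v)))\<^sup>2) * ennreal (\<rho> u v) \<partial>P)"
    by (intro nn_integral_cong)
       (simp add: U_def norm_mult power_mult_distrib less_imp_le ennreal_mult'[symmetric] mult.commute)
  also have "\<dots> = (\<integral>\<^sup>+v. ennreal ((cmod (f (shear J u (shear J (- u) v))))\<^sup>2) \<partial>P)"
    by (rule nn_integral_shear[OF m, symmetric])
  finally show ?thesis by (simp add: shear_add shear_0)
qed

lemma shear_continuous: "continuous_on UNIV (\<lambda>u. shear J u v)"
proof (rule continuous_on_coordinatewise_then_product)
  fix i show "continuous_on UNIV (\<lambda>u. shear J u v i)"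
    by (cases "i \<in> tg ` J") (auto simp: shear_def intro!: continuous_intros)
qed

lemma \<phi>_shear_derivative:
  "((\<lambda>u. \<phi> (shear J u v)) has_vector_derivative (\<Sum>j\<in>JF. complex_of_real (v (sr j)) * pd j (shear J u v))) (at u)"
proof -
  define c where "c i = v (sr (the_inv_into J tg i))" for i
  have c: "c (tg j) = v (sr j)" if "j \<in> J" for j
    using that by (simp add: c_def the_inv_into_f_f[OF inj_tg])
  let ?l = "\<lambda>u j. v j + (if j \<in> tg ` JF then u * c j else 0)"
  have ag: "\<forall>i\<in>F. shear J u v i = ?l u i" for u
    by (auto simp: shear_def c_def JF_def)
  have "((\<lambda>u. \<phi> (?l u)) has_vector_derivative (\<Sum>i\<in>tg ` JF. complex_of_real (c i) * partial_deriv i \<phi> (?l u))) (at u)"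
    by (rule smooth_along_line[OF smooth]) (use JF in auto)
  moreover have "(\<Sum>i\<in>tg ` JF. complex_of_real (c i) * partial_deriv i \<phi> (?l u)) =
    (\<Sum>j\<in>JF. complex_of_real (v (sr j)) * pd j (shear J u v))"
  proof (subst sum.reindex[OF inj_on_subset[OF inj_tg JF(2)]], rule sum.cong)
    fix j assume j: "j \<in> JF"
    have "pd j (?l u) = pd j (shear J u v)"
      using partial_deriv_dep[OF dep JF(3)[OF j] ag[of u]] by simp
    then show "((\<lambda>i. complex_of_real (c i) * partial_deriv i \<phi> (?l u)) \<circ> tg) j = complex_of_real (v (sr j)) * pd j (shear J u v)"
      using c j JF(2) by (auto simp del: of_real_eq_iff)
  qed simp
  moreover have "(\<lambda>u. \<phi> (?l u)) = (\<lambda>u. \<phi> (shear J u v))"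
    by (rule ext, rule dep) (use ag in auto)
  ultimately show ?thesis by simp
qed

text \<open>The logarithmic derivative of \<open>sqrt (\<rho> u v)\<close> in \<open>u\<close> is
  \<open>- (Pl v + u * Ql v)\<close>, which by \<open>good_shear\<close> is \<open>- Pl\<close> at
  the sheared point. Hence the derivative at every \<open>u\<close>, not only at 0, is the flow
  applied to \<open>gen\<close>.\<close>

lemma U_derivative:
  assumes v: "v \<in> good"
  shows "((\<lambda>u. U u \<phi> v) has_vector_derivative U u gen v) (at u)"
proof -
  have "((\<lambda>u. sqrt (\<rho> u v)) has_real_derivative - (Pl v + u * Ql v) * sqrt (\<rho> u v)) (at u)"
    unfolding sqrt_\<rho> by (auto intro!: derivative_eq_intros)
  then have "((\<lambda>u. sqrt (\<rho> u v) *\<^sub>R \<phi> (shear J u v)) has_vector_derivative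
    sqrt (\<rho> u v) *\<^sub>R (\<Sum>j\<in>JF. complex_of_real (v (sr j)) * pd j (shear J u v)) +
    (- (Pl v + u * Ql v) * sqrt (\<rho> u v)) *\<^sub>R \<phi> (shear J u v)) (at u)"
    by (intro has_vector_derivative_scaleR \<phi>_shear_derivative)
  moreover have "sqrt (\<rho> u v) *\<^sub>R (\<Sum>j\<in>JF. complex_of_real (v (sr j)) * pd j (shear J u v)) +
    (- (Pl v + u * Ql v) * sqrt (\<rho> u v)) *\<^sub>R \<phi> (shear J u v) = U u gen v"
  proof -
    have e: "gen (shear J u v) = (\<Sum>j\<in>JF. complex_of_real (v (sr j)) * pd j (shear J u v)) - complex_of_real (Pl v + u * Ql v) * \<phi> (shear J u v)"
      using JF(2) by (simp add: gen_def good_shear[OF v] shear_sr subset_iff cong: sum.cong)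
    show ?thesis unfolding U_def e scaleR_conv_of_real right_diff_distrib
      by (simp add: algebra_simps)
  qed
  ultimately show ?thesis by (simp add: U_def scaleR_conv_of_real)
qed

lemma U_gen_continuous:
  assumes v: "v \<in> good" shows "continuous_on UNIV (\<lambda>u. U u gen v)"
proof -
  have e: "U u gen v = complex_of_real (exp (- u * Pl v - u\<^sup>2 * Ql v / 2)) *
    ((\<Sum>j\<in>JF. complex_of_real (v (sr j)) * pd j (shear J u v)) - complex_of_real (Pl v + u * Ql v) * \<phi> (shear J u v))" for u
    using JF(2) by (simp add: U_def sqrt_\<rho> gen_def good_shear[OF v] shear_sr subset_iff cong: sum.cong)
  have "continuous_on UNIV (\<lambda>u. \<phi> (shear J u v))"
    by (rule continuous_on_compose2[OF \<phi>_cont shear_continuous]) auto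
  moreover have "continuous_on UNIV (\<lambda>u. pd j (shear J u v))" if "j \<in> JF" for j
    by (rule continuous_on_compose2[OF pd_cont[OF that] shear_continuous]) auto
  ultimately show ?thesis unfolding e by (auto intro!: continuous_intros)
qed

text \<open>By the fundamental theorem of calculus the quotient is the average of
  \<open>U (\<theta> * t) gen v\<close> over \<open>\<theta>\<close> in an interval of length one;
  Cauchy-Schwarz bounds the square of an average by the average of squares.\<close>

lemma difference_quotient_le:
  assumes v: "v \<in> good" and t: "t \<noteq> 0"
  shows "ennreal ((cmod ((U t \<phi> v - \<phi> v) / complex_of_real t))\<^sup>2) \<le>
    (\<integral>\<^sup>+\<theta>. ennreal ((cmod (U (\<theta> * t) gen v))\<^sup>2) * indicator {0..1} \<theta> \<partial>lborel)"
proof -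
  let ?k = "\<lambda>\<theta>. U (\<theta> * t) gen v"
  have cont: "continuous_on A ?k" for A
    by (rule continuous_on_compose2[OF U_gen_continuous[OF v], of A "\<lambda>\<theta>. \<theta> * t"]) (auto intro!: continuous_intros)
  have d: "((\<lambda>\<theta>. U (\<theta> * t) \<phi> v) has_vector_derivative t *\<^sub>R ?k \<theta>) (at \<theta> within {0..1})" for \<theta>
  proof -
    have "((\<lambda>\<theta>. \<theta> * t) has_vector_derivative t) (at \<theta>)"
      by (auto intro!: derivative_eq_intros simp: has_real_derivative_iff_has_vector_derivative[symmetric])
    from vector_diff_chain_at[OF this U_derivative[OF v]] show ?thesis
      by (simp add: o_def has_vector_derivative_at_within)
  qed
  have "(LINT \<theta>|lborel. indicator {0..1} \<theta> *\<^sub>R (t *\<^sub>R ?k \<theta>)) = U (1 * t) \<phi> v - U (0 * t) \<phi> v"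
    by (rule integral_FTC_Icc) (auto intro: d continuous_intros cont)
  also have "U (0 * t) \<phi> v = \<phi> v" by (simp add: U_def \<rho>_def shear_0)
  also have "(LINT \<theta>|lborel. indicator {0..1} \<theta> *\<^sub>R (t *\<^sub>R ?k \<theta>)) = complex_of_real t * (LINT \<theta>|lborel. indicator {0..1} \<theta> *\<^sub>R ?k \<theta>)"
    by (subst integral_mult_right_zero[symmetric]) (simp add: scaleR_conv_of_real ac_simps)
  finally have e: "(U t \<phi> v - \<phi> v) / complex_of_real t = (LINT \<theta>|lborel. indicator {0..1} \<theta> *\<^sub>R ?k \<theta>)"
    using t by (simp add: field_simps)
  have int: "integrable lborel (\<lambda>\<theta>. indicator {0..1} \<theta> *\<^sub>R ?k \<theta>)"
    using borel_integrable_compact[of "{0..1::real}" ?k] cont by simp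
  have km [measurable]: "?k \<in> borel_measurable borel" by (rule borel_measurable_continuous_onI[OF cont])
  have "ennreal (cmod (LINT \<theta>|lborel. indicator {0..1} \<theta> *\<^sub>R ?k \<theta>)) \<le> (\<integral>\<^sup>+\<theta>. ennreal (cmod (indicator {0..1} \<theta> *\<^sub>R ?k \<theta>)) \<partial>lborel)"
    by (rule integral_norm_bound_ennreal[OF int])
  also have "\<dots> = (\<integral>\<^sup>+\<theta>. (ennreal (cmod (?k \<theta>)) * indicator {0..1} \<theta>) * indicator {0..1} \<theta> \<partial>lborel)"
    by (intro nn_integral_cong) (auto split: split_indicator)
  finally have "(ennreal (cmod (LINT \<theta>|lborel. indicator {0..1} \<theta> *\<^sub>R ?k \<theta>)))\<^sup>2 \<le>
    (\<integral>\<^sup>+\<theta>. (ennreal (cmod (?k \<theta>)) * indicator {0..1} \<theta>) * indicator {0..1} \<theta> \<partial>lborel)\<^sup>2"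
    by (intro power_mono) auto
  also have "\<dots> \<le> (\<integral>\<^sup>+\<theta>. (ennreal (cmod (?k \<theta>)) * indicator {0..1} \<theta>)\<^sup>2 \<partial>lborel) * (\<integral>\<^sup>+\<theta>. (indicator {0..1::real} \<theta>)\<^sup>2 \<partial>lborel)"
    by (rule Cauchy_Schwarz_nn_integral) (use km in \<open>auto intro!: borel_measurable_times_ennreal\<close>)
  also have "(\<integral>\<^sup>+\<theta>. (indicator {0..1::real} \<theta>)\<^sup>2 \<partial>lborel) = (\<integral>\<^sup>+\<theta>. indicator {0..1::real} \<theta> \<partial>lborel)"
    by (intro nn_integral_cong) (auto split: split_indicator)
  also have "\<dots> = 1" by simp
  also have "(\<integral>\<^sup>+\<theta>. (ennreal (cmod (?k \<theta>)) * indicator {0..1} \<theta>)\<^sup>2 \<partial>lborel) =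
    (\<integral>\<^sup>+\<theta>. ennreal ((cmod (?k \<theta>))\<^sup>2) * indicator {0..1} \<theta> \<partial>lborel)"
    by (intro nn_integral_cong) (auto simp: ennreal_power split: split_indicator)
  finally show ?thesis unfolding e by (simp add: ennreal_power)
qed

text \<open>Tonelli's theorem puts the integral over \<open>v\<close> inside, where each
  \<open>U (\<theta> * t)\<close> is isometric, so the bound does not depend on
  \<open>\<theta>\<close> or \<open>t\<close>.\<close>

lemma difference_quotient_norm:
  assumes t: "t \<noteq> 0"
  shows "(\<integral>\<^sup>+v. ennreal ((cmod ((U t \<phi> v - \<phi> v) / complex_of_real t))\<^sup>2) \<partial>P) \<le> (\<integral>\<^sup>+v. ennreal ((cmod (gen v))\<^sup>2) \<partial>P)"
proof -
  interpret pair_sigma_finite P "lborel :: real measure" ..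
  have gm [measurable]: "gen \<in> borel_measurable P" using gen_L2 by (rule L2_measurable)
  have sm: "(\<lambda>p. shear J (snd p * t) (fst p)) \<in> measurable (P \<Otimes>\<^sub>M lborel) P"
    by (rule shear_measurable_pair) measurable
  have [measurable]: "(\<lambda>p. gen (shear J (snd p * t) (fst p))) \<in> borel_measurable (P \<Otimes>\<^sub>M lborel)"
    by (rule measurable_compose[OF sm gm])
  have m: "(\<lambda>(v, \<theta>). ennreal ((cmod (U (\<theta> * t) gen v))\<^sup>2) * indicator {0..1} \<theta>) \<in> borel_measurable (P \<Otimes>\<^sub>M lborel)"
    unfolding U_def \<rho>_def case_prod_beta' by measurable
  have "(\<integral>\<^sup>+v. ennreal ((cmod ((U t \<phi> v - \<phi> v) / complex_of_real t))\<^sup>2) \<partial>P) \<le>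
    (\<integral>\<^sup>+v. (\<integral>\<^sup>+\<theta>. ennreal ((cmod (U (\<theta> * t) gen v))\<^sup>2) * indicator {0..1} \<theta> \<partial>lborel) \<partial>P)"
    using AE_good by (intro nn_integral_mono_AE) (auto elim!: eventually_mono intro: difference_quotient_le[OF _ t])
  also have "\<dots> = (\<integral>\<^sup>+\<theta>. (\<integral>\<^sup>+v. ennreal ((cmod (U (\<theta> * t) gen v))\<^sup>2) * indicator {0..1} \<theta> \<partial>P) \<partial>lborel)"
    by (rule Fubini'[OF m, symmetric])
  also have "\<dots> = (\<integral>\<^sup>+\<theta>. (\<integral>\<^sup>+v. ennreal ((cmod (gen v))\<^sup>2) \<partial>P) * indicator {0..1::real} \<theta> \<partial>lborel)"
  proof (rule nn_integral_cong)
    fix \<theta> :: real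
    have "(\<lambda>v. ennreal ((cmod (U (\<theta> * t) gen v))\<^sup>2)) \<in> borel_measurable P" using U_measurable[OF gm] by measurable
    then show "(\<integral>\<^sup>+v. ennreal ((cmod (U (\<theta> * t) gen v))\<^sup>2) * indicator {0..1} \<theta> \<partial>P) = (\<integral>\<^sup>+v. ennreal ((cmod (gen v))\<^sup>2) \<partial>P) * indicator {0..1} \<theta>"
      by (subst nn_integral_multc) (auto simp: U_norm[OF gm])
  qed
  also have "\<dots> = (\<integral>\<^sup>+v. ennreal ((cmod (gen v))\<^sup>2) \<partial>P)"
    by (subst nn_integral_cmult) auto
  finally show ?thesis .
qed

lemma \<phi>_L2: "\<phi> \<in> L2 P"
proof -
  obtain B where "0 \<le> B" "\<And>v. cmod (\<phi> v) \<le> B" using \<phi>_bound by blast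
  then show ?thesis using L2_real_mult[of "\<lambda>_. 1" P \<phi> B] P.emeasure_space_1 by simp
qed

lemma quotient_L2: "(\<lambda>v. (U t \<phi> v - \<phi> v) / complex_of_real t) \<in> L2 P"
proof -
  have "U t \<phi> \<in> L2 P" using \<phi>_L2 U_norm[OF \<phi>_measurable] U_measurable[OF \<phi>_measurable] by (simp add: L2_iff_nn)
  then have "(\<lambda>v. inverse (complex_of_real t) * (U t \<phi> v - \<phi> v)) \<in> L2 P"
    by (intro L2_cmult L2_diff \<phi>_L2)
  then show ?thesis by (simp add: divide_inverse mult.commute)
qed

theorem U_generator: "L2_tendsto P (\<lambda>t v. (U t \<phi> v - \<phi> v) / complex_of_real t) gen (at 0)"
  unfolding L2_tendsto_at_iff[OF quotient_L2]
proof (intro allI impI)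
  fix X :: "nat \<Rightarrow> real" assume X: "\<forall>i. X i \<noteq> 0" "X \<longlonglongrightarrow> 0"
  show "L2_tendsto P (\<lambda>n v. (U (X n) \<phi> v - \<phi> v) / complex_of_real (X n)) gen sequentially"
  proof (rule L2_tendsto_norm_le[OF quotient_L2 gen_L2 _ difference_quotient_norm])
    show "X n \<noteq> 0" for n using X by simp
    show "AE v in P. (\<lambda>n. (U (X n) \<phi> v - \<phi> v) / complex_of_real (X n)) \<longlonglongrightarrow> gen v"
      using AE_good
    proof eventually_elim
      case (elim v)
      have 0: "U 0 f v = f v" for f by (simp add: U_def \<rho>_def shear_0)
      have "((\<lambda>u. U u \<phi> v) has_vector_derivative gen v) (at 0)"
        using U_derivative[OF elim, of 0] by (simp add: 0)
      then have "((\<lambda>t. (U t \<phi> v - \<phi> v) /\<^sub>R t) \<longlongrightarrow> gen v) (at 0)"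
        by (rule has_vector_derivative_quotient[where f = "\<lambda>u. U u \<phi> v", unfolded 0])
      moreover have "filterlim X (at 0) sequentially" using X by (auto simp: filterlim_at)
      ultimately have "(\<lambda>n. (U (X n) \<phi> v - \<phi> v) /\<^sub>R X n) \<longlonglongrightarrow> gen v" by (rule filterlim_compose)
      then show ?case by (simp add: scaleR_conv_of_real divide_inverse mult.commute)
    qed
  qed
qed

end

section \<open>Transfer of the generators to the matrix group\<close>

lemma L2_cong: "(\<And>x. x \<in> space M \<Longrightarrow> f x = g x) \<Longrightarrow> f \<in> L2 M \<longleftrightarrow> g \<in> L2 M"
  unfolding L2_def mem_Collect_eq
  by (intro conj_cong measurable_cong Bochner_Integration.integrable_cong) auto

lemma L2_tendsto_cong:
  assumes F: "\<And>i x. x \<in> space M \<Longrightarrow> F i x = F' i x" and g: "\<And>x. x \<in> space M \<Longrightarrow> g x = g' x"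
    and lim: "L2_tendsto M F g \<FF>"
  shows "L2_tendsto M F' g' \<FF>"
proof -
  have "F i \<in> L2 M \<longleftrightarrow> F' i \<in> L2 M" for i using F by (rule L2_cong)
  moreover have "g \<in> L2 M \<longleftrightarrow> g' \<in> L2 M" using g by (rule L2_cong)
  moreover have "(LINT x|M. (cmod (F i x - g x))\<^sup>2) = (LINT x|M. (cmod (F' i x - g' x))\<^sup>2)" for i
    using F g by (intro Bochner_Integration.integral_cong) auto
  ultimately show ?thesis using lim by (simp add: L2_tendsto_def)
qed

lemma L2_tendsto_Suc:
  assumes "L2_tendsto M F g sequentially" shows "L2_tendsto M (\<lambda>n. F (Suc n)) g sequentially"
  using assms unfolding L2_tendsto_def
  by (auto intro: LIMSEQ_Suc eventually_sequentially_Suc[THEN iffD2])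

lemma sum_descending:
  "(\<Sum>j<Suc N. g (k - int j)) = (\<Sum>s\<in>{k - int N..<k}. g s) + (g k :: complex)"
proof -
  have "(\<Sum>j<Suc N. g (k - int j)) = g k + (\<Sum>j\<in>{1..N}. g (k - int j))"
    by (subst lessThan_Suc_atMost, subst atMost_atLeast0, subst sum.atLeast_Suc_atMost) auto
  also have "(\<Sum>j\<in>{1..N}. g (k - int j)) = (\<Sum>s\<in>{k - int N..<k}. g s)"
    by (rule sum.reindex_bij_witness[of _ "\<lambda>s. nat (k - s)" "\<lambda>j. k - int j"]) auto
  finally show ?thesis by simp
qed

lemma coords_translate:
  "coords m (translate m s r t x) = (coords m x)((s, r) := coords m x (s, r) + t)"
  by (auto simp: coords_def coord_def translate_def Let_def fun_eq_iff)

context setting begin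

lemma L2_coords: assumes f: "f \<in> L2 (nu m b)" shows "(\<lambda>x. f (coords m x)) \<in> L2 (mu m b)"
proof -
  have fm: "f \<in> borel_measurable (nu m b)" using f by (rule L2_measurable)
  then have "(\<lambda>v. ennreal ((cmod (f v))\<^sup>2)) \<in> borel_measurable (nu m b)" by measurable
  from nn_integral_mu_coords[OF this] show ?thesis
    using f measurable_compose[OF coords_nu fm] by (simp add: L2_iff_nn)
qed

lemma L2_tendsto_coords:
  assumes "L2_tendsto (nu m b) F g \<FF>"
  shows "L2_tendsto (mu m b) (\<lambda>i x. F i (coords m x)) (\<lambda>x. g (coords m x)) \<FF>"
  unfolding L2_tendsto_def
proof (intro conjI)
  have F: "\<forall>\<^sub>F i in \<FF>. F i \<in> L2 (nu m b)" and g: "g \<in> L2 (nu m b)"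
    and lim: "((\<lambda>i. LINT v|nu m b. (cmod (F i v - g v))\<^sup>2) \<longlongrightarrow> 0) \<FF>"
    using assms by (auto simp: L2_tendsto_def)
  show "\<forall>\<^sub>F i in \<FF>. (\<lambda>x. F i (coords m x)) \<in> L2 (mu m b)" using F by eventually_elim (rule L2_coords)
  show "(\<lambda>x. g (coords m x)) \<in> L2 (mu m b)" using g by (rule L2_coords)
  have "\<forall>\<^sub>F i in \<FF>. (LINT v|nu m b. (cmod (F i v - g v))\<^sup>2) = (LINT x|mu m b. (cmod (F i (coords m x) - g (coords m x)))\<^sup>2)"
    using F
  proof eventually_elim
    case (elim i)
    note [measurable] = L2_measurable[OF elim] L2_measurable[OF g]
    have "(\<lambda>v. (cmod (F i v - g v))\<^sup>2) \<in> borel_measurable (nu m b)" by measurable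
    then have "(LINT v|distr (mu m b) (nu m b) (coords m). (cmod (F i v - g v))\<^sup>2) = (LINT x|mu m b. (cmod (F i (coords m x) - g (coords m x)))\<^sup>2)"
      by (rule integral_distr[OF coords_nu])
    then show ?case by (simp only: distr_mu_nu)
  qed
  with lim show "((\<lambda>i. LINT x|mu m b. (cmod (F i (coords m x) - g (coords m x)))\<^sup>2) \<longlongrightarrow> 0) \<FF>"
    by (rule Lim_transform_eventually)
qed

lemma cocycle_elem:
  assumes kr: "(k, r) \<in> Idx m" and x: "x \<in> X_space m" shows "cocycle m x (mat_elem k r t) = mat_id"
proof (intro ext)
  fix i n
  have BZ: "mat_elem k r t \<in> BZ" using Idx_less[OF kr] by simp
  have off: "(k, r) \<notin> Delta_mid m" using kr by (auto simp: Idx_def Delta_sub_def Delta_sup_def Delta_mid_def)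
  show "cocycle m x (mat_elem k r t) i n = mat_id i n"
  proof (cases "(i, n) \<in> Delta_mid m")
    case False
    then show ?thesis using unitri_entry[OF cocycle_char(1)[OF x BZ]] by simp
  next
    case True
    then have "i \<le> m" "m < n" by (auto simp: Delta_mid_def)
    then have "cocycle m x (mat_elem k r t) i n = 0"
      using cocycle_entry[OF x BZ, of i n "{}"] off
      by (auto simp: mat_elem_def mat_id_def Delta_mid_def split: if_splits)
    then show ?thesis using \<open>i \<le> m\<close> \<open>m < n\<close> by (simp add: mat_id_def)
  qed
qed

context
  fixes F :: "(int \<times> int) set" and \<phi> :: "(int \<times> int \<Rightarrow> real) \<Rightarrow> complex" and R :: real and f
  assumes F: "finite F" and dep: "\<And>v w. (\<forall>i\<in>F. v i = w i) \<Longrightarrow> \<phi> v = \<phi> w"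
    and smooth: "smooth_along F \<phi>" and supp: "\<And>v. \<phi> v \<noteq> 0 \<Longrightarrow> \<forall>i\<in>F. \<bar>v i\<bar> \<le> R"
    and f: "f = (\<lambda>x. \<phi> (coords m x))"
begin

lemma shear_test: "(k, r) \<in> Idx m \<Longrightarrow> shear_test (coordM m b) (shear_rows k r) (shear_index k r) (shear_index k k) (shear_prec k r) (shear_var k r) F \<phi> R"
  by (intro shear_test.intro gauss_shear shear_test_axioms.intro F smooth) (use dep supp in blast)+

lemma D_op_coords:
  "D_op m b s r f x = partial_deriv (s, r) \<phi> (coords m x) - complex_of_real (b s r * coords m x (s, r)) * \<phi> (coords m x)"
proof -
  let ?v = "coords m x"
  have "((\<lambda>t. \<phi> (?v((s, r) := ?v (s, r) + t))) has_vector_derivative partial_deriv (s, r) \<phi> ?v) (at 0)"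
  proof (cases "(s, r) \<in> F")
    case True
    have "((\<lambda>t. ?v (s, r) + t) has_vector_derivative 1) (at 0)"
      by (auto intro!: derivative_eq_intros simp: has_real_derivative_iff_has_vector_derivative[symmetric])
    moreover have "((\<lambda>t. \<phi> (?v((s, r) := t))) has_vector_derivative partial_deriv (s, r) \<phi> ?v) (at (?v (s, r) + 0))"
      using smooth_along_deriv[OF smooth True, of ?v] by simp
    ultimately show ?thesis
      using vector_diff_chain_at[of "\<lambda>t. ?v (s, r) + t" 1 0 "\<lambda>t. \<phi> (?v((s, r) := t))"] by (simp add: o_def)
  next
    case False
    have "(\<lambda>t. \<phi> (?v((s, r) := ?v (s, r) + t))) = (\<lambda>t. \<phi> ?v)"
      by (rule ext, rule dep) (use False in auto)
    moreover have "partial_deriv (s, r) \<phi> ?v = 0" using dep False by (rule partial_deriv_indep)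
    ultimately show ?thesis by simp
  qed
  then have "vector_derivative (\<lambda>t. f (translate m s r t x)) (at 0) = partial_deriv (s, r) \<phi> ?v"
    unfolding f coords_translate by (rule vector_derivative_at)
  then show ?thesis unfolding D_op_def by (simp add: f coords_def)
qed

text \<open>Offset 0 has source \<open>x_kk = 1\<close> and gives \<open>D_kr\<close>; the offsets
  from 1 to \<open>N\<close> give the sum over \<open>s\<close>. Hence \<open>Suc N\<close> on one
  side and \<open>N\<close> on the other.\<close>

lemma gen_n_coords:
  assumes kr: "(k, r) \<in> Idx m" and x: "x \<in> X_space m" and N: "\<And>j. j \<le> N \<Longrightarrow> (k - int j, r) \<in> Idx m"
  shows "shear_test.gen_n (shear_rows k r) (shear_index k r) (shear_index k k) (shear_prec k r) \<phi> (Suc N) (coords m x) =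
    (\<Sum>s\<in>{k - int N..<k}. complex_of_real (coord m x s k) * D_op m b s r f x) + D_op m b k r f x"
proof -
  interpret S: shear_test "coordM m b" "shear_rows k r" "shear_index k r" "shear_index k k" "shear_prec k r" "shear_var k r" F \<phi> R by (rule shear_test[OF kr])
  have "j \<in> shear_rows k r" if "j \<le> N" for j using N[OF that] by (simp add: shear_rows_def)
  then have J: "S.Jn (Suc N) = {..<Suc N}" by (auto simp: S.Jn_def less_Suc_eq_le)
  have "coord m x k k = 1"
    using BZ_diag[OF unitri_BZ, of "fst x" "Delta_sub m" k] BZ_diag[OF unitri_BZ, of "snd x" "Delta_sup m" k] x
    by (simp add: coord_def X_space_iff)
  then have "(\<Sum>s\<in>{k - int N..<k}. complex_of_real (coord m x s k) * D_op m b s r f x) + D_op m b k r f x =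
    (\<Sum>j<Suc N. complex_of_real (coord m x (k - int j) k) * D_op m b (k - int j) r f x)"
    unfolding sum_descending[of "\<lambda>s. complex_of_real (coord m x s k) * D_op m b s r f x"] by simp
  also have "\<dots> = S.gen_n (Suc N) (coords m x)"
    unfolding S.gen_n_def J D_op_coords by (simp add: shear_index_def shear_prec_def coords_def)
  finally show ?thesis by simp
qed

lemma T_elem:
  assumes kr: "(k, r) \<in> Idx m"
  shows "AE x in mu m b. shear_test.U (shear_rows k r) (shear_index k r) (shear_index k k) (shear_prec k r) (shear_var k r) t \<phi> (coords m x) = T_rep m b y (mat_elem k r t) f x"
proof -
  interpret S: shear_test "coordM m b" "shear_rows k r" "shear_index k r" "shear_index k k" "shear_prec k r" "shear_var k r" F \<phi> R by (rule shear_test[OF kr])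
  show ?thesis using rn_elem[OF kr, of t] AE_space
    by eventually_elim
       (simp add: T_rep_def S.U_def cocycle_elem[OF kr] character_id dens_def f coords_act_elem[OF kr])
qed

lemma generator_elem:
  assumes kr: "(k, r) \<in> Idx m"
  shows "generator_maps (mu m b) (\<lambda>t. T_rep m b y (mat_elem k r t)) f
    (\<lambda>x. shear_test.gen (shear_rows k r) (shear_index k r) (shear_index k k) (shear_prec k r) (shear_var k r) F \<phi> (coords m x))"
proof -
  interpret S: shear_test "coordM m b" "shear_rows k r" "shear_index k r" "shear_index k k" "shear_prec k r" "shear_var k r" F \<phi> R by (rule shear_test[OF kr])
  have fL2: "f \<in> L2 (mu m b)" unfolding f by (rule L2_coords[OF S.\<phi>_L2[unfolded PR_P]])
  have fm: "f \<in> borel_measurable (mu m b)" using fL2 by (rule L2_measurable)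
  have "L2_tendsto (mu m b) (\<lambda>t x. (T_rep m b y (mat_elem k r t) f x - f x) / complex_of_real t) (\<lambda>x. S.gen (coords m x)) (at 0)"
  proof (rule L2_tendsto_cong_AE[OF _ _ _ L2_tendsto_coords[OF S.U_generator[unfolded PR_P]]])
    fix t
    have "mat_elem k r t \<in> B0Z" using Idx_less[OF kr] by (rule mat_elem_B0Z)
    then show "(\<lambda>x. (T_rep m b y (mat_elem k r t) f x - f x) / complex_of_real t) \<in> borel_measurable (mu m b)"
      using fm T_measurable[OF _ fm] by measurable
    show "(\<lambda>x. (S.U t \<phi> (coords m x) - \<phi> (coords m x)) / complex_of_real t) \<in> borel_measurable (mu m b)"
      by (rule L2_measurable[OF L2_coords[OF S.quotient_L2[unfolded PR_P]]])
    show "AE x in mu m b. (S.U t \<phi> (coords m x) - \<phi> (coords m x)) / complex_of_real t =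
      (T_rep m b y (mat_elem k r t) f x - f x) / complex_of_real t"
      using T_elem[OF kr, of t] by eventually_elim (simp add: f)
  qed
  then show ?thesis using fL2 by (simp add: generator_maps_def)
qed

lemma generator_sup:
  assumes kr: "(k, r) \<in> Delta_sup m"
  shows "\<exists>g. L2_tendsto (mu m b)
      (\<lambda>N::nat. \<lambda>x. (\<Sum>s\<in>{k - int N..<k}. complex_of_real (coord m x s k) * D_op m b s r f x) + D_op m b k r f x) g sequentially \<and>
    generator_maps (mu m b) (\<lambda>t. T_rep m b y (mat_elem k r t)) f g"
proof -
  have kr': "(k, r) \<in> Idx m" using kr by (simp add: Idx_def)
  interpret S: shear_test "coordM m b" "shear_rows k r" "shear_index k r" "shear_index k k" "shear_prec k r" "shear_var k r" F \<phi> R by (rule shear_test[OF kr'])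
  have lim: "L2_tendsto (mu m b) (\<lambda>N x. S.gen_n (Suc N) (coords m x)) (\<lambda>x. S.gen (coords m x)) sequentially"
    by (rule L2_tendsto_coords[OF L2_tendsto_Suc[OF S.gen_n_tendsto[unfolded PR_P]]])
  have "L2_tendsto (mu m b)
      (\<lambda>N::nat. \<lambda>x. (\<Sum>s\<in>{k - int N..<k}. complex_of_real (coord m x s k) * D_op m b s r f x) + D_op m b k r f x)
      (\<lambda>x. S.gen (coords m x)) sequentially"
    by (rule L2_tendsto_cong[OF _ _ lim])
       (use kr in \<open>auto intro!: gen_n_coords[OF kr'] simp: Idx_def Delta_sup_def\<close>)
  then show ?thesis using generator_elem[OF kr'] by blast
qed

text \<open>Beyond \<open>m\<close> only \<open>k - m\<close> rows take part, so the partial sums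
  become constant, \<open>Pl\<close> is one of them, and the generator is the finite sum
  itself.\<close>

lemma generator_sub:
  assumes kr: "(k, r) \<in> Delta_sub m"
  shows "generator_maps (mu m b) (\<lambda>t. T_rep m b y (mat_elem k r t)) f
    (\<lambda>x. (\<Sum>s\<in>{m + 1..<k}. complex_of_real (coord m x s k) * D_op m b s r f x) + D_op m b k r f x)"
proof -
  have kr': "(k, r) \<in> Idx m" using kr by (simp add: Idx_def)
  interpret S: shear_test "coordM m b" "shear_rows k r" "shear_index k r" "shear_index k k" "shear_prec k r" "shear_var k r" F \<phi> R by (rule shear_test[OF kr'])
  define N where "N = nat (k - m - 1)"
  have N: "k - int N = m + 1" using kr by (simp add: N_def Delta_sub_def)
  have J: "j \<le> N" if "j \<in> shear_rows k r" for j
  proof -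
    have "m + 1 \<le> k - int j" using that kr by (auto simp: shear_rows_def Idx_def Delta_sub_def Delta_sup_def)
    then show ?thesis using N by linarith
  qed
  have Jn: "S.Jn n = shear_rows k r" if "Suc N \<le> n" for n using J that by (fastforce simp: S.Jn_def)
  have Pl: "S.Pl v = S.Ps (S.Jn (Suc N)) v" for v
    unfolding S.Pl_def
  proof (intro limI tendsto_eventually, unfold eventually_sequentially, intro exI allI impI)
    fix i assume "Suc N \<le> i"
    then have "Suc N \<le> S.fast i" using S.fast(1)[of i] by simp
    then show "S.Ps (S.Jn (S.fast i)) v = S.Ps (S.Jn (Suc N)) v" by (simp add: Jn)
  qed
  have "S.gen (coords m x) = (\<Sum>s\<in>{m + 1..<k}. complex_of_real (coord m x s k) * D_op m b s r f x) + D_op m b k r f x"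
    if x: "x \<in> X_space m" for x
  proof -
    have "S.JF \<subseteq> S.Jn (Suc N)" using S.JF(2) by (simp add: Jn)
    then have "S.gen (coords m x) = S.gen_n (Suc N) (coords m x)" by (simp add: S.gen_n_eq S.gen_def Pl)
    also have "\<dots> = (\<Sum>s\<in>{k - int N..<k}. complex_of_real (coord m x s k) * D_op m b s r f x) + D_op m b k r f x"
      by (rule gen_n_coords[OF kr' x]) (use kr N in \<open>auto simp: Idx_def Delta_sub_def\<close>)
    finally show ?thesis by (simp add: N)
  qed
  then show ?thesis using generator_elem[OF kr'] unfolding generator_maps_def
    by (auto elim!: L2_tendsto_cong[rotated 2])
qed

end

lemma cylinder_generators:
  assumes "cylinder_test_fun m f"
  shows "(k, r) \<in> Delta_sup m \<Longrightarrow> \<exists>g. L2_tendsto (mu m b)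
      (\<lambda>N::nat. \<lambda>x. (\<Sum>s\<in>{k - int N..<k}. complex_of_real (coord m x s k) * D_op m b s r f x) + D_op m b k r f x) g sequentially \<and>
    generator_maps (mu m b) (\<lambda>t. T_rep m b y (mat_elem k r t)) f g"
    and "(k, r) \<in> Delta_sub m \<Longrightarrow> generator_maps (mu m b) (\<lambda>t. T_rep m b y (mat_elem k r t)) f
      (\<lambda>x. (\<Sum>s\<in>{m + 1..<k}. complex_of_real (coord m x s k) * D_op m b s r f x) + D_op m b k r f x)"
proof -
  obtain F \<phi> R where F: "finite F" and dep: "\<forall>v w. (\<forall>i\<in>F. v i = w i) \<longrightarrow> \<phi> v = \<phi> w"
    and smooth: "smooth_along F \<phi>" and supp: "\<forall>v. \<phi> v \<noteq> 0 \<longrightarrow> (\<forall>i\<in>F. \<bar>v i\<bar> \<le> R)"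
    and f: "f = (\<lambda>x. \<phi> (\<lambda>(k, n). coord m x k n))"
    using assms unfolding cylinder_test_fun_def by blast
  have f': "f = (\<lambda>x. \<phi> (coords m x))" by (simp add: f coords_def)
  note supp' = supp[THEN spec, THEN mp]
  show "(k, r) \<in> Delta_sup m \<Longrightarrow> \<exists>g. L2_tendsto (mu m b)
      (\<lambda>N::nat. \<lambda>x. (\<Sum>s\<in>{k - int N..<k}. complex_of_real (coord m x s k) * D_op m b s r f x) + D_op m b k r f x) g sequentially \<and>
    generator_maps (mu m b) (\<lambda>t. T_rep m b y (mat_elem k r t)) f g"
    by (rule generator_sup[OF F dep[THEN spec, THEN spec, THEN mp] smooth supp' f'])
  show "(k, r) \<in> Delta_sub m \<Longrightarrow> generator_maps (mu m b) (\<lambda>t. T_rep m b y (mat_elem k r t)) f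
      (\<lambda>x. (\<Sum>s\<in>{m + 1..<k}. complex_of_real (coord m x s k) * D_op m b s r f x) + D_op m b k r f x)"
    by (rule generator_sub[OF F dep[THEN spec, THEN spec, THEN mp] smooth supp' f'])
qed

end

theorem theorem3p14:
  fixes m :: int and a b y :: zmat and C :: real
  assumes a_pos: "\<And>k n. k < n \<Longrightarrow> 0 < a k n"
    and C_pos: "0 < C"
    and a_mult: "\<And>k l n. k < l \<Longrightarrow> l < n \<Longrightarrow> a k n \<le> C * a k l * a l n"
    and y_dual: "y \<in> b2_dual a"
    and y_supp: "\<And>i j. (\<nexists>r::nat. i = m + int r + 1 \<and> j = m - int r) \<Longrightarrow> y i j = 0"
    and y_nz: "\<And>r::nat. y (m + int r + 1) (m - int r) \<noteq> 0"
    and b_pos: "\<And>k n. (k, n) \<in> Delta_sub m \<union> Delta_sup m \<Longrightarrow> 0 < b k n"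
    and ab_summable:
      "(\<lambda>(k, n). a k n / b k n) summable_on (Delta_sub m \<union> Delta_sup m)"
    and b_summable:
      "\<And>k n. k < n \<Longrightarrow> n \<le> m \<Longrightarrow> (\<lambda>s. b s n / b s k) summable_on {..<k}"
  shows "(right_ergodic m b \<longrightarrow>
      irreducible_unitary_rep B0Z_group (mu m b) (T_rep m b y)) \<and>
    (\<forall>(k, r) \<in> Delta_sup m. \<forall>f. cylinder_test_fun m f \<longrightarrow>
      (\<exists>g. L2_tendsto (mu m b)
             (\<lambda>N::nat. \<lambda>x.
               (\<Sum>s\<in>{k - int N..<k}. complex_of_real (coord m x s k) * D_op m b s r f x) + D_op m b k r f x)
             g sequentially \<and>
           generator_maps (mu m b) (\<lambda>t. T_rep m b y (mat_elem k r t)) f g)) \<and>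
    (\<forall>(k, r) \<in> Delta_sub m. \<forall>f. cylinder_test_fun m f \<longrightarrow>
      generator_maps (mu m b) (\<lambda>t. T_rep m b y (mat_elem k r t)) f
        (\<lambda>x. (\<Sum>s\<in>{m + 1..<k}. complex_of_real (coord m x s k) * D_op m b s r f x) + D_op m b k r f x)) \<and>
    (\<forall>(k, r) \<in> Delta_mid m.
      (\<forall>f \<in> L2 (mu m b). \<forall>g \<in> L2 (mu m b).
         generator_maps (mu m b) (\<lambda>t. T_rep m b y (mat_elem k r t)) f g \<longleftrightarrow>
         (AE x in mu m b. g x = 2 * complex_of_real pi * \<i> * complex_of_real (S_fun m y k r x) * f x)) \<and>
      (AE x in mu m b.
         ((\<lambda>p::nat. mat_inv (fst x) r (m + int p + 1) * y (m + int p + 1) (m - int p) *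
              snd x (m - int p) k) has_sum S_fun m y k r x) UNIV \<and>
         S_fun m y k r x = (mat_inv (fst x) \<odot> y \<odot> snd x) r k))"
proof -
  interpret setting m a b y C
  proof
    show "antidiag m y" using y_supp by (simp add: antidiag_def)
  qed (use a_pos C_pos a_mult y_dual y_nz b_pos ab_summable b_summable in \<open>simp_all add: Idx_def\<close>)
  show ?thesis
  proof (intro conjI impI ballI allI)
    show "irreducible_unitary_rep B0Z_group (mu m b) (T_rep m b y)" if "right_ergodic m b"
      using that by (rule irreducible)
  qed (auto simp: Delta_mid_def cylinder_generators generator_mid S_fun_sums[unfolded AE_conj_iff])
qed

end
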